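(* Let $(d,h)$ be a higher matrix factorization with respect to a regular sequence $f_1,\dots,f_c$ in a ring $S$, and construct the complexes $\mathbf T(1),\dots,\mathbf T(c)$ recursively as described in the context. Then: (1) For each $1\le p\le c$, the complex $\mathbf T(p)$ is an $R(p)$-free resolution of $M(p)$ whose first differential is $R(p)\otimes d_p$ and whose second differential is $$R(p)\otimes\Big(\bigoplus_{q\le p}A_0(q)\xrightarrow{\ h\ }A_1(p)\Big),$$ where the $q$-th component of $h$ is $h_q:A_0(q)\to A_1(q)\hookrightarrow A_1(p)$. (2) If $S$ is local, then $\mathbf T(p)$ is the minimal free resolution of $M(p)$ if and only if the higher matrix factorization $(d_p,\,h(p)=(h_1|\cdots|h_p))$ with respect to $f_1,\dots,f_p$ is minimal.
   Context: All rings are commutative and Noetherian, all modules finitely generated. For elements $f_1,\dots,f_c$ of a ring $S$ put $R(p)=S/(f_1,\dots,f_p)$ for $0\le p\le c$ (so $R(0)=S$) and $R=R(c)$. A higher matrix factorization (HMF) $(d,h)$ with respect to $f_1,\dots,f_c$ consists of: (1) finitely generated free $S$-modules $A_0,A_1$ with filtrations $0=A_s(0)\subseteq A_s(1)\subseteq\cdots\subseteq A_s(c)=A_s$ ($s=0,1$) such that each $A_s(p-1)$ is a free summand of $A_s(p)$; (2) $S$-linear maps $d:A_1\to A_0$ and $h:\bigoplus_{q=1}^cA_0(q)\to A_1$ preserving filtrations, where $\bigoplus_qA_0(q)$ is filtered by the submodules $\bigoplus_{q\le p}A_0(q)$; such that, writing $d_p:A_1(p)\to A_0(p)$ and $h_p:A_0(p)\to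 A_1(p)$ for the induced maps ($h_p$ is the restriction of $h$ to the $p$-th summand), $B_s(p)=A_s(p)/A_s(p-1)$ (free modules), and $\pi_p:A_1(p)\to B_1(p)$ for the projection, one has for all $1\le p\le c$: (a) $d_ph_p\equiv f_p\,\mathrm{Id}_{A_0(p)}$ modulo $(f_1,\dots,f_{p-1})A_0(p)$; (b) $\pi_ph_pd_p\equiv f_p\,\pi_p$ modulo $(f_1,\dots,f_{p-1})B_1(p)$. Put $M(p)=\operatorname{coker}(R(p)\otimes d_p)$. Over a local ring $S$ with maximal ideal $\mathfrak m$, a higher matrix factorization is minimal if the images of $d$ and $h$ are contained in $\mathfrak m$ times their targets. For each $p$, $d_p$ together with $h(p)=(h_1|\cdots|h_p):\bigoplus_{q\le p}A_0(q)\to A_1(p)$ is a higher matrix factorization with respect to $f_1,\dots,f_p$. Shamash construction: let $Q$ be a ring, $f\in Q$, and $\mathbf G$ a complex of free $Q$-modules. A system of higher homotopies for $f$ on $\mathbf G$ is a collection of maps $\sigma_j$ ($j\ge0$) of the underlying graded module, $\sigma_j:G_n\to G_{n+2j-1}$, such that $\sigma_0$ is the differential, $\sigma_0\sigma_1+\sigma_1\sigma_0=f$, and $\sum_{i+j=m}\sigma_i\sigma_j=0$ for $m\ge2$. (One exists whenever $\mathbf G$ is a free resolution of a module annihilated by $f$.) The Shamash complex $\mathrm{Sh}(\mathbf G,\sigma)$ is the complex of free $Q/(f)$-modules $\bigoplus_{i\ge0}y^{(i)}\,\mathbf G\otimes Q/(f)$, with $y^{(i)}G_n$ in homological degree $n+2i$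 and differential $\delta(y^{(i)}g)=\sum_{0\le j\le i}y^{(i-j)}\sigma_j(g)$. Construction: choose splittings $A_s(p)=A_s(p-1)\oplus B_s(p)$ and let $\psi_p:B_1(p)\to A_0(p-1)$ be the component of $d_p$, and $\mathbf B(p)$ the complex $b_p:B_1(p)\to B_0(p)$ induced by $d$. Set $\mathbf U(1)=\mathbf B(1)$ and $\mathbf T(1)=\mathrm{Sh}(\mathbf U(1),h_1)$ (using $h_1$ as homotopy for $f_1$ and zero higher homotopies). For $p\ge2$, given an $R(p-1)$-free resolution $\mathbf T(p-1)$ of $M(p-1)$ beginning with $R(p-1)\otimes d_{p-1}:R(p-1)\otimes A_1(p-1)\to R(p-1)\otimes A_0(p-1)$, let $\mathbf U(p)$ be the mapping cone of the map of complexes $R(p-1)\otimes\mathbf B(p)[-1]\to\mathbf T(p-1)$ induced by $\psi_p$; that is, $U_n(p)=T_n(p-1)\oplus (R(p-1)\otimes B_n(p))$ (with $B_n(p)=0$ for $n\ge2$), the first differential is $R(p-1)\otimes d_p$ and the other differentials are those of $\mathbf T(p-1)$. The complex $\mathbf U(p)$ is an $R(p-1)$-free resolution of $M(p)$; choose a system of higher homotopies $\sigma(p)$ for $f_p$ on $\mathbf U(p)$ whose $\sigma_1$ on $U_0(p)=R(p-1)\otimes A_0(p)$ is $R(p-1)\otimes h_p$, and set $\mathbf T(p)=\mathrm{Sh}(\mathbf U(p),\sigma(p))$. *)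

theory Defs
  imports "HOL-Algebra.Ring_Divisibility" "HOL-Algebra.QuotRing" "HOL-Algebra.Module"
begin

section \<open>Modules over a commutative ring\<close>

definition module_hom ::
  "('a, 'k) ring_scheme \<Rightarrow> ('a, 'm, 'k1) module_scheme \<Rightarrow> ('a, 'n, 'k2) module_scheme \<Rightarrow> ('m \<Rightarrow> 'n) set"
  where "module_hom R M N =
    {g \<in> carrier M \<rightarrow> carrier N.
       (\<forall>x\<in>carrier M. \<forall>y\<in>carrier M. g (x \<oplus>\<^bsub>M\<^esub> y) = g x \<oplus>\<^bsub>N\<^esub> g y) \<and>
       (\<forall>r\<in>carrier R. \<forall>x\<in>carrier M. g (r \<odot>\<^bsub>M\<^esub> x) = r \<odot>\<^bsub>N\<^esub> g x)}"

definition module_iso ::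
  "('a, 'k) ring_scheme \<Rightarrow> ('a, 'm, 'k1) module_scheme \<Rightarrow> ('a, 'n, 'k2) module_scheme \<Rightarrow> ('m \<Rightarrow> 'n) set"
  where "module_iso R M N = {g \<in> module_hom R M N. bij_betw g (carrier M) (carrier N)}"

definition module_basis ::
  "('a, 'k) ring_scheme \<Rightarrow> ('a, 'm, 'k1) module_scheme \<Rightarrow> 'm set \<Rightarrow> bool"
  where "module_basis R M E \<longleftrightarrow>
    finite E \<and> E \<subseteq> carrier M \<and>
    (\<forall>x\<in>carrier M. \<exists>!k. k \<in> E \<rightarrow>\<^sub>E carrier R \<and> x = (\<Oplus>\<^bsub>M\<^esub>e\<in>E. k e \<odot>\<^bsub>M\<^esub> e))"

definition fg_free :: "('a, 'k) ring_scheme \<Rightarrow> ('a, 'm, 'k1) module_scheme \<Rightarrow> bool"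
  where "fg_free R M \<longleftrightarrow> module R M \<and> (\<exists>E. module_basis R M E)"

definition internal_direct_sum ::
  "('a, 'k) ring_scheme \<Rightarrow> ('a, 'm, 'k1) module_scheme \<Rightarrow> 'm set \<Rightarrow> 'm set \<Rightarrow> bool"
  where "internal_direct_sum R M N K \<longleftrightarrow>
    submodule N R M \<and> submodule K R M \<and> N <+>\<^bsub>M\<^esub> K = carrier M \<and> N \<inter> K = {\<zero>\<^bsub>M\<^esub>}"

text \<open>\<open>I M\<close>, the submodule of \<open>M\<close> generated by all products.\<close>

definition ideal_smult ::
  "('a, 'k) ring_scheme \<Rightarrow> 'a set \<Rightarrow> ('a, 'm, 'k1) module_scheme \<Rightarrow> 'm set"
  where "ideal_smult R I M =
    \<Inter>{N. submodule N R M \<and> (\<forall>a\<in>I. \<forall>x\<in>carrier M. a \<odot>\<^bsub>M\<^esub> x \<in> N)}"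

definition quot_module :: "('a, 'm, 'k1) module_scheme \<Rightarrow> 'm set \<Rightarrow> ('a, 'm set) module"
  where "quot_module M N =
    \<lparr>carrier = a_rcosets\<^bsub>M\<^esub> N, mult = undefined, one = undefined, zero = N, add = set_add M,
     smult = (\<lambda>r X. \<Union>x\<in>X. N +>\<^bsub>M\<^esub> (r \<odot>\<^bsub>M\<^esub> x))\<rparr>"

text \<open>\<open>R/I \<otimes> M\<close>, realised as \<open>M / I M\<close> with its structure of a module over \<open>R Quot I\<close>.\<close>

definition base_change ::
  "('a, 'k) ring_scheme \<Rightarrow> 'a set \<Rightarrow> ('a, 'm, 'k1) module_scheme \<Rightarrow> ('a set, 'm set) module"
  where "base_change R I M =
    \<lparr>carrier = a_rcosets\<^bsub>M\<^esub> (ideal_smult R I M), mult = undefined, one = undefined,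
     zero = ideal_smult R I M, add = set_add M,
     smult = (\<lambda>P X. \<Union>r\<in>P. \<Union>x\<in>X. ideal_smult R I M +>\<^bsub>M\<^esub> (r \<odot>\<^bsub>M\<^esub> x))\<rparr>"

text \<open>
  The map sending the class of \<open>x\<close> (modulo some \<open>J M\<close> with \<open>J \<subseteq> I\<close>) to the class of \<open>g x\<close> in
  \<open>R/I \<otimes> N\<close>. For \<open>J = I\<close> this is \<open>R/I \<otimes> g\<close>; for \<open>J \<subseteq> I\<close> and \<open>g = id\<close> it is the reduction
  \<open>R/J \<otimes> N \<rightarrow> R/I \<otimes> N\<close>.
\<close>

definition base_change_map ::
  "('a, 'k) ring_scheme \<Rightarrow> 'a set \<Rightarrow> ('a, 'n, 'k2) module_scheme \<Rightarrow> ('m \<Rightarrow> 'n) \<Rightarrow> 'm set \<Rightarrow> 'n set"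
  where "base_change_map R I N g X = (\<Union>x\<in>X. ideal_smult R I N +>\<^bsub>N\<^esub> g x)"

definition direct_sum :: "'i set \<Rightarrow> ('i \<Rightarrow> ('a, 'm, 'k1) module_scheme) \<Rightarrow> ('a, 'i \<Rightarrow> 'm) module"
  where "direct_sum J M =
    \<lparr>carrier = (\<Pi>\<^sub>E i\<in>J. carrier (M i)), mult = undefined, one = undefined,
     zero = (\<lambda>i\<in>J. \<zero>\<^bsub>M i\<^esub>), add = (\<lambda>x y. \<lambda>i\<in>J. x i \<oplus>\<^bsub>M i\<^esub> y i),
     smult = (\<lambda>r x. \<lambda>i\<in>J. r \<odot>\<^bsub>M i\<^esub> x i)\<rparr>"


section \<open>Local rings, regular sequences, resolutions\<close>

definition local_ring :: "('a, 'k) ring_scheme \<Rightarrow> bool"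
  where "local_ring R \<longleftrightarrow> cring R \<and> (\<exists>!m. maximalideal m R)"

definition max_ideal :: "('a, 'k) ring_scheme \<Rightarrow> 'a set"
  where "max_ideal R = (THE m. maximalideal m R)"

definition seq_ideal :: "('a, 'k) ring_scheme \<Rightarrow> (nat \<Rightarrow> 'a) \<Rightarrow> nat \<Rightarrow> 'a set"
  where "seq_ideal S f p = Idl\<^bsub>S\<^esub> (f ` {1..p})"

definition regular_sequence :: "('a, 'k) ring_scheme \<Rightarrow> (nat \<Rightarrow> 'a) \<Rightarrow> nat \<Rightarrow> bool"
  where "regular_sequence S f c \<longleftrightarrow>
    f ` {1..c} \<subseteq> carrier S \<and> seq_ideal S f c \<noteq> carrier S \<and>
    (\<forall>p\<in>{1..c}. \<forall>x\<in>carrier S.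
       f p \<otimes>\<^bsub>S\<^esub> x \<in> seq_ideal S f (p - 1) \<longrightarrow> x \<in> seq_ideal S f (p - 1))"

text \<open>The differential \<open>\<delta> n\<close> maps \<open>T n\<close> to \<open>T (n - 1)\<close>, for \<open>n \<ge> 1\<close>.\<close>

definition free_resolution ::
  "('a, 'k) ring_scheme \<Rightarrow> (nat \<Rightarrow> ('a, 'm, 'k1) module_scheme) \<Rightarrow> (nat \<Rightarrow> 'm \<Rightarrow> 'm) \<Rightarrow>
    ('a, 'n, 'k2) module_scheme \<Rightarrow> bool"
  where "free_resolution R T \<delta> M \<longleftrightarrow>
    (\<forall>n. fg_free R (T n)) \<and>
    (\<forall>n\<ge>1. \<delta> n \<in> module_hom R (T n) (T (n - 1))) \<and>
    (\<forall>n\<ge>1. \<delta> (n + 1) ` carrier (T (n + 1)) = {x \<in> carrier (T n). \<delta> n x = \<zero>\<^bsub>T (n - 1)\<^esub>}) \<and>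
    (\<exists>\<epsilon>\<in>module_hom R (T 0) M.
       \<epsilon> ` carrier (T 0) = carrier M \<and>
       \<delta> 1 ` carrier (T 1) = {x \<in> carrier (T 0). \<epsilon> x = \<zero>\<^bsub>M\<^esub>})"

definition minimal_free_resolution ::
  "('a, 'k) ring_scheme \<Rightarrow> (nat \<Rightarrow> ('a, 'm, 'k1) module_scheme) \<Rightarrow> (nat \<Rightarrow> 'm \<Rightarrow> 'm) \<Rightarrow>
    ('a, 'n, 'k2) module_scheme \<Rightarrow> bool"
  where "minimal_free_resolution R T \<delta> M \<longleftrightarrow>
    free_resolution R T \<delta> M \<and>
    (\<forall>n\<ge>1. \<delta> n ` carrier (T n) \<subseteq> ideal_smult R (max_ideal R) (T (n - 1)))"

text \<open>\<open>g : M \<rightarrow> N\<close> is the map \<open>g' : M' \<rightarrow> N'\<close> under the identifications \<open>\<alpha> : M' \<cong> M\<close>, \<open>\<beta> : N' \<cong> N\<close>.\<close>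

definition is_map_via ::
  "('a, 'k) ring_scheme \<Rightarrow> ('a, 'm, 'k1) module_scheme \<Rightarrow> ('a, 'n, 'k2) module_scheme \<Rightarrow> ('m \<Rightarrow> 'n) \<Rightarrow>
    ('m1 \<Rightarrow> 'm) \<Rightarrow> ('n1 \<Rightarrow> 'n) \<Rightarrow>
    ('a, 'm1, 'k3) module_scheme \<Rightarrow> ('a, 'n1, 'k4) module_scheme \<Rightarrow> ('m1 \<Rightarrow> 'n1) \<Rightarrow> bool"
  where "is_map_via R M N g \<alpha> \<beta> M' N' g' \<longleftrightarrow>
    \<alpha> \<in> module_iso R M' M \<and> \<beta> \<in> module_iso R N' N \<and>
    g' \<in> module_hom R M' N' \<and> (\<forall>x\<in>carrier M'. g (\<alpha> x) = \<beta> (g' x))"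


section \<open>Higher homotopies and the Shamash differential\<close>

text \<open>
  \<open>\<sigma> j n\<close> is the restriction of \<open>\<sigma>\<^sub>j\<close> to \<open>G n\<close>; it has target \<open>G (n + 2j - 1)\<close>. Complexes vanish in
  negative degrees, so that \<open>\<sigma> 0 0\<close> is never used.
\<close>

definition higher_homotopies ::
  "('a, 'k) ring_scheme \<Rightarrow> 'a \<Rightarrow> (nat \<Rightarrow> ('a, 'm, 'k1) module_scheme) \<Rightarrow> (nat \<Rightarrow> 'm \<Rightarrow> 'm) \<Rightarrow>
    (nat \<Rightarrow> nat \<Rightarrow> 'm \<Rightarrow> 'm) \<Rightarrow> bool"
  where "higher_homotopies Q a G d \<sigma> \<longleftrightarrow>
    (\<forall>j n. 1 \<le> n + 2 * j \<longrightarrow> \<sigma> j n \<in> module_hom Q (G n) (G (n + 2 * j - 1))) \<and>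
    (\<forall>n\<ge>1. \<forall>x\<in>carrier (G n). \<sigma> 0 n x = d n x) \<and>
    (\<forall>x\<in>carrier (G 0). \<sigma> 0 1 (\<sigma> 1 0 x) = a \<odot>\<^bsub>G 0\<^esub> x) \<and>
    (\<forall>n\<ge>1. \<forall>x\<in>carrier (G n).
       \<sigma> 0 (n + 1) (\<sigma> 1 n x) \<oplus>\<^bsub>G n\<^esub> \<sigma> 1 (n - 1) (\<sigma> 0 n x) = a \<odot>\<^bsub>G n\<^esub> x) \<and>
    (\<forall>m\<ge>2. \<forall>n. \<forall>x\<in>carrier (G n).
       (\<Oplus>\<^bsub>G (n + 2 * m - 2)\<^esub>j\<in>{j. j \<le> m \<and> 1 \<le> n + 2 * j}. \<sigma> (m - j) (n + 2 * j - 1) (\<sigma> j n x))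
         = \<zero>\<^bsub>G (n + 2 * m - 2)\<^esub>)"

text \<open>
  \<open>y i n : G n \<rightarrow> T (n + 2i)\<close> stands for \<open>g \<mapsto> y\<^sup>(\<^sup>i\<^sup>) g\<close>, where \<open>T\<close> is the direct sum of the
  modules \<open>y\<^sup>(\<^sup>i\<^sup>) G \<otimes> Q'\<close> over \<open>Q' = Q/(a)\<close>. As the elements \<open>y\<^sup>(\<^sup>i\<^sup>) g\<close> generate \<open>T\<close>, the condition
  determines \<open>\<delta>\<close>.
\<close>

definition shamash_differential ::
  "('b, 'k) ring_scheme \<Rightarrow> (nat \<Rightarrow> ('a, 'm, 'k1) module_scheme) \<Rightarrow> (nat \<Rightarrow> nat \<Rightarrow> 'm \<Rightarrow> 'm) \<Rightarrow>
    (nat \<Rightarrow> ('b, 't, 'k2) module_scheme) \<Rightarrow> (nat \<Rightarrow> nat \<Rightarrow> 'm \<Rightarrow> 't) \<Rightarrow> (nat \<Rightarrow> 't \<Rightarrow> 't) \<Rightarrow> bool"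
  where "shamash_differential Q' G \<sigma> T y \<delta> \<longleftrightarrow>
    (\<forall>n\<ge>1. \<delta> n \<in> module_hom Q' (T n) (T (n - 1))) \<and>
    (\<forall>i n. 1 \<le> n + 2 * i \<longrightarrow>
       (\<forall>g\<in>carrier (G n).
          \<delta> (n + 2 * i) (y i n g) =
            (\<Oplus>\<^bsub>T (n + 2 * i - 1)\<^esub>j\<in>{j. j \<le> i \<and> 1 \<le> n + 2 * j}.
               y (i - j) (n + 2 * j - 1) (\<sigma> j n g))))"


section \<open>Higher matrix factorizations\<close>

text \<open>
  \<open>A 0\<close>, \<open>A 1\<close> are the two modules, \<open>F s p\<close> is the carrier of \<open>A\<^sub>s(p)\<close>. The map \<open>h\<close> on
  \<open>A\<^sub>0(1) \<oplus> \<dots> \<oplus> A\<^sub>0(c)\<close> is given by its components \<open>h q\<close>.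
\<close>

definition filt ::
  "(nat \<Rightarrow> ('a, 'b, 'k) module_scheme) \<Rightarrow> (nat \<Rightarrow> nat \<Rightarrow> 'b set) \<Rightarrow> nat \<Rightarrow> nat \<Rightarrow>
    ('a, 'b, 'k) module_scheme"
  where "filt A F s p = A s\<lparr>carrier := F s p\<rparr>"

definition gr ::
  "(nat \<Rightarrow> ('a, 'b, 'k) module_scheme) \<Rightarrow> (nat \<Rightarrow> nat \<Rightarrow> 'b set) \<Rightarrow> nat \<Rightarrow> nat \<Rightarrow>
    ('a, 'b set) module"
  where "gr A F s p = quot_module (filt A F s p) (F s (p - 1))"

definition gr_proj ::
  "(nat \<Rightarrow> ('a, 'b, 'k) module_scheme) \<Rightarrow> (nat \<Rightarrow> nat \<Rightarrow> 'b set) \<Rightarrow> nat \<Rightarrow> nat \<Rightarrow> 'b \<Rightarrow> 'b set"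
  where "gr_proj A F s p x = F s (p - 1) +>\<^bsub>filt A F s p\<^esub> x"

definition higher_matrix_factorization ::
  "('a, 'k) ring_scheme \<Rightarrow> (nat \<Rightarrow> 'a) \<Rightarrow> nat \<Rightarrow> (nat \<Rightarrow> ('a, 'b, 'k1) module_scheme) \<Rightarrow>
    (nat \<Rightarrow> nat \<Rightarrow> 'b set) \<Rightarrow> ('b \<Rightarrow> 'b) \<Rightarrow> (nat \<Rightarrow> 'b \<Rightarrow> 'b) \<Rightarrow> bool"
  where "higher_matrix_factorization S f c A F d h \<longleftrightarrow>
    (\<forall>s\<in>{0,1}.
       module S (A s) \<and> F s 0 = {\<zero>\<^bsub>A s\<^esub>} \<and> F s c = carrier (A s) \<and>
       (\<forall>p\<le>c. submodule (F s p) S (A s) \<and> fg_free S (filt A F s p)) \<and>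
       (\<forall>p\<in>{1..c}. fg_free S (gr A F s p) \<and>
          (\<exists>K. internal_direct_sum S (filt A F s p) (F s (p - 1)) K))) \<and>
    d \<in> module_hom S (A 1) (A 0) \<and>
    (\<forall>p\<in>{1..c}. d ` F 1 p \<subseteq> F 0 p) \<and>
    (\<forall>p\<in>{1..c}. h p \<in> module_hom S (filt A F 0 p) (A 1) \<and> h p ` F 0 p \<subseteq> F 1 p) \<and>
    (\<forall>p\<in>{1..c}.
       (\<forall>x\<in>F 0 p.
          d (h p x) \<ominus>\<^bsub>A 0\<^esub> f p \<odot>\<^bsub>A 0\<^esub> x
            \<in> ideal_smult S (seq_ideal S f (p - 1)) (filt A F 0 p)) \<and>
       (\<forall>x\<in>F 1 p.
          gr_proj A F 1 p (h p (d x)) \<ominus>\<^bsub>gr A F 1 p\<^esub> f p \<odot>\<^bsub>gr A F 1 p\<^esub> gr_proj A F 1 p x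
            \<in> ideal_smult S (seq_ideal S f (p - 1)) (gr A F 1 p)))"

definition h_source ::
  "(nat \<Rightarrow> ('a, 'b, 'k) module_scheme) \<Rightarrow> (nat \<Rightarrow> nat \<Rightarrow> 'b set) \<Rightarrow> nat \<Rightarrow> ('a, nat \<Rightarrow> 'b) module"
  where "h_source A F p = direct_sum {1..p} (filt A F 0)"

text \<open>\<open>h(p) = (h\<^sub>1 | \<dots> | h\<^sub>p)\<close>\<close>

definition h_row ::
  "(nat \<Rightarrow> ('a, 'b, 'k) module_scheme) \<Rightarrow> (nat \<Rightarrow> 'b \<Rightarrow> 'b) \<Rightarrow> nat \<Rightarrow> (nat \<Rightarrow> 'b) \<Rightarrow> 'b"
  where "h_row A h p v = (\<Oplus>\<^bsub>A 1\<^esub>q\<in>{1..p}. h q (v q))"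

text \<open>Minimality of the higher matrix factorization \<open>(d\<^sub>p, h(p))\<close> with respect to \<open>f\<^sub>1, \<dots>, f\<^sub>p\<close>.\<close>

definition hmf_minimal ::
  "('a, 'k) ring_scheme \<Rightarrow> (nat \<Rightarrow> ('a, 'b, 'k1) module_scheme) \<Rightarrow> (nat \<Rightarrow> nat \<Rightarrow> 'b set) \<Rightarrow>
    ('b \<Rightarrow> 'b) \<Rightarrow> (nat \<Rightarrow> 'b \<Rightarrow> 'b) \<Rightarrow> nat \<Rightarrow> bool"
  where "hmf_minimal S A F d h p \<longleftrightarrow>
    d ` F 1 p \<subseteq> ideal_smult S (max_ideal S) (filt A F 0 p) \<and>
    h_row A h p ` carrier (h_source A F p) \<subseteq> ideal_smult S (max_ideal S) (filt A F 1 p)"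

definition splittings ::
  "('a, 'k) ring_scheme \<Rightarrow> nat \<Rightarrow> (nat \<Rightarrow> ('a, 'b, 'k1) module_scheme) \<Rightarrow> (nat \<Rightarrow> nat \<Rightarrow> 'b set) \<Rightarrow>
    (nat \<Rightarrow> nat \<Rightarrow> 'b set) \<Rightarrow> bool"
  where "splittings S c A F B \<longleftrightarrow>
    (\<forall>s\<in>{0,1}. \<forall>p\<in>{1..c}. internal_direct_sum S (filt A F s p) (F s (p - 1)) (B s p))"

definition hmf_ring :: "('a, 'k) ring_scheme \<Rightarrow> (nat \<Rightarrow> 'a) \<Rightarrow> nat \<Rightarrow> 'a set ring"
  where "hmf_ring S f p = S Quot (seq_ideal S f p)"

text \<open>\<open>R(p) \<otimes> A\<^sub>s(p)\<close>, \<open>R(p) \<otimes> d\<^sub>p\<close> and its cokernel \<open>M(p)\<close>\<close>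

definition RA ::
  "('a, 'k) ring_scheme \<Rightarrow> (nat \<Rightarrow> 'a) \<Rightarrow> (nat \<Rightarrow> ('a, 'b, 'k1) module_scheme) \<Rightarrow>
    (nat \<Rightarrow> nat \<Rightarrow> 'b set) \<Rightarrow> nat \<Rightarrow> nat \<Rightarrow> ('a set, 'b set) module"
  where "RA S f A F s p = base_change S (seq_ideal S f p) (filt A F s p)"

definition Rd ::
  "('a, 'k) ring_scheme \<Rightarrow> (nat \<Rightarrow> 'a) \<Rightarrow> (nat \<Rightarrow> ('a, 'b, 'k1) module_scheme) \<Rightarrow>
    (nat \<Rightarrow> nat \<Rightarrow> 'b set) \<Rightarrow> ('b \<Rightarrow> 'b) \<Rightarrow> nat \<Rightarrow> 'b set \<Rightarrow> 'b set"
  where "Rd S f A F d p = base_change_map S (seq_ideal S f p) (filt A F 0 p) d"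

definition hmf_module ::
  "('a, 'k) ring_scheme \<Rightarrow> (nat \<Rightarrow> 'a) \<Rightarrow> (nat \<Rightarrow> ('a, 'b, 'k1) module_scheme) \<Rightarrow>
    (nat \<Rightarrow> nat \<Rightarrow> 'b set) \<Rightarrow> ('b \<Rightarrow> 'b) \<Rightarrow> nat \<Rightarrow> ('a set, 'b set set) module"
  where "hmf_module S f A F d p =
    quot_module (RA S f A F 0 p) (Rd S f A F d p ` carrier (RA S f A F 1 p))"


section \<open>The modules of the complexes \<open>U(p)\<close> and \<open>T(p)\<close>\<close>

text \<open>
  The recursion for \<open>T(p)\<close> adjoins summands \<open>B\<^sub>n(p)\<close> (cone) and applies \<open>y\<^sub>p\<^sup>(\<^sup>i\<^sup>)\<close> (Shamash). Hence
  \<open>T\<^sub>n(p)\<close> is a direct sum of modules \<open>R(p) \<otimes> y\<^sub>p\<^sup>(\<^sup>i\<^sup>) y\<^sub>p\<^sub>-\<^sub>1\<^sup>(\<^sup>j\<^sup>) \<dots> y\<^sub>q\<^sup>(\<^sup>k\<^sup>) B\<^sub>s(q)\<close>, and this summand is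
  labelled by the word \<open>[i, j, \<dots>, k]\<close>, of length \<open>p + 1 - q\<close>. In \<open>U\<^sub>n(p)\<close> the words of
  \<open>T\<^sub>n(p - 1)\<close> are kept and \<open>B\<^sub>n(p)\<close> gets the empty word. Multiplication by \<open>y\<^sub>p\<^sup>(\<^sup>i\<^sup>)\<close> prefixes \<open>i\<close>.
  Since the \<open>y\<close>'s have degree 2, \<open>s = n mod 2\<close>. For \<open>T(0) = 0\<close> the recursion gives \<open>U(1) = B(1)\<close>.
\<close>

definition cone_index :: "(nat \<Rightarrow> nat list set) \<Rightarrow> nat \<Rightarrow> nat list set"
  where "cone_index J n = J n \<union> (if n < 2 then {[]} else {})"

definition shamash_index :: "(nat \<Rightarrow> nat list set) \<Rightarrow> nat \<Rightarrow> nat list set"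
  where "shamash_index J n = {i # w | i w. 2 * i \<le> n \<and> w \<in> J (n - 2 * i)}"

primrec T_index :: "nat \<Rightarrow> nat \<Rightarrow> nat list set"
  where
    "T_index 0 = (\<lambda>n. {})"
  | "T_index (Suc p) = shamash_index (cone_index (T_index p))"

definition U_index :: "nat \<Rightarrow> nat \<Rightarrow> nat list set"
  where "U_index p = cone_index (T_index (p - 1))"

context
  fixes S :: "('a, 'k) ring_scheme"
    and f :: "nat \<Rightarrow> 'a"
    and c :: nat
    and A :: "nat \<Rightarrow> ('a, 'b, 'k1) module_scheme"
    and F :: "nat \<Rightarrow> nat \<Rightarrow> 'b set"
    and d :: "'b \<Rightarrow> 'b"
    and h :: "nat \<Rightarrow> 'b \<Rightarrow> 'b"
    and B :: "nat \<Rightarrow> nat \<Rightarrow> 'b set"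
begin

definition U_module :: "nat \<Rightarrow> nat \<Rightarrow> ('a set, nat list \<Rightarrow> 'b set) module"
  where "U_module p n =
    direct_sum (U_index p n)
      (\<lambda>w. base_change S (seq_ideal S f (p - 1)) (filt A B (n mod 2) (p - length w)))"

definition T_module :: "nat \<Rightarrow> nat \<Rightarrow> ('a set, nat list \<Rightarrow> 'b set) module"
  where "T_module p n =
    direct_sum (T_index p n)
      (\<lambda>w. base_change S (seq_ideal S f p) (filt A B (n mod 2) (p + 1 - length w)))"

text \<open>\<open>y_mult p i n : U\<^sub>n(p) \<rightarrow> T\<^sub>n\<^sub>+\<^sub>2\<^sub>i(p)\<close>, \<open>g \<mapsto> y\<^sub>p\<^sup>(\<^sup>i\<^sup>) g\<close>\<close>

definition y_mult :: "nat \<Rightarrow> nat \<Rightarrow> nat \<Rightarrow> (nat list \<Rightarrow> 'b set) \<Rightarrow> nat list \<Rightarrow> 'b set"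
  where "y_mult p i n g =
    (\<lambda>w\<in>T_index p (n + 2 * i).
       let N = filt A B (n mod 2) (p + 1 - length w) in
       if hd w = i then base_change_map S (seq_ideal S f p) N id (g (tl w))
       else \<zero>\<^bsub>base_change S (seq_ideal S f p) N\<^esub>)"

text \<open>The component of \<open>x\<close> in \<open>B\<^sub>s(q)\<close>, for the decomposition \<open>A\<^sub>s = B\<^sub>s(1) \<oplus> \<dots> \<oplus> B\<^sub>s(c)\<close>.\<close>

definition component :: "nat \<Rightarrow> 'b \<Rightarrow> nat \<Rightarrow> 'b"
  where "component s x =
    (THE b. b \<in> (\<Pi>\<^sub>E q\<in>{1..c}. B s q) \<and> x = (\<Oplus>\<^bsub>A s\<^esub>q\<in>{1..c}. b q))"

text \<open>
  The identifications \<open>R(p-1) \<otimes> A\<^sub>s(p) \<cong> U\<^sub>s(p)\<close> and \<open>R(p) \<otimes> A\<^sub>s(p) \<cong> T\<^sub>s(p)\<close> for \<open>s = 0, 1\<close>.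
\<close>

definition U_ident :: "nat \<Rightarrow> nat \<Rightarrow> 'b set \<Rightarrow> nat list \<Rightarrow> 'b set"
  where "U_ident p s X =
    (\<lambda>w\<in>U_index p s.
       base_change_map S (seq_ideal S f (p - 1)) (filt A B s (p - length w))
         (\<lambda>x. component s x (p - length w)) X)"

definition T_ident :: "nat \<Rightarrow> nat \<Rightarrow> 'b set \<Rightarrow> nat list \<Rightarrow> 'b set"
  where "T_ident p s X =
    (\<lambda>w\<in>T_index p s.
       base_change_map S (seq_ideal S f p) (filt A B s (p + 1 - length w))
         (\<lambda>x. component s x (p + 1 - length w)) X)"

text \<open>
  The identification of \<open>R(p) \<otimes> (A\<^sub>0(1) \<oplus> \<dots> \<oplus> A\<^sub>0(p))\<close> with \<open>T\<^sub>2(p)\<close>, the summand \<open>A\<^sub>0(q)\<close> becoming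
  \<open>y\<^sub>q A\<^sub>0(q)\<close>. In a word occurring in \<open>T\<^sub>2(p)\<close> exactly one entry is 1, the others are 0; if the 1
  is preceded by \<open>k\<close> zeros, the word belongs to \<open>y\<^sub>q\<close> with \<open>q = p - k\<close>.
\<close>

definition T2_ident :: "nat \<Rightarrow> (nat \<Rightarrow> 'b) set \<Rightarrow> nat list \<Rightarrow> 'b set"
  where "T2_ident p X =
    (\<lambda>w\<in>T_index p 2.
       base_change_map S (seq_ideal S f p) (filt A B 0 (p + 1 - length w))
         (\<lambda>v. component 0 (v (p - length (takeWhile (\<lambda>i. i = 0) w))) (p + 1 - length w)) X)"

text \<open>The components \<open>\<psi>\<^sub>p : B\<^sub>1(p) \<rightarrow> A\<^sub>0(p-1)\<close> and \<open>b\<^sub>p : B\<^sub>1(p) \<rightarrow> B\<^sub>0(p)\<close> of \<open>d\<close>\<close>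

definition psi :: "nat \<Rightarrow> 'b \<Rightarrow> 'b"
  where "psi p x = (\<Oplus>\<^bsub>A 0\<^esub>q\<in>{1..p - 1}. component 0 (d x) q)"

definition b_map :: "nat \<Rightarrow> 'b \<Rightarrow> 'b"
  where "b_map p x = component 0 (d x) p"

text \<open>
  The differential of the mapping cone \<open>U(p)\<close>, where \<open>\<delta>\<close> is the differential of \<open>T(p-1)\<close>. It has
  no signs: in degree 1 it is \<open>(t, b) \<mapsto> (\<delta> t + \<psi>\<^sub>p b, b\<^sub>p b)\<close>.
\<close>

definition U_diff ::
  "nat \<Rightarrow> (nat \<Rightarrow> (nat list \<Rightarrow> 'b set) \<Rightarrow> nat list \<Rightarrow> 'b set) \<Rightarrow> nat \<Rightarrow>
    (nat list \<Rightarrow> 'b set) \<Rightarrow> nat list \<Rightarrow> 'b set"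
  where "U_diff p \<delta> n u =
    (let I = seq_ideal S f (p - 1); t = restrict u (T_index (p - 1) n) in
     (\<lambda>w\<in>U_index p (n - 1).
        if n = 1 then
          (if w = [] then base_change_map S I (filt A B 0 p) (b_map p) (u [])
           else \<delta> 1 t w
             \<oplus>\<^bsub>base_change S I (filt A B 0 (p - length w))\<^esub>
             T_ident (p - 1) 0
               (base_change_map S I (filt A F 0 (p - 1)) (psi p) (u [])) w)
        else
          (if w = [] then \<zero>\<^bsub>base_change S I (filt A B ((n - 1) mod 2) p)\<^esub> else \<delta> n t w)))"

text \<open>
  \<open>\<sigma> p\<close> are the higher homotopies chosen on \<open>U(p)\<close> and \<open>\<delta> p\<close> is the resulting differential of
  \<open>T(p)\<close>. As \<open>U(1)\<close> is concentrated in degrees 0 and 1, the conditions for \<open>p = 1\<close> say that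
  \<open>\<sigma>\<^sub>1\<close> is given by \<open>h\<^sub>1\<close> and that all other higher homotopies are zero.
\<close>

definition T_construction ::
  "(nat \<Rightarrow> nat \<Rightarrow> nat \<Rightarrow> (nat list \<Rightarrow> 'b set) \<Rightarrow> nat list \<Rightarrow> 'b set) \<Rightarrow>
    (nat \<Rightarrow> nat \<Rightarrow> (nat list \<Rightarrow> 'b set) \<Rightarrow> nat list \<Rightarrow> 'b set) \<Rightarrow> bool"
  where "T_construction \<sigma> \<delta> \<longleftrightarrow>
    (\<forall>p\<in>{1..c}.
       higher_homotopies (hmf_ring S f (p - 1)) (seq_ideal S f (p - 1) +>\<^bsub>S\<^esub> f p)
         (U_module p) (U_diff p (\<delta> (p - 1))) (\<sigma> p) \<and>
       (\<forall>X\<in>carrier (base_change S (seq_ideal S f (p - 1)) (filt A F 0 p)).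
          \<sigma> p 1 0 (U_ident p 0 X) =
            U_ident p 1 (base_change_map S (seq_ideal S f (p - 1)) (filt A F 1 p) (h p) X)) \<and>
       shamash_differential (hmf_ring S f p) (U_module p) (\<sigma> p) (T_module p) (y_mult p) (\<delta> p))"

end

end

theory Submission
  imports Defs "HOL-Algebra.Ideal_Product"
begin

text \<open>
  Write \<open>I(p)\<close> for the ideal of \<open>f\<^sub>1, \<dots>, f\<^sub>p\<close>. The modules \<open>U\<^sub>n(p)\<close> and \<open>T\<^sub>n(p)\<close> are finite direct sums of reductions of
  the free modules \<open>B\<^sub>s(q)\<close>, so each is the reduction of a free \<open>S\<close>-module, and maps between them can be computed on
  representatives and lifted. The locale \<open>reduction\<close> axiomatises surjections of this kind. It is needed in
  two ways: \<open>T\<^sub>n(p)\<close> is the reduction modulo \<open>I(p)\<close> of a free module \<open>Tm p n\<close>, and the reduction modulo \<open>I(p-1)\<close> of the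
  same module is \<open>\<Oplus>\<^sub>i y\<^sup>(\<^sup>i\<^sup>) U\<^sub>n\<^sub>-\<^sub>2\<^sub>i(p)\<close>, the Shamash complex before division by \<open>f\<^sub>p\<close>.

  \<^emph>\<open>Exactness\<close> is proved by induction on \<open>p\<close>, starting from \<open>T(0) = 0\<close>. In degrees \<open>\<ge> 2\<close> the cone \<open>U(p)\<close> coincides
  with \<open>T(p-1)\<close>, so the point is degree 1. If \<open>d x\<close> vanishes modulo \<open>I(p-1)\<close>, then so does
  \<open>h\<^sub>p d x\<close>, and by condition (b) so does \<open>f\<^sub>p\<close> times the component of \<open>x\<close> in \<open>B\<^sub>1(p)\<close>; as \<open>f\<^sub>p\<close> is a nonzerodivisor
  modulo \<open>I(p-1)\<close>, the component itself vanishes and \<open>x\<close> is a cycle of \<open>T(p-1)\<close> (\<open>kernel_reduces\<close>). For the Shamash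
  complex, let \<open>D\<close> be given over \<open>R(p-1)\<close> by the formula for its differential. The equations for higher homotopies say
  that \<open>D\<^sup>2 = f\<^sub>p t\<close>, where \<open>t\<close> lowers the power of \<open>y\<close> by one (\<open>D_D\<close>). Hence \<open>D\<close> is a differential modulo \<open>f\<^sub>p\<close>, and since
  \<open>f\<^sub>p\<close> is a nonzerodivisor, exactness of \<open>U(p)\<close> implies exactness modulo \<open>f\<^sub>p\<close> (\<open>exact_mod\<close>, \<open>resolves_step\<close>).

  \<^emph>\<open>The first differentials.\<close> In degree 1 the Shamash differential is that of the cone, which is assembled from the
  components of \<open>d\<^sub>p\<close>. In degree 2, \<open>T\<^sub>2(p)\<close> is the sum of the reductions of \<open>T\<^sub>2(p-1)\<close> and of \<open>y\<^sub>p A\<^sub>0(p)\<close>; on the first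
  summand the differential is that of \<open>T(p-1)\<close>, and on the second it is \<open>\<sigma>\<^sub>1 = h\<^sub>p\<close> (\<open>second_step\<close>).

  \<^emph>\<open>Minimality.\<close> By the preceding identifications the matrix factorization is minimal iff the first two differentials
  are. It remains to show that minimality then holds in all degrees \<open>n \<ge> 3\<close>. Let \<open>m\<close> be the maximal ideal of \<open>S\<close>, and let \<open>L\<close> be a lift of the differential of \<open>T(p)\<close> to the free modules
  \<open>Tm p n\<close>, so that \<open>L\<^sup>2\<close> has values in \<open>I(p) Tm\<close>. For lifts that extend each other as \<open>p\<close> grows,
  \<open>L\<^sup>2 y \<in> m I(p) Tm\<close> forces \<open>y \<in> m Tm\<close>: modulo \<open>I(p-1)\<close> one has \<open>L\<^sup>2 = f\<^sub>p t\<close>, and as \<open>f\<^sub>p r \<in> m I(p) + I(p-1)\<close>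
  implies \<open>r \<in> m\<close>, the part of \<open>y\<close> with positive powers of \<open>y\<^sub>p\<close> is in \<open>m Tm\<close>; the rest belongs to \<open>Tm (p - 1)\<close>, where
  \<open>m I(p) \<inter> I(p-1) \<subseteq> m I(p-1)\<close> allows induction (\<open>detects_step\<close>). Now if \<open>L\<close> is minimal in degree \<open>n - 2\<close>, then
  \<open>L\<^sup>2 (L x) = L (L\<^sup>2 x) \<in> L (I(p) Tm) \<subseteq> m I(p) Tm\<close> for \<open>x\<close> in degree \<open>n\<close>, whence \<open>L x \<in> m Tm\<close> (\<open>minimal_from_degree_2\<close>).
\<close>

section \<open>Linear maps\<close>

lemma (in abelian_group) diff_diff:
  assumes "u \<in> carrier G" "v \<in> carrier G"
  shows "u \<ominus> (u \<ominus> v) = v"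
  using assms by (simp add: minus_eq minus_add r_neg2 r_neg1)

lemma (in abelian_group) add_diff:
  assumes "u \<in> carrier G" "v \<in> carrier G"
  shows "(u \<oplus> v) \<ominus> v = u"
  using assms by (simp add: minus_eq a_assoc r_neg)

lemma (in abelian_group) diff_add:
  assumes "u \<in> carrier G" "v \<in> carrier G"
  shows "v \<oplus> (u \<ominus> v) = u"
  using assms by (simp add: minus_eq a_lcomm r_neg)

lemma module_homD:
  assumes "g \<in> module_hom R M N"
  shows "x \<in> carrier M \<Longrightarrow> g x \<in> carrier N"
    and "x \<in> carrier M \<Longrightarrow> y \<in> carrier M \<Longrightarrow> g (x \<oplus>\<^bsub>M\<^esub> y) = g x \<oplus>\<^bsub>N\<^esub> g y"
    and "r \<in> carrier R \<Longrightarrow> x \<in> carrier M \<Longrightarrow> g (r \<odot>\<^bsub>M\<^esub> x) = r \<odot>\<^bsub>N\<^esub> g x"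
  using assms by (auto simp: module_hom_def)

lemma module_homI:
  assumes "\<And>x. x \<in> carrier M \<Longrightarrow> g x \<in> carrier N"
    and "\<And>x y. x \<in> carrier M \<Longrightarrow> y \<in> carrier M \<Longrightarrow> g (x \<oplus>\<^bsub>M\<^esub> y) = g x \<oplus>\<^bsub>N\<^esub> g y"
    and "\<And>r x. r \<in> carrier R \<Longrightarrow> x \<in> carrier M \<Longrightarrow> g (r \<odot>\<^bsub>M\<^esub> x) = r \<odot>\<^bsub>N\<^esub> g x"
  shows "g \<in> module_hom R M N"
  using assms by (auto simp: module_hom_def)

text \<open>Scalars are left out so that the notion also covers maps that are semilinear over \<open>S \<rightarrow> S/I\<close> or \<open>S/J \<rightarrow> S/I\<close>.\<close>

definition additive_map :: "('m, 'k1) ring_scheme \<Rightarrow> ('n, 'k2) ring_scheme \<Rightarrow> ('m \<Rightarrow> 'n) \<Rightarrow> bool"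
  where "additive_map M N g \<longleftrightarrow> abelian_group M \<and> abelian_group N \<and> g \<in> carrier M \<rightarrow> carrier N \<and>
    (\<forall>x\<in>carrier M. \<forall>y\<in>carrier M. g (x \<oplus>\<^bsub>M\<^esub> y) = g x \<oplus>\<^bsub>N\<^esub> g y)"

lemma module_hom_additive:
  assumes "module R M" "module R N" "g \<in> module_hom R M N"
  shows "additive_map M N g"
  using assms by (auto simp: additive_map_def module_hom_def module_def)

context
  fixes M :: "('m, 'k1) ring_scheme" (structure) and N :: "('n, 'k2) ring_scheme" and g
  assumes add: "additive_map M N g"
begin

interpretation M: abelian_group M using add by (simp add: additive_map_def)
interpretation N: abelian_group N using add by (simp add: additive_map_def)

lemma additive_closed: "x \<in> carrier M \<Longrightarrow> g x \<in> carrier N"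
  using add by (auto simp: additive_map_def)

lemma additive_add: "x \<in> carrier M \<Longrightarrow> y \<in> carrier M \<Longrightarrow> g (x \<oplus> y) = g x \<oplus>\<^bsub>N\<^esub> g y"
  using add by (auto simp: additive_map_def)

lemma additive_zero: "g \<zero> = \<zero>\<^bsub>N\<^esub>"
proof -
  have "g \<zero> \<oplus>\<^bsub>N\<^esub> g \<zero> = g \<zero> \<oplus>\<^bsub>N\<^esub> \<zero>\<^bsub>N\<^esub>"
    using additive_add[of \<zero> \<zero>] additive_closed[of \<zero>] by simp
  then show ?thesis using additive_closed[of \<zero>] by (metis M.zero_closed N.add.l_cancel N.zero_closed)
qed

lemma additive_neg: "x \<in> carrier M \<Longrightarrow> g (\<ominus> x) = \<ominus>\<^bsub>N\<^esub> g x"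
  using additive_add[of "\<ominus> x" x] additive_zero additive_closed
  by (metis M.a_inv_closed M.l_neg N.minus_equality)

lemma additive_diff: "x \<in> carrier M \<Longrightarrow> y \<in> carrier M \<Longrightarrow> g (x \<ominus> y) = g x \<ominus>\<^bsub>N\<^esub> g y"
  by (simp add: M.minus_eq N.minus_eq additive_add additive_neg)

lemma additive_finsum:
  assumes "finite E" "k \<in> E \<rightarrow> carrier M"
  shows "g (\<Oplus>e\<in>E. k e) = (\<Oplus>\<^bsub>N\<^esub>e\<in>E. g (k e))"
  using assms
proof (induction E rule: finite_induct)
  case empty
  then show ?case by (simp add: additive_zero)
next
  case (insert e E)
  then have "k e \<in> carrier M" "k \<in> E \<rightarrow> carrier M" by auto
  then show ?case using insert
    by (simp add: M.finsum_insert N.finsum_insert additive_add additive_closed Pi_iff)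
qed

end

lemma additive_comp:
  "additive_map M N g \<Longrightarrow> additive_map N P k \<Longrightarrow> additive_map M P (\<lambda>x. k (g x))"
  by (auto simp: additive_map_def Pi_iff)

lemma module_hom_comp:
  "g \<in> module_hom R M N \<Longrightarrow> k \<in> module_hom R N P \<Longrightarrow> (\<lambda>x. k (g x)) \<in> module_hom R M P"
  by (simp add: module_hom_def Pi_iff)

lemma module_hom_add:
  assumes "module R M" "module R N" "g \<in> module_hom R M N" "k \<in> module_hom R M N"
  shows "(\<lambda>x. g x \<oplus>\<^bsub>N\<^esub> k x) \<in> module_hom R M N"
proof -
  interpret N: module R N by fact
  show ?thesis
  proof (rule module_homI)
    fix x y assume "x \<in> carrier M" "y \<in> carrier M"
    then show "g (x \<oplus>\<^bsub>M\<^esub> y) \<oplus>\<^bsub>N\<^esub> k (x \<oplus>\<^bsub>M\<^esub> y) = (g x \<oplus>\<^bsub>N\<^esub> k x) \<oplus>\<^bsub>N\<^esub> (g y \<oplus>\<^bsub>N\<^esub> k y)"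
      using module_homD[OF assms(3)] module_homD[OF assms(4)] by (simp add: N.a_ac)
  qed (use module_homD[OF assms(3)] module_homD[OF assms(4)] in \<open>auto simp: N.smult_r_distr\<close>)
qed

lemma module_hom_zero_map:
  assumes "module R N" shows "(\<lambda>x. \<zero>\<^bsub>N\<^esub>) \<in> module_hom R M N"
proof -
  interpret N: module R N by fact
  show ?thesis by (auto intro!: module_homI)
qed

lemma module_hom_cong:
  assumes "module R M" "g \<in> module_hom R M N" "\<And>x. x \<in> carrier M \<Longrightarrow> g' x = g x"
  shows "g' \<in> module_hom R M N"
proof -
  interpret M: module R M by fact
  show ?thesis using assms by (auto simp: module_hom_def)
qed

lemma module_hom_finsum_map:
  assumes "module R M" "module R N" "finite J" "\<And>j. j \<in> J \<Longrightarrow> g j \<in> module_hom R M N"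
  shows "(\<lambda>x. \<Oplus>\<^bsub>N\<^esub>j\<in>J. g j x) \<in> module_hom R M N"
  using assms(3,4)
proof (induction J rule: finite_induct)
  case empty
  interpret N: module R N by fact
  show ?case using module_hom_zero_map[OF assms(2)] by simp
next
  case (insert j J)
  interpret M: module R M by fact
  interpret N: module R N by fact
  have "(\<lambda>x. g j x \<oplus>\<^bsub>N\<^esub> (\<Oplus>\<^bsub>N\<^esub>j\<in>J. g j x)) \<in> module_hom R M N"
    using insert by (intro module_hom_add assms(1,2)) auto
  then show ?case
  proof (rule module_hom_cong[OF assms(1)])
    fix x assume "x \<in> carrier M"
    then have "(\<lambda>j. g j x) \<in> J \<rightarrow> carrier N" "g j x \<in> carrier N"
      using module_homD(1)[OF insert.prems] by auto
    then show "(\<Oplus>\<^bsub>N\<^esub>j\<in>insert j J. g j x) = g j x \<oplus>\<^bsub>N\<^esub> (\<Oplus>\<^bsub>N\<^esub>j\<in>J. g j x)"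
      using insert.hyps by (intro N.finsum_insert)
  qed
qed

lemma module_iso_inverse:
  assumes "module R M" "g \<in> module_iso R M N"
  shows "inv_into (carrier M) g \<in> module_iso R N M"
proof -
  interpret M: module R M by fact
  let ?k = "inv_into (carrier M) g"
  have g: "g \<in> module_hom R M N" and b: "bij_betw g (carrier M) (carrier N)"
    using assms(2) by (auto simp: module_iso_def)
  have gk: "g (?k y) = y" if "y \<in> carrier N" for y
    using b that by (simp add: bij_betw_inv_into_right)
  have kg: "?k (g x) = x" if "x \<in> carrier M" for x
    using b that by (simp add: bij_betw_inv_into_left)
  have kc: "?k y \<in> carrier M" if "y \<in> carrier N" for y
    using bij_betw_inv_into[OF b] that by (auto simp: bij_betw_def)
  have "?k \<in> module_hom R N M"
  proof (rule module_homI)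
    fix x y assume xy: "x \<in> carrier N" "y \<in> carrier N"
    have "?k (x \<oplus>\<^bsub>N\<^esub> y) = ?k (g (?k x \<oplus>\<^bsub>M\<^esub> ?k y))"
      using xy by (simp add: module_homD(2)[OF g] kc gk)
    then show "?k (x \<oplus>\<^bsub>N\<^esub> y) = ?k x \<oplus>\<^bsub>M\<^esub> ?k y" using xy by (simp add: kg kc)
  next
    fix r x assume rx: "r \<in> carrier R" "x \<in> carrier N"
    have "?k (r \<odot>\<^bsub>N\<^esub> x) = ?k (g (r \<odot>\<^bsub>M\<^esub> ?k x))"
      using rx by (simp add: module_homD(3)[OF g] kc gk)
    then show "?k (r \<odot>\<^bsub>N\<^esub> x) = r \<odot>\<^bsub>M\<^esub> ?k x" using rx by (simp add: kg kc)
  qed (use kc in auto)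
  then show ?thesis using bij_betw_inv_into[OF b] by (simp add: module_iso_def)
qed

lemma module_isoI:
  assumes "module R M" "module R N" "g \<in> module_hom R M N"
    and "\<And>x. x \<in> carrier M \<Longrightarrow> g x = \<zero>\<^bsub>N\<^esub> \<Longrightarrow> x = \<zero>\<^bsub>M\<^esub>"
    and "\<And>y. y \<in> carrier N \<Longrightarrow> \<exists>x\<in>carrier M. g x = y"
  shows "g \<in> module_iso R M N"
proof -
  interpret M: module R M by fact
  interpret N: module R N by fact
  have add: "additive_map M N g" by (rule module_hom_additive) fact+
  have "inj_on g (carrier M)"
  proof (rule inj_onI)
    fix x y assume xy: "x \<in> carrier M" "y \<in> carrier M" "g x = g y"
    then have "g (x \<ominus>\<^bsub>M\<^esub> y) = \<zero>\<^bsub>N\<^esub>"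
      using additive_closed[OF add] by (simp add: additive_diff[OF add] N.minus_eq N.r_neg)
    then have "x \<ominus>\<^bsub>M\<^esub> y = \<zero>\<^bsub>M\<^esub>" using xy assms(4) by simp
    then show "x = y" using xy by (metis M.minus_eq M.a_inv_closed M.add.inv_equality M.minus_minus)
  qed
  moreover have "g ` carrier M = carrier N"
    using assms(5) module_homD(1)[OF assms(3)] by blast
  ultimately show ?thesis using assms(3) by (simp add: module_iso_def bij_betw_def)
qed

section \<open>Products of an ideal and a module\<close>

lemma submodule_additive_subgroup:
  assumes "module R M" "submodule N R M"
  shows "abelian_subgroup N M"
proof -
  interpret M: module R M by fact
  show ?thesis
    using assms(2) by (intro abelian_subgroupI3 additive_subgroup.intro)
      (auto simp: submodule_def M.abelian_group_axioms)
qed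

context
  fixes R :: "('a, 'k) ring_scheme" (structure) and M :: "('a, 'm, 'k1) module_scheme"
  assumes M: "module R M"
begin

interpretation M: module R M by (rule M)

lemma submoduleD:
  assumes "submodule N R M"
  shows "x \<in> N \<Longrightarrow> x \<in> carrier M" and "\<zero>\<^bsub>M\<^esub> \<in> N"
    and "x \<in> N \<Longrightarrow> y \<in> N \<Longrightarrow> x \<oplus>\<^bsub>M\<^esub> y \<in> N"
    and "x \<in> N \<Longrightarrow> \<ominus>\<^bsub>M\<^esub> x \<in> N"
    and "x \<in> N \<Longrightarrow> y \<in> N \<Longrightarrow> x \<ominus>\<^bsub>M\<^esub> y \<in> N"
    and "r \<in> carrier R \<Longrightarrow> x \<in> N \<Longrightarrow> r \<odot>\<^bsub>M\<^esub> x \<in> N"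
proof -
  interpret abelian_subgroup N M by (rule submodule_additive_subgroup[OF M assms])
  show "x \<in> N \<Longrightarrow> x \<in> carrier M" "\<zero>\<^bsub>M\<^esub> \<in> N" "x \<in> N \<Longrightarrow> y \<in> N \<Longrightarrow> x \<oplus>\<^bsub>M\<^esub> y \<in> N"
    "x \<in> N \<Longrightarrow> \<ominus>\<^bsub>M\<^esub> x \<in> N" "x \<in> N \<Longrightarrow> y \<in> N \<Longrightarrow> x \<ominus>\<^bsub>M\<^esub> y \<in> N"
    "r \<in> carrier R \<Longrightarrow> x \<in> N \<Longrightarrow> r \<odot>\<^bsub>M\<^esub> x \<in> N"
    using submodule.smult_closed[OF assms] by (auto simp: M.minus_eq)
qed

lemma submodule_finsum:
  assumes "submodule N R M" "finite E" "\<And>e. e \<in> E \<Longrightarrow> k e \<in> N"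
  shows "(\<Oplus>\<^bsub>M\<^esub>e\<in>E. k e) \<in> N"
  using assms(2,3)
proof (induction E rule: finite_induct)
  case empty
  then show ?case using submoduleD[OF assms(1)] by simp
next
  case (insert e E)
  then have "k \<in> E \<rightarrow> carrier M" "k e \<in> carrier M" using submoduleD(1)[OF assms(1)] by blast+
  then show ?case using insert submoduleD(3)[OF assms(1)] by (simp add: M.finsum_insert)
qed

lemma ideal_smult_submodule:
  assumes "ideal I R"
  shows "submodule (ideal_smult R I M) R M"
proof (rule M.submoduleI)
  show "ideal_smult R I M \<subseteq> carrier M"
    by (rule subsetI, unfold ideal_smult_def, erule InterD) (auto intro: M.carrier_is_submodule M.smult_closed ideal.Icarr[OF assms])
qed (auto simp: ideal_smult_def submoduleD)

lemmas ideal_smultD = submoduleD[OF ideal_smult_submodule]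

lemma ideal_smult_gen: "a \<in> I \<Longrightarrow> x \<in> carrier M \<Longrightarrow> a \<odot>\<^bsub>M\<^esub> x \<in> ideal_smult R I M"
  by (auto simp: ideal_smult_def)

lemma ideal_smult_least:
  "submodule N R M \<Longrightarrow> (\<And>a x. a \<in> I \<Longrightarrow> x \<in> carrier M \<Longrightarrow> a \<odot>\<^bsub>M\<^esub> x \<in> N) \<Longrightarrow>
    x \<in> ideal_smult R I M \<Longrightarrow> x \<in> N"
  by (auto simp: ideal_smult_def)

lemma ideal_smult_mono:
  assumes "ideal J R" "I \<subseteq> J" "x \<in> ideal_smult R I M"
  shows "x \<in> ideal_smult R J M"
  using ideal_smult_submodule[OF assms(1)] _ assms(3)
  by (rule ideal_smult_least) (use assms(2) in \<open>auto intro: ideal_smult_gen\<close>)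

end

lemma submodule_vimage:
  assumes "module R M" "module R N" "g \<in> module_hom R M N" "submodule K R N"
  shows "submodule {x \<in> carrier M. g x \<in> K} R M"
proof -
  interpret M: module R M by fact
  have add: "additive_map M N g" by (rule module_hom_additive) fact+
  show ?thesis
    by (rule M.submoduleI)
      (auto simp: additive_zero[OF add] additive_neg[OF add] additive_add[OF add]
        submoduleD[OF assms(2,4)] module_homD[OF assms(3)])
qed

lemma ideal_smult_hom:
  assumes "module R M" "module R N" "g \<in> module_hom R M N" "x \<in> ideal_smult R I M" "ideal I R"
  shows "g x \<in> ideal_smult R I N"
proof -
  interpret M: module R M by fact
  have "x \<in> {x \<in> carrier M. g x \<in> ideal_smult R I N}"
  proof (rule ideal_smult_least[OF assms(1) submodule_vimage[OF assms(1-3) ideal_smult_submodule[OF assms(2,5)]] _ assms(4)])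
    fix a x assume "a \<in> I" "x \<in> carrier M"
    then show "a \<odot>\<^bsub>M\<^esub> x \<in> {x \<in> carrier M. g x \<in> ideal_smult R I N}"
      using ideal.Icarr[OF assms(5)]
      by (simp add: module_homD[OF assms(3)] ideal_smult_gen[OF assms(2)])
  qed
  then show ?thesis by simp
qed

text \<open>\<open>g (I M) = I g(M) \<subseteq> I (J N) = (J I) N\<close>.\<close>

lemma ideal_smult_hom_prod:
  assumes "module R M" "module R N" "g \<in> module_hom R M N" "ideal I R" "ideal J R"
    and "\<And>x. x \<in> carrier M \<Longrightarrow> g x \<in> ideal_smult R J N" "x \<in> ideal_smult R I M"
  shows "g x \<in> ideal_smult R (ideal_prod R J I) N"
proof -
  interpret M: module R M by fact
  interpret N: module R N by fact
  note sub = ideal_smult_submodule[OF assms(2) M.ideal_prod_is_ideal[OF assms(5,4)]]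
  have ac: "a \<in> carrier R" if "a \<in> I" for a using that ideal.Icarr[OF assms(4)] by blast
  have bc: "a \<in> carrier R" if "a \<in> J" for a using that ideal.Icarr[OF assms(5)] by blast
  have *: "a \<odot>\<^bsub>N\<^esub> z \<in> ideal_smult R (ideal_prod R J I) N" if "a \<in> I" "z \<in> ideal_smult R J N" for a z
  proof -
    let ?K = "{z \<in> carrier N. a \<odot>\<^bsub>N\<^esub> z \<in> ideal_smult R (ideal_prod R J I) N}"
    have "(\<lambda>z. a \<odot>\<^bsub>N\<^esub> z) \<in> module_hom R N N"
    proof (rule module_homI)
      fix r z assume "r \<in> carrier R" "z \<in> carrier N"
      then show "a \<odot>\<^bsub>N\<^esub> (r \<odot>\<^bsub>N\<^esub> z) = r \<odot>\<^bsub>N\<^esub> (a \<odot>\<^bsub>N\<^esub> z)"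
        using ac[OF that(1)] N.smult_assoc1[of a r z] N.smult_assoc1[of r a z] M.m_comm[of a r] by simp
    qed (use ac[OF that(1)] in \<open>simp_all add: N.smult_r_distr\<close>)
    from submodule_vimage[OF assms(2) assms(2) this sub] have "submodule ?K R N" .
    moreover have "b \<odot>\<^bsub>N\<^esub> w \<in> ?K" if "b \<in> J" "w \<in> carrier N" for b w
    proof -
      have "a \<odot>\<^bsub>N\<^esub> (b \<odot>\<^bsub>N\<^esub> w) = (b \<otimes>\<^bsub>R\<^esub> a) \<odot>\<^bsub>N\<^esub> w"
        using that ac[OF \<open>a \<in> I\<close>] bc by (simp add: N.smult_assoc1[symmetric] M.m_comm)
      also have "\<dots> \<in> ideal_smult R (ideal_prod R J I) N"
        using that \<open>a \<in> I\<close> by (intro ideal_smult_gen[OF assms(2)] ideal_prod.prod)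
      finally show ?thesis using that bc by simp
    qed
    ultimately have "z \<in> ?K" using ideal_smult_least[OF assms(2)] that(2) by blast
    then show ?thesis by simp
  qed
  have "x \<in> {x \<in> carrier M. g x \<in> ideal_smult R (ideal_prod R J I) N}"
  proof (rule ideal_smult_least[OF assms(1) submodule_vimage[OF assms(1-3) sub] _ assms(7)])
    fix a x assume "a \<in> I" "x \<in> carrier M"
    then show "a \<odot>\<^bsub>M\<^esub> x \<in> {x \<in> carrier M. g x \<in> ideal_smult R (ideal_prod R J I) N}"
      using * assms(6) ac by (simp add: module_homD[OF assms(3)])
  qed
  then show ?thesis by simp
qed

lemma module_iso_ideal_smult_iff:
  assumes M: "module R M" and N: "module R N" and g: "g \<in> module_iso R M N" and K: "ideal K R" and x: "x \<in> carrier M"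
  shows "g x \<in> ideal_smult R K N \<longleftrightarrow> x \<in> ideal_smult R K M"
proof
  have inv: "inv_into (carrier M) g \<in> module_hom R N M" and gh: "g \<in> module_hom R M N" and inj: "inj_on g (carrier M)"
    using module_iso_inverse[OF M g] g by (auto simp: module_iso_def bij_betw_def)
  show "g x \<in> ideal_smult R K N \<Longrightarrow> x \<in> ideal_smult R K M"
    using ideal_smult_hom[OF N M inv _ K, of "g x"] inv_into_f_f[OF inj x] by simp
  show "x \<in> ideal_smult R K M \<Longrightarrow> g x \<in> ideal_smult R K N"
    by (rule ideal_smult_hom[OF M N gh _ K])
qed

section \<open>Reduction modulo an ideal\<close>

definition residue :: "('a, 'k) ring_scheme \<Rightarrow> 'a set \<Rightarrow> ('a, 'm, 'k1) module_scheme \<Rightarrow> 'm \<Rightarrow> 'm set"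
  where "residue R I M x = ideal_smult R I M +>\<^bsub>M\<^esub> x"

text \<open>A module \<open>P\<close> over \<open>R/I\<close> together with a map that induces \<open>M/IM \<cong> P\<close>. Working with the map \<open>q\<close> rather than with
  the particular module \<open>base_change R I M\<close> makes the notion stable under direct sums and isomorphisms.\<close>

locale reduction =
  fixes R :: "('a, 'k) ring_scheme" and I :: "'a set"
    and M :: "('a, 'm, 'k1) module_scheme" and P :: "('a set, 'p, 'k2) module_scheme" and q :: "'m \<Rightarrow> 'p"
  assumes M: "module R M" and I: "ideal I R" and P: "module (R Quot I) P"
    and closed: "x \<in> carrier M \<Longrightarrow> q x \<in> carrier P"
    and onto: "y \<in> carrier P \<Longrightarrow> \<exists>x\<in>carrier M. q x = y"
    and add: "x \<in> carrier M \<Longrightarrow> x' \<in> carrier M \<Longrightarrow> q (x \<oplus>\<^bsub>M\<^esub> x') = q x \<oplus>\<^bsub>P\<^esub> q x'"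
    and smult: "r \<in> carrier R \<Longrightarrow> x \<in> carrier M \<Longrightarrow> q (r \<odot>\<^bsub>M\<^esub> x) = (I +>\<^bsub>R\<^esub> r) \<odot>\<^bsub>P\<^esub> q x"
    and kernel: "x \<in> carrier M \<Longrightarrow> q x = \<zero>\<^bsub>P\<^esub> \<longleftrightarrow> x \<in> ideal_smult R I M"
begin

lemma additive_map: "additive_map M P q"
  using M P by (auto simp: additive_map_def module_def closed add)

lemma eq_iff:
  assumes "x \<in> carrier M" "y \<in> carrier M"
  shows "q x = q y \<longleftrightarrow> x \<ominus>\<^bsub>M\<^esub> y \<in> ideal_smult R I M"
proof -
  interpret M: module R M by (rule M)
  interpret P: module "R Quot I" P by (rule P)
  have "q x = q y \<longleftrightarrow> q x \<ominus>\<^bsub>P\<^esub> q y = \<zero>\<^bsub>P\<^esub>"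
    using closed assms
    by (metis P.minus_eq P.a_inv_closed P.add.inv_equality P.minus_minus P.r_neg)
  also have "\<dots> \<longleftrightarrow> q (x \<ominus>\<^bsub>M\<^esub> y) = \<zero>\<^bsub>P\<^esub>" using assms by (simp add: additive_diff[OF additive_map])
  finally show ?thesis using assms kernel by simp
qed

lemma scalar_onto: "a \<in> carrier (R Quot I) \<Longrightarrow> \<exists>r\<in>carrier R. I +>\<^bsub>R\<^esub> r = a"
  by (auto simp: FactRing_def A_RCOSETS_def' a_r_coset_def')

lemma scalar_closed: "r \<in> carrier R \<Longrightarrow> I +>\<^bsub>R\<^esub> r \<in> carrier (R Quot I)"
  by (auto simp: FactRing_def A_RCOSETS_def' a_r_coset_def')

end

lemma abelian_group_cosets:
  assumes "abelian_subgroup N M" "carrier P = a_rcosets\<^bsub>M\<^esub> N" "\<zero>\<^bsub>P\<^esub> = N" "add P = set_add M"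
  shows "abelian_group P"
proof -
  interpret G: comm_group "M A_Mod N" by (rule abelian_subgroup.a_factorgroup_is_comm_group[OF assms(1)])
  have G: "carrier (M A_Mod N) = carrier P" "\<And>x y. x \<otimes>\<^bsub>M A_Mod N\<^esub> y = x \<oplus>\<^bsub>P\<^esub> y" "\<one>\<^bsub>M A_Mod N\<^esub> = \<zero>\<^bsub>P\<^esub>"
    using assms(2-4) by (simp_all add: A_FactGroup_def')
  show ?thesis
  proof (rule abelian_groupI)
    fix x assume "x \<in> carrier P"
    then show "\<exists>y\<in>carrier P. y \<oplus>\<^bsub>P\<^esub> x = \<zero>\<^bsub>P\<^esub>"
      using G.l_inv[unfolded G] G.inv_closed[unfolded G] by blast
  qed (use G.m_closed[unfolded G] G.one_closed[unfolded G] G.l_one[unfolded G] in simp_all,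
      rule G.m_assoc[unfolded G], simp_all, rule G.m_comm[unfolded G], simp_all)
qed

context
  fixes R :: "('a, 'k) ring_scheme" and I :: "'a set" and M :: "('a, 'm, 'k1) module_scheme"
  assumes M: "module R M" and I: "ideal I R"
begin

interpretation M: module R M by (rule M)
interpretation I: ideal I R by (rule I)
interpretation IM: abelian_subgroup "ideal_smult R I M" M
  by (rule submodule_additive_subgroup[OF M ideal_smult_submodule[OF M I]])

lemma residue_mem: "x' \<in> residue R I M x \<Longrightarrow> x \<in> carrier M \<Longrightarrow> x' \<in> carrier M \<and> residue R I M x' = residue R I M x"
  unfolding residue_def using IM.a_elemrcos_carrier IM.a_repr_independence' by metis

lemma residue_self: "x \<in> carrier M \<Longrightarrow> x \<in> residue R I M x"
  unfolding residue_def by (rule IM.a_rcos_self)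

lemma residue_eq_iff:
  "x \<in> carrier M \<Longrightarrow> y \<in> carrier M \<Longrightarrow> residue R I M x = residue R I M y \<longleftrightarrow> x \<ominus>\<^bsub>M\<^esub> y \<in> ideal_smult R I M"
  unfolding residue_def M.minus_eq
  by (metis IM.a_rcos_module IM.a_rcos_self IM.a_repr_independence' M.is_abelian_group)

lemma residue_add:
  "x \<in> carrier M \<Longrightarrow> y \<in> carrier M \<Longrightarrow>
    residue R I M (x \<oplus>\<^bsub>M\<^esub> y) = residue R I M x \<oplus>\<^bsub>base_change R I M\<^esub> residue R I M y"
  by (simp add: residue_def base_change_def IM.a_rcos_sum)

lemma residue_smult:
  assumes "r \<in> carrier R" "x \<in> carrier M"
  shows "residue R I M (r \<odot>\<^bsub>M\<^esub> x) = (I +>\<^bsub>R\<^esub> r) \<odot>\<^bsub>base_change R I M\<^esub> residue R I M x"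
proof -
  have *: "residue R I M (r' \<odot>\<^bsub>M\<^esub> x') = residue R I M (r \<odot>\<^bsub>M\<^esub> x)"
    if "r' \<in> I +>\<^bsub>R\<^esub> r" "x' \<in> residue R I M x" for r' x'
  proof -
    have x': "x' \<in> carrier M" using residue_mem that assms by blast
    have r': "r' \<in> carrier R" "r' \<ominus>\<^bsub>R\<^esub> r \<in> I"
      using that(1) assms(1) I.a_elemrcos_carrier I.a_rcos_module_minus[OF M.ring_axioms] by blast+
    have d: "x' \<ominus>\<^bsub>M\<^esub> x \<in> ideal_smult R I M"
      using residue_mem that assms residue_eq_iff x' by blast
    have "r' \<odot>\<^bsub>M\<^esub> x' \<ominus>\<^bsub>M\<^esub> r \<odot>\<^bsub>M\<^esub> x = (r' \<ominus>\<^bsub>R\<^esub> r) \<odot>\<^bsub>M\<^esub> x' \<oplus>\<^bsub>M\<^esub> r \<odot>\<^bsub>M\<^esub> (x' \<ominus>\<^bsub>M\<^esub> x)"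
      using r' assms x'
      by (simp add: M.minus_eq M.R.minus_eq M.smult_l_distr M.smult_r_distr M.smult_l_minus M.smult_r_minus
          M.a_assoc M.r_neg1 M.r_neg2)
    also have "\<dots> \<in> ideal_smult R I M"
      using r' assms x' d by (intro ideal_smultD(3,6)[OF M I] ideal_smult_gen[OF M])
    finally show ?thesis using r' assms x' by (simp add: residue_eq_iff)
  qed
  have "(\<Union>r\<in>I +>\<^bsub>R\<^esub> r. \<Union>x\<in>residue R I M x. residue R I M (r \<odot>\<^bsub>M\<^esub> x)) = residue R I M (r \<odot>\<^bsub>M\<^esub> x)"
    using I.a_rcos_self[OF assms(1)] residue_self[OF assms(2)] * by blast
  then show ?thesis by (simp add: base_change_def residue_def)
qed

lemma residue_carrier: "carrier (base_change R I M) = residue R I M ` carrier M"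
  by (auto simp: base_change_def residue_def A_RCOSETS_def' a_r_coset_def')

lemma residue_zero: "\<zero>\<^bsub>base_change R I M\<^esub> = residue R I M \<zero>\<^bsub>M\<^esub>"
  by (simp add: base_change_def residue_def IM.a_subset)

lemma base_change_module: "module (R Quot I) (base_change R I M)"
proof (rule moduleI)
  show "cring (R Quot I)" by (rule I.quotient_is_cring) (rule M.is_cring)
  show "abelian_group (base_change R I M)"
    by (rule abelian_group_cosets[OF IM.is_abelian_subgroup]) (auto simp: base_change_def)
  have q: "\<exists>r\<in>carrier R. a = I +>\<^bsub>R\<^esub> r" if "a \<in> carrier (R Quot I)" for a
    using that by (auto simp: FactRing_def A_RCOSETS_def' a_r_coset_def')
  have m: "\<exists>u\<in>carrier M. x = residue R I M u" if "x \<in> carrier (base_change R I M)" for x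
    using that by (auto simp: residue_carrier)
  note s = residue_smult[symmetric] residue_add[symmetric]
  fix a x assume ax: "a \<in> carrier (R Quot I)" "x \<in> carrier (base_change R I M)"
  show "a \<odot>\<^bsub>base_change R I M\<^esub> x \<in> carrier (base_change R I M)"
    using q[OF ax(1)] m[OF ax(2)] by (auto simp: s residue_carrier)
  fix y assume y: "y \<in> carrier (base_change R I M)"
  show "a \<odot>\<^bsub>base_change R I M\<^esub> (x \<oplus>\<^bsub>base_change R I M\<^esub> y)
      = a \<odot>\<^bsub>base_change R I M\<^esub> x \<oplus>\<^bsub>base_change R I M\<^esub> a \<odot>\<^bsub>base_change R I M\<^esub> y"
    using q[OF ax(1)] m[OF ax(2)] m[OF y] by (auto simp: s M.smult_r_distr)
next
  have q: "\<exists>r\<in>carrier R. a = I +>\<^bsub>R\<^esub> r" if "a \<in> carrier (R Quot I)" for a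
    using that by (auto simp: FactRing_def A_RCOSETS_def' a_r_coset_def')
  note s = residue_smult[symmetric] residue_add[symmetric]
  fix a b x
  assume ab: "a \<in> carrier (R Quot I)" "b \<in> carrier (R Quot I)" and "x \<in> carrier (base_change R I M)"
  then obtain u where u: "u \<in> carrier M" "x = residue R I M u" by (auto simp: residue_carrier)
  obtain r t where rt: "r \<in> carrier R" "a = I +>\<^bsub>R\<^esub> r" "t \<in> carrier R" "b = I +>\<^bsub>R\<^esub> t" using q ab by metis
  have 1: "a \<oplus>\<^bsub>R Quot I\<^esub> b = I +>\<^bsub>R\<^esub> (r \<oplus>\<^bsub>R\<^esub> t)" "a \<otimes>\<^bsub>R Quot I\<^esub> b = I +>\<^bsub>R\<^esub> (r \<otimes>\<^bsub>R\<^esub> t)"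
    using rt by (auto simp: FactRing_def I.a_rcos_sum I.rcoset_mult_add)
  show "(a \<oplus>\<^bsub>R Quot I\<^esub> b) \<odot>\<^bsub>base_change R I M\<^esub> x
      = a \<odot>\<^bsub>base_change R I M\<^esub> x \<oplus>\<^bsub>base_change R I M\<^esub> b \<odot>\<^bsub>base_change R I M\<^esub> x"
    unfolding 1 using rt u by (simp add: s M.smult_l_distr)
  show "(a \<otimes>\<^bsub>R Quot I\<^esub> b) \<odot>\<^bsub>base_change R I M\<^esub> x
      = a \<odot>\<^bsub>base_change R I M\<^esub> (b \<odot>\<^bsub>base_change R I M\<^esub> x)"
    unfolding 1 using rt u by (simp add: s M.smult_assoc1)
next
  fix x assume "x \<in> carrier (base_change R I M)"
  then show "\<one>\<^bsub>R Quot I\<^esub> \<odot>\<^bsub>base_change R I M\<^esub> x = x"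
    by (auto simp: FactRing_def residue_smult[symmetric] residue_carrier)
qed

lemma base_change_reduction: "reduction R I M (base_change R I M) (residue R I M)"
proof (rule reduction.intro)
  show "residue R I M x = \<zero>\<^bsub>base_change R I M\<^esub> \<longleftrightarrow> x \<in> ideal_smult R I M" if "x \<in> carrier M" for x
    using that residue_eq_iff[of x "\<zero>\<^bsub>M\<^esub>"] M.minus_equality[of "\<zero>\<^bsub>M\<^esub>" "\<zero>\<^bsub>M\<^esub>"]
    by (simp add: residue_zero M.minus_eq)
qed (use base_change_module residue_carrier residue_add residue_smult M I in \<open>auto intro: base_change_module\<close>)

end

lemma base_change_map_residue:
  assumes "module R M" "module R N" "ideal I R" "ideal J R" "J \<subseteq> I" "g \<in> module_hom R M N"
    and "x \<in> carrier M"
  shows "base_change_map R I N g (residue R J M x) = residue R I N (g x)"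
proof -
  interpret M: module R M by fact
  have add: "additive_map M N g" by (rule module_hom_additive) fact+
  have "residue R I N (g x') = residue R I N (g x)" if "x' \<in> residue R J M x" for x'
  proof -
    have x': "x' \<in> carrier M" "x' \<ominus>\<^bsub>M\<^esub> x \<in> ideal_smult R J M"
      using residue_mem[OF assms(1,4) that assms(7)] residue_eq_iff[OF assms(1,4)] assms(7) by blast+
    then have "g (x' \<ominus>\<^bsub>M\<^esub> x) \<in> ideal_smult R J N"
      using ideal_smult_hom[OF assms(1,2,6) _ assms(4)] by blast
    then have "g (x' \<ominus>\<^bsub>M\<^esub> x) \<in> ideal_smult R I N"
      using ideal_smult_mono[OF assms(2,3,5)] by blast
    then show ?thesis
      using x' assms(7) residue_eq_iff[OF assms(2,3), of "g x'" "g x"] module_homD(1)[OF assms(6)]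
      by (simp add: additive_diff[OF add])
  qed
  moreover have "x \<in> residue R J M x" using residue_self[OF assms(1,4,7)] .
  ultimately have "(\<Union>x'\<in>residue R J M x. residue R I N (g x')) = residue R I N (g x)"
    by (intro SUP_eq_const) blast+
  then show ?thesis by (simp add: base_change_map_def residue_def[of R I N])
qed

lemma reduction_iso:
  assumes "reduction R I M P q" "module R M'" "g \<in> module_iso R M' M"
  shows "reduction R I M' P (\<lambda>x. q (g x))"
proof (rule reduction.intro)
  interpret reduction R I M P q by fact
  have g: "g \<in> module_hom R M' M" and bij: "bij_betw g (carrier M') (carrier M)"
    using assms(3) by (auto simp: module_iso_def)
  let ?k = "inv_into (carrier M') g"
  have k: "?k \<in> module_hom R M M'" using module_iso_inverse[OF assms(2,3)] by (simp add: module_iso_def)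
  show "module R M'" "ideal I R" "module (R Quot I) P" by (fact assms(2), rule I, rule P)
  show "\<exists>x\<in>carrier M'. q (g x) = y" if "y \<in> carrier P" for y
    using onto[OF that] bij_betw_imp_surj_on[OF bij] by (metis imageE)
  fix x assume x: "x \<in> carrier M'"
  show "q (g x) = \<zero>\<^bsub>P\<^esub> \<longleftrightarrow> x \<in> ideal_smult R I M'"
    using kernel[OF module_homD(1)[OF g x]] ideal_smult_hom[OF assms(2) M g, of x I] I
      ideal_smult_hom[OF M assms(2) k, of "g x" I] bij_betw_inv_into_left[OF bij x] by auto
qed (use assms in \<open>auto simp: module_iso_def module_homD reduction.closed reduction.add reduction.smult\<close>)

text \<open>As the reduction map is onto, a map given on classes by a linear map of representatives is itself linear.\<close>

lemma reduction_induced_hom: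
  assumes P: "reduction R I M P q" and P': "reduction R I N P' q'" and \<phi>: "\<phi> \<in> module_hom R M N"
    and g: "\<And>x. x \<in> carrier M \<Longrightarrow> g (q x) = q' (\<phi> x)"
  shows "g \<in> module_hom (R Quot I) P P'"
proof -
  interpret P: reduction R I M P q by (rule P)
  interpret P': reduction R I N P' q' by (rule P')
  interpret PM: module R M by (rule P.M)
  show ?thesis
  proof (rule module_homI)
    fix y assume "y \<in> carrier P"
    then obtain x where x: "x \<in> carrier M" "y = q x" using P.onto by blast
    show "g y \<in> carrier P'" using x g P'.closed module_homD(1)[OF \<phi>] by simp
    fix z assume "z \<in> carrier P"
    then obtain w where w: "w \<in> carrier M" "z = q w" using P.onto by blast
    have "g (y \<oplus>\<^bsub>P\<^esub> z) = g (q (x \<oplus>\<^bsub>M\<^esub> w))" using x w by (simp add: P.add)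
    also have "\<dots> = g y \<oplus>\<^bsub>P'\<^esub> g z"
      using x w by (simp add: g module_homD(1,2)[OF \<phi>] P'.add)
    finally show "g (y \<oplus>\<^bsub>P\<^esub> z) = g y \<oplus>\<^bsub>P'\<^esub> g z" .
  next
    fix a y assume "a \<in> carrier (R Quot I)" "y \<in> carrier P"
    then obtain r x where r: "r \<in> carrier R" "a = I +>\<^bsub>R\<^esub> r" and x: "x \<in> carrier M" "y = q x"
      using P.onto P.scalar_onto by metis
    have "g (a \<odot>\<^bsub>P\<^esub> y) = g (q (r \<odot>\<^bsub>M\<^esub> x))" using r x by (simp add: P.smult)
    also have "\<dots> = a \<odot>\<^bsub>P'\<^esub> g y" using r x by (simp add: g module_homD[OF \<phi>] P'.smult)
    finally show "g (a \<odot>\<^bsub>P\<^esub> y) = a \<odot>\<^bsub>P'\<^esub> g y" .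
  qed
qed

lemma reduction_induced_iso:
  assumes P: "reduction R I M P q" and P': "reduction R I N P' q'" and \<phi>: "\<phi> \<in> module_iso R M N"
    and g: "\<And>x. x \<in> carrier M \<Longrightarrow> g (q x) = q' (\<phi> x)"
  shows "g \<in> module_iso (R Quot I) P P'"
proof -
  interpret P: reduction R I M P q by (rule P)
  interpret P': reduction R I N P' q' by (rule P')
  have h: "\<phi> \<in> module_hom R M N" and bij: "bij_betw \<phi> (carrier M) (carrier N)" using \<phi> by (auto simp: module_iso_def)
  have k: "inv_into (carrier M) \<phi> \<in> module_hom R N M"
    using module_iso_inverse[OF P.M \<phi>] by (simp add: module_iso_def)
  show ?thesis
  proof (rule module_isoI[OF P.P P'.P reduction_induced_hom[OF P P' h g]])
    fix y assume "y \<in> carrier P" and z: "g y = \<zero>\<^bsub>P'\<^esub>"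
    then obtain x where x: "x \<in> carrier M" "y = q x" using P.onto by blast
    then have "\<phi> x \<in> ideal_smult R I N" using z g P'.kernel module_homD(1)[OF h] by simp
    then have "x \<in> ideal_smult R I M"
      using ideal_smult_hom[OF P'.M P.M k _ P.I, of "\<phi> x"] bij_betw_inv_into_left[OF bij x(1)] by simp
    then show "y = \<zero>\<^bsub>P\<^esub>" using P.kernel x by simp
  next
    fix y assume "y \<in> carrier P'"
    then obtain z where z: "z \<in> carrier N" "y = q' z" using P'.onto by blast
    then obtain x where "x \<in> carrier M" "z = \<phi> x" using bij_betw_imp_surj_on[OF bij] by blast
    then show "\<exists>x\<in>carrier P. g x = y" using z g P.closed by blast
  qed
qed

section \<open>Direct sums\<close>

definition ds_inj :: "'i set \<Rightarrow> ('i \<Rightarrow> ('a, 'm, 'k1) module_scheme) \<Rightarrow> 'i \<Rightarrow> 'm \<Rightarrow> 'i \<Rightarrow> 'm"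
  where "ds_inj J M j x = (\<lambda>i\<in>J. if i = j then x else \<zero>\<^bsub>M i\<^esub>)"

lemma direct_sum_simps:
  "carrier (direct_sum J M) = (\<Pi>\<^sub>E i\<in>J. carrier (M i))"
  "\<zero>\<^bsub>direct_sum J M\<^esub> = (\<lambda>i\<in>J. \<zero>\<^bsub>M i\<^esub>)"
  "x \<oplus>\<^bsub>direct_sum J M\<^esub> y = (\<lambda>i\<in>J. x i \<oplus>\<^bsub>M i\<^esub> y i)"
  "r \<odot>\<^bsub>direct_sum J M\<^esub> x = (\<lambda>i\<in>J. r \<odot>\<^bsub>M i\<^esub> x i)"
  by (simp_all add: direct_sum_def)

lemma direct_sum_module:
  assumes "cring R" "\<And>j. j \<in> J \<Longrightarrow> module R (M j)"
  shows "module R (direct_sum J M)"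
proof (rule moduleI)
  show "cring R" by fact
  have ag: "abelian_group (M j)" if "j \<in> J" for j using assms(2)[OF that] by (simp add: module_def)
  show "abelian_group (direct_sum J M)"
  proof (rule abelian_groupI)
    fix x assume x: "x \<in> carrier (direct_sum J M)"
    have "(\<lambda>j\<in>J. \<ominus>\<^bsub>M j\<^esub> x j) \<in> carrier (direct_sum J M)"
      using x ag by (auto simp: direct_sum_simps PiE_iff abelian_group.a_inv_closed)
    moreover have "(\<lambda>j\<in>J. \<ominus>\<^bsub>M j\<^esub> x j) \<oplus>\<^bsub>direct_sum J M\<^esub> x = \<zero>\<^bsub>direct_sum J M\<^esub>"
      using x ag by (auto simp: direct_sum_simps PiE_iff abelian_group.l_neg intro!: restrict_ext)
    ultimately show "\<exists>y\<in>carrier (direct_sum J M). y \<oplus>\<^bsub>direct_sum J M\<^esub> x = \<zero>\<^bsub>direct_sum J M\<^esub>" by blast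
  next
    fix x assume x: "x \<in> carrier (direct_sum J M)"
    show "\<zero>\<^bsub>direct_sum J M\<^esub> \<oplus>\<^bsub>direct_sum J M\<^esub> x = x"
      using x ag by (auto simp: direct_sum_simps PiE_iff fun_eq_iff restrict_def extensional_def
          abelian_group.axioms(1) abelian_monoid.l_zero)
  qed (use ag in \<open>auto simp: direct_sum_simps PiE_iff abelian_group.axioms(1) abelian_monoid.a_closed
      abelian_monoid.zero_closed intro!: restrict_ext abelian_monoid.a_assoc abelian_monoid.a_comm\<close>)
next
  fix x assume "x \<in> carrier (direct_sum J M)"
  then show "\<one>\<^bsub>R\<^esub> \<odot>\<^bsub>direct_sum J M\<^esub> x = x"
    using assms(2) by (auto simp: direct_sum_simps PiE_iff fun_eq_iff restrict_def extensional_def module.smult_one)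
qed (auto simp: direct_sum_simps PiE_iff module.smult_closed[OF assms(2)] module.smult_l_distr[OF assms(2)]
    module.smult_r_distr[OF assms(2)] module.smult_assoc1[OF assms(2)] intro!: restrict_ext)

context
  fixes R :: "('a, 'k) ring_scheme" and J :: "'i set" and M :: "'i \<Rightarrow> ('a, 'm, 'k1) module_scheme"
  assumes R: "cring R" and M: "\<And>j. j \<in> J \<Longrightarrow> module R (M j)" and J: "finite J"
begin

interpretation D: module R "direct_sum J M" by (rule direct_sum_module[OF R M])

lemma ds_mem: "x \<in> carrier (direct_sum J M) \<longleftrightarrow> x \<in> extensional J \<and> (\<forall>j\<in>J. x j \<in> carrier (M j))"
  by (auto simp: direct_sum_simps PiE_iff)

lemma ds_eqI:
  "x \<in> carrier (direct_sum J M) \<Longrightarrow> y \<in> carrier (direct_sum J M) \<Longrightarrow> (\<And>j. j \<in> J \<Longrightarrow> x j = y j) \<Longrightarrow> x = y"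
  by (auto simp: ds_mem intro: extensionalityI)

lemma ds_proj_hom: "j \<in> J \<Longrightarrow> (\<lambda>x. x j) \<in> module_hom R (direct_sum J M) (M j)"
  by (auto intro!: module_homI simp: direct_sum_simps)

lemma ds_proj_additive: "j \<in> J \<Longrightarrow> additive_map (direct_sum J M) (M j) (\<lambda>x. x j)"
  by (rule module_hom_additive[OF D.module_axioms M ds_proj_hom])

lemma ds_homI:
  assumes "module R L" "\<And>j. j \<in> J \<Longrightarrow> g j \<in> module_hom R L (M j)"
  shows "(\<lambda>x. \<lambda>j\<in>J. g j x) \<in> module_hom R L (direct_sum J M)"
  by (rule module_homI) (auto simp: direct_sum_simps module_homD[OF assms(2)] intro!: restrict_ext)

lemma ds_inj_apply: "i \<in> J \<Longrightarrow> ds_inj J M j x i = (if i = j then x else \<zero>\<^bsub>M i\<^esub>)"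
  by (simp add: ds_inj_def)

lemma ds_zero_in: "j \<in> J \<Longrightarrow> \<zero>\<^bsub>M j\<^esub> \<in> carrier (M j)"
  using M[of j] by (auto simp: module_def abelian_group_def intro: abelian_monoid.zero_closed)

lemma ds_inj_hom:
  assumes "j \<in> J" shows "ds_inj J M j \<in> module_hom R (M j) (direct_sum J M)"
proof (rule module_homI)
  fix x y assume xy: "x \<in> carrier (M j)" "y \<in> carrier (M j)"
  have z: "\<zero>\<^bsub>M i\<^esub> = \<zero>\<^bsub>M i\<^esub> \<oplus>\<^bsub>M i\<^esub> \<zero>\<^bsub>M i\<^esub>" if "i \<in> J" for i
  proof -
    interpret module R "M i" using M that .
    show ?thesis by simp
  qed
  then show "ds_inj J M j (x \<oplus>\<^bsub>M j\<^esub> y) = ds_inj J M j x \<oplus>\<^bsub>direct_sum J M\<^esub> ds_inj J M j y"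
    by (auto simp: ds_inj_def direct_sum_simps intro!: restrict_ext)
next
  fix r x assume "r \<in> carrier R"
  then have "\<zero>\<^bsub>M i\<^esub> = r \<odot>\<^bsub>M i\<^esub> \<zero>\<^bsub>M i\<^esub>" if "i \<in> J" for i
    using module.smult_r_null[OF M[OF that]] by simp
  then show "ds_inj J M j (r \<odot>\<^bsub>M j\<^esub> x) = r \<odot>\<^bsub>direct_sum J M\<^esub> ds_inj J M j x"
    by (auto simp: ds_inj_def direct_sum_simps intro!: restrict_ext)
next
  fix x assume "x \<in> carrier (M j)"
  then show "ds_inj J M j x \<in> carrier (direct_sum J M)"
    using ds_zero_in by (auto simp: ds_mem ds_inj_def)
qed

lemma ds_finsum_apply:
  assumes "finite E" "\<And>e. e \<in> E \<Longrightarrow> k e \<in> carrier (direct_sum J M)" "j \<in> J"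
  shows "(\<Oplus>\<^bsub>direct_sum J M\<^esub>e\<in>E. k e) j = (\<Oplus>\<^bsub>M j\<^esub>e\<in>E. k e j)"
  using additive_finsum[OF ds_proj_additive[OF assms(3)] assms(1)] assms(2) by blast

lemma ds_decomp:
  assumes "x \<in> carrier (direct_sum J M)"
  shows "x = (\<Oplus>\<^bsub>direct_sum J M\<^esub>j\<in>J. ds_inj J M j (x j))"
proof (rule ds_eqI)
  have c: "ds_inj J M j (x j) \<in> carrier (direct_sum J M)" if "j \<in> J" for j
    using module_homD(1)[OF ds_inj_hom[OF that]] assms that by (auto simp: ds_mem)
  then show "(\<Oplus>\<^bsub>direct_sum J M\<^esub>j\<in>J. ds_inj J M j (x j)) \<in> carrier (direct_sum J M)"
    by (intro D.finsum_closed) auto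
  fix i assume i: "i \<in> J"
  interpret Mi: module R "M i" using M i .
  have "(\<Oplus>\<^bsub>direct_sum J M\<^esub>j\<in>J. ds_inj J M j (x j)) i = (\<Oplus>\<^bsub>M i\<^esub>j\<in>J. ds_inj J M j (x j) i)"
    using c J i by (intro ds_finsum_apply) auto
  also have "\<dots> = (\<Oplus>\<^bsub>M i\<^esub>j\<in>J. if i = j then (if j = i then x j else \<zero>\<^bsub>M i\<^esub>) else \<zero>\<^bsub>M i\<^esub>)"
    using i assms by (intro Mi.finsum_cong') (auto simp: ds_inj_apply ds_mem)
  also have "\<dots> = x i"
    using i J assms by (subst Mi.finsum_singleton) (auto simp: ds_mem)
  finally show "x i = (\<Oplus>\<^bsub>direct_sum J M\<^esub>j\<in>J. ds_inj J M j (x j)) i" by simp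
qed (rule assms)

text \<open>The elements of single summands generate the direct sum.\<close>

lemma additive_eq_on_ds:
  assumes "additive_map (direct_sum J M) N g" "additive_map (direct_sum J M) N g'"
    and "\<And>j x. j \<in> J \<Longrightarrow> x \<in> carrier (M j) \<Longrightarrow> g (ds_inj J M j x) = g' (ds_inj J M j x)"
    and "x \<in> carrier (direct_sum J M)"
  shows "g x = g' x"
proof -
  have N: "abelian_group N" using assms(1) by (simp add: additive_map_def)
  interpret N: abelian_group N by (rule N)
  have c: "(\<lambda>j. ds_inj J M j (x j)) \<in> J \<rightarrow> carrier (direct_sum J M)"
    using module_homD(1)[OF ds_inj_hom] assms(4) by (auto simp: ds_mem)
  have "g x = (\<Oplus>\<^bsub>N\<^esub>j\<in>J. g (ds_inj J M j (x j)))"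
    using additive_finsum[OF assms(1) J c] ds_decomp[OF assms(4)] by simp
  also have "\<dots> = (\<Oplus>\<^bsub>N\<^esub>j\<in>J. g' (ds_inj J M j (x j)))"
    using c assms(3,4) additive_closed[OF assms(2)] by (intro N.finsum_cong' refl) (simp_all add: ds_mem Pi_iff)
  also have "\<dots> = g' x"
    using additive_finsum[OF assms(2) J c] ds_decomp[OF assms(4)] by simp
  finally show ?thesis .
qed

lemma ideal_smult_direct_sum:
  assumes "ideal I R" "x \<in> carrier (direct_sum J M)"
  shows "x \<in> ideal_smult R I (direct_sum J M) \<longleftrightarrow> (\<forall>j\<in>J. x j \<in> ideal_smult R I (M j))"
proof
  assume "x \<in> ideal_smult R I (direct_sum J M)"
  then show "\<forall>j\<in>J. x j \<in> ideal_smult R I (M j)"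
    using ideal_smult_hom[OF D.module_axioms M ds_proj_hom _ assms(1)] by blast
next
  assume *: "\<forall>j\<in>J. x j \<in> ideal_smult R I (M j)"
  have "(\<Oplus>\<^bsub>direct_sum J M\<^esub>j\<in>J. ds_inj J M j (x j)) \<in> ideal_smult R I (direct_sum J M)"
    using ideal_smult_hom[OF M D.module_axioms ds_inj_hom _ assms(1)] *
    by (intro submodule_finsum[OF D.module_axioms ideal_smult_submodule[OF D.module_axioms assms(1)] J]) blast
  then show "x \<in> ideal_smult R I (direct_sum J M)" using ds_decomp[OF assms(2)] by simp
qed

end

lemma direct_sum_reduction:
  assumes "cring R" "ideal I R" "finite J" "\<And>j. j \<in> J \<Longrightarrow> reduction R I (M j) (P j) (q j)"
  shows "reduction R I (direct_sum J M) (direct_sum J P) (\<lambda>x. \<lambda>j\<in>J. q j (x j))"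
proof -
  have cQ: "cring (R Quot I)" by (rule ideal.quotient_is_cring[OF assms(2,1)])
  have mM: "module R (M j)" if "j \<in> J" for j using reduction.M[OF assms(4)[OF that]] .
  have mP: "module (R Quot I) (P j)" if "j \<in> J" for j using reduction.P[OF assms(4)[OF that]] .
  note memM = ds_mem[OF assms(1) mM assms(3)] and memP = ds_mem[OF cQ mP assms(3)]
  show ?thesis
  proof (rule reduction.intro)
    show "module R (direct_sum J M)" by (rule direct_sum_module[OF assms(1) mM])
    show "module (R Quot I) (direct_sum J P)" by (rule direct_sum_module[OF cQ mP])
    show "ideal I R" by fact
  next
    fix y assume y: "y \<in> carrier (direct_sum J P)"
    then have "\<forall>j\<in>J. \<exists>x\<in>carrier (M j). q j x = y j" using reduction.onto[OF assms(4)] by (auto simp: memP)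
    then obtain x where x: "\<forall>j\<in>J. x j \<in> carrier (M j) \<and> q j (x j) = y j" by metis
    then have "restrict x J \<in> carrier (direct_sum J M)" "(\<lambda>j\<in>J. q j (restrict x J j)) = y"
      using y by (auto simp: memM memP extensional_def fun_eq_iff restrict_def)
    then show "\<exists>x\<in>carrier (direct_sum J M). (\<lambda>j\<in>J. q j (x j)) = y" by blast
  next
    fix x assume x: "x \<in> carrier (direct_sum J M)"
    have "(\<lambda>j\<in>J. q j (x j)) = \<zero>\<^bsub>direct_sum J P\<^esub> \<longleftrightarrow> (\<forall>j\<in>J. q j (x j) = \<zero>\<^bsub>P j\<^esub>)"
      by (auto simp: direct_sum_simps fun_eq_iff restrict_def)
    also have "\<dots> \<longleftrightarrow> (\<forall>j\<in>J. x j \<in> ideal_smult R I (M j))"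
      using reduction.kernel[OF assms(4)] x by (auto simp: memM)
    also have "\<dots> \<longleftrightarrow> x \<in> ideal_smult R I (direct_sum J M)"
      using ideal_smult_direct_sum[OF assms(1) mM assms(3,2) x] by simp
    finally show "(\<lambda>j\<in>J. q j (x j)) = \<zero>\<^bsub>direct_sum J P\<^esub> \<longleftrightarrow> x \<in> ideal_smult R I (direct_sum J M)" .
  qed (auto simp: direct_sum_simps PiE_iff reduction.closed[OF assms(4)] reduction.add[OF assms(4)]
      reduction.smult[OF assms(4)] intro!: restrict_ext)
qed

section \<open>Free modules\<close>

text \<open>The basis is an indexed family, since reductions and direct sums provide families of
  basis vectors without their distinctness.\<close>

locale coordinates =
  fixes R :: "('a, 'k) ring_scheme" and M :: "('a, 'm, 'k1) module_scheme" and X :: "'x set" and b :: "'x \<Rightarrow> 'm"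
  assumes module: "module R M" and finite: "finite X" and basis: "x \<in> X \<Longrightarrow> b x \<in> carrier M"
    and unique: "m \<in> carrier M \<Longrightarrow> \<exists>!k. k \<in> X \<rightarrow>\<^sub>E carrier R \<and> m = (\<Oplus>\<^bsub>M\<^esub>x\<in>X. k x \<odot>\<^bsub>M\<^esub> b x)"
begin

interpretation M: module R M by (rule module)

definition coord :: "'m \<Rightarrow> 'x \<Rightarrow> 'a"
  where "coord m = (THE k. k \<in> X \<rightarrow>\<^sub>E carrier R \<and> m = (\<Oplus>\<^bsub>M\<^esub>x\<in>X. k x \<odot>\<^bsub>M\<^esub> b x))"

lemma coord_prop:
  assumes "m \<in> carrier M"
  shows "coord m \<in> X \<rightarrow>\<^sub>E carrier R \<and> m = (\<Oplus>\<^bsub>M\<^esub>x\<in>X. coord m x \<odot>\<^bsub>M\<^esub> b x)"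
  unfolding coord_def by (rule theI'[OF unique[OF assms]])

lemma coord_closed: "m \<in> carrier M \<Longrightarrow> x \<in> X \<Longrightarrow> coord m x \<in> carrier R"
  using coord_prop by blast

lemma coord_sum: "m \<in> carrier M \<Longrightarrow> (\<Oplus>\<^bsub>M\<^esub>x\<in>X. coord m x \<odot>\<^bsub>M\<^esub> b x) = m"
  using coord_prop by simp

lemma comb_closed:
  assumes "\<And>x. x \<in> X \<Longrightarrow> k x \<in> carrier R"
  shows "(\<Oplus>\<^bsub>M\<^esub>x\<in>X. k x \<odot>\<^bsub>M\<^esub> b x) \<in> carrier M"
  using assms basis by (intro M.finsum_closed) auto

lemma coord_comb:
  assumes k: "\<And>x. x \<in> X \<Longrightarrow> k x \<in> carrier R" and x: "x \<in> X"
  shows "coord (\<Oplus>\<^bsub>M\<^esub>x\<in>X. k x \<odot>\<^bsub>M\<^esub> b x) x = k x"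
proof -
  let ?m = "\<Oplus>\<^bsub>M\<^esub>x\<in>X. k x \<odot>\<^bsub>M\<^esub> b x"
  have m: "?m \<in> carrier M" by (rule comb_closed[OF k])
  have "restrict k X \<in> X \<rightarrow>\<^sub>E carrier R \<and> ?m = (\<Oplus>\<^bsub>M\<^esub>x\<in>X. restrict k X x \<odot>\<^bsub>M\<^esub> b x)"
    using k basis by (auto intro!: M.finsum_cong')
  then have "coord ?m = restrict k X" using unique[OF m] coord_prop[OF m] by blast
  then show ?thesis using x by simp
qed

lemma coord_add:
  assumes "m \<in> carrier M" "n \<in> carrier M" "x \<in> X"
  shows "coord (m \<oplus>\<^bsub>M\<^esub> n) x = coord m x \<oplus>\<^bsub>R\<^esub> coord n x"
proof -
  have "(\<Oplus>\<^bsub>M\<^esub>x\<in>X. (coord m x \<oplus>\<^bsub>R\<^esub> coord n x) \<odot>\<^bsub>M\<^esub> b x)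
    = (\<Oplus>\<^bsub>M\<^esub>x\<in>X. coord m x \<odot>\<^bsub>M\<^esub> b x \<oplus>\<^bsub>M\<^esub> coord n x \<odot>\<^bsub>M\<^esub> b x)"
    using assms basis coord_closed by (intro M.finsum_cong') (auto simp: M.smult_l_distr)
  also have "\<dots> = m \<oplus>\<^bsub>M\<^esub> n"
    using assms basis coord_closed by (subst M.finsum_addf) (auto simp: coord_sum)
  finally show ?thesis
    using coord_comb[of "\<lambda>x. coord m x \<oplus>\<^bsub>R\<^esub> coord n x" x] assms coord_closed by simp
qed

lemma coord_smult:
  assumes "r \<in> carrier R" "m \<in> carrier M" "x \<in> X"
  shows "coord (r \<odot>\<^bsub>M\<^esub> m) x = r \<otimes>\<^bsub>R\<^esub> coord m x"
proof -
  have "r \<odot>\<^bsub>M\<^esub> m = r \<odot>\<^bsub>M\<^esub> (\<Oplus>\<^bsub>M\<^esub>x\<in>X. coord m x \<odot>\<^bsub>M\<^esub> b x)"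
    using assms by (simp add: coord_sum)
  also have "\<dots> = (\<Oplus>\<^bsub>M\<^esub>x\<in>X. r \<odot>\<^bsub>M\<^esub> (coord m x \<odot>\<^bsub>M\<^esub> b x))"
    using assms basis coord_closed finite by (intro M.finsum_smult_ldistr) auto
  also have "\<dots> = (\<Oplus>\<^bsub>M\<^esub>x\<in>X. (r \<otimes>\<^bsub>R\<^esub> coord m x) \<odot>\<^bsub>M\<^esub> b x)"
    using assms basis coord_closed by (intro M.finsum_cong') (auto simp: M.smult_assoc1)
  finally show ?thesis
    using coord_comb[of "\<lambda>x. r \<otimes>\<^bsub>R\<^esub> coord m x" x] assms coord_closed by simp
qed

lemma coord_zero: "x \<in> X \<Longrightarrow> coord \<zero>\<^bsub>M\<^esub> x = \<zero>\<^bsub>R\<^esub>"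
  using coord_smult[of "\<zero>\<^bsub>R\<^esub>" "\<zero>\<^bsub>M\<^esub>" x] coord_closed[of "\<zero>\<^bsub>M\<^esub>" x] by simp

lemma coord_neg: "m \<in> carrier M \<Longrightarrow> x \<in> X \<Longrightarrow> coord (\<ominus>\<^bsub>M\<^esub> m) x = \<ominus>\<^bsub>R\<^esub> coord m x"
  using coord_add[of "\<ominus>\<^bsub>M\<^esub> m" m x] coord_closed coord_zero
  by (metis M.M.a_inv_closed M.M.l_neg M.R.minus_equality)

lemma ideal_smult_coord:
  assumes "ideal I R" "m \<in> carrier M"
  shows "m \<in> ideal_smult R I M \<longleftrightarrow> (\<forall>x\<in>X. coord m x \<in> I)"
proof
  interpret I: ideal I R by fact
  let ?N = "{m \<in> carrier M. \<forall>x\<in>X. coord m x \<in> I}"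
  have "submodule ?N R M"
    by (rule M.submoduleI) (auto simp: coord_zero coord_neg coord_add coord_smult I.I_l_closed)
  moreover have "a \<odot>\<^bsub>M\<^esub> n \<in> ?N" if "a \<in> I" "n \<in> carrier M" for a n
    using that by (auto simp: coord_smult coord_closed I.I_r_closed)
  moreover assume "m \<in> ideal_smult R I M"
  ultimately have "m \<in> ?N" by (rule ideal_smult_least[OF module])
  then show "\<forall>x\<in>X. coord m x \<in> I" by simp
next
  assume *: "\<forall>x\<in>X. coord m x \<in> I"
  have "(\<Oplus>\<^bsub>M\<^esub>x\<in>X. coord m x \<odot>\<^bsub>M\<^esub> b x) \<in> ideal_smult R I M"
    using * basis by (intro submodule_finsum[OF module ideal_smult_submodule[OF module assms(1)] finite]
        ideal_smult_gen[OF module]) auto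
  then show "m \<in> ideal_smult R I M" using assms by (simp add: coord_sum)
qed

lemma coordinates_iso:
  assumes "Module.module R N" "g \<in> module_iso R M N"
  shows "coordinates R N X (\<lambda>x. g (b x))"
proof (rule coordinates.intro)
  interpret N: module R N by fact
  have g: "g \<in> module_hom R M N" and bij: "bij_betw g (carrier M) (carrier N)"
    using assms(2) by (auto simp: module_iso_def)
  have add: "additive_map M N g" by (rule module_hom_additive[OF module assms(1) g])
  have comb: "(\<Oplus>\<^bsub>N\<^esub>x\<in>X. k x \<odot>\<^bsub>N\<^esub> g (b x)) = g (\<Oplus>\<^bsub>M\<^esub>x\<in>X. k x \<odot>\<^bsub>M\<^esub> b x)"
    if "k \<in> X \<rightarrow>\<^sub>E carrier R" for k
  proof -
    have "g (\<Oplus>\<^bsub>M\<^esub>x\<in>X. k x \<odot>\<^bsub>M\<^esub> b x) = (\<Oplus>\<^bsub>N\<^esub>x\<in>X. g (k x \<odot>\<^bsub>M\<^esub> b x))"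
      using that basis by (intro additive_finsum[OF add finite]) auto
    also have "\<dots> = (\<Oplus>\<^bsub>N\<^esub>x\<in>X. k x \<odot>\<^bsub>N\<^esub> g (b x))"
      using PiE_mem[OF that] basis module_homD(1)[OF g] by (intro N.finsum_cong' refl) (auto simp: module_homD(3)[OF g])
    finally show ?thesis by simp
  qed
  show "\<exists>!k. k \<in> X \<rightarrow>\<^sub>E carrier R \<and> n = (\<Oplus>\<^bsub>N\<^esub>x\<in>X. k x \<odot>\<^bsub>N\<^esub> g (b x))" if n: "n \<in> carrier N" for n
  proof -
    obtain m where m: "m \<in> carrier M" "n = g m" using bij n by (auto simp: bij_betw_def)
    have "n = (\<Oplus>\<^bsub>N\<^esub>x\<in>X. k x \<odot>\<^bsub>N\<^esub> g (b x)) \<longleftrightarrow> m = (\<Oplus>\<^bsub>M\<^esub>x\<in>X. k x \<odot>\<^bsub>M\<^esub> b x)"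
      if "k \<in> X \<rightarrow>\<^sub>E carrier R" for k
      using comb[OF that] m that bij comb_closed[of k]
      by (metis PiE_mem bij_betw_imp_inj_on inj_on_eq_iff)
    then have "(k \<in> X \<rightarrow>\<^sub>E carrier R \<and> n = (\<Oplus>\<^bsub>N\<^esub>x\<in>X. k x \<odot>\<^bsub>N\<^esub> g (b x)))
      \<longleftrightarrow> (k \<in> X \<rightarrow>\<^sub>E carrier R \<and> m = (\<Oplus>\<^bsub>M\<^esub>x\<in>X. k x \<odot>\<^bsub>M\<^esub> b x))" for k by blast
    then show ?thesis using unique[OF m(1)] by (simp only:)
  qed
  show "g (b x) \<in> carrier N" if "x \<in> X" for x by (rule module_homD(1)[OF g basis[OF that]])
qed (fact assms(1), fact finite)

text \<open>Over the zero ring distinct indices could have the same vector; otherwise a basis is injective on its indices, so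
  that its image is a basis in the sense of a set.\<close>

lemma fg_freeI:
  assumes "\<one>\<^bsub>R\<^esub> \<noteq> \<zero>\<^bsub>R\<^esub>"
  shows "fg_free R M"
proof -
  have delta: "coord (b y) x = (if x = y then \<one>\<^bsub>R\<^esub> else \<zero>\<^bsub>R\<^esub>)" if "x \<in> X" "y \<in> X" for x y
  proof -
    let ?k = "\<lambda>x. if x = y then \<one>\<^bsub>R\<^esub> else \<zero>\<^bsub>R\<^esub>"
    have "(\<Oplus>\<^bsub>M\<^esub>x\<in>X. ?k x \<odot>\<^bsub>M\<^esub> b x) = (\<Oplus>\<^bsub>M\<^esub>x\<in>X. if y = x then b x else \<zero>\<^bsub>M\<^esub>)"
      using basis by (intro M.finsum_cong') auto
    also have "\<dots> = b y" using that basis finite by (subst M.finsum_singleton) auto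
    finally show ?thesis using coord_comb[of ?k x] that by simp
  qed
  have inj: "inj_on b X"
    by (rule inj_onI) (metis assms delta)
  have "module_basis R M (b ` X)"
    unfolding module_basis_def
  proof (intro conjI ballI)
    show "b ` X \<subseteq> carrier M" using basis by auto
    fix m assume m: "m \<in> carrier M"
    have re: "(\<Oplus>\<^bsub>M\<^esub>e\<in>b ` X. k e \<odot>\<^bsub>M\<^esub> e) = (\<Oplus>\<^bsub>M\<^esub>x\<in>X. k (b x) \<odot>\<^bsub>M\<^esub> b x)"
      if "k \<in> b ` X \<rightarrow>\<^sub>E carrier R" for k
      using that basis inj by (intro M.finsum_reindex) auto
    show "\<exists>!k. k \<in> b ` X \<rightarrow>\<^sub>E carrier R \<and> m = (\<Oplus>\<^bsub>M\<^esub>e\<in>b ` X. k e \<odot>\<^bsub>M\<^esub> e)"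
    proof (rule ex1I)
      let ?k = "\<lambda>e\<in>b ` X. coord m (inv_into X b e)"
      have k: "?k \<in> b ` X \<rightarrow>\<^sub>E carrier R"
        using inj m coord_closed by auto
      moreover have "(\<Oplus>\<^bsub>M\<^esub>x\<in>X. ?k (b x) \<odot>\<^bsub>M\<^esub> b x) = (\<Oplus>\<^bsub>M\<^esub>x\<in>X. coord m x \<odot>\<^bsub>M\<^esub> b x)"
        using inj basis m coord_closed by (intro M.finsum_cong') auto
      ultimately show "?k \<in> b ` X \<rightarrow>\<^sub>E carrier R \<and> m = (\<Oplus>\<^bsub>M\<^esub>e\<in>b ` X. ?k e \<odot>\<^bsub>M\<^esub> e)"
        unfolding re[OF k] using coord_sum[OF m] by simp
      fix k assume k: "k \<in> b ` X \<rightarrow>\<^sub>E carrier R \<and> m = (\<Oplus>\<^bsub>M\<^esub>e\<in>b ` X. k e \<odot>\<^bsub>M\<^esub> e)"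
      have "coord m x = k (b x)" if "x \<in> X" for x
        using k re[of k] coord_comb[of "\<lambda>x. k (b x)" x] that by auto
      then show "k = ?k" using k inj by (auto intro!: extensionalityI simp: PiE_iff)
    qed
  qed (use finite in auto)
  then show ?thesis using module by (auto simp: fg_free_def)
qed

end

lemma fg_freeD:
  assumes "fg_free R M"
  shows "\<exists>E. coordinates R M E (\<lambda>e. e)"
proof -
  obtain E where E: "module R M" "module_basis R M E" using assms by (auto simp: fg_free_def)
  have "coordinates R M E (\<lambda>e. e)"
    by (rule coordinates.intro) (use E in \<open>simp_all add: module_basis_def subset_iff\<close>)
  then show ?thesis ..
qed

lemma fg_free_iso:
  assumes "fg_free R M" "module R N" "g \<in> module_iso R M N" "\<one>\<^bsub>R\<^esub> \<noteq> \<zero>\<^bsub>R\<^esub>"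
  shows "fg_free R N"
  using fg_freeD[OF assms(1)] coordinates.coordinates_iso[OF _ assms(2,3)] coordinates.fg_freeI assms(4) by blast

text \<open>For a free module membership in \<open>I M\<close> means that all coordinates are in \<open>I\<close>, so \<open>I M \<inter> J M = (I \<inter> J) M\<close>.\<close>

lemma fg_free_Int:
  assumes "fg_free R M" "ideal I R" "ideal J R" "x \<in> ideal_smult R I M" "x \<in> ideal_smult R J M"
    "ideal K R" "I \<inter> J \<subseteq> K"
  shows "x \<in> ideal_smult R K M"
proof -
  obtain E where E: "coordinates R M E (\<lambda>e. e)" using fg_freeD[OF assms(1)] ..
  then interpret coordinates R M E "\<lambda>e. e" .
  have x: "x \<in> carrier M" using ideal_smultD(1)[OF module assms(2)] assms(4) by blast
  show ?thesis
    using assms(4-7) ideal_smult_coord[OF assms(2) x] ideal_smult_coord[OF assms(3) x] ideal_smult_coord[OF assms(6) x]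
    by blast
qed

lemma fg_free_divide:
  assumes "fg_free R M" "ideal I R" "ideal J R" "a \<in> carrier R" "x \<in> carrier M"
    and "a \<odot>\<^bsub>M\<^esub> x \<in> ideal_smult R I M"
    and "\<And>r. r \<in> carrier R \<Longrightarrow> a \<otimes>\<^bsub>R\<^esub> r \<in> I \<Longrightarrow> r \<in> J"
  shows "x \<in> ideal_smult R J M"
proof -
  obtain E where E: "coordinates R M E (\<lambda>e. e)" using fg_freeD[OF assms(1)] ..
  then interpret coordinates R M E "\<lambda>e. e" .
  have "a \<odot>\<^bsub>M\<^esub> x \<in> carrier M" using assms module.smult_closed[OF module] by blast
  then have "\<forall>e\<in>E. a \<otimes>\<^bsub>R\<^esub> coord x e \<in> I"
    using assms(6) ideal_smult_coord[OF assms(2)] coord_smult[OF assms(4,5)] by simp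
  then show ?thesis using ideal_smult_coord[OF assms(3,5)] assms(7) coord_closed[OF assms(5)] by simp
qed

lemma coordinates_direct_sum:
  assumes "cring R" "finite J" "\<And>j. j \<in> J \<Longrightarrow> coordinates R (M j) (X j) (b j)"
  shows "coordinates R (direct_sum J M) (Sigma J X) (\<lambda>(j, x). ds_inj J M j (b j x))"
proof (rule coordinates.intro)
  have mod: "module R (M j)" if "j \<in> J" for j using coordinates.module[OF assms(3)[OF that]] .
  note fin = coordinates.finite[OF assms(3)] and bas = coordinates.basis[OF assms(3)]
  show D: "module R (direct_sum J M)" by (rule direct_sum_module[OF assms(1) mod])
  show "finite (Sigma J X)" using assms(2) fin by auto
  let ?b = "\<lambda>(j, x). ds_inj J M j (b j x)"
  interpret D: module R "direct_sum J M" by (rule D)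
  show bc: "?b p \<in> carrier (direct_sum J M)" if "p \<in> Sigma J X" for p
    using that bas module_homD(1)[OF ds_inj_hom[OF assms(1) mod assms(2)]] by auto
  note mem = ds_mem[OF assms(1) mod assms(2)]
  have comb: "(\<Oplus>\<^bsub>direct_sum J M\<^esub>p\<in>Sigma J X. k p \<odot>\<^bsub>direct_sum J M\<^esub> ?b p) j = (\<Oplus>\<^bsub>M j\<^esub>x\<in>X j. k (j, x) \<odot>\<^bsub>M j\<^esub> b j x)"
    if k: "k \<in> Sigma J X \<rightarrow> carrier R" and j: "j \<in> J" for k j
  proof -
    interpret Mj: module R "M j" using mod[OF j] .
    have val: "(k p \<odot>\<^bsub>direct_sum J M\<^esub> ?b p) j = (if fst p = j then k p \<odot>\<^bsub>M j\<^esub> b j (snd p) else \<zero>\<^bsub>M j\<^esub>)"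
      if "p \<in> Sigma J X" for p
      using funcset_mem[OF k that] j by (cases p) (simp add: direct_sum_simps ds_inj_def)
    have "(\<Oplus>\<^bsub>direct_sum J M\<^esub>p\<in>Sigma J X. k p \<odot>\<^bsub>direct_sum J M\<^esub> ?b p) j
      = (\<Oplus>\<^bsub>M j\<^esub>p\<in>Sigma J X. (k p \<odot>\<^bsub>direct_sum J M\<^esub> ?b p) j)"
      using k bc \<open>finite (Sigma J X)\<close> by (intro ds_finsum_apply[OF assms(1) mod assms(2) _ _ j]) auto
    also have "\<dots> = (\<Oplus>\<^bsub>M j\<^esub>p\<in>Pair j ` X j. k p \<odot>\<^bsub>M j\<^esub> b j (snd p))"
    proof (rule Mj.add.finprod_mono_neutral_cong)
      show "finite (Sigma J X)" "finite (Pair j ` X j)" using \<open>finite (Sigma J X)\<close> fin[OF j] by auto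
      show "(k i \<odot>\<^bsub>direct_sum J M\<^esub> ?b i) j = \<zero>\<^bsub>M j\<^esub>" if "i \<in> Sigma J X - Pair j ` X j" for i
        using that val[of i] by (cases i) (auto split: if_splits)
      show "k i \<odot>\<^bsub>M j\<^esub> b j (snd i) = \<zero>\<^bsub>M j\<^esub>" if "i \<in> Pair j ` X j - Sigma J X" for i
        using that j by auto
      show "(k i \<odot>\<^bsub>direct_sum J M\<^esub> ?b i) j = k i \<odot>\<^bsub>M j\<^esub> b j (snd i)" if "i \<in> Sigma J X \<inter> Pair j ` X j" for i
        using that val[of i] by (cases i) (auto split: if_splits)
      have kb: "k (j, x) \<odot>\<^bsub>M j\<^esub> b j x \<in> carrier (M j)" if "x \<in> X j" for x
        using that j funcset_mem[OF k, of "(j, x)"] bas[OF j that] by simp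
      show "(\<lambda>p. k p \<odot>\<^bsub>M j\<^esub> b j (snd p)) \<in> Pair j ` X j \<rightarrow> carrier (M j)"
        using kb by auto
      show "(\<lambda>p. (k p \<odot>\<^bsub>direct_sum J M\<^esub> ?b p) j) \<in> Sigma J X \<rightarrow> carrier (M j)"
      proof
        fix p assume p: "p \<in> Sigma J X"
        then show "(k p \<odot>\<^bsub>direct_sum J M\<^esub> ?b p) j \<in> carrier (M j)"
          using kb by (subst val[OF p]) auto
      qed
    qed
    also have "\<dots> = (\<Oplus>\<^bsub>M j\<^esub>x\<in>X j. k (j, x) \<odot>\<^bsub>M j\<^esub> b j (snd (j, x)))"
      using k j bas by (intro Mj.finsum_reindex) (auto simp: inj_on_def)
    finally show ?thesis by simp
  qed
  show "\<exists>!k. k \<in> Sigma J X \<rightarrow>\<^sub>E carrier R \<and> m = (\<Oplus>\<^bsub>direct_sum J M\<^esub>p\<in>Sigma J X. k p \<odot>\<^bsub>direct_sum J M\<^esub> ?b p)"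
    if m: "m \<in> carrier (direct_sum J M)" for m
  proof (rule ex1I)
    let ?c = "\<lambda>j. coordinates.coord R (M j) (X j) (b j) (m j)"
    let ?k = "\<lambda>p\<in>Sigma J X. ?c (fst p) (snd p)"
    have mj: "m j \<in> carrier (M j)" if "j \<in> J" for j using m that by (simp add: mem)
    note cc = coordinates.coord_closed[OF assms(3) mj]
    have k: "?k \<in> Sigma J X \<rightarrow>\<^sub>E carrier R" using cc by auto
    have "m = (\<Oplus>\<^bsub>direct_sum J M\<^esub>p\<in>Sigma J X. ?k p \<odot>\<^bsub>direct_sum J M\<^esub> ?b p)" (is "m = ?s")
    proof (rule ds_eqI[OF assms(1) mod assms(2) m])
      show "?s \<in> carrier (direct_sum J M)"
        using PiE_mem[OF k] bc by (intro D.finsum_closed Pi_I D.smult_closed)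
      fix j assume j: "j \<in> J"
      interpret Mj: module R "M j" using mod[OF j] .
      have "?s j = (\<Oplus>\<^bsub>M j\<^esub>x\<in>X j. ?k (j, x) \<odot>\<^bsub>M j\<^esub> b j x)" by (rule comb[OF _ j]) (use k in \<open>simp only: PiE_def Int_iff\<close>)
      also have "\<dots> = (\<Oplus>\<^bsub>M j\<^esub>x\<in>X j. ?c j x \<odot>\<^bsub>M j\<^esub> b j x)"
        using j cc bas by (intro Mj.finsum_cong') auto
      also have "\<dots> = m j" by (rule coordinates.coord_sum[OF assms(3)[OF j] mj[OF j]])
      finally show "m j = ?s j" by simp
    qed
    then show "?k \<in> Sigma J X \<rightarrow>\<^sub>E carrier R \<and> m = ?s" using k by simp
    fix k assume k: "k \<in> Sigma J X \<rightarrow>\<^sub>E carrier R \<and> m = (\<Oplus>\<^bsub>direct_sum J M\<^esub>p\<in>Sigma J X. k p \<odot>\<^bsub>direct_sum J M\<^esub> ?b p)"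
    have "k (j, x) = ?c j x" if "j \<in> J" "x \<in> X j" for j x
    proof -
      have kp: "k \<in> Sigma J X \<rightarrow> carrier R" using k by (simp only: PiE_def Int_iff)
      have "m j = (\<Oplus>\<^bsub>M j\<^esub>x\<in>X j. k (j, x) \<odot>\<^bsub>M j\<^esub> b j x)"
        using comb[OF kp that(1)] k by simp
      moreover have "k (j, x) \<in> carrier R" if "x \<in> X j" for x
        using funcset_mem[OF kp] \<open>j \<in> J\<close> that by blast
      ultimately show ?thesis
        using coordinates.coord_comb[OF assms(3)[OF that(1)], of "\<lambda>x. k (j, x)" x] that(2) by simp
    qed
    then show "k = ?k" using k by (auto intro!: extensionalityI simp: PiE_iff)
  qed
qed

lemma fg_free_direct_sum:
  assumes "cring R" "finite J" "\<And>j. j \<in> J \<Longrightarrow> fg_free R (M j)" "\<one>\<^bsub>R\<^esub> \<noteq> \<zero>\<^bsub>R\<^esub>"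
  shows "fg_free R (direct_sum J M)"
proof -
  have "\<forall>j\<in>J. \<exists>E. coordinates R (M j) E (\<lambda>e. e)" using fg_freeD[OF assms(3)] by blast
  then obtain E where E: "\<And>j. j \<in> J \<Longrightarrow> coordinates R (M j) (E j) (\<lambda>e. e)" by metis
  show ?thesis
    by (rule coordinates.fg_freeI[OF coordinates_direct_sum[OF assms(1,2), where b = "\<lambda>j e. e"] assms(4)]) (rule E)
qed

context reduction
begin

interpretation M: module R M by (rule M)
interpretation P: module "R Quot I" P by (rule P)
interpretation I: ideal I R by (rule I)

lemma comb:
  assumes "finite X" "\<And>x. x \<in> X \<Longrightarrow> b x \<in> carrier M" "\<And>x. x \<in> X \<Longrightarrow> k x \<in> carrier R"
  shows "q (\<Oplus>\<^bsub>M\<^esub>x\<in>X. k x \<odot>\<^bsub>M\<^esub> b x) = (\<Oplus>\<^bsub>P\<^esub>x\<in>X. (I +>\<^bsub>R\<^esub> k x) \<odot>\<^bsub>P\<^esub> q (b x))"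
proof -
  have "q (\<Oplus>\<^bsub>M\<^esub>x\<in>X. k x \<odot>\<^bsub>M\<^esub> b x) = (\<Oplus>\<^bsub>P\<^esub>x\<in>X. q (k x \<odot>\<^bsub>M\<^esub> b x))"
    using assms by (intro additive_finsum[OF additive_map]) auto
  also have "\<dots> = (\<Oplus>\<^bsub>P\<^esub>x\<in>X. (I +>\<^bsub>R\<^esub> k x) \<odot>\<^bsub>P\<^esub> q (b x))"
    using assms scalar_closed closed by (intro P.finsum_cong' refl) (auto simp: smult)
  finally show ?thesis .
qed

lemma coordinates_reduction:
  assumes "coordinates R M X b"
  shows "coordinates (R Quot I) P X (\<lambda>x. q (b x))"
proof (rule coordinates.intro)
  interpret C: coordinates R M X b by fact
  show "module (R Quot I) P" by (rule P)
  show "finite X" by (rule C.finite)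
  show "q (b x) \<in> carrier P" if "x \<in> X" for x using C.basis[OF that] closed by simp
  fix m assume "m \<in> carrier P"
  then obtain n where n: "n \<in> carrier M" "q n = m" using onto by blast
  show "\<exists>!k. k \<in> X \<rightarrow>\<^sub>E carrier (R Quot I) \<and> m = (\<Oplus>\<^bsub>P\<^esub>x\<in>X. k x \<odot>\<^bsub>P\<^esub> q (b x))"
  proof (rule ex1I)
    let ?k = "\<lambda>x\<in>X. I +>\<^bsub>R\<^esub> C.coord n x"
    have "m = (\<Oplus>\<^bsub>P\<^esub>x\<in>X. (I +>\<^bsub>R\<^esub> C.coord n x) \<odot>\<^bsub>P\<^esub> q (b x))"
      using comb[OF C.finite, of b "C.coord n"] C.basis C.coord_closed[OF n(1)] C.coord_sum[OF n(1)] n by simp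
    also have "\<dots> = (\<Oplus>\<^bsub>P\<^esub>x\<in>X. ?k x \<odot>\<^bsub>P\<^esub> q (b x))"
      using scalar_closed C.coord_closed[OF n(1)] closed C.basis by (intro P.finsum_cong' refl) auto
    finally show "?k \<in> X \<rightarrow>\<^sub>E carrier (R Quot I) \<and> m = (\<Oplus>\<^bsub>P\<^esub>x\<in>X. ?k x \<odot>\<^bsub>P\<^esub> q (b x))"
      using scalar_closed C.coord_closed[OF n(1)] by auto
    fix k assume k: "k \<in> X \<rightarrow>\<^sub>E carrier (R Quot I) \<and> m = (\<Oplus>\<^bsub>P\<^esub>x\<in>X. k x \<odot>\<^bsub>P\<^esub> q (b x))"
    then have "\<forall>x\<in>X. \<exists>r\<in>carrier R. I +>\<^bsub>R\<^esub> r = k x" using scalar_onto by (auto simp: PiE_iff)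
    then obtain r where r: "\<And>x. x \<in> X \<Longrightarrow> r x \<in> carrier R" "\<And>x. x \<in> X \<Longrightarrow> I +>\<^bsub>R\<^esub> r x = k x" by metis
    let ?n = "\<Oplus>\<^bsub>M\<^esub>x\<in>X. r x \<odot>\<^bsub>M\<^esub> b x"
    have n': "?n \<in> carrier M" by (rule C.comb_closed[OF r(1)])
    have "(\<Oplus>\<^bsub>P\<^esub>x\<in>X. (I +>\<^bsub>R\<^esub> r x) \<odot>\<^bsub>P\<^esub> q (b x)) = (\<Oplus>\<^bsub>P\<^esub>x\<in>X. k x \<odot>\<^bsub>P\<^esub> q (b x))"
      using k closed C.basis r(2) by (intro P.finsum_cong' refl) auto
    then have "q ?n = q n"
      using comb[OF C.finite, of b r] C.basis r(1) k n by simp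
    then have d: "?n \<ominus>\<^bsub>M\<^esub> n \<in> ideal_smult R I M" using eq_iff[OF n' n(1)] by simp
    have "k x = I +>\<^bsub>R\<^esub> C.coord n x" if x: "x \<in> X" for x
    proof -
      have "C.coord (?n \<ominus>\<^bsub>M\<^esub> n) x \<in> I" using C.ideal_smult_coord[OF I] d n' n(1) x by simp
      also have "C.coord (?n \<ominus>\<^bsub>M\<^esub> n) x = r x \<ominus>\<^bsub>R\<^esub> C.coord n x"
        using n' n(1) x C.coord_comb[OF r(1) x] by (simp add: M.M.minus_eq C.coord_add C.coord_neg M.R.minus_eq)
      finally show ?thesis
        using M.quotient_eq_iff_same_a_r_cos[OF I r(1)[OF x] C.coord_closed[OF n(1) x]] r(2)[OF x] by simp
    qed
    then show "k = ?k" using k by (auto intro!: extensionalityI simp: PiE_iff)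
  qed
qed

lemma fg_free_reduction:
  assumes "fg_free R M" "I \<noteq> carrier R"
  shows "fg_free (R Quot I) P"
proof -
  obtain E where E: "coordinates R M E (\<lambda>e. e)" using fg_freeD[OF assms(1)] ..
  have "\<one>\<^bsub>R Quot I\<^esub> \<noteq> \<zero>\<^bsub>R Quot I\<^esub>"
    using assms(2) I.a_rcos_self[OF M.one_closed] I.one_imp_carrier by (auto simp: FactRing_def)
  then show ?thesis using coordinates.fg_freeI[OF coordinates_reduction[OF E]] by simp
qed

text \<open>Free modules are projective: the images of the basis vectors are lifted one by one.\<close>

lemma lift_exists:
  assumes free: "fg_free R M" and N: "reduction R I N P' q'" and g: "g \<in> module_hom (R Quot I) P P'"
  shows "\<exists>g'\<in>module_hom R M N. \<forall>x\<in>carrier M. q' (g' x) = g (q x)"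
proof -
  obtain E where E: "coordinates R M E (\<lambda>e. e)" using fg_freeD[OF free] ..
  interpret C: coordinates R M E "\<lambda>e. e" by (rule E)
  interpret N: reduction R I N P' q' by (rule N)
  interpret NM: module R N by (rule N.M)
  interpret NP: module "R Quot I" P' by (rule N.P)
  have "\<forall>e\<in>E. \<exists>n\<in>carrier N. q' n = g (q e)"
    using N.onto module_homD(1)[OF g] closed C.basis by blast
  then obtain n where n: "\<And>e. e \<in> E \<Longrightarrow> n e \<in> carrier N" "\<And>e. e \<in> E \<Longrightarrow> q' (n e) = g (q e)" by metis
  have add: "additive_map P P' g" by (rule module_hom_additive[OF P N.P g])
  let ?g = "\<lambda>x. \<Oplus>\<^bsub>N\<^esub>e\<in>E. C.coord x e \<odot>\<^bsub>N\<^esub> n e"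
  have "?g \<in> module_hom R M N"
  proof (rule module_hom_finsum_map[OF M N.M C.finite])
    fix e assume e: "e \<in> E"
    show "(\<lambda>x. C.coord x e \<odot>\<^bsub>N\<^esub> n e) \<in> module_hom R M N"
      using e n(1) by (intro module_homI)
        (auto simp: C.coord_closed C.coord_add C.coord_smult NM.smult_l_distr NM.smult_assoc1)
  qed
  moreover have "q' (?g x) = g (q x)" if x: "x \<in> carrier M" for x
  proof -
    note cc = C.coord_closed[OF x]
    have "q' (?g x) = (\<Oplus>\<^bsub>P'\<^esub>e\<in>E. (I +>\<^bsub>R\<^esub> C.coord x e) \<odot>\<^bsub>P'\<^esub> q' (n e))"
      using n(1) cc by (intro N.comb C.finite)
    also have "\<dots> = (\<Oplus>\<^bsub>P'\<^esub>e\<in>E. g ((I +>\<^bsub>R\<^esub> C.coord x e) \<odot>\<^bsub>P\<^esub> q e))"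
      using n cc scalar_closed closed C.basis module_homD(1)[OF g]
      by (intro NP.finsum_cong' refl) (auto simp: module_homD(3)[OF g])
    also have "\<dots> = g (\<Oplus>\<^bsub>P\<^esub>e\<in>E. (I +>\<^bsub>R\<^esub> C.coord x e) \<odot>\<^bsub>P\<^esub> q e)"
      using cc scalar_closed closed C.basis by (intro additive_finsum[OF add C.finite, symmetric]) auto
    also have "\<dots> = g (q x)" using comb[OF C.finite, of "\<lambda>e. e" "C.coord x"] C.basis cc C.coord_sum[OF x] by simp
    finally show ?thesis .
  qed
  ultimately show ?thesis by (intro bexI[of _ ?g] ballI)
qed

text \<open>As \<open>K\<close> contains \<open>I\<close>, the submodule \<open>K M\<close> contains the kernel of the reduction, so it is the preimage of its image.\<close>

lemma ideal_smult_iff: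
  assumes K: "ideal K R" "I \<subseteq> K" and x: "x \<in> carrier M" and KQ: "ideal ((\<lambda>r. I +>\<^bsub>R\<^esub> r) ` K) (R Quot I)"
  shows "q x \<in> ideal_smult (R Quot I) ((\<lambda>r. I +>\<^bsub>R\<^esub> r) ` K) P \<longleftrightarrow> x \<in> ideal_smult R K M"
proof
  let ?K = "(\<lambda>r. I +>\<^bsub>R\<^esub> r) ` K"
  have Kc: "r \<in> carrier R" if "r \<in> K" for r using that ideal.Icarr[OF K(1)] by blast
  note KM = ideal_smultD[OF M K(1)] and KP = ideal_smultD[OF P KQ]
  {
    let ?N = "q ` ideal_smult R K M"
    assume "q x \<in> ideal_smult (R Quot I) ?K P"
    moreover have "submodule ?N (R Quot I) P"
    proof (rule P.submoduleI)
      show "?N \<subseteq> carrier P" using closed KM(1) by auto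
      show "\<zero>\<^bsub>P\<^esub> \<in> ?N" using additive_zero[OF additive_map] KM(2) by (metis imageI)
      fix a assume "a \<in> ?N"
      then obtain u where u: "u \<in> ideal_smult R K M" "a = q u" by blast
      show "\<ominus>\<^bsub>P\<^esub> a \<in> ?N"
        using additive_neg[OF additive_map KM(1)[OF u(1)]] KM(4)[OF u(1)] u(2) by (metis imageI)
      fix b assume "b \<in> ?N"
      then obtain v where v: "v \<in> ideal_smult R K M" "b = q v" by blast
      show "a \<oplus>\<^bsub>P\<^esub> b \<in> ?N"
        using add[OF KM(1)[OF u(1)] KM(1)[OF v(1)]] KM(3)[OF u(1) v(1)] u(2) v(2) by (metis imageI)
    next
      fix a b assume a: "a \<in> carrier (R Quot I)" and "b \<in> ?N"
      then obtain v where v: "v \<in> ideal_smult R K M" "b = q v" by blast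
      obtain r where r: "r \<in> carrier R" "I +>\<^bsub>R\<^esub> r = a" using scalar_onto[OF a] by blast
      show "a \<odot>\<^bsub>P\<^esub> b \<in> ?N"
        using smult[OF r(1) KM(1)[OF v(1)]] KM(6)[OF r(1) v(1)] r(2) v(2) by (metis imageI)
    qed
    moreover have "a \<odot>\<^bsub>P\<^esub> y \<in> ?N" if ay: "a \<in> ?K" "y \<in> carrier P" for a y
    proof -
      obtain r where r: "r \<in> K" "a = I +>\<^bsub>R\<^esub> r" using ay(1) by auto
      obtain z where z: "z \<in> carrier M" "q z = y" using onto[OF ay(2)] by blast
      show ?thesis
        using smult[OF Kc[OF r(1)] z(1)] ideal_smult_gen[OF M r(1) z(1)] r(2) z(2) by (metis imageI)
    qed
    ultimately have "q x \<in> ?N" by (rule ideal_smult_least[OF P, rotated 2])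
    then obtain x' where x': "x' \<in> ideal_smult R K M" "q x = q x'" by blast
    then have "x \<ominus>\<^bsub>M\<^esub> x' \<in> ideal_smult R K M"
      using eq_iff[OF x KM(1)] ideal_smult_mono[OF M K] by blast
    then have "(x \<ominus>\<^bsub>M\<^esub> x') \<oplus>\<^bsub>M\<^esub> x' \<in> ideal_smult R K M" using KM(3) x' by blast
    then show "x \<in> ideal_smult R K M"
      using x KM(1)[OF x'(1)] by (simp add: M.M.minus_eq M.M.a_assoc M.M.l_neg)
  }
  {
    assume "x \<in> ideal_smult R K M"
    moreover have "submodule {x \<in> carrier M. q x \<in> ideal_smult (R Quot I) ?K P} R M"
      using additive_zero[OF additive_map] additive_neg[OF additive_map] scalar_closed
      by (intro M.submoduleI) (auto simp: add smult KP)
    moreover have "a \<odot>\<^bsub>M\<^esub> y \<in> {x \<in> carrier M. q x \<in> ideal_smult (R Quot I) ?K P}"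
      if "a \<in> K" "y \<in> carrier M" for a y
      using that Kc closed by (auto simp: smult intro!: ideal_smult_gen[OF P])
    ultimately have "x \<in> {x \<in> carrier M. q x \<in> ideal_smult (R Quot I) ?K P}" by (rule ideal_smult_least[OF M, rotated 2])
    then show "q x \<in> ideal_smult (R Quot I) ?K P" by simp
  }
qed

end

section \<open>The Shamash complex before reduction\<close>

lemma (in abelian_group) finsum_Sigma:
  assumes "finite K" "\<And>k. k \<in> K \<Longrightarrow> finite (J k)" "\<And>k j. k \<in> K \<Longrightarrow> j \<in> J k \<Longrightarrow> \<phi> k j \<in> carrier G"
  shows "(\<Oplus>k\<in>K. \<Oplus>j\<in>J k. \<phi> k j) = (\<Oplus>p\<in>Sigma K J. \<phi> (fst p) (snd p))"
  using assms
proof (induction K rule: finite_induct)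
  case (insert k K)
  have S: "Sigma (insert k K) J = Pair k ` J k \<union> Sigma K J" by auto
  have "(\<Oplus>p\<in>Sigma (insert k K) J. \<phi> (fst p) (snd p))
    = (\<Oplus>p\<in>Pair k ` J k. \<phi> (fst p) (snd p)) \<oplus> (\<Oplus>p\<in>Sigma K J. \<phi> (fst p) (snd p))"
    unfolding S using insert.hyps insert.prems by (intro finsum_Un_disjoint) auto
  also have "(\<Oplus>p\<in>Pair k ` J k. \<phi> (fst p) (snd p)) = (\<Oplus>j\<in>J k. \<phi> (fst (k, j)) (snd (k, j)))"
    using insert.prems by (intro finsum_reindex) (auto simp: inj_on_def)
  also have "(\<Oplus>p\<in>Sigma K J. \<phi> (fst p) (snd p)) = (\<Oplus>k\<in>K. \<Oplus>j\<in>J k. \<phi> k j)"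
    using insert.IH insert.prems by simp
  finally show ?case
    using insert.hyps insert.prems by (subst finsum_insert) (auto intro!: finsum_closed)
qed simp

lemma finite_halves [simp]:
  "finite {i::nat. 2 * i \<le> n}" "finite {j::nat. 2 * i + 2 * j \<le> n}" "finite {j::nat. 2 * i + 2 * k + 2 * j \<le> n}"
  by (rule finite_subset[of _ "{..n}"]; auto)+

text \<open>This will be applied to \<open>Q = R(p-1)\<close>, the class \<open>a\<close> of \<open>f\<^sub>p\<close> and \<open>G = U(p)\<close>. That \<open>G\<close> is a complex is expressed through \<open>\<sigma> 0\<close>,
  which is the differential in positive degrees.\<close>

locale shamash_system =
  fixes Q :: "('a, 'k) ring_scheme" and a :: 'a and G :: "nat \<Rightarrow> ('a, 'm, 'k1) module_scheme"
    and d :: "nat \<Rightarrow> 'm \<Rightarrow> 'm" and \<sigma> :: "nat \<Rightarrow> nat \<Rightarrow> 'm \<Rightarrow> 'm"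
  assumes Q: "cring Q" and a: "a \<in> carrier Q" and G: "module Q (G n)"
    and homotopies: "higher_homotopies Q a G d \<sigma>"
    and complex: "2 \<le> n \<Longrightarrow> x \<in> carrier (G n) \<Longrightarrow> \<sigma> 0 (n - 1) (\<sigma> 0 n x) = \<zero>\<^bsub>G (n - 2)\<^esub>"
begin

definition hat :: "nat \<Rightarrow> ('a, nat \<Rightarrow> 'm) module"
  where "hat n = direct_sum {i. 2 * i \<le> n} (\<lambda>i. G (n - 2 * i))"

text \<open>The formula of the Shamash differential, before division by \<open>a\<close>: an element of \<open>hat n\<close> is a sum of terms \<open>y\<^sup>(\<^sup>i\<^sup>) x\<^sub>i\<close>,
  and \<open>\<sigma>\<^sub>j\<close> lowers the power by \<open>j\<close>.\<close>

definition D :: "nat \<Rightarrow> (nat \<Rightarrow> 'm) \<Rightarrow> nat \<Rightarrow> 'm"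
  where "D n x = (\<lambda>i\<in>{i. 2 * i \<le> n - 1}.
    \<Oplus>\<^bsub>G (n - 1 - 2 * i)\<^esub>j\<in>{j. 2 * (i + j) \<le> n}. \<sigma> j (n - 2 * (i + j)) (x (i + j)))"

lemma hat_module: "module Q (hat n)"
  unfolding hat_def by (rule direct_sum_module[OF Q G])

lemma hat_mem: "x \<in> carrier (hat n) \<longleftrightarrow> x \<in> extensional {i. 2 * i \<le> n} \<and> (\<forall>i. 2 * i \<le> n \<longrightarrow> x i \<in> carrier (G (n - 2 * i)))"
  unfolding hat_def using ds_mem[OF Q G, of "{i. 2 * i \<le> n}"] by auto

lemma hat_eqI:
  "x \<in> carrier (hat n) \<Longrightarrow> y \<in> carrier (hat n) \<Longrightarrow> (\<And>i. 2 * i \<le> n \<Longrightarrow> x i = y i) \<Longrightarrow> x = y"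
  by (auto simp: hat_mem intro: extensionalityI)

lemma hat_apply:
  "2 * i \<le> n \<Longrightarrow> (x \<oplus>\<^bsub>hat n\<^esub> y) i = x i \<oplus>\<^bsub>G (n - 2 * i)\<^esub> y i"
  "2 * i \<le> n \<Longrightarrow> (r \<odot>\<^bsub>hat n\<^esub> x) i = r \<odot>\<^bsub>G (n - 2 * i)\<^esub> x i"
  "2 * i \<le> n \<Longrightarrow> \<zero>\<^bsub>hat n\<^esub> i = \<zero>\<^bsub>G (n - 2 * i)\<^esub>"
  by (simp_all add: hat_def direct_sum_simps)

definition y_inj :: "nat \<Rightarrow> nat \<Rightarrow> 'm \<Rightarrow> nat \<Rightarrow> 'm"
  where "y_inj n i = ds_inj {i. 2 * i \<le> n} (\<lambda>i. G (n - 2 * i)) i"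

lemma y_inj_hom: "2 * i \<le> n \<Longrightarrow> y_inj n i \<in> module_hom Q (G (n - 2 * i)) (hat n)"
  unfolding hat_def y_inj_def using ds_inj_hom[OF Q, of "{i. 2 * i \<le> n}" "\<lambda>i. G (n - 2 * i)" i] G by simp

lemma y_inj_apply: "2 * j \<le> n \<Longrightarrow> y_inj n i g j = (if j = i then g else \<zero>\<^bsub>G (n - 2 * j)\<^esub>)"
  by (simp add: y_inj_def ds_inj_def)

lemma sigma_hom:
  assumes "2 * (i + j) \<le> n" "2 * i < n"
  shows "\<sigma> j (n - 2 * (i + j)) \<in> module_hom Q (G (n - 2 * (i + j))) (G (n - 1 - 2 * i))"
proof -
  have "1 \<le> n - 2 * (i + j) + 2 * j" using assms by arith
  then have "\<sigma> j (n - 2 * (i + j)) \<in> module_hom Q (G (n - 2 * (i + j))) (G (n - 2 * (i + j) + 2 * j - 1))"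
    using homotopies unfolding higher_homotopies_def by blast
  also have "n - 2 * (i + j) + 2 * j - 1 = n - 1 - 2 * i" using assms by arith
  finally show ?thesis .
qed

lemma D_hom:
  assumes "1 \<le> n"
  shows "D n \<in> module_hom Q (hat n) (hat (n - 1))"
  unfolding D_def hat_def[of "n - 1"]
proof (rule ds_homI[OF Q G _ hat_module])
  fix i assume "i \<in> {i. 2 * i \<le> n - 1}"
  then have i: "2 * i < n" using assms by auto
  show "(\<lambda>x. \<Oplus>\<^bsub>G (n - 1 - 2 * i)\<^esub>j\<in>{j. 2 * (i + j) \<le> n}. \<sigma> j (n - 2 * (i + j)) (x (i + j)))
    \<in> module_hom Q (hat n) (G (n - 1 - 2 * i))"
  proof (rule module_hom_finsum_map[OF hat_module G])
    fix j assume j: "j \<in> {j. 2 * (i + j) \<le> n}"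
    have "(\<lambda>x. x (i + j)) \<in> module_hom Q (hat n) (G (n - 2 * (i + j)))"
      unfolding hat_def using j by (intro ds_proj_hom[OF Q G]) auto
    from module_hom_comp[OF this sigma_hom] j i
    show "(\<lambda>x. \<sigma> j (n - 2 * (i + j)) (x (i + j))) \<in> module_hom Q (hat n) (G (n - 1 - 2 * i))" by simp
  qed simp
qed simp

lemma D_additive: "1 \<le> n \<Longrightarrow> additive_map (hat n) (hat (n - 1)) (D n)"
  by (rule module_hom_additive[OF hat_module hat_module D_hom])

lemma D_closed: "1 \<le> n \<Longrightarrow> x \<in> carrier (hat n) \<Longrightarrow> D n x \<in> carrier (hat (n - 1))"
  by (rule module_homD(1)[OF D_hom])

lemma D_apply:
  "2 * i \<le> n - 1 \<Longrightarrow> D n x i = (\<Oplus>\<^bsub>G (n - 1 - 2 * i)\<^esub>j\<in>{j. 2 * (i + j) \<le> n}. \<sigma> j (n - 2 * (i + j)) (x (i + j)))"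
  by (simp add: D_def)

lemma D_y_inj:
  assumes k: "2 * k \<le> n" and g: "g \<in> carrier (G (n - 2 * k))" and i: "2 * i \<le> n - 1" "1 \<le> n"
  shows "D n (y_inj n k g) i = (if i \<le> k then \<sigma> (k - i) (n - 2 * k) g else \<zero>\<^bsub>G (n - 1 - 2 * i)\<^esub>)"
proof -
  interpret H: module Q "G (n - 1 - 2 * i)" by (rule G)
  have s0: "\<sigma> j (n - 2 * (i + j)) \<zero>\<^bsub>G (n - 2 * (i + j))\<^esub> = \<zero>\<^bsub>G (n - 1 - 2 * i)\<^esub>" if "2 * (i + j) \<le> n" for j
    using that i by (intro additive_zero[OF module_hom_additive[OF G G sigma_hom]]) auto
  have val: "\<sigma> j (n - 2 * (i + j)) (y_inj n k g (i + j)) = (if i + j = k then \<sigma> (k - i) (n - 2 * k) g else \<zero>\<^bsub>G (n - 1 - 2 * i)\<^esub>)"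
    if "2 * (i + j) \<le> n" for j
    using that s0 by (auto simp: y_inj_apply)
  have gc: "\<sigma> (k - i) (n - 2 * k) g \<in> carrier (G (n - 1 - 2 * i))" if "i \<le> k"
    using module_homD(1)[OF sigma_hom[of i "k - i" n] , of g] that k i g by simp
  have "D n (y_inj n k g) i = (\<Oplus>\<^bsub>G (n - 1 - 2 * i)\<^esub>j\<in>{j. 2 * (i + j) \<le> n}. if i + j = k then \<sigma> (k - i) (n - 2 * k) g else \<zero>\<^bsub>G (n - 1 - 2 * i)\<^esub>)"
    unfolding D_apply[OF i(1)]
  proof (rule H.finsum_cong'[OF refl])
    show "(\<lambda>j. if i + j = k then \<sigma> (k - i) (n - 2 * k) g else \<zero>\<^bsub>G (n - 1 - 2 * i)\<^esub>)
      \<in> {j. 2 * (i + j) \<le> n} \<rightarrow> carrier (G (n - 1 - 2 * i))"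
    proof
      fix j
      show "(if i + j = k then \<sigma> (k - i) (n - 2 * k) g else \<zero>\<^bsub>G (n - 1 - 2 * i)\<^esub>) \<in> carrier (G (n - 1 - 2 * i))"
        using gc H.zero_closed by (cases "i + j = k") auto
    qed
    fix j assume "j \<in> {j. 2 * (i + j) \<le> n}"
    then show "\<sigma> j (n - 2 * (i + j)) (y_inj n k g (i + j)) =
        (if i + j = k then \<sigma> (k - i) (n - 2 * k) g else \<zero>\<^bsub>G (n - 1 - 2 * i)\<^esub>)"
      using val by blast
  qed
  also have "\<dots> = (if i \<le> k then \<sigma> (k - i) (n - 2 * k) g else \<zero>\<^bsub>G (n - 1 - 2 * i)\<^esub>)"
  proof (cases "i \<le> k")
    case True
    have "(\<Oplus>\<^bsub>G (n - 1 - 2 * i)\<^esub>j\<in>{j. 2 * (i + j) \<le> n}. if i + j = k then \<sigma> (k - i) (n - 2 * k) g else \<zero>\<^bsub>G (n - 1 - 2 * i)\<^esub>)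
      = (\<Oplus>\<^bsub>G (n - 1 - 2 * i)\<^esub>j\<in>{j. 2 * (i + j) \<le> n}. if k - i = j then \<sigma> (k - i) (n - 2 * k) g else \<zero>\<^bsub>G (n - 1 - 2 * i)\<^esub>)"
      using gc True H.zero_closed by (intro H.finsum_cong' refl) auto
    also have "\<dots> = \<sigma> (k - i) (n - 2 * k) g"
      using gc True k H.zero_closed by (intro H.finsum_singleton) auto
    finally show ?thesis using True by simp
  next
    case False
    then have "(\<Oplus>\<^bsub>G (n - 1 - 2 * i)\<^esub>j\<in>{j. 2 * (i + j) \<le> n}. if i + j = k then \<sigma> (k - i) (n - 2 * k) g else \<zero>\<^bsub>G (n - 1 - 2 * i)\<^esub>)
      = (\<Oplus>\<^bsub>G (n - 1 - 2 * i)\<^esub>j\<in>{j. 2 * (i + j) \<le> n}. \<zero>\<^bsub>G (n - 1 - 2 * i)\<^esub>)"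
      using H.zero_closed by (intro H.finsum_cong' refl) auto
    also have "\<dots> = \<zero>\<^bsub>G (n - 1 - 2 * i)\<^esub>" by (rule H.finsum_zero)
    finally show ?thesis using False by simp
  qed
  finally show ?thesis .
qed

text \<open>The equations for higher homotopies in one formula; the case \<open>l = 0\<close> is that \<open>\<sigma>\<^sub>0\<close> is a differential.\<close>

lemma homotopy_sum:
  assumes g: "g \<in> carrier (G m)" and N: "2 \<le> m + 2 * l"
  shows "(\<Oplus>\<^bsub>G (m + 2 * l - 2)\<^esub>j\<in>{j. j \<le> l \<and> 1 \<le> m + 2 * j}. \<sigma> (l - j) (m + 2 * j - 1) (\<sigma> j m g))
    = (if l = 1 then a \<odot>\<^bsub>G m\<^esub> g else \<zero>\<^bsub>G (m + 2 * l - 2)\<^esub>)"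
proof -
  interpret H: module Q "G (m + 2 * l - 2)" by (rule G)
  interpret M: module Q "G m" by (rule G)
  note hh = homotopies[unfolded higher_homotopies_def]
  have hom: "\<sigma> j n \<in> module_hom Q (G n) (G (n + 2 * j - 1))" if "1 \<le> n + 2 * j" for j n
    using hh that by blast
  consider "l = 0" | "l = 1" "m = 0" | "l = 1" "1 \<le> m" | "2 \<le> l" by arith
  then show ?thesis
  proof cases
    case 1
    interpret H0: module Q "G (m - 2)" by (rule G)
    from 1 have "{j. j \<le> l \<and> 1 \<le> m + 2 * j} = {0}" using N by auto
    moreover have "\<sigma> 0 (m - 1) (\<sigma> 0 m g) = \<zero>\<^bsub>G (m - 2)\<^esub>" using complex[OF _ g] N 1 by simp
    ultimately show ?thesis using 1 by (simp add: H0.finsum_insert)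
  next
    case 2
    interpret M0: module Q "G 0" by (rule G)
    from 2 have "{j. j \<le> l \<and> 1 \<le> m + 2 * j} = {1}" by auto
    moreover have "\<sigma> 0 1 (\<sigma> 1 0 g) = a \<odot>\<^bsub>G 0\<^esub> g" using hh g 2 by blast
    ultimately show ?thesis using 2 g a by (simp add: M0.finsum_insert)
  next
    case 3
    then have s: "{j. j \<le> l \<and> 1 \<le> m + 2 * j} = {1, 0}" by auto
    have e: "\<sigma> 0 (m + 1) (\<sigma> 1 m g) \<oplus>\<^bsub>G m\<^esub> \<sigma> 1 (m - 1) (\<sigma> 0 m g) = a \<odot>\<^bsub>G m\<^esub> g"
      using hh g 3 by blast
    have c: "\<sigma> 0 (m + 1) (\<sigma> 1 m g) \<in> carrier (G m)" "\<sigma> 1 (m - 1) (\<sigma> 0 m g) \<in> carrier (G m)"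
      using module_homD(1)[OF hom[of "m + 1" 0]] module_homD(1)[OF hom[of m 1]] g
        module_homD(1)[OF hom[of "m - 1" 1]] module_homD(1)[OF hom[of m 0]] 3 by auto
    show ?thesis unfolding s using 3 e c by (simp add: M.finsum_insert)
  next
    case 4
    then show ?thesis using hh g by auto
  qed
qed

text \<open>In \<open>D\<^sup>2\<close> the terms are collected by the total drop \<open>l\<close> of the power of \<open>y\<close>. The sum of all \<open>\<sigma>\<^sub>i \<sigma>\<^sub>j\<close> with \<open>i + j = l\<close> is
  zero unless \<open>l = 1\<close>, where it is multiplication by \<open>a\<close>.\<close>

lemma D_D:
  assumes n: "2 \<le> n" and x: "x \<in> carrier (hat n)" and i: "2 * i \<le> n - 2"
  shows "D (n - 1) (D n x) i = a \<odot>\<^bsub>G (n - 2 - 2 * i)\<^esub> x (Suc i)"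
proof -
  let ?H = "G (n - 2 - 2 * i)"
  interpret H: module Q "G (n - 2 - 2 * i)" by (rule G)
  define K where "K = {k. 2 * (i + k) \<le> n - 1}"
  define J where "J k = {j. 2 * (i + k + j) \<le> n}" for k
  define L where "L = {l. 2 * (i + l) \<le> n}"
  define J' where "J' l = {j. j \<le> l \<and> 1 \<le> n - 2 * (i + l) + 2 * j}" for l
  define \<phi> where "\<phi> k j = \<sigma> k (n - 1 - 2 * (i + k)) (\<sigma> j (n - 2 * (i + k + j)) (x (i + k + j)))" for k j
  define \<psi> where "\<psi> l j = \<sigma> (l - j) (n - 2 * (i + l) + 2 * j - 1) (\<sigma> j (n - 2 * (i + l)) (x (i + l)))" for l j
  have fin: "finite K" "finite L" "finite (J k)" "finite (J' l)" for k l
    by (auto simp: K_def L_def J_def J'_def)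
  have xc: "x l \<in> carrier (G (n - 2 * l))" if "2 * l \<le> n" for l using x that by (auto simp: hat_mem)
  have s1: "\<sigma> j (n - 2 * (i + k + j)) (x (i + k + j)) \<in> carrier (G (n - 1 - 2 * (i + k)))" if "k \<in> K" "j \<in> J k" for k j
    using that n by (intro module_homD(1)[OF sigma_hom] xc) (auto simp: K_def J_def)
  have hk: "\<sigma> k (n - 1 - 2 * (i + k)) \<in> module_hom Q (G (n - 1 - 2 * (i + k))) ?H" if "k \<in> K" for k
    using sigma_hom[of i k "n - 1"] that n i by (simp add: K_def numeral_2_eq_2)
  have phi: "\<phi> k j \<in> carrier ?H" if "k \<in> K" "j \<in> J k" for k j
    unfolding \<phi>_def by (rule module_homD(1)[OF hk[OF that(1)] s1[OF that]])
  have "x (Suc i) \<in> carrier ?H" using xc[of "Suc i"] n i by (simp add: numeral_2_eq_2)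
  then have ax: "a \<odot>\<^bsub>?H\<^esub> x (Suc i) \<in> carrier ?H" using a by (intro H.smult_closed)
  have \<psi>\<phi>: "\<psi> (fst p + snd p) (snd p) = \<phi> (fst p) (snd p)" if "p \<in> Sigma K J" for p
  proof -
    have "n - 2 * (i + (fst p + snd p)) + 2 * snd p - 1 = n - 1 - 2 * (i + fst p)"
      using that by (auto simp: K_def J_def)
    then show ?thesis by (simp only: \<psi>_def \<phi>_def add.assoc add_diff_cancel_right')
  qed
  have psi: "\<psi> (fst p + snd p) (snd p) \<in> carrier ?H" if "p \<in> Sigma K J" for p
    unfolding \<psi>\<phi>[OF that] using that by (intro phi) auto
  have "D (n - 1) (D n x) i = (\<Oplus>\<^bsub>?H\<^esub>k\<in>K. \<Oplus>\<^bsub>?H\<^esub>j\<in>J k. \<phi> k j)"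
  proof -
    have "D (n - 1) (D n x) i = (\<Oplus>\<^bsub>?H\<^esub>k\<in>K. \<sigma> k (n - 1 - 2 * (i + k)) (D n x (i + k)))"
      using i by (simp add: D_apply K_def numeral_2_eq_2)
    also have "\<dots> = (\<Oplus>\<^bsub>?H\<^esub>k\<in>K. \<Oplus>\<^bsub>?H\<^esub>j\<in>J k. \<phi> k j)"
    proof (rule H.finsum_cong')
      show "(\<lambda>k. \<Oplus>\<^bsub>?H\<^esub>j\<in>J k. \<phi> k j) \<in> K \<rightarrow> carrier ?H" by (intro Pi_I H.finsum_closed phi)
      fix k assume k: "k \<in> K"
      have "D n x (i + k) = (\<Oplus>\<^bsub>G (n - 1 - 2 * (i + k))\<^esub>j\<in>J k. \<sigma> j (n - 2 * (i + k + j)) (x (i + k + j)))"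
        using k unfolding J_def by (subst D_apply) (auto simp: K_def add.assoc)
      moreover have "\<sigma> k (n - 1 - 2 * (i + k)) (\<Oplus>\<^bsub>G (n - 1 - 2 * (i + k))\<^esub>j\<in>J k. \<sigma> j (n - 2 * (i + k + j)) (x (i + k + j)))
          = (\<Oplus>\<^bsub>?H\<^esub>j\<in>J k. \<phi> k j)"
        unfolding \<phi>_def
        by (rule additive_finsum[OF module_hom_additive[OF G G hk[OF k]] fin(3)]) (use s1[OF k] in blast)
      ultimately show "\<sigma> k (n - 1 - 2 * (i + k)) (D n x (i + k)) = (\<Oplus>\<^bsub>?H\<^esub>j\<in>J k. \<phi> k j)"
        by (simp only:)
    qed simp
    finally show ?thesis .
  qed
  also have "\<dots> = (\<Oplus>\<^bsub>?H\<^esub>p\<in>Sigma K J. \<phi> (fst p) (snd p))"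
    using fin phi by (intro H.finsum_Sigma)
  \<comment> \<open>the pair of drops \<open>(k, j)\<close> is replaced by the total drop and the first one, \<open>(k + j, j)\<close>\<close>
  also have "\<dots> = (\<Oplus>\<^bsub>?H\<^esub>p\<in>Sigma K J. \<psi> (fst (fst p + snd p, snd p)) (snd (fst p + snd p, snd p)))"
  proof (intro H.finsum_cong' refl)
    fix p assume p: "p \<in> Sigma K J"
    show "\<phi> (fst p) (snd p) = \<psi> (fst (fst p + snd p, snd p)) (snd (fst p + snd p, snd p))"
      using \<psi>\<phi>[OF p] by simp
  qed (use psi in auto)
  also have "\<dots> = (\<Oplus>\<^bsub>?H\<^esub>p\<in>(\<lambda>p. (fst p + snd p, snd p)) ` Sigma K J. \<psi> (fst p) (snd p))"
  proof (intro H.finsum_reindex[symmetric])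
    show "inj_on (\<lambda>p. (fst p + snd p, snd p)) (Sigma K J)" by (auto simp: inj_on_def)
  qed (use psi in auto)
  also have "(\<lambda>p. (fst p + snd p, snd p)) ` Sigma K J = Sigma L J'"
  proof (rule subset_antisym; rule subsetI)
    fix p assume "p \<in> Sigma L J'"
    then have "p = (\<lambda>p. (fst p + snd p, snd p)) (fst p - snd p, snd p)" "(fst p - snd p, snd p) \<in> Sigma K J"
      using n by (auto simp: L_def J'_def K_def J_def)
    then show "p \<in> (\<lambda>p. (fst p + snd p, snd p)) ` Sigma K J" by (rule image_eqI)
  qed (use n in \<open>auto simp: L_def J'_def K_def J_def\<close>)
  also have "(\<Oplus>\<^bsub>?H\<^esub>p\<in>Sigma L J'. \<psi> (fst p) (snd p)) = (\<Oplus>\<^bsub>?H\<^esub>l\<in>L. \<Oplus>\<^bsub>?H\<^esub>j\<in>J' l. \<psi> l j)"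
  proof (intro H.finsum_Sigma[symmetric] fin)
    fix l j assume lj: "l \<in> L" "j \<in> J' l"
    then have "l - j \<in> K" "j \<in> J (l - j)" using n by (auto simp: L_def J'_def K_def J_def)
    then have "(l - j, j) \<in> Sigma K J" by auto
    from psi[OF this] show "\<psi> l j \<in> carrier ?H" using lj by (simp add: J'_def)
  qed
  also have "\<dots> = (\<Oplus>\<^bsub>?H\<^esub>l\<in>L. if 1 = l then a \<odot>\<^bsub>?H\<^esub> x (Suc i) else \<zero>\<^bsub>?H\<^esub>)"
  proof (intro H.finsum_cong' refl)
    show "(\<lambda>l. if 1 = l then a \<odot>\<^bsub>?H\<^esub> x (Suc i) else \<zero>\<^bsub>?H\<^esub>) \<in> L \<rightarrow> carrier ?H"
      using H.zero_closed ax by (intro Pi_I) (simp only: split: if_split, blast)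
    fix l assume l: "l \<in> L"
    have "n - 2 * (i + l) + 2 * l - 2 = n - 2 - 2 * i" "2 \<le> n - 2 * (i + l) + 2 * l" using l i n by (auto simp: L_def)
    moreover have "x (i + l) \<in> carrier (G (n - 2 * (i + l)))" using l by (intro xc) (auto simp: L_def)
    ultimately show "(\<Oplus>\<^bsub>?H\<^esub>j\<in>J' l. \<psi> l j) = (if 1 = l then a \<odot>\<^bsub>?H\<^esub> x (Suc i) else \<zero>\<^bsub>?H\<^esub>)"
      using homotopy_sum[of "x (i + l)" "n - 2 * (i + l)" l] unfolding J'_def \<psi>_def by auto
  qed
  also have "\<dots> = a \<odot>\<^bsub>?H\<^esub> x (Suc i)"
    using n i ax by (intro H.finsum_singleton fin Pi_I) (simp_all add: L_def)
  finally show ?thesis .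
qed

text \<open>Let \<open>t\<close> lower and \<open>s\<close> raise the power of \<open>y\<close> by one, so that \<open>D\<^sup>2 = a t\<close>. Applying \<open>D\<close> to \<open>D z = a u\<close> and cancelling
  \<open>a\<close> gives \<open>t z = D u\<close>. Therefore \<open>z\<close> and \<open>D (s u)\<close> have the same components at all positive powers, and \<open>z - D (s u)\<close>
  is an element of \<open>G\<close>. It is a cycle because \<open>D\<^sup>2 (s u) = a u = D z\<close>, hence a boundary.\<close>

lemma exact_mod:
  assumes nzd: "\<And>n x. x \<in> carrier (G n) \<Longrightarrow> a \<odot>\<^bsub>G n\<^esub> x = \<zero>\<^bsub>G n\<^esub> \<Longrightarrow> x = \<zero>\<^bsub>G n\<^esub>"
    and exact: "\<And>n x. 1 \<le> n \<Longrightarrow> x \<in> carrier (G n) \<Longrightarrow> \<sigma> 0 n x = \<zero>\<^bsub>G (n - 1)\<^esub> \<Longrightarrow>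
      \<exists>y\<in>carrier (G (n + 1)). \<sigma> 0 (n + 1) y = x"
    and n: "1 \<le> n" and z: "z \<in> carrier (hat n)" and u: "u \<in> carrier (hat (n - 1))"
    and Dz: "D n z = a \<odot>\<^bsub>hat (n - 1)\<^esub> u"
  shows "\<exists>v\<in>carrier (hat (n + 1)). D (n + 1) v = z"
proof -
  interpret H: module Q "hat n" by (rule hat_module)
  interpret H': module Q "hat (n - 1)" by (rule hat_module)
  interpret Gn: module Q "G n" by (rule G)
  \<comment> \<open>the element \<open>s u\<close>\<close>
  define su where "su = (\<lambda>i\<in>{i. 2 * i \<le> n + 1}. if i = 0 then \<zero>\<^bsub>G (n + 1)\<^esub> else u (i - 1))"
  have uc: "u i \<in> carrier (G (n - 1 - 2 * i))" if "2 * i \<le> n - 1" for i using u that by (auto simp: hat_mem)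
  have zc: "z i \<in> carrier (G (n - 2 * i))" if "2 * i \<le> n" for i using z that by (auto simp: hat_mem)
  have z0: "\<zero>\<^bsub>G k\<^esub> \<in> carrier (G k)" for k
    using G[of k] by (auto simp: module_def abelian_group_def intro: abelian_monoid.zero_closed)
  have su: "su \<in> carrier (hat (n + 1))"
    unfolding hat_mem
  proof (intro conjI allI impI)
    fix i assume i: "2 * i \<le> n + 1"
    show "su i \<in> carrier (G (n + 1 - 2 * i))"
    proof (cases i)
      case (Suc k)
      then show ?thesis using i uc[of k] by (simp add: su_def)
    qed (use z0 in \<open>simp add: su_def\<close>)
  qed (simp add: su_def)
  define w where "w = z \<ominus>\<^bsub>hat n\<^esub> D (n + 1) su"
  have Dsu: "D (n + 1) su \<in> carrier (hat n)" using D_closed[OF _ su] by simp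
  have w: "w \<in> carrier (hat n)" unfolding w_def using Dsu z by simp
  have shift: "D (n + 1) su i = z i" if i: "2 * i \<le> n" "1 \<le> i" for i
  proof -
    interpret Gi: module Q "G (n - 2 * i)" by (rule G)
    have n2: "2 \<le> n" using i by arith
    have "D (n + 1) su i = (\<Oplus>\<^bsub>G (n - 2 * i)\<^esub>j\<in>{j. 2 * (i + j) \<le> n + 1}. \<sigma> j (n + 1 - 2 * (i + j)) (su (i + j)))"
      using i by (simp add: D_apply)
    also have "{j. 2 * (i + j) \<le> n + 1} = {j. 2 * (i - 1 + j) \<le> n - 1}" using i by auto
    also have "(\<Oplus>\<^bsub>G (n - 2 * i)\<^esub>j\<in>\<dots>. \<sigma> j (n + 1 - 2 * (i + j)) (su (i + j)))
      = (\<Oplus>\<^bsub>G (n - 2 * i)\<^esub>j\<in>{j. 2 * (i - 1 + j) \<le> n - 1}. \<sigma> j (n - 1 - 2 * (i - 1 + j)) (u (i - 1 + j)))"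
    proof (rule Gi.finsum_cong'[OF refl])
      fix j assume j: "j \<in> {j. 2 * (i - 1 + j) \<le> n - 1}"
      have e: "n + 1 - 2 * (i + j) = n - 1 - 2 * (i - 1 + j)" "su (i + j) = u (i - 1 + j)"
        using i j n by (auto simp: su_def)
      show "\<sigma> j (n + 1 - 2 * (i + j)) (su (i + j)) = \<sigma> j (n - 1 - 2 * (i - 1 + j)) (u (i - 1 + j))"
        unfolding e ..
    next
      show "(\<lambda>j. \<sigma> j (n - 1 - 2 * (i - 1 + j)) (u (i - 1 + j))) \<in> {j. 2 * (i - 1 + j) \<le> n - 1} \<rightarrow> carrier (G (n - 2 * i))"
      proof
        fix j assume j: "j \<in> {j. 2 * (i - 1 + j) \<le> n - 1}"
        have "\<sigma> j (n - 1 - 2 * (i - 1 + j)) (u (i - 1 + j)) \<in> carrier (G (n - 1 - 1 - 2 * (i - 1)))"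
          using i j by (intro module_homD(1)[OF sigma_hom] uc) auto
        also have "n - 1 - 1 - 2 * (i - 1) = n - 2 * i" using i by arith
        finally show "\<sigma> j (n - 1 - 2 * (i - 1 + j)) (u (i - 1 + j)) \<in> carrier (G (n - 2 * i))" .
      qed
    qed
    also have "\<dots> = D (n - 1) u (i - 1)"
    proof -
      have e: "n - 1 - 1 - 2 * (i - 1) = n - 2 * i" "2 * (i - 1) \<le> n - 1 - 1" using i by arith+
      show ?thesis unfolding D_apply[OF e(2)] e(1) ..
    qed
    finally have eq: "D (n + 1) su i = D (n - 1) u (i - 1)" .
    have e2: "n - 1 - 1 - 2 * (i - 1) = n - 2 * i" "n - 2 - 2 * (i - 1) = n - 2 * i" "2 * (i - 1) \<le> n - 1 - 1" "2 * (i - 1) \<le> n - 2"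
      using i by arith+
    have n1: "1 \<le> n - 1" using n2 by arith
    have Duc: "D (n - 1) u (i - 1) \<in> carrier (G (n - 2 * i))"
      using D_closed[OF n1 u] e2 by (auto simp: hat_mem)
    have "a \<odot>\<^bsub>G (n - 2 * i)\<^esub> D (n - 1) u (i - 1) = D (n - 1) (a \<odot>\<^bsub>hat (n - 1)\<^esub> u) (i - 1)"
      using module_homD(3)[OF D_hom[OF n1] a u] e2 by (simp add: hat_apply)
    also have "\<dots> = a \<odot>\<^bsub>G (n - 2 * i)\<^esub> z i"
      using D_D[OF n2 z e2(4)] i unfolding Dz e2 by simp
    finally have "a \<odot>\<^bsub>G (n - 2 * i)\<^esub> (D (n - 1) u (i - 1) \<ominus>\<^bsub>G (n - 2 * i)\<^esub> z i) = \<zero>\<^bsub>G (n - 2 * i)\<^esub>"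
      using Duc zc[OF i(1)] a by (simp add: Gi.M.minus_eq Gi.smult_r_distr Gi.smult_r_minus Gi.M.r_neg)
    then have "D (n - 1) u (i - 1) \<ominus>\<^bsub>G (n - 2 * i)\<^esub> z i = \<zero>\<^bsub>G (n - 2 * i)\<^esub>"
      using nzd Duc zc[OF i(1)] by blast
    then show ?thesis using eq Duc zc[OF i(1)]
      by (metis Gi.M.minus_eq Gi.M.a_inv_closed Gi.M.add.inv_equality Gi.M.minus_minus)
  qed
  have w_apply: "w i = z i \<ominus>\<^bsub>G (n - 2 * i)\<^esub> D (n + 1) su i" if "2 * i \<le> n" for i
    unfolding w_def using that z Dsu
    by (intro additive_diff[OF ds_proj_additive[OF Q G, of "{i. 2 * i \<le> n}" _ "\<lambda>i. n - 2 * i", folded hat_def]]) auto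
  define g where "g = w 0"
  have g: "g \<in> carrier (G n)" using w by (auto simp: g_def hat_mem dest: spec[of _ 0])
  have wi: "w = y_inj n 0 g"
  proof (rule hat_eqI[OF w])
    show "y_inj n 0 g \<in> carrier (hat n)" using module_homD(1)[OF y_inj_hom[of 0 n]] g by simp
    fix i assume i: "2 * i \<le> n"
    interpret Gi: module Q "G (n - 2 * i)" by (rule G)
    show "w i = y_inj n 0 g i"
      using i shift[OF i] w_apply[OF i] zc[OF i]
      by (cases "i = 0") (auto simp: y_inj_apply g_def Gi.M.minus_eq Gi.M.r_neg)
  qed
  have DDsu: "D n (D (n + 1) su) = a \<odot>\<^bsub>hat (n - 1)\<^esub> u"
  proof (rule hat_eqI)
    show "D n (D (n + 1) su) \<in> carrier (hat (n - 1))" by (rule D_closed[OF n Dsu])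
    show "a \<odot>\<^bsub>hat (n - 1)\<^esub> u \<in> carrier (hat (n - 1))" by (rule H'.smult_closed[OF a u])
    fix i assume i: "2 * i \<le> n - 1"
    have "D (n + 1 - 1) (D (n + 1) su) i = a \<odot>\<^bsub>G (n + 1 - 2 - 2 * i)\<^esub> su (Suc i)"
      using i n by (intro D_D su) auto
    then show "D n (D (n + 1) su) i = (a \<odot>\<^bsub>hat (n - 1)\<^esub> u) i"
      using i n by (cases n) (simp_all add: hat_apply su_def)
  qed
  have "D n w = a \<odot>\<^bsub>hat (n - 1)\<^esub> u \<ominus>\<^bsub>hat (n - 1)\<^esub> a \<odot>\<^bsub>hat (n - 1)\<^esub> u"
    unfolding w_def using additive_diff[OF D_additive[OF n] z Dsu] by (simp only: Dz DDsu)
  also have "\<dots> = \<zero>\<^bsub>hat (n - 1)\<^esub>"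
    using H'.M.r_neg[OF H'.smult_closed[OF a u]] by (simp only: H'.M.minus_eq)
  finally have "D n w = \<zero>\<^bsub>hat (n - 1)\<^esub>" .
  then have "\<sigma> 0 n g = \<zero>\<^bsub>G (n - 1)\<^esub>"
    using D_y_inj[of 0 n g 0] g n wi by (simp add: hat_apply)
  then obtain y where y: "y \<in> carrier (G (n + 1))" "\<sigma> 0 (n + 1) y = g" using exact[OF n g] by blast
  have yi: "y_inj (n + 1) 0 y \<in> carrier (hat (n + 1))"
    using module_homD(1)[OF y_inj_hom[of 0 "n + 1"]] y by simp
  interpret H1: module Q "hat (n + 1)" by (rule hat_module)
  have Dy: "D (n + 1) (y_inj (n + 1) 0 y) = w"
  proof (rule hat_eqI[OF _ w])
    show "D (n + 1) (y_inj (n + 1) 0 y) \<in> carrier (hat n)" using D_closed[OF _ yi] by simp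
    fix i assume i: "2 * i \<le> n"
    then show "D (n + 1) (y_inj (n + 1) 0 y) i = w i"
      using D_y_inj[of 0 "n + 1" y i] y by (simp add: wi y_inj_apply)
  qed
  have "D (n + 1) (su \<oplus>\<^bsub>hat (n + 1)\<^esub> y_inj (n + 1) 0 y) = D (n + 1) su \<oplus>\<^bsub>hat n\<^esub> w"
    using additive_add[OF D_additive[of "n + 1"] su yi] Dy by simp
  also have "\<dots> = z"
    unfolding w_def using z Dsu by (simp add: H.M.minus_eq H.M.a_ac H.M.r_neg H.M.r_neg1 H.M.r_neg2)
  finally show ?thesis using su yi by blast
qed

end

section \<open>Filtered modules with chosen splittings\<close>

lemma submodule_trans:
  assumes "module R M" "submodule K R M" "submodule N R (M\<lparr>carrier := K\<rparr>)"
  shows "submodule N R M"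
proof -
  interpret M: module R M by fact
  interpret K: module R "M\<lparr>carrier := K\<rparr>" by (rule submodule.submodule_is_module[OF assms(2,1)])
  note E = submoduleD[OF K.module_axioms assms(3), simplified]
  have NM: "x \<in> carrier M" if "x \<in> N" for x using E(1)[OF that] submoduleD(1)[OF assms(1,2)] by blast
  show ?thesis
  proof (rule M.submoduleI)
    fix x assume x: "x \<in> N"
    have "\<ominus>\<^bsub>M\<^esub> x = (\<ominus>\<^bsub>R\<^esub> \<one>\<^bsub>R\<^esub>) \<odot>\<^bsub>M\<^esub> x" using NM[OF x] by (simp add: M.smult_l_minus)
    then show "\<ominus>\<^bsub>M\<^esub> x \<in> N" using E(6)[OF _ x] by simp
  qed (use E NM in auto)
qed

lemma submodule_homs:
  assumes "module R M" "submodule K R M"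
  shows "(\<lambda>x. x) \<in> module_hom R (M\<lparr>carrier := K\<rparr>) M"
    and "g \<in> module_hom R M N \<Longrightarrow> g \<in> module_hom R (M\<lparr>carrier := K\<rparr>) N"
    and "k \<in> module_hom R L M \<Longrightarrow> (\<And>x. x \<in> carrier L \<Longrightarrow> k x \<in> K) \<Longrightarrow> k \<in> module_hom R L (M\<lparr>carrier := K\<rparr>)"
  using submoduleD(1)[OF assms] by (auto simp: module_hom_def)

locale filtered_module =
  fixes R :: "('a, 'k) ring_scheme" and M :: "('a, 'm, 'k1) module_scheme"
    and F B :: "nat \<Rightarrow> 'm set" and c :: nat
  assumes M: "module R M" and F0: "F 0 = {\<zero>\<^bsub>M\<^esub>}" and Fc: "F c = carrier M"
    and sub: "p \<le> c \<Longrightarrow> submodule (F p) R M"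
    and split: "1 \<le> p \<Longrightarrow> p \<le> c \<Longrightarrow> internal_direct_sum R (M\<lparr>carrier := F p\<rparr>) (F (p - 1)) (B p)"
begin

interpretation M: module R M by (rule M)

definition comp :: "'m \<Rightarrow> nat \<Rightarrow> 'm"
  where "comp x = (THE b. b \<in> (\<Pi>\<^sub>E q\<in>{1..c}. B q) \<and> x = (\<Oplus>\<^bsub>M\<^esub>q\<in>{1..c}. b q))"

abbreviation FF :: "nat \<Rightarrow> ('a, 'm, 'k1) module_scheme" where "FF p \<equiv> M\<lparr>carrier := F p\<rparr>"
abbreviation BB :: "nat \<Rightarrow> ('a, 'm, 'k1) module_scheme" where "BB p \<equiv> M\<lparr>carrier := B p\<rparr>"

lemma FF_module: "p \<le> c \<Longrightarrow> module R (FF p)"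
  by (rule submodule.submodule_is_module[OF sub M])

lemma B_sub: "1 \<le> p \<Longrightarrow> p \<le> c \<Longrightarrow> submodule (B p) R M"
  using split by (auto simp: internal_direct_sum_def intro: submodule_trans[OF M sub])

lemma BB_module: "1 \<le> p \<Longrightarrow> p \<le> c \<Longrightarrow> module R (BB p)"
  by (rule submodule.submodule_is_module[OF B_sub M])

lemmas FD = submoduleD[OF M sub] and BD = submoduleD[OF M B_sub]

lemma split_sum:
  assumes "1 \<le> p" "p \<le> c"
  shows "F p = {x \<oplus>\<^bsub>M\<^esub> b | x b. x \<in> F (p - 1) \<and> b \<in> B p}"
proof -
  have "(\<Union>x\<in>F (p - 1). \<Union>b\<in>B p. {x \<oplus>\<^bsub>M\<^esub> b}) = F p"
    using split[OF assms] by (simp add: internal_direct_sum_def set_add_def set_mult_def)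
  then show ?thesis by blast
qed

lemma split_Int: "1 \<le> p \<Longrightarrow> p \<le> c \<Longrightarrow> x \<in> F (p - 1) \<Longrightarrow> x \<in> B p \<Longrightarrow> x = \<zero>\<^bsub>M\<^esub>"
  using split by (auto simp: internal_direct_sum_def)

lemma F_step: "1 \<le> p \<Longrightarrow> p \<le> c \<Longrightarrow> x \<in> F (p - 1) \<Longrightarrow> x \<in> F p"
  using split[of p] FF_module[of p] submoduleD(1)[of R "FF p" "F (p - 1)" x]
  by (auto simp: internal_direct_sum_def)

lemma B_F: "1 \<le> p \<Longrightarrow> p \<le> c \<Longrightarrow> x \<in> B p \<Longrightarrow> x \<in> F p"
  using split[of p] FF_module[of p] submoduleD(1)[of R "FF p" "B p" x]
  by (auto simp: internal_direct_sum_def)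

lemma F_mono: "p \<le> q \<Longrightarrow> q \<le> c \<Longrightarrow> x \<in> F p \<Longrightarrow> x \<in> F q"
proof (induction q rule: nat_induct)
  case (Suc q)
  then show ?case using F_step[of "Suc q" x] by (cases "p = Suc q") auto
qed simp

lemma sum_Suc:
  assumes "\<And>q. q \<in> {1..Suc p} \<Longrightarrow> b q \<in> carrier M"
  shows "(\<Oplus>\<^bsub>M\<^esub>q\<in>{1..Suc p}. b q) = (\<Oplus>\<^bsub>M\<^esub>q\<in>{1..p}. b q) \<oplus>\<^bsub>M\<^esub> b (Suc p)"
proof -
  have "{1..Suc p} = insert (Suc p) {1..p}" by auto
  then have "(\<Oplus>\<^bsub>M\<^esub>q\<in>{1..Suc p}. b q) = b (Suc p) \<oplus>\<^bsub>M\<^esub> (\<Oplus>\<^bsub>M\<^esub>q\<in>{1..p}. b q)"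
    using assms by (simp only:) (rule M.finsum_insert; auto)
  then show ?thesis using assms by (simp add: M.a_comm M.finsum_closed Pi_iff)
qed

lemma sum_in_F: "p \<le> c \<Longrightarrow> (\<And>q. q \<in> {1..p} \<Longrightarrow> b q \<in> B q) \<Longrightarrow> (\<Oplus>\<^bsub>M\<^esub>q\<in>{1..p}. b q) \<in> F p"
proof (rule submodule_finsum[OF M sub])
  fix q assume "p \<le> c" "\<And>q. q \<in> {1..p} \<Longrightarrow> b q \<in> B q" "q \<in> {1..p}"
  then show "b q \<in> F p" using F_mono[of q p] B_F[of q "b q"] by auto
qed auto

lemma sum_zero:
  "p \<le> c \<Longrightarrow> (\<And>q. q \<in> {1..p} \<Longrightarrow> b q \<in> B q) \<Longrightarrow> (\<Oplus>\<^bsub>M\<^esub>q\<in>{1..p}. b q) = \<zero>\<^bsub>M\<^esub> \<Longrightarrow> q \<in> {1..p} \<Longrightarrow> b q = \<zero>\<^bsub>M\<^esub>"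
proof (induction p)
  case (Suc p)
  let ?s = "\<Oplus>\<^bsub>M\<^esub>q\<in>{1..p}. b q"
  have bc: "b q \<in> carrier M" if "q \<in> {1..Suc p}" for q
    using BD(1)[of q] Suc.prems(1,2) that by auto
  have s: "?s \<in> F p" using Suc.prems by (intro sum_in_F) auto
  then have sc: "?s \<in> carrier M" using FD(1)[of p] Suc.prems(1) by simp
  have "?s \<oplus>\<^bsub>M\<^esub> b (Suc p) = \<zero>\<^bsub>M\<^esub>" using Suc.prems(3) sum_Suc[OF bc] by simp
  then have b: "b (Suc p) = \<ominus>\<^bsub>M\<^esub> ?s" using sc bc[of "Suc p"] M.minus_equality[of "b (Suc p)" ?s] by (simp add: M.a_comm)
  then have "b (Suc p) \<in> F p" using FD(4)[of p ?s] s Suc.prems(1) by simp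
  then have bz: "b (Suc p) = \<zero>\<^bsub>M\<^esub>" using split_Int[of "Suc p"] Suc.prems(1,2) by simp
  then have "?s = \<zero>\<^bsub>M\<^esub>" using b sc by (metis M.minus_minus M.minus_equality M.l_zero M.zero_closed)
  then show ?case using Suc.IH Suc.prems bz by (cases "q = Suc p") auto
qed simp

lemma decomp_ex: "p \<le> c \<Longrightarrow> x \<in> F p \<Longrightarrow> \<exists>b. (\<forall>q\<in>{1..p}. b q \<in> B q) \<and> x = (\<Oplus>\<^bsub>M\<^esub>q\<in>{1..p}. b q)"
proof (induction p arbitrary: x)
  case 0
  then show ?case using F0 by simp
next
  case (Suc p)
  obtain y z where yz: "x = y \<oplus>\<^bsub>M\<^esub> z" "y \<in> F p" "z \<in> B (Suc p)" using split_sum[of "Suc p"] Suc.prems by auto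
  obtain b where b: "\<forall>q\<in>{1..p}. b q \<in> B q" "y = (\<Oplus>\<^bsub>M\<^esub>q\<in>{1..p}. b q)" using Suc.IH[OF _ yz(2)] Suc.prems(1) by auto
  let ?b = "b(Suc p := z)"
  have bB: "?b q \<in> B q" if "q \<in> {1..Suc p}" for q using b yz that by auto
  have bc: "?b q \<in> carrier M" if "q \<in> {1..Suc p}" for q
    using BD(1)[of q] bB[OF that] Suc.prems(1) that by auto
  have "(\<Oplus>\<^bsub>M\<^esub>q\<in>{1..p}. ?b q) = (\<Oplus>\<^bsub>M\<^esub>q\<in>{1..p}. b q)"
  proof (rule M.finsum_cong'[OF refl])
    show "b \<in> {1..p} \<rightarrow> carrier M"
    proof
      fix q assume "q \<in> {1..p}"
      then show "b q \<in> carrier M" using bc[of q] by simp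
    qed
  qed auto
  then have "x = (\<Oplus>\<^bsub>M\<^esub>q\<in>{1..Suc p}. ?b q)" using yz b sum_Suc[OF bc] by simp
  then show ?case using bB by blast
qed

lemma comp_ex1:
  assumes "x \<in> carrier M"
  shows "\<exists>!b. b \<in> (\<Pi>\<^sub>E q\<in>{1..c}. B q) \<and> x = (\<Oplus>\<^bsub>M\<^esub>q\<in>{1..c}. b q)"
proof (rule ex_ex1I)
  obtain b where b: "\<forall>q\<in>{1..c}. b q \<in> B q" "x = (\<Oplus>\<^bsub>M\<^esub>q\<in>{1..c}. b q)"
    using decomp_ex[of c x] assms Fc by auto
  have "(\<Oplus>\<^bsub>M\<^esub>q\<in>{1..c}. restrict b {1..c} q) = (\<Oplus>\<^bsub>M\<^esub>q\<in>{1..c}. b q)"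
  proof (rule M.finsum_cong'[OF refl])
    show "b \<in> {1..c} \<rightarrow> carrier M"
    proof
      fix q assume "q \<in> {1..c}"
      then show "b q \<in> carrier M" using b(1) BD(1)[of q] by auto
    qed
  qed auto
  then have "restrict b {1..c} \<in> (\<Pi>\<^sub>E q\<in>{1..c}. B q) \<and> x = (\<Oplus>\<^bsub>M\<^esub>q\<in>{1..c}. restrict b {1..c} q)"
    using b by auto
  then show "\<exists>b. b \<in> (\<Pi>\<^sub>E q\<in>{1..c}. B q) \<and> x = (\<Oplus>\<^bsub>M\<^esub>q\<in>{1..c}. b q)" by blast
next
  fix b b' assume b: "b \<in> (\<Pi>\<^sub>E q\<in>{1..c}. B q) \<and> x = (\<Oplus>\<^bsub>M\<^esub>q\<in>{1..c}. b q)"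
    and b': "b' \<in> (\<Pi>\<^sub>E q\<in>{1..c}. B q) \<and> x = (\<Oplus>\<^bsub>M\<^esub>q\<in>{1..c}. b' q)"
  have bm: "b q \<in> B q" "b' q \<in> B q" if "q \<in> {1..c}" for q using b b' that by auto
  have bc: "b q \<in> carrier M" "b' q \<in> carrier M" if "q \<in> {1..c}" for q using bm[OF that] BD(1)[of q] that by auto
  have "(\<Oplus>\<^bsub>M\<^esub>q\<in>{1..c}. b q) = (\<Oplus>\<^bsub>M\<^esub>q\<in>{1..c}. (b q \<ominus>\<^bsub>M\<^esub> b' q) \<oplus>\<^bsub>M\<^esub> b' q)"
    using bc by (intro M.finsum_cong') (auto simp: M.minus_eq M.a_assoc M.l_neg)
  also have "\<dots> = (\<Oplus>\<^bsub>M\<^esub>q\<in>{1..c}. b q \<ominus>\<^bsub>M\<^esub> b' q) \<oplus>\<^bsub>M\<^esub> (\<Oplus>\<^bsub>M\<^esub>q\<in>{1..c}. b' q)"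
    using bc by (intro M.finsum_addf) auto
  finally have "x = (\<Oplus>\<^bsub>M\<^esub>q\<in>{1..c}. b q \<ominus>\<^bsub>M\<^esub> b' q) \<oplus>\<^bsub>M\<^esub> x" using b b' by simp
  moreover have "(\<Oplus>\<^bsub>M\<^esub>q\<in>{1..c}. b q \<ominus>\<^bsub>M\<^esub> b' q) \<in> carrier M" using bc by (intro M.finsum_closed) auto
  ultimately have z: "(\<Oplus>\<^bsub>M\<^esub>q\<in>{1..c}. b q \<ominus>\<^bsub>M\<^esub> b' q) = \<zero>\<^bsub>M\<^esub>" using assms by (metis M.add.r_cancel_one)
  have "b q \<ominus>\<^bsub>M\<^esub> b' q = \<zero>\<^bsub>M\<^esub>" if "q \<in> {1..c}" for q
  proof (rule sum_zero[OF le_refl _ z that])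
    fix q assume "q \<in> {1..c}"
    then show "b q \<ominus>\<^bsub>M\<^esub> b' q \<in> B q" using bm[of q] BD(5)[of q] by auto
  qed
  then have "b q = b' q" if "q \<in> {1..c}" for q
    using bc[OF that] that by (metis M.minus_eq M.a_inv_closed M.add.inv_equality M.minus_minus)
  then show "b = b'" using PiE_ext[of b "{1..c}" B b'] b b' by blast
qed

lemma comp_prop: "x \<in> carrier M \<Longrightarrow> comp x \<in> (\<Pi>\<^sub>E q\<in>{1..c}. B q) \<and> x = (\<Oplus>\<^bsub>M\<^esub>q\<in>{1..c}. comp x q)"
  unfolding comp_def by (rule theI'[OF comp_ex1])

lemma comp_B: "x \<in> carrier M \<Longrightarrow> 1 \<le> q \<Longrightarrow> q \<le> c \<Longrightarrow> comp x q \<in> B q"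
  using comp_prop[of x] by (auto simp: PiE_iff)

lemma comp_closed: "x \<in> carrier M \<Longrightarrow> 1 \<le> q \<Longrightarrow> q \<le> c \<Longrightarrow> comp x q \<in> carrier M"
  using comp_B BD(1) by blast

lemma comp_unique:
  assumes "\<And>q. q \<in> {1..c} \<Longrightarrow> b q \<in> B q" "1 \<le> q" "q \<le> c"
  shows "comp (\<Oplus>\<^bsub>M\<^esub>q\<in>{1..c}. b q) q = b q"
proof -
  let ?x = "\<Oplus>\<^bsub>M\<^esub>q\<in>{1..c}. b q"
  have bc: "b q \<in> carrier M" if "q \<in> {1..c}" for q using assms(1)[OF that] BD(1)[of q] that by auto
  have x: "?x \<in> carrier M" using bc by (intro M.finsum_closed) auto
  have "?x = (\<Oplus>\<^bsub>M\<^esub>q\<in>{1..c}. restrict b {1..c} q)" using bc by (intro M.finsum_cong') auto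
  then have "comp ?x = restrict b {1..c}"
    using comp_ex1[OF x] comp_prop[OF x] assms(1) by (metis (no_types, lifting) restrict_PiE_iff)
  then show ?thesis using assms by simp
qed

lemma comp_sum_partial:
  assumes p: "p \<le> c" and b: "\<And>q. q \<in> {1..p} \<Longrightarrow> b q \<in> B q" and q: "1 \<le> q" "q \<le> c"
  shows "comp (\<Oplus>\<^bsub>M\<^esub>q\<in>{1..p}. b q) q = (if q \<le> p then b q else \<zero>\<^bsub>M\<^esub>)"
proof -
  let ?b = "\<lambda>q. if q \<le> p then b q else \<zero>\<^bsub>M\<^esub>"
  have bB: "?b q \<in> B q" if "q \<in> {1..c}" for q using b BD(2)[of q] that by auto
  have bc: "?b q \<in> carrier M" if "q \<in> {1..c}" for q using bB[OF that] BD(1)[of q] that by auto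
  have "(\<Oplus>\<^bsub>M\<^esub>q\<in>{1..p}. b q) = (\<Oplus>\<^bsub>M\<^esub>q\<in>{1..c}. ?b q)"
    using p bc by (intro M.add.finprod_mono_neutral_cong_left) (auto split: if_splits)
  then show ?thesis using comp_unique[OF bB q] by simp
qed

lemma comp_sum: "x \<in> carrier M \<Longrightarrow> (\<Oplus>\<^bsub>M\<^esub>q\<in>{1..c}. comp x q) = x"
  using comp_prop by simp

lemma comp_hom_M:
  assumes "1 \<le> q" "q \<le> c"
  shows "(\<lambda>x. comp x q) \<in> module_hom R M (BB q)"
proof (rule module_homI)
  fix x y assume xy: "x \<in> carrier M" "y \<in> carrier M"
  have "x \<oplus>\<^bsub>M\<^esub> y = (\<Oplus>\<^bsub>M\<^esub>q\<in>{1..c}. comp x q \<oplus>\<^bsub>M\<^esub> comp y q)"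
    using xy comp_closed comp_sum[OF xy(1)] comp_sum[OF xy(2)] by (subst M.finsum_addf) auto
  then show "comp (x \<oplus>\<^bsub>M\<^esub> y) q = comp x q \<oplus>\<^bsub>BB q\<^esub> comp y q"
    using comp_unique[of "\<lambda>q. comp x q \<oplus>\<^bsub>M\<^esub> comp y q" q] assms xy comp_B[of x] comp_B[of y] BD(3) by simp
next
  fix r x assume rx: "r \<in> carrier R" "x \<in> carrier M"
  have "r \<odot>\<^bsub>M\<^esub> x = (\<Oplus>\<^bsub>M\<^esub>q\<in>{1..c}. r \<odot>\<^bsub>M\<^esub> comp x q)"
    using rx comp_closed comp_sum[OF rx(2)] by (subst M.finsum_smult_ldistr[symmetric]) auto
  then show "comp (r \<odot>\<^bsub>M\<^esub> x) q = r \<odot>\<^bsub>BB q\<^esub> comp x q"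
    using comp_unique[of "\<lambda>q. r \<odot>\<^bsub>M\<^esub> comp x q" q] assms rx comp_B BD(6) by simp
qed (use assms comp_B in auto)

lemma comp_hom: "p \<le> c \<Longrightarrow> 1 \<le> q \<Longrightarrow> q \<le> c \<Longrightarrow> (\<lambda>x. comp x q) \<in> module_hom R (FF p) (BB q)"
  by (rule submodule_homs(2)[OF M sub comp_hom_M])

lemma comp_vanish: "p \<le> c \<Longrightarrow> x \<in> F p \<Longrightarrow> p < q \<Longrightarrow> q \<le> c \<Longrightarrow> comp x q = \<zero>\<^bsub>M\<^esub>"
  using decomp_ex[of p x] comp_sum_partial[of p _ q] by fastforce

lemma comp_sum_F:
  assumes "p \<le> c" "x \<in> F p"
  shows "(\<Oplus>\<^bsub>M\<^esub>q\<in>{1..p}. comp x q) = x"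
proof -
  obtain b where b: "\<forall>q\<in>{1..p}. b q \<in> B q" "x = (\<Oplus>\<^bsub>M\<^esub>q\<in>{1..p}. b q)" using decomp_ex[OF assms] by blast
  then have "comp x q = b q" if "q \<in> {1..p}" for q using comp_sum_partial[OF assms(1), of b q] that assms(1) by auto
  moreover have "b q \<in> carrier M" if "q \<in> {1..p}" for q using b(1) BD(1)[of q] that assms(1) by auto
  ultimately have "(\<Oplus>\<^bsub>M\<^esub>q\<in>{1..p}. comp x q) = (\<Oplus>\<^bsub>M\<^esub>q\<in>{1..p}. b q)" by (intro M.finsum_cong') auto
  then show ?thesis using b by simp
qed

lemma comp_in_B:
  assumes "1 \<le> q" "q \<le> c" "x \<in> B q" "1 \<le> q'" "q' \<le> c"
  shows "comp x q' = (if q' = q then x else \<zero>\<^bsub>M\<^esub>)"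
proof -
  let ?b = "\<lambda>i. if q = i then x else \<zero>\<^bsub>M\<^esub>"
  have xc: "x \<in> carrier M" using BD(1) assms by blast
  have "(\<Oplus>\<^bsub>M\<^esub>i\<in>{1..c}. ?b i) = x" using assms xc by (intro M.finsum_singleton) auto
  moreover have "?b i \<in> B i" if "i \<in> {1..c}" for i using assms BD(2)[of i] that by auto
  ultimately show ?thesis using comp_unique[of ?b q'] assms by auto
qed

lemma retract_hom:
  assumes "1 \<le> p" "p \<le> c"
  shows "(\<lambda>x. x \<ominus>\<^bsub>M\<^esub> comp x p) \<in> module_hom R (FF p) (FF (p - 1))"
    and "x \<in> F (p - 1) \<Longrightarrow> x \<ominus>\<^bsub>M\<^esub> comp x p = x"
    and "x \<in> F p \<Longrightarrow> x = (x \<ominus>\<^bsub>M\<^esub> comp x p) \<oplus>\<^bsub>M\<^esub> comp x p"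
proof -
  have p1: "p - 1 \<le> c" using assms by simp
  note cp = comp_hom_M[OF assms]
  have xc: "x \<in> carrier M" if "x \<in> F p" for x using FD(1)[OF assms(2) that] .
  have cc: "comp x p \<in> carrier M" if "x \<in> F p" for x using comp_closed[OF xc[OF that] assms] .
  show "(\<lambda>x. x \<ominus>\<^bsub>M\<^esub> comp x p) \<in> module_hom R (FF p) (FF (p - 1))"
  proof (rule module_homI)
    fix x assume "x \<in> carrier (FF p)"
    then have x: "x \<in> F p" by simp
    then obtain y z where yz: "x = y \<oplus>\<^bsub>M\<^esub> z" "y \<in> F (p - 1)" "z \<in> B p" using split_sum[OF assms] by blast
    have c: "y \<in> carrier M" "z \<in> carrier M" using FD(1)[OF p1] BD(1)[OF assms] yz by auto
    have "comp x p = comp y p \<oplus>\<^bsub>M\<^esub> comp z p" using module_homD(2)[OF cp c] yz by simp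
    then have "comp x p = z"
      using comp_vanish[OF p1 yz(2), of p] comp_in_B[OF assms yz(3) assms] c assms by simp
    then have "x \<ominus>\<^bsub>M\<^esub> comp x p = y" using yz c by (simp add: M.minus_eq M.a_assoc M.r_neg)
    then show "x \<ominus>\<^bsub>M\<^esub> comp x p \<in> carrier (FF (p - 1))" using yz by simp
  next
    fix x y assume "x \<in> carrier (FF p)" "y \<in> carrier (FF p)"
    then have xy: "x \<in> F p" "y \<in> F p" by auto
    show "(x \<oplus>\<^bsub>FF p\<^esub> y) \<ominus>\<^bsub>M\<^esub> comp (x \<oplus>\<^bsub>FF p\<^esub> y) p = (x \<ominus>\<^bsub>M\<^esub> comp x p) \<oplus>\<^bsub>FF (p - 1)\<^esub> (y \<ominus>\<^bsub>M\<^esub> comp y p)"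
      using xc[OF xy(1)] xc[OF xy(2)] cc[OF xy(1)] cc[OF xy(2)] module_homD(2)[OF cp xc[OF xy(1)] xc[OF xy(2)]]
      by (simp add: M.minus_eq M.minus_add M.a_ac)
  next
    fix r x assume r: "r \<in> carrier R" and "x \<in> carrier (FF p)"
    then have x: "x \<in> F p" by simp
    show "(r \<odot>\<^bsub>FF p\<^esub> x) \<ominus>\<^bsub>M\<^esub> comp (r \<odot>\<^bsub>FF p\<^esub> x) p = r \<odot>\<^bsub>FF (p - 1)\<^esub> (x \<ominus>\<^bsub>M\<^esub> comp x p)"
      using r xc[OF x] cc[OF x] module_homD(3)[OF cp r xc[OF x]]
      by (simp add: M.minus_eq M.smult_r_distr M.smult_r_minus)
  qed
  show "x \<ominus>\<^bsub>M\<^esub> comp x p = x" if "x \<in> F (p - 1)"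
  proof -
    have "x \<in> carrier M" using FD(1)[OF p1 that] .
    then show ?thesis using comp_vanish[OF p1 that, of p] assms M.minus_equality[of "\<zero>\<^bsub>M\<^esub>" "\<zero>\<^bsub>M\<^esub>"] by (simp add: M.minus_eq)
  qed
  show "x = (x \<ominus>\<^bsub>M\<^esub> comp x p) \<oplus>\<^bsub>M\<^esub> comp x p" if "x \<in> F p"
    using xc[OF that] cc[OF that] by (simp add: M.minus_eq M.a_assoc M.l_neg)
qed

text \<open>The decomposition \<open>F p = B 1 \<oplus> \<dots> \<oplus> B p\<close>, with the summands labelled by an arbitrary index set. The labels will be
  words, each of which determines the summand by its length.\<close>

lemma ident_iso:
  assumes p: "p \<le> c" and \<rho>: "bij_betw \<rho> J {1..p}" and cR: "cring R"
  shows "(\<lambda>x. \<lambda>w\<in>J. comp x (\<rho> w)) \<in> module_iso R (FF p) (direct_sum J (\<lambda>w. BB (\<rho> w)))"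
proof (rule module_isoI[OF FF_module[OF p]])
  have J: "finite J" using \<rho> bij_betw_finite by blast
  have \<rho>J: "1 \<le> \<rho> w" "\<rho> w \<le> p" "\<rho> w \<le> c" if "w \<in> J" for w using bij_betwE[OF \<rho>] that p by auto
  have mod: "module R (BB (\<rho> w))" if "w \<in> J" for w using BB_module \<rho>J[OF that] by blast
  show "module R (direct_sum J (\<lambda>w. BB (\<rho> w)))" by (rule direct_sum_module[OF cR mod])
  show "(\<lambda>x. \<lambda>w\<in>J. comp x (\<rho> w)) \<in> module_hom R (FF p) (direct_sum J (\<lambda>w. BB (\<rho> w)))"
    by (rule ds_homI[OF cR mod J FF_module[OF p]]) (auto intro: comp_hom p \<rho>J)
  show "x = \<zero>\<^bsub>FF p\<^esub>"
    if x: "x \<in> carrier (FF p)" and z: "(\<lambda>w\<in>J. comp x (\<rho> w)) = \<zero>\<^bsub>direct_sum J (\<lambda>w. BB (\<rho> w))\<^esub>" for x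
  proof -
    have "comp x q = \<zero>\<^bsub>M\<^esub>" if q: "q \<in> {1..p}" for q
    proof -
      obtain w where "w \<in> J" "q = \<rho> w" using bij_betw_imp_surj_on[OF \<rho>] q by blast
      then show ?thesis using fun_cong[OF z, of w] by (simp add: direct_sum_simps)
    qed
    then have "(\<Oplus>\<^bsub>M\<^esub>q\<in>{1..p}. comp x q) = (\<Oplus>\<^bsub>M\<^esub>q\<in>{1..p}. \<zero>\<^bsub>M\<^esub>)" by (intro M.finsum_cong') auto
    then show ?thesis using comp_sum_F[OF p] x by simp
  qed
  show "\<exists>x\<in>carrier (FF p). (\<lambda>w\<in>J. comp x (\<rho> w)) = y" if y: "y \<in> carrier (direct_sum J (\<lambda>w. BB (\<rho> w)))" for y
  proof -
    let ?b = "\<lambda>q. y (inv_into J \<rho> q)"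
    have inv: "inv_into J \<rho> q \<in> J" "\<rho> (inv_into J \<rho> q) = q" if "q \<in> {1..p}" for q
      using \<rho> that by (auto simp: bij_betw_def inv_into_into f_inv_into_f)
    have yB: "y w \<in> B (\<rho> w)" if "w \<in> J" for w using y that by (auto simp: direct_sum_simps PiE_iff)
    have b: "?b q \<in> B q" if "q \<in> {1..p}" for q using yB[OF inv(1)[OF that]] inv(2)[OF that] by simp
    let ?x = "\<Oplus>\<^bsub>M\<^esub>q\<in>{1..p}. ?b q"
    have "comp ?x (\<rho> w) = y w" if "w \<in> J" for w
      using comp_sum_partial[OF p b, of "\<rho> w"] \<rho>J[OF that] \<rho> that by (simp add: bij_betw_def)
    then have "(\<lambda>w\<in>J. comp ?x (\<rho> w)) = y" using y by (auto simp: direct_sum_simps PiE_iff extensional_def)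
    then show ?thesis using sum_in_F[OF p b] by auto
  qed
qed

end

section \<open>Index words\<close>

text \<open>The recursion unfolds to a condition on words: the new letter \<open>i\<close> accounts for the part \<open>2 i\<close> of the degree \<open>n\<close>, and the
  degree left over at the innermost \<open>B\<^sub>s(q)\<close> is \<open>s = n mod 2\<close>.\<close>

lemma T_index_eq: "T_index p n = {w. w \<noteq> [] \<and> length w \<le> p \<and> sum_list w = n div 2}"
proof (induction p arbitrary: n)
  case (Suc p)
  have "w \<in> cone_index (T_index p) m \<longleftrightarrow> length w \<le> p \<and> sum_list w = m div 2" for w m
    by (auto simp: cone_index_def Suc.IH)
  moreover have "(n - 2 * i) div 2 = n div 2 - i" for i by arith
  ultimately have "w \<in> T_index (Suc p) n \<longleftrightarrow> w \<noteq> [] \<and> length w \<le> Suc p \<and> sum_list w = n div 2" for w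
    by (cases w) (auto simp: shamash_index_def)
  then show ?case by blast
qed auto

lemma U_index_eq: "1 \<le> p \<Longrightarrow> U_index p n = {w. length w < p \<and> sum_list w = n div 2}"
  by (auto simp: U_index_def cone_index_def T_index_eq)

lemma finite_words: "finite {w :: nat list. length w \<le> p \<and> sum_list w = m}"
proof (rule finite_subset)
  show "{w. length w \<le> p \<and> sum_list w = m} \<subseteq> {w. set w \<subseteq> {..m} \<and> length w \<le> p}"
    using member_le_sum_list by fastforce
  show "finite {w. set w \<subseteq> {..m} \<and> length w \<le> p}" by (rule finite_lists_length_le) simp
qed

lemma finite_T_index: "finite (T_index p n)"
  unfolding T_index_eq by (rule finite_subset[OF _ finite_words[of p "n div 2"]]) auto

lemma finite_U_index: "1 \<le> p \<Longrightarrow> finite (U_index p n)"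
  unfolding U_index_eq by (rule finite_subset[OF _ finite_words[of p "n div 2"]]) auto

lemma T_index_Cons: "1 \<le> p \<Longrightarrow> i # w \<in> T_index p n \<longleftrightarrow> 2 * i \<le> n \<and> w \<in> U_index p (n - 2 * i)"
  by (auto simp: T_index_eq U_index_eq)

lemma T_index_hd_tl: "1 \<le> p \<Longrightarrow> w \<in> T_index p n \<Longrightarrow> 2 * hd w \<le> n \<and> tl w \<in> U_index p (n - 2 * hd w) \<and> w \<noteq> []"
  by (cases w) (auto simp: T_index_eq U_index_eq)

lemma U_index_Nil_iff: "1 \<le> p \<Longrightarrow> [] \<in> U_index p n \<longleftrightarrow> n < 2"
  by (auto simp: U_index_eq)

lemma U_index_ge2: "1 \<le> p \<Longrightarrow> 2 \<le> n \<Longrightarrow> U_index p n = T_index (p - 1) n"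
  by (auto simp: T_index_eq U_index_eq)

lemma zero_word: "sum_list (w :: nat list) = 0 \<longleftrightarrow> w = replicate (length w) 0"
  by (induction w) auto

lemma U_index_bij:
  assumes "1 \<le> p" "n < 2"
  shows "bij_betw (\<lambda>w. p - length w) (U_index p n) {1..p}"
proof (rule bij_betw_byWitness[where f' = "\<lambda>q. replicate (p - q) 0"])
  show "\<forall>w\<in>U_index p n. replicate (p - (p - length w)) 0 = w"
    using assms zero_word by (auto simp: U_index_eq)
qed (use assms in \<open>auto simp: U_index_eq sum_list_replicate\<close>)

lemma T_index_bij:
  assumes "n < 2"
  shows "bij_betw (\<lambda>w. p + 1 - length w) (T_index p n) {1..p}"
proof (rule bij_betw_byWitness[where f' = "\<lambda>q. replicate (p + 1 - q) 0"])
  show "\<forall>w\<in>T_index p n. replicate (p + 1 - (p + 1 - length w)) 0 = w"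
    using assms zero_word by (auto simp: T_index_eq)
  show "(\<lambda>w. p + 1 - length w) ` T_index p n \<subseteq> {1..p}"
  proof
    fix q assume "q \<in> (\<lambda>w. p + 1 - length w) ` T_index p n"
    then obtain w :: "nat list" where w: "w \<noteq> []" "length w \<le> p" "q = p + 1 - length w" by (auto simp: T_index_eq)
    then have "1 \<le> length w" by (cases w) auto
    then show "q \<in> {1..p}" using w by auto
  qed
qed (use assms in \<open>auto simp: T_index_eq sum_list_replicate\<close>)

lemma T_index_range: "w \<in> T_index p n \<Longrightarrow> 1 \<le> p + 1 - length w \<and> p + 1 - length w \<le> p"
  by (cases w) (auto simp: T_index_eq)

lemma U_index_range: "1 \<le> p \<Longrightarrow> w \<in> U_index p n \<Longrightarrow> 1 \<le> p - length w \<and> p - length w \<le> p"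
  by (auto simp: U_index_eq)

text \<open>The word of the summand \<open>B\<^sub>0(q')\<close> of \<open>y\<^sub>q A\<^sub>0(q)\<close> in \<open>T\<^sub>2(p)\<close>.\<close>

definition T2_word :: "nat \<Rightarrow> nat \<Rightarrow> nat \<Rightarrow> nat list"
  where "T2_word p q q' = replicate (p - q) 0 @ 1 # replicate (q - q') 0"

abbreviation leading_zeros :: "nat list \<Rightarrow> nat"
  where "leading_zeros w \<equiv> length (takeWhile (\<lambda>i. i = 0) w)"

lemma T2_word:
  assumes "1 \<le> q'" "q' \<le> q" "q \<le> p"
  shows "T2_word p q q' \<in> T_index p 2" and "p - leading_zeros (T2_word p q q') = q"
    and "p + 1 - length (T2_word p q q') = q'"
proof -
  have "takeWhile (\<lambda>i. i = 0) (replicate k (0::nat) @ 1 # xs) = replicate k 0" for k xs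
    by (induction k) auto
  then show "p - leading_zeros (T2_word p q q') = q" using assms by (simp add: T2_word_def)
  show "T2_word p q q' \<in> T_index p 2" "p + 1 - length (T2_word p q q') = q'"
    using assms by (auto simp: T2_word_def T_index_eq sum_list_replicate)
qed

lemma word_sum_1:
  "sum_list w = (1::nat) \<Longrightarrow> \<exists>l. w = replicate (leading_zeros w) 0 @ 1 # replicate l 0"
proof (induction w)
  case (Cons i w)
  show ?case
  proof (cases "i = 0")
    case True
    then show ?thesis using Cons by auto
  next
    case False
    moreover have "i + sum_list w = 1" using Cons.prems by simp
    ultimately have "i = 1" "sum_list w = 0" by linarith+
    then show ?thesis using zero_word[of w] by (intro exI[of _ "length w"]) simp
  qed
qed simp

lemma T_index_2:
  assumes "w \<in> T_index p 2"
  shows "1 \<le> p + 1 - length w" "p + 1 - length w \<le> p - leading_zeros w" "1 \<le> p - leading_zeros w" "p - leading_zeros w \<le> p"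
    and "w = T2_word p (p - leading_zeros w) (p + 1 - length w)"
proof -
  have w: "length w \<le> p" "sum_list w = 1" using assms by (auto simp: T_index_eq)
  obtain k l where kl: "w = replicate k 0 @ 1 # replicate l 0" "k = leading_zeros w" using word_sum_1[OF w(2)] by blast
  have len: "length w = k + 1 + l" by (subst kl(1)) simp
  show "1 \<le> p + 1 - length w" "p + 1 - length w \<le> p - leading_zeros w" "1 \<le> p - leading_zeros w" "p - leading_zeros w \<le> p"
    unfolding kl(2)[symmetric] using len w by auto
  have "p - (p - k) = k" "p - k - (p + 1 - length w) = l" using len w by auto
  then show "w = T2_word p (p - leading_zeros w) (p + 1 - length w)"
    unfolding kl(2)[symmetric] T2_word_def using kl(1) by simp
qed

section \<open>Quotient modules\<close>

lemma quot_module_hom: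
  assumes "module R M" "submodule N R M"
  shows "(\<lambda>x. N +>\<^bsub>M\<^esub> x) \<in> module_hom R M (quot_module M N)"
    and "y \<in> carrier (quot_module M N) \<Longrightarrow> \<exists>x\<in>carrier M. N +>\<^bsub>M\<^esub> x = y"
    and "x \<in> carrier M \<Longrightarrow> N +>\<^bsub>M\<^esub> x = \<zero>\<^bsub>quot_module M N\<^esub> \<longleftrightarrow> x \<in> N"
proof -
  interpret M: module R M by fact
  interpret N: abelian_subgroup N M by (rule submodule_additive_subgroup[OF assms])
  note ND = submoduleD[OF assms]
  show "(\<lambda>x. N +>\<^bsub>M\<^esub> x) \<in> module_hom R M (quot_module M N)"
  proof (rule module_homI)
    show "N +>\<^bsub>M\<^esub> x \<in> carrier (quot_module M N)" if "x \<in> carrier M" for x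
      using M.a_rcosetsI[OF N.a_subset that] by (simp add: quot_module_def)
    show "N +>\<^bsub>M\<^esub> (x \<oplus>\<^bsub>M\<^esub> y) = (N +>\<^bsub>M\<^esub> x) \<oplus>\<^bsub>quot_module M N\<^esub> (N +>\<^bsub>M\<^esub> y)"
      if "x \<in> carrier M" "y \<in> carrier M" for x y
      using that by (simp add: quot_module_def N.a_rcos_sum)
    fix r x assume rx: "r \<in> carrier R" "x \<in> carrier M"
    have const: "N +>\<^bsub>M\<^esub> (r \<odot>\<^bsub>M\<^esub> x') = N +>\<^bsub>M\<^esub> (r \<odot>\<^bsub>M\<^esub> x)" if "x' \<in> N +>\<^bsub>M\<^esub> x" for x'
    proof -
      have x': "x' \<in> carrier M" using N.a_elemrcos_carrier[OF rx(2) that] .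
      have "x' \<oplus>\<^bsub>M\<^esub> \<ominus>\<^bsub>M\<^esub> x \<in> N" using N.a_rcos_module[OF rx(2) x'] that by simp
      then have "r \<odot>\<^bsub>M\<^esub> (x' \<oplus>\<^bsub>M\<^esub> \<ominus>\<^bsub>M\<^esub> x) \<in> N" using ND(6) rx(1) by blast
      then have "r \<odot>\<^bsub>M\<^esub> x' \<oplus>\<^bsub>M\<^esub> \<ominus>\<^bsub>M\<^esub> (r \<odot>\<^bsub>M\<^esub> x) \<in> N"
        using rx x' by (simp add: M.smult_r_distr M.smult_r_minus)
      then have "r \<odot>\<^bsub>M\<^esub> x' \<in> N +>\<^bsub>M\<^esub> (r \<odot>\<^bsub>M\<^esub> x)"
        using N.a_rcos_module[of "r \<odot>\<^bsub>M\<^esub> x" "r \<odot>\<^bsub>M\<^esub> x'"] rx x' by simp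
      then show ?thesis using N.a_repr_independence' rx by (metis M.smult_closed)
    qed
    have "(\<Union>x'\<in>N +>\<^bsub>M\<^esub> x. N +>\<^bsub>M\<^esub> (r \<odot>\<^bsub>M\<^esub> x')) = N +>\<^bsub>M\<^esub> (r \<odot>\<^bsub>M\<^esub> x)"
      using N.a_rcos_self[OF rx(2)] const by (intro SUP_eq_const) blast+
    then show "N +>\<^bsub>M\<^esub> (r \<odot>\<^bsub>M\<^esub> x) = r \<odot>\<^bsub>quot_module M N\<^esub> (N +>\<^bsub>M\<^esub> x)"
      by (simp add: quot_module_def)
  qed
  show "\<exists>x\<in>carrier M. N +>\<^bsub>M\<^esub> x = y" if "y \<in> carrier (quot_module M N)"
    using that by (auto simp: quot_module_def A_RCOSETS_def' a_r_coset_def')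
  show "N +>\<^bsub>M\<^esub> x = \<zero>\<^bsub>quot_module M N\<^esub> \<longleftrightarrow> x \<in> N" if "x \<in> carrier M"
  proof -
    have "N +>\<^bsub>M\<^esub> x = N \<longleftrightarrow> x \<in> N"
      using M.a_coset_join1[of N x] M.a_coset_join2[of x N] N.a_subgroup N.a_rcos_self[OF that] that by auto
    then show ?thesis by (simp add: quot_module_def)
  qed
qed

lemma hom_image_submodule:
  assumes "module R M" "module R N" "g \<in> module_hom R M N"
  shows "submodule (g ` carrier M) R N"
proof -
  interpret M: module R M by fact
  interpret N: module R N by fact
  have add: "additive_map M N g" by (rule module_hom_additive) fact+
  show ?thesis
  proof (rule N.submoduleI)
    show "\<zero>\<^bsub>N\<^esub> \<in> g ` carrier M" using additive_zero[OF add] by (metis M.zero_closed imageI)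
    fix a assume "a \<in> g ` carrier M"
    then obtain u where u: "u \<in> carrier M" "a = g u" by blast
    show "\<ominus>\<^bsub>N\<^esub> a \<in> g ` carrier M" using additive_neg[OF add u(1)] u by (metis M.a_inv_closed imageI)
    fix b assume "b \<in> g ` carrier M"
    then obtain v where v: "v \<in> carrier M" "b = g v" by blast
    show "a \<oplus>\<^bsub>N\<^esub> b \<in> g ` carrier M" using additive_add[OF add u(1) v(1)] u v by (metis M.a_closed imageI)
  next
    fix a b assume a: "a \<in> carrier R" and "b \<in> g ` carrier M"
    then obtain v where v: "v \<in> carrier M" "b = g v" by blast
    show "a \<odot>\<^bsub>N\<^esub> b \<in> g ` carrier M" using module_homD(3)[OF assms(3) a v(1)] v a by (metis M.smult_closed imageI)
  qed (use module_homD(1)[OF assms(3)] in auto)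
qed

section \<open>Local rings\<close>

lemma (in noetherian_ring) proper_ideal_in_maximal:
  assumes "ideal J R" "J \<noteq> carrier R"
  shows "\<exists>m. maximalideal m R \<and> J \<subseteq> m"
proof -
  let ?A = "{K. ideal K R \<and> J \<subseteq> K \<and> K \<noteq> carrier R}"
  have "\<exists>M\<in>?A. \<forall>X\<in>?A. M \<subseteq> X \<longrightarrow> X = M"
  proof (rule subset_Zorn_nonempty)
    show "?A \<noteq> {}" using assms by blast
    fix C assume C: "C \<noteq> {}" "subset.chain ?A C"
    then have "subset.chain {I. ideal I R} C" by (auto simp: pred_on.chain_def)
    then have "\<Union> C \<in> C" using ideal_chain_is_trivial C(1) by blast
    then show "\<Union> C \<in> ?A" using C(2) by (auto simp: pred_on.chain_def)
  qed
  then obtain M where MA: "M \<in> ?A" and max: "\<forall>X\<in>?A. M \<subseteq> X \<longrightarrow> X = M" by (rule bexE)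
  have M: "ideal M R" "J \<subseteq> M" "M \<noteq> carrier R" using MA by auto
  have "maximalideal M R"
  proof (rule maximalidealI[OF M(1)])
    show "carrier R \<noteq> M" using M(3) by simp
    fix K assume "ideal K R" "M \<subseteq> K" "K \<subseteq> carrier R"
    then show "K = M \<or> K = carrier R" using M(2) max by blast
  qed
  then show ?thesis using M(2) by blast
qed

lemma max_ideal_local:
  assumes "local_ring R" "noetherian_ring R"
  shows "maximalideal (max_ideal R) R" and "ideal J R \<Longrightarrow> J \<noteq> carrier R \<Longrightarrow> J \<subseteq> max_ideal R"
proof -
  have u: "\<exists>!m. maximalideal m R" using assms(1) by (simp add: local_ring_def)
  show m: "maximalideal (max_ideal R) R" unfolding max_ideal_def by (rule theI'[OF u])
  show "J \<subseteq> max_ideal R" if "ideal J R" "J \<noteq> carrier R"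
    using noetherian_ring.proper_ideal_in_maximal[OF assms(2) that] u m by blast
qed

text \<open>A proper ideal of the quotient pulls back to a proper ideal, which lies in the maximal ideal; so the image of the
  maximal ideal contains all proper ideals of the quotient.\<close>

lemma max_ideal_quotient:
  assumes R: "local_ring R" "noetherian_ring R" and J: "ideal J R" "J \<noteq> carrier R"
  shows "max_ideal (R Quot J) = (\<lambda>r. J +>\<^bsub>R\<^esub> r) ` max_ideal R"
    and "ideal ((\<lambda>r. J +>\<^bsub>R\<^esub> r) ` max_ideal R) (R Quot J)"
proof -
  interpret cring R using R(1) by (simp add: local_ring_def)
  interpret J: ideal J R by (rule J(1))
  interpret q: ring_hom_ring R "R Quot J" "(+>\<^bsub>R\<^esub>) J" by (rule J.rcos_ring_hom_ring)
  let ?m = "max_ideal R" and ?M = "(\<lambda>r. J +>\<^bsub>R\<^esub> r) ` max_ideal R"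
  interpret m: maximalideal ?m R by (rule max_ideal_local(1)[OF R])
  have Jm: "J \<subseteq> ?m" by (rule max_ideal_local(2)[OF R J])
  have onto: "\<exists>r\<in>carrier R. a = J +>\<^bsub>R\<^esub> r" if "a \<in> carrier (R Quot J)" for a
    using that by (auto simp: FactRing_def A_RCOSETS_def' a_r_coset_def')
  have M_ideal: "ideal ?M (R Quot J)" using ring_ideal_imp_quot_ideal[OF J(1) m.is_ideal] by simp
  then show "ideal ?M (R Quot J)" .
  have proper: "?M \<noteq> carrier (R Quot J)"
  proof
    assume "?M = carrier (R Quot J)"
    then obtain r where r: "r \<in> ?m" "J +>\<^bsub>R\<^esub> \<one>\<^bsub>R\<^esub> = J +>\<^bsub>R\<^esub> r" using q.hom_closed[OF one_closed] by blast
    have rc: "r \<in> carrier R" using m.Icarr r(1) .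
    have "\<one>\<^bsub>R\<^esub> \<ominus>\<^bsub>R\<^esub> r \<in> J" using quotient_eq_iff_same_a_r_cos[OF J(1) one_closed rc] r(2) by simp
    then have "(\<one>\<^bsub>R\<^esub> \<ominus>\<^bsub>R\<^esub> r) \<oplus>\<^bsub>R\<^esub> r \<in> ?m" using Jm r(1) m.a_closed by blast
    then have "\<one>\<^bsub>R\<^esub> \<in> ?m" using rc by (simp add: minus_eq a_assoc l_neg)
    then show False using m.one_imp_carrier m.I_notcarr by simp
  qed
  have below: "K \<subseteq> ?M" if K: "ideal K (R Quot J)" "K \<noteq> carrier (R Quot J)" for K
  proof -
    let ?K = "{r \<in> carrier R. J +>\<^bsub>R\<^esub> r \<in> K}"
    have "ideal ?K R" by (rule q.ideal_vimage[OF K(1)])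
    moreover have "?K \<noteq> carrier R"
    proof
      assume "?K = carrier R"
      then have "carrier (R Quot J) \<subseteq> K" using onto by blast
      then show False using K ideal.Icarr[OF K(1)] by blast
    qed
    ultimately have "?K \<subseteq> ?m" by (rule max_ideal_local(2)[OF R])
    then show ?thesis using onto ideal.Icarr[OF K(1)] by blast
  qed
  have "maximalideal ?M (R Quot J)"
  proof (rule maximalidealI[OF M_ideal])
    show "carrier (R Quot J) \<noteq> ?M" using proper by simp
    fix K assume "ideal K (R Quot J)" "?M \<subseteq> K"
    then show "K = ?M \<or> K = carrier (R Quot J)" using below by blast
  qed
  moreover have "K = ?M" if K: "maximalideal K (R Quot J)" for K
  proof -
    interpret K: maximalideal K "R Quot J" by (rule K)
    have "K \<subseteq> ?M" using below[OF K.is_ideal] K.I_notcarr by blast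
    then show ?thesis
      using K.I_maximal[OF M_ideal] proper ideal.Icarr[OF M_ideal] by blast
  qed
  ultimately show "max_ideal (R Quot J) = ?M" unfolding max_ideal_def by (rule the_equality)
qed

section \<open>Higher matrix factorizations\<close>

locale hmf_setting =
  fixes S :: "('a, 'k) ring_scheme"
    and f :: "nat \<Rightarrow> 'a"
    and c :: nat
    and A :: "nat \<Rightarrow> ('a, 'b, 'k1) module_scheme"
    and F :: "nat \<Rightarrow> nat \<Rightarrow> 'b set"
    and d :: "'b \<Rightarrow> 'b"
    and h :: "nat \<Rightarrow> 'b \<Rightarrow> 'b"
    and B :: "nat \<Rightarrow> nat \<Rightarrow> 'b set"
  assumes S: "cring S" and regular: "regular_sequence S f c"
    and hmf: "higher_matrix_factorization S f c A F d h" and spl: "splittings S c A F B"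
begin

interpretation S: cring S by (rule S)

abbreviation I :: "nat \<Rightarrow> 'a set" where "I p \<equiv> seq_ideal S f p"
abbreviation AF :: "nat \<Rightarrow> nat \<Rightarrow> ('a, 'b, 'k1) module_scheme" where "AF s p \<equiv> filt A F s p"
abbreviation C :: "nat \<Rightarrow> nat \<Rightarrow> ('a, 'b, 'k1) module_scheme" where "C s q \<equiv> filt A B s q"
abbreviation cmp :: "nat \<Rightarrow> 'b \<Rightarrow> nat \<Rightarrow> 'b" where "cmp s x q \<equiv> component c A B s x q"

subsection \<open>The ideals of the regular sequence\<close>

lemma f_closed: "1 \<le> p \<Longrightarrow> p \<le> c \<Longrightarrow> f p \<in> carrier S"
  using regular by (auto simp: regular_sequence_def image_subset_iff)

lemma f_image: "p \<le> c \<Longrightarrow> f ` {1..p} \<subseteq> carrier S"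
  using f_closed by auto

lemma I_ideal: "p \<le> c \<Longrightarrow> ideal (I p) S"
  unfolding seq_ideal_def by (rule S.genideal_ideal[OF f_image])

lemma I_mono: "p \<le> q \<Longrightarrow> q \<le> c \<Longrightarrow> I p \<subseteq> I q"
  unfolding seq_ideal_def by (rule S.subset_Idl_subset[OF f_image]) auto

lemma I_zero: "I 0 = {\<zero>\<^bsub>S\<^esub>}"
  using S.genideal_minimal[OF S.zeroideal, of "{}"] ideal.axioms(1)[OF I_ideal[of 0]]
    additive_subgroup.zero_closed by (fastforce simp: seq_ideal_def)

lemma I_proper: "p \<le> c \<Longrightarrow> I p \<noteq> carrier S"
  using I_mono[of p c] regular ideal.Icarr[OF I_ideal[of c]] by (auto simp: regular_sequence_def)

lemma one_neq_zero: "\<one>\<^bsub>S\<^esub> \<noteq> \<zero>\<^bsub>S\<^esub>"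
  using I_proper[of 0] S.carrier_one_zero by (auto simp: I_zero)

lemma f_nonzerodivisor:
  "1 \<le> p \<Longrightarrow> p \<le> c \<Longrightarrow> x \<in> carrier S \<Longrightarrow> f p \<otimes>\<^bsub>S\<^esub> x \<in> I (p - 1) \<Longrightarrow> x \<in> I (p - 1)"
  using regular by (auto simp: regular_sequence_def)

lemma f_in_I: "1 \<le> p \<Longrightarrow> p \<le> c \<Longrightarrow> f p \<in> I p"
  unfolding seq_ideal_def using S.genideal_self[OF f_image] by fastforce

lemma I_step:
  assumes "1 \<le> p" "p \<le> c" "x \<in> I p"
  shows "\<exists>r\<in>carrier S. \<exists>y\<in>I (p - 1). x = f p \<otimes>\<^bsub>S\<^esub> r \<oplus>\<^bsub>S\<^esub> y"
proof -
  have 1: "ideal (PIdl\<^bsub>S\<^esub> (f p)) S" by (rule S.cgenideal_ideal[OF f_closed[OF assms(1,2)]])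
  have 2: "ideal (I (p - 1)) S" using assms by (intro I_ideal) simp
  have "f ` {1..p} \<subseteq> PIdl\<^bsub>S\<^esub> (f p) <+>\<^bsub>S\<^esub> I (p - 1)"
  proof
    fix y assume "y \<in> f ` {1..p}"
    then obtain q where q: "y = f q" "1 \<le> q" "q \<le> p" by auto
    have z: "\<zero>\<^bsub>S\<^esub> \<in> PIdl\<^bsub>S\<^esub> (f p)" "\<zero>\<^bsub>S\<^esub> \<in> I (p - 1)"
      using 1 2 by (auto simp: ideal_def additive_subgroup.zero_closed)
    show "y \<in> PIdl\<^bsub>S\<^esub> (f p) <+>\<^bsub>S\<^esub> I (p - 1)"
    proof (cases "q = p")
      case True
      then have "y \<in> PIdl\<^bsub>S\<^esub> (f p)" using S.cgenideal_self f_closed assms q by blast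
      moreover have "y = y \<oplus>\<^bsub>S\<^esub> \<zero>\<^bsub>S\<^esub>" using q f_closed[OF assms(1,2)] True by simp
      ultimately show ?thesis using z by (auto simp: set_add_def set_mult_def)
    next
      case False
      then have "q \<le> p - 1" "p - 1 \<le> c" using q assms by auto
      then have "y \<in> I (p - 1)" using f_in_I[of q] I_mono[of q "p - 1"] q by (auto simp: subset_iff)
      moreover have "y = \<zero>\<^bsub>S\<^esub> \<oplus>\<^bsub>S\<^esub> y" using q f_closed[of q] assms by simp
      ultimately show ?thesis using z by (auto simp: set_add_def set_mult_def)
    qed
  qed
  then have "I p \<subseteq> PIdl\<^bsub>S\<^esub> (f p) <+>\<^bsub>S\<^esub> I (p - 1)"
    unfolding seq_ideal_def[of S f p] by (rule S.genideal_minimal[OF S.add_ideals[OF 1 2]])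
  then obtain u y where u: "x = u \<oplus>\<^bsub>S\<^esub> y" "u \<in> PIdl\<^bsub>S\<^esub> (f p)" "y \<in> I (p - 1)"
    using assms(3) by (auto simp: set_add_def set_mult_def)
  then obtain r where "r \<in> carrier S" "u = f p \<otimes>\<^bsub>S\<^esub> r"
    using f_closed[OF assms(1,2)] by (auto simp: cgenideal_def S.m_comm)
  then show ?thesis using u by blast
qed

lemma ideal_smult_step:
  assumes "1 \<le> p" "p \<le> c" and M: "module S M" and x: "x \<in> ideal_smult S (I p) M"
  shows "\<exists>y\<in>carrier M. x \<ominus>\<^bsub>M\<^esub> f p \<odot>\<^bsub>M\<^esub> y \<in> ideal_smult S (I (p - 1)) M"
proof -
  interpret M: module S M by (rule M)
  have fp: "f p \<in> carrier S" by (rule f_closed[OF assms(1,2)])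
  have id: "ideal (I (p - 1)) S" using assms by (intro I_ideal) simp
  note D = ideal_smultD[OF M id]
  let ?N = "{x \<in> carrier M. \<exists>y\<in>carrier M. x \<ominus>\<^bsub>M\<^esub> f p \<odot>\<^bsub>M\<^esub> y \<in> ideal_smult S (I (p - 1)) M}"
  have "submodule ?N S M"
  proof (rule M.submoduleI)
    have "\<zero>\<^bsub>M\<^esub> \<ominus>\<^bsub>M\<^esub> f p \<odot>\<^bsub>M\<^esub> \<zero>\<^bsub>M\<^esub> = \<zero>\<^bsub>M\<^esub>" using fp by (simp add: M.minus_eq M.r_neg)
    then show "\<zero>\<^bsub>M\<^esub> \<in> ?N" using D(2) by (metis (mono_tags, lifting) M.zero_closed mem_Collect_eq)
  next
    fix x assume "x \<in> ?N"
    then obtain y where y: "x \<in> carrier M" "y \<in> carrier M" "x \<ominus>\<^bsub>M\<^esub> f p \<odot>\<^bsub>M\<^esub> y \<in> ideal_smult S (I (p - 1)) M" by blast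
    have "\<ominus>\<^bsub>M\<^esub> x \<ominus>\<^bsub>M\<^esub> f p \<odot>\<^bsub>M\<^esub> (\<ominus>\<^bsub>M\<^esub> y) = \<ominus>\<^bsub>M\<^esub> (x \<ominus>\<^bsub>M\<^esub> f p \<odot>\<^bsub>M\<^esub> y)"
      using y fp by (simp add: M.minus_eq M.smult_r_minus M.minus_add M.a_comm)
    then show "\<ominus>\<^bsub>M\<^esub> x \<in> ?N" using D(4)[OF y(3)] y by (metis (mono_tags, lifting) M.a_inv_closed mem_Collect_eq)
    fix x' assume "x' \<in> ?N"
    then obtain y' where y': "x' \<in> carrier M" "y' \<in> carrier M" "x' \<ominus>\<^bsub>M\<^esub> f p \<odot>\<^bsub>M\<^esub> y' \<in> ideal_smult S (I (p - 1)) M" by blast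
    have "(x \<oplus>\<^bsub>M\<^esub> x') \<ominus>\<^bsub>M\<^esub> f p \<odot>\<^bsub>M\<^esub> (y \<oplus>\<^bsub>M\<^esub> y') = (x \<ominus>\<^bsub>M\<^esub> f p \<odot>\<^bsub>M\<^esub> y) \<oplus>\<^bsub>M\<^esub> (x' \<ominus>\<^bsub>M\<^esub> f p \<odot>\<^bsub>M\<^esub> y')"
      using y y' fp by (simp add: M.minus_eq M.smult_r_distr M.minus_add M.a_ac)
    then show "x \<oplus>\<^bsub>M\<^esub> x' \<in> ?N" using D(3)[OF y(3) y'(3)] y y' by (metis (mono_tags, lifting) M.a_closed mem_Collect_eq)
  next
    fix r x assume r: "r \<in> carrier S" and "x \<in> ?N"
    then obtain y where y: "x \<in> carrier M" "y \<in> carrier M" "x \<ominus>\<^bsub>M\<^esub> f p \<odot>\<^bsub>M\<^esub> y \<in> ideal_smult S (I (p - 1)) M" by blast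
    have "f p \<odot>\<^bsub>M\<^esub> (r \<odot>\<^bsub>M\<^esub> y) = r \<odot>\<^bsub>M\<^esub> (f p \<odot>\<^bsub>M\<^esub> y)"
      using M.smult_assoc1[OF fp r y(2)] M.smult_assoc1[OF r fp y(2)] S.m_comm[OF fp r] by simp
    then have "r \<odot>\<^bsub>M\<^esub> x \<ominus>\<^bsub>M\<^esub> f p \<odot>\<^bsub>M\<^esub> (r \<odot>\<^bsub>M\<^esub> y) = r \<odot>\<^bsub>M\<^esub> (x \<ominus>\<^bsub>M\<^esub> f p \<odot>\<^bsub>M\<^esub> y)"
      using y fp r by (simp add: M.minus_eq M.smult_r_distr M.smult_r_minus)
    then show "r \<odot>\<^bsub>M\<^esub> x \<in> ?N" using D(6)[OF r y(3)] y r by (metis (mono_tags, lifting) M.smult_closed mem_Collect_eq)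
  qed blast
  moreover have "a \<odot>\<^bsub>M\<^esub> x \<in> ?N" if a: "a \<in> I p" and x: "x \<in> carrier M" for a x
  proof -
    obtain r b where rb: "r \<in> carrier S" "b \<in> I (p - 1)" "a = f p \<otimes>\<^bsub>S\<^esub> r \<oplus>\<^bsub>S\<^esub> b"
      using I_step[OF assms(1,2) a] by blast
    have bc: "b \<in> carrier S" using ideal.Icarr[OF id rb(2)] .
    have "a \<odot>\<^bsub>M\<^esub> x = f p \<odot>\<^bsub>M\<^esub> (r \<odot>\<^bsub>M\<^esub> x) \<oplus>\<^bsub>M\<^esub> b \<odot>\<^bsub>M\<^esub> x"
      using rb bc fp x by (simp add: M.smult_l_distr M.smult_assoc1)
    then have "a \<odot>\<^bsub>M\<^esub> x \<ominus>\<^bsub>M\<^esub> f p \<odot>\<^bsub>M\<^esub> (r \<odot>\<^bsub>M\<^esub> x) = b \<odot>\<^bsub>M\<^esub> x"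
      using rb bc fp x by (simp add: M.minus_eq M.a_ac M.r_neg M.r_neg1)
    moreover have "b \<odot>\<^bsub>M\<^esub> x \<in> ideal_smult S (I (p - 1)) M" using ideal_smult_gen[OF M rb(2) x] .
    moreover have "a \<odot>\<^bsub>M\<^esub> x \<in> carrier M" using rb bc fp x by simp
    ultimately show ?thesis using rb(1) x by (metis (mono_tags, lifting) M.smult_closed mem_Collect_eq)
  qed
  ultimately have "x \<in> ?N" by (rule ideal_smult_least[OF M, rotated 2, OF x])
  then show ?thesis by blast
qed

subsection \<open>The filtered modules\<close>

lemma filtered: "s < 2 \<Longrightarrow> filtered_module S (A s) (F s) (B s) c"
  using hmf spl
  by (intro filtered_module.intro)
     (auto simp: higher_matrix_factorization_def splittings_def filt_def less_2_cases_iff)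

lemma component_eq: "s < 2 \<Longrightarrow> component c A B s = filtered_module.comp (A s) (B s) c"
proof -
  assume "s < 2"
  then interpret filtered_module S "A s" "F s" "B s" c by (rule filtered)
  show ?thesis by (intro ext) (simp add: component_def comp_def)
qed

lemma AF_carrier [simp]: "carrier (AF s p) = F s p" "carrier (C s q) = B s q"
  and AF_ops [simp]: "add (AF s p) = add (A s)" "zero (AF s p) = zero (A s)" "smult (AF s p) = smult (A s)"
    "add (C s p) = add (A s)" "zero (C s p) = zero (A s)" "smult (C s p) = smult (A s)"
  by (simp_all add: filt_def)

lemma A_module: "s < 2 \<Longrightarrow> module S (A s)"
  using filtered_module.M[OF filtered] .

lemma AF_module: "s < 2 \<Longrightarrow> p \<le> c \<Longrightarrow> module S (AF s p)"
  using filtered_module.FF_module[OF filtered] by (simp add: filt_def)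

lemma C_module: "s < 2 \<Longrightarrow> 1 \<le> q \<Longrightarrow> q \<le> c \<Longrightarrow> module S (C s q)"
  using filtered_module.BB_module[OF filtered] by (simp add: filt_def)

lemma AF_sub: "s < 2 \<Longrightarrow> p \<le> c \<Longrightarrow> submodule (F s p) S (A s)"
  using filtered_module.sub[OF filtered] .

lemma cmp_hom: "s < 2 \<Longrightarrow> p \<le> c \<Longrightarrow> 1 \<le> q \<Longrightarrow> q \<le> c \<Longrightarrow> (\<lambda>x. cmp s x q) \<in> module_hom S (AF s p) (C s q)"
  using filtered_module.comp_hom[OF filtered] component_eq by (simp add: filt_def)

lemma C_in_AF: "s < 2 \<Longrightarrow> 1 \<le> p \<Longrightarrow> p \<le> c \<Longrightarrow> x \<in> B s p \<Longrightarrow> x \<in> F s p"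
  using filtered_module.B_F[OF filtered] .

lemma C_incl: "s < 2 \<Longrightarrow> 1 \<le> p \<Longrightarrow> p \<le> c \<Longrightarrow> (\<lambda>x. x) \<in> module_hom S (C s p) (AF s p)"
  by (rule module_homI) (auto intro: C_in_AF)

lemma AF_mono: "s < 2 \<Longrightarrow> p \<le> q \<Longrightarrow> q \<le> c \<Longrightarrow> x \<in> F s p \<Longrightarrow> x \<in> F s q"
  using filtered_module.F_mono[OF filtered] .

lemma cmp_vanish: "s < 2 \<Longrightarrow> p \<le> c \<Longrightarrow> x \<in> F s p \<Longrightarrow> p < q \<Longrightarrow> q \<le> c \<Longrightarrow> cmp s x q = \<zero>\<^bsub>A s\<^esub>"
  using filtered_module.comp_vanish[OF filtered] component_eq by simp

lemma cmp_in_C: "s < 2 \<Longrightarrow> 1 \<le> q \<Longrightarrow> q \<le> c \<Longrightarrow> x \<in> B s q \<Longrightarrow> 1 \<le> q' \<Longrightarrow> q' \<le> c \<Longrightarrow>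
    cmp s x q' = (if q' = q then x else \<zero>\<^bsub>A s\<^esub>)"
  using filtered_module.comp_in_B[OF filtered] component_eq by simp

lemma retract_hom:
  assumes "s < 2" "1 \<le> p" "p \<le> c"
  shows "(\<lambda>x. x \<ominus>\<^bsub>A s\<^esub> cmp s x p) \<in> module_hom S (AF s p) (AF s (p - 1))"
    and "x \<in> F s (p - 1) \<Longrightarrow> x \<ominus>\<^bsub>A s\<^esub> cmp s x p = x"
    and "x \<in> F s p \<Longrightarrow> x = (x \<ominus>\<^bsub>A s\<^esub> cmp s x p) \<oplus>\<^bsub>A s\<^esub> cmp s x p"
  using filtered_module.retract_hom[OF filtered[OF assms(1)] assms(2,3)] component_eq[OF assms(1)]
  by (simp_all add: filt_def)

lemma ident_iso:
  assumes "s < 2" "p \<le> c" "bij_betw \<rho> J {1..p}"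
  shows "(\<lambda>x. \<lambda>w\<in>J. cmp s x (\<rho> w)) \<in> module_iso S (AF s p) (direct_sum J (\<lambda>w. C s (\<rho> w)))"
  using filtered_module.ident_iso[OF filtered[OF assms(1)] assms(2,3) S] component_eq[OF assms(1)]
  by (simp add: filt_def)

lemma d_hom: "p \<le> c \<Longrightarrow> d \<in> module_hom S (AF 1 p) (AF 0 p)"
proof -
  assume p: "p \<le> c"
  have d: "d \<in> module_hom S (A 1) (A 0)" and dF: "\<forall>p\<in>{1..c}. d ` F 1 p \<subseteq> F 0 p"
    and z: "F 1 0 = {\<zero>\<^bsub>A 1\<^esub>}" "F 0 0 = {\<zero>\<^bsub>A 0\<^esub>}"
    using hmf by (auto simp: higher_matrix_factorization_def)
  have "d x \<in> F 0 p" if "x \<in> F 1 p" for x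
  proof (cases "p = 0")
    case True
    then show ?thesis using that z additive_zero[OF module_hom_additive[OF A_module A_module d]] by simp
  next
    case False
    then have "p \<in> {1..c}" using p by simp
    then show ?thesis using dF that by blast
  qed
  then show ?thesis
    using module_homD[OF d] submoduleD(1)[OF A_module[of 1] AF_sub[of 1 p]] p by (intro module_homI) auto
qed

lemma h_hom:
  assumes "1 \<le> p" "p \<le> c"
  shows "h p \<in> module_hom S (AF 0 p) (AF 1 p)"
proof -
  have "h p \<in> module_hom S (AF 0 p) (A 1)" "h p ` F 0 p \<subseteq> F 1 p"
    using hmf assms by (auto simp: higher_matrix_factorization_def)
  then show ?thesis using module_homD[of "h p" S "AF 0 p" "A 1"] by (intro module_homI) auto
qed

text \<open>The chosen complement \<open>B\<^sub>s(p)\<close> maps isomorphically to the graded piece \<open>A\<^sub>s(p)/A\<^sub>s(p-1)\<close>. Through this isomorphism the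
  freeness of the graded pieces and condition (b), which are stated for quotients, are transported to the complements.\<close>

lemma gr_iso:
  assumes s: "s < 2" and p: "1 \<le> p" "p \<le> c"
  shows "gr_proj A F s p \<in> module_iso S (C s p) (gr A F s p)"
    and "gr_proj A F s p \<in> module_hom S (AF s p) (gr A F s p)"
    and "module S (gr A F s p)" and "fg_free S (gr A F s p)"
    and "x \<in> F s p \<Longrightarrow> gr_proj A F s p x = gr_proj A F s p (cmp s x p)"
proof -
  have s': "s \<in> {0, 1}" using s by auto
  have M: "module S (AF s p)" by (rule AF_module[OF s p(2)])
  have N: "submodule (F s (p - 1)) S (AF s p)"
    using filtered_module.split[OF filtered[OF s] p] by (simp add: internal_direct_sum_def filt_def)
  show free: "fg_free S (gr A F s p)"
    using hmf s' p by (auto simp: higher_matrix_factorization_def)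
  then show gm: "module S (gr A F s p)" by (simp add: fg_free_def)
  note q = quot_module_hom[OF M N, folded gr_def gr_proj_def]
  have e: "gr_proj A F s p = (\<lambda>x. gr_proj A F s p x)" by simp
  show hom: "gr_proj A F s p \<in> module_hom S (AF s p) (gr A F s p)" using q(1) by simp
  have add: "additive_map (AF s p) (gr A F s p) (gr_proj A F s p)" by (rule module_hom_additive[OF M gm hom])
  interpret G: module S "gr A F s p" by (rule gm)
  show pc: "gr_proj A F s p x = gr_proj A F s p (cmp s x p)" if x: "x \<in> F s p" for x
  proof -
    let ?y = "x \<ominus>\<^bsub>A s\<^esub> cmp s x p"
    have y: "?y \<in> F s (p - 1)" using module_homD(1)[OF retract_hom(1)[OF s p], of x] x by simp
    then have y': "?y \<in> F s p" using AF_mono[OF s, of "p - 1" p] p by simp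
    have cF: "cmp s x p \<in> F s p" using module_homD(1)[OF cmp_hom[OF s p(2) p], of x] x C_in_AF[OF s p] by simp
    have "gr_proj A F s p x = gr_proj A F s p (?y \<oplus>\<^bsub>A s\<^esub> cmp s x p)" using retract_hom(3)[OF s p x] by simp
    also have "\<dots> = gr_proj A F s p ?y \<oplus>\<^bsub>gr A F s p\<^esub> gr_proj A F s p (cmp s x p)"
      using additive_add[OF add, of ?y "cmp s x p"] y' cF by simp
    also have "gr_proj A F s p ?y = \<zero>\<^bsub>gr A F s p\<^esub>" using q(3)[of ?y] y y' by simp
    finally show ?thesis using module_homD(1)[OF hom, of "cmp s x p"] cF by simp
  qed
  show "gr_proj A F s p \<in> module_iso S (C s p) (gr A F s p)"
  proof (rule module_isoI[OF C_module[OF s p] gm])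
    show "gr_proj A F s p \<in> module_hom S (C s p) (gr A F s p)"
      using module_hom_comp[OF C_incl[OF s p] hom] by simp
    show "x = \<zero>\<^bsub>C s p\<^esub>" if "x \<in> carrier (C s p)" "gr_proj A F s p x = \<zero>\<^bsub>gr A F s p\<^esub>" for x
      using that q(3)[of x] C_in_AF[OF s p, of x] filtered_module.split_Int[OF filtered[OF s] p, of x] by simp
    show "\<exists>x\<in>carrier (C s p). gr_proj A F s p x = y" if "y \<in> carrier (gr A F s p)" for y
      using q(2)[OF that] pc module_homD(1)[OF cmp_hom[OF s p(2) p]] by (metis AF_carrier)
  qed
qed

lemma C_free:
  assumes "s < 2" "1 \<le> p" "p \<le> c"
  shows "fg_free S (C s p)"
  by (rule fg_free_iso[OF gr_iso(4)[OF assms] C_module[OF assms]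
        module_iso_inverse[OF C_module[OF assms] gr_iso(1)[OF assms]] one_neq_zero])

lemma cmp_h_d:
  assumes p: "1 \<le> p" "p \<le> c" and x: "x \<in> F 1 p"
  shows "cmp 1 (h p (d x)) p \<ominus>\<^bsub>C 1 p\<^esub> f p \<odot>\<^bsub>C 1 p\<^esub> cmp 1 x p \<in> ideal_smult S (I (p - 1)) (C 1 p)"
proof -
  let ?g = "gr_proj A F 1 p"
  have s: "(1::nat) < 2" by simp
  note iso = gr_iso[OF s p]
  let ?k = "inv_into (carrier (C 1 p)) ?g"
  have k: "?k \<in> module_hom S (gr A F 1 p) (C 1 p)"
    using module_iso_inverse[OF C_module[OF s p] iso(1)] by (simp add: module_iso_def)
  have gC: "?g \<in> module_hom S (C 1 p) (gr A F 1 p)" and bij: "bij_betw ?g (carrier (C 1 p)) (carrier (gr A F 1 p))"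
    using iso(1) by (auto simp: module_iso_def)
  interpret CM: module S "C 1 p" by (rule C_module[OF s p])
  have hd: "h p (d x) \<in> F 1 p"
    using module_homD(1)[OF h_hom[OF p]] module_homD(1)[OF d_hom[OF p(2)]] x by simp
  have cc: "cmp 1 y p \<in> carrier (C 1 p)" if "y \<in> F 1 p" for y
    using module_homD(1)[OF cmp_hom[OF s p(2) p]] that by simp
  have fx: "f p \<odot>\<^bsub>C 1 p\<^esub> cmp 1 x p \<in> carrier (C 1 p)" using cc[OF x] f_closed[OF p] CM.smult_closed by blast
  let ?z = "cmp 1 (h p (d x)) p \<ominus>\<^bsub>C 1 p\<^esub> f p \<odot>\<^bsub>C 1 p\<^esub> cmp 1 x p"
  have z: "?z \<in> carrier (C 1 p)" using cc[OF hd] fx CM.M.minus_closed by blast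
  have "?g ?z = ?g (cmp 1 (h p (d x)) p) \<ominus>\<^bsub>gr A F 1 p\<^esub> f p \<odot>\<^bsub>gr A F 1 p\<^esub> ?g (cmp 1 x p)"
    using additive_diff[OF module_hom_additive[OF C_module[OF s p] iso(3) gC] cc[OF hd] fx]
      module_homD(3)[OF gC f_closed[OF p] cc[OF x]] by simp
  also have "\<dots> = ?g (h p (d x)) \<ominus>\<^bsub>gr A F 1 p\<^esub> f p \<odot>\<^bsub>gr A F 1 p\<^esub> ?g x"
    using iso(5)[OF hd] iso(5)[OF x] by simp
  also have "\<dots> \<in> ideal_smult S (I (p - 1)) (gr A F 1 p)"
    using hmf p x by (auto simp: higher_matrix_factorization_def)
  finally have "?k (?g ?z) \<in> ideal_smult S (I (p - 1)) (C 1 p)"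
    using p by (intro ideal_smult_hom[OF iso(3) C_module[OF s p] k] I_ideal) auto
  then show ?thesis using bij_betw_inv_into_left[OF bij z] by simp
qed

text \<open>If \<open>d x\<close> is in \<open>I(p-1) A\<^sub>0(p)\<close>, then \<open>h\<^sub>p d x\<close> is in \<open>I(p-1) A\<^sub>1(p)\<close>, and by condition (b) \<open>f\<^sub>p\<close> times the component \<open>b\<close> of
  \<open>x\<close> in \<open>B\<^sub>1(p)\<close> is in \<open>I(p-1) B\<^sub>1(p)\<close>. Regularity removes the factor \<open>f\<^sub>p\<close>, so \<open>x\<close> may be replaced by \<open>x - b\<close>.\<close>

lemma kernel_reduces:
  assumes p: "1 \<le> p" "p \<le> c" and x: "x \<in> F 1 p" and dx: "d x \<in> ideal_smult S (I (p - 1)) (AF 0 p)"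
  shows "\<exists>a\<in>F 1 (p - 1). x \<ominus>\<^bsub>A 1\<^esub> a \<in> ideal_smult S (I (p - 1)) (AF 1 p)
    \<and> d a \<in> ideal_smult S (I (p - 1)) (AF 0 (p - 1))"
proof -
  have s: "(1::nat) < 2" "(0::nat) < 2" by auto
  have p1: "p - 1 \<le> c" using p by simp
  note id = I_ideal[OF p1]
  interpret CM: module S "C 1 p" by (rule C_module[OF s(1) p])
  interpret A1: module S "A 1" by (rule A_module[OF s(1)])
  interpret A0: module S "A 0" by (rule A_module[OF s(2)])
  let ?b = "cmp 1 x p" and ?a = "x \<ominus>\<^bsub>A 1\<^esub> cmp 1 x p"
  have b: "?b \<in> carrier (C 1 p)" using module_homD(1)[OF cmp_hom[OF s(1) p(2) p], of x] x by simp
  have "h p (d x) \<in> ideal_smult S (I (p - 1)) (AF 1 p)"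
    by (rule ideal_smult_hom[OF AF_module[OF s(2) p(2)] AF_module[OF s(1) p(2)] h_hom[OF p] dx id])
  then have hd: "cmp 1 (h p (d x)) p \<in> ideal_smult S (I (p - 1)) (C 1 p)"
    by (rule ideal_smult_hom[OF AF_module[OF s(1) p(2)] C_module[OF s(1) p] cmp_hom[OF s(1) p(2) p] _ id])
  note D = ideal_smultD[OF C_module[OF s(1) p] id]
  let ?u = "cmp 1 (h p (d x)) p" and ?v = "f p \<odot>\<^bsub>C 1 p\<^esub> ?b"
  have v: "?v \<in> carrier (C 1 p)" using b f_closed[OF p] CM.smult_closed by blast
  have uc: "?u \<in> carrier (C 1 p)" using D(1)[OF hd] .
  have "?v = ?u \<ominus>\<^bsub>C 1 p\<^esub> (?u \<ominus>\<^bsub>C 1 p\<^esub> ?v)"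
    using CM.M.diff_diff[OF uc v] by simp
  also have "\<dots> \<in> ideal_smult S (I (p - 1)) (C 1 p)"
    using D(5)[OF hd cmp_h_d[OF p x]] .
  finally have bI: "?b \<in> ideal_smult S (I (p - 1)) (C 1 p)"
    by (rule fg_free_divide[OF C_free[OF s(1) p] id id f_closed[OF p] b _ f_nonzerodivisor[OF p]])
  have bI': "?b \<in> ideal_smult S (I (p - 1)) (AF 1 p)"
    by (rule ideal_smult_hom[OF C_module[OF s(1) p] AF_module[OF s(1) p(2)] C_incl[OF s(1) p] bI id])
  have a: "?a \<in> F 1 (p - 1)" using module_homD(1)[OF retract_hom(1)[OF s(1) p], of x] x by simp
  have ap: "?a \<in> F 1 p" using AF_mono[OF s(1) _ p(2) a] by simp
  have bp: "?b \<in> F 1 p" using C_in_AF[OF s(1) p] b by simp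
  have xA: "x \<in> carrier (A 1)" "?b \<in> carrier (A 1)" using submoduleD(1)[OF A_module[OF s(1)] AF_sub[OF s(1) p(2)]] x bp by auto
  have 1: "x \<ominus>\<^bsub>A 1\<^esub> ?a = ?b"
    by (rule A1.M.diff_diff[OF xA])
  have dadd: "additive_map (AF 1 p) (AF 0 p) d"
    by (rule module_hom_additive[OF AF_module[OF s(1) p(2)] AF_module[OF s(2) p(2)] d_hom[OF p(2)]])
  have "d x = d ?a \<oplus>\<^bsub>A 0\<^esub> d ?b"
    using additive_add[OF dadd, of ?a ?b] retract_hom(3)[OF s(1) p x] ap bp by simp
  moreover have db: "d ?b \<in> ideal_smult S (I (p - 1)) (AF 0 p)"
    by (rule ideal_smult_hom[OF AF_module[OF s(1) p(2)] AF_module[OF s(2) p(2)] d_hom[OF p(2)] bI' id])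
  moreover have da: "d ?a \<in> F 0 (p - 1)" using module_homD(1)[OF d_hom[OF p1], of ?a] a by simp
  note E = ideal_smultD[OF AF_module[OF s(2) p(2)] id]
  interpret P0: module S "AF 0 p" by (rule AF_module[OF s(2) p(2)])
  have dc: "d ?a \<in> carrier (AF 0 p)" "d ?b \<in> carrier (AF 0 p)" using AF_mono[OF s(2) _ p(2) da] E(1)[OF db] by auto
  have "d ?a = d x \<ominus>\<^bsub>AF 0 p\<^esub> d ?b"
    using P0.M.add_diff[OF dc] calculation by simp
  then have "d ?a \<in> ideal_smult S (I (p - 1)) (AF 0 p)" using E(5)[OF dx db] by simp
  from ideal_smult_hom[OF AF_module[OF s(2) p(2)] AF_module[OF s(2) p1] retract_hom(1)[OF s(2) p] this id]
  have "d ?a \<in> ideal_smult S (I (p - 1)) (AF 0 (p - 1))" using retract_hom(2)[OF s(2) p da] by simp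
  then show ?thesis using a bI' by (intro bexI[of _ ?a] conjI) (simp_all only: 1)
qed

section \<open>The modules of the construction as reductions of free modules\<close>

abbreviation RR :: "nat \<Rightarrow> 'a set ring" where "RR p \<equiv> S Quot I p"
abbreviation TM :: "nat \<Rightarrow> nat \<Rightarrow> ('a set, nat list \<Rightarrow> 'b set) module" where "TM \<equiv> T_module S f A B"
abbreviation UM :: "nat \<Rightarrow> nat \<Rightarrow> ('a set, nat list \<Rightarrow> 'b set) module" where "UM \<equiv> U_module S f A B"
abbreviation cl :: "nat \<Rightarrow> ('a, 'b, 'k1) module_scheme \<Rightarrow> 'b \<Rightarrow> 'b set" where "cl p \<equiv> residue S (I p)"

text \<open>Modules over \<open>S\<close> of which \<open>T\<^sub>n(p)\<close> and \<open>U\<^sub>n(p)\<close> are the reductions modulo \<open>I(p)\<close> and \<open>I(p-1)\<close>.\<close>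

definition Tm :: "nat \<Rightarrow> nat \<Rightarrow> ('a, nat list \<Rightarrow> 'b) module"
  where "Tm p n = direct_sum (T_index p n) (\<lambda>w. C (n mod 2) (p + 1 - length w))"

definition Um :: "nat \<Rightarrow> nat \<Rightarrow> ('a, nat list \<Rightarrow> 'b) module"
  where "Um p n = direct_sum (U_index p n) (\<lambda>w. C (n mod 2) (p - length w))"

definition redT :: "nat \<Rightarrow> nat \<Rightarrow> (nat list \<Rightarrow> 'b) \<Rightarrow> nat list \<Rightarrow> 'b set"
  where "redT p n x = (\<lambda>w\<in>T_index p n. cl p (C (n mod 2) (p + 1 - length w)) (x w))"

definition redU :: "nat \<Rightarrow> nat \<Rightarrow> (nat list \<Rightarrow> 'b) \<Rightarrow> nat list \<Rightarrow> 'b set"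
  where "redU p n x = (\<lambda>w\<in>U_index p n. cl (p - 1) (C (n mod 2) (p - length w)) (x w))"

lemma TC_module: "p \<le> c \<Longrightarrow> w \<in> T_index p n \<Longrightarrow> module S (C (n mod 2) (p + 1 - length w))"
  using T_index_range[of w p n] by (intro C_module) auto

lemma UC_module: "1 \<le> p \<Longrightarrow> p \<le> c \<Longrightarrow> w \<in> U_index p n \<Longrightarrow> module S (C (n mod 2) (p - length w))"
  using U_index_range[of p w n] by (intro C_module) auto

lemma TC_free: "p \<le> c \<Longrightarrow> w \<in> T_index p n \<Longrightarrow> fg_free S (C (n mod 2) (p + 1 - length w))"
  using T_index_range[of w p n] by (intro C_free) auto

lemma UC_free: "1 \<le> p \<Longrightarrow> p \<le> c \<Longrightarrow> w \<in> U_index p n \<Longrightarrow> fg_free S (C (n mod 2) (p - length w))"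
  using U_index_range[of p w n] by (intro C_free) auto

lemma Tm_module: "p \<le> c \<Longrightarrow> module S (Tm p n)"
  unfolding Tm_def by (rule direct_sum_module[OF S TC_module])

lemma Um_module: "1 \<le> p \<Longrightarrow> p \<le> c \<Longrightarrow> module S (Um p n)"
  unfolding Um_def by (rule direct_sum_module[OF S UC_module])

lemma Tm_free: "p \<le> c \<Longrightarrow> fg_free S (Tm p n)"
  unfolding Tm_def by (rule fg_free_direct_sum[OF S finite_T_index TC_free one_neq_zero])

lemma Um_free: "1 \<le> p \<Longrightarrow> p \<le> c \<Longrightarrow> fg_free S (Um p n)"
  unfolding Um_def by (rule fg_free_direct_sum[OF S finite_U_index UC_free one_neq_zero])

lemma redT: "p \<le> c \<Longrightarrow> reduction S (I p) (Tm p n) (TM p n) (redT p n)"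
  unfolding Tm_def redT_def T_module_def
  by (rule direct_sum_reduction[OF S I_ideal finite_T_index base_change_reduction[OF TC_module I_ideal]])

lemma redU: "1 \<le> p \<Longrightarrow> p \<le> c \<Longrightarrow> reduction S (I (p - 1)) (Um p n) (UM p n) (redU p n)"
  unfolding Um_def redU_def U_module_def
  by (rule direct_sum_reduction[OF S I_ideal finite_U_index base_change_reduction[OF UC_module I_ideal]]) auto

lemma TM_module: "p \<le> c \<Longrightarrow> module (RR p) (TM p n)"
  by (rule reduction.P[OF redT])

lemma UM_module: "1 \<le> p \<Longrightarrow> p \<le> c \<Longrightarrow> module (RR (p - 1)) (UM p n)"
  by (rule reduction.P[OF redU])

lemma TM_free: "p \<le> c \<Longrightarrow> fg_free (RR p) (TM p n)"
  by (rule reduction.fg_free_reduction[OF redT Tm_free I_proper])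

lemma UM_eq_TM: "1 \<le> p \<Longrightarrow> 2 \<le> n \<Longrightarrow> UM p n = TM (p - 1) n"
  by (simp add: U_module_def T_module_def U_index_ge2)

lemma RR_cring: "p \<le> c \<Longrightarrow> cring (RR p)"
  by (rule ideal.quotient_is_cring[OF I_ideal S])

definition a_elt :: "nat \<Rightarrow> 'a set" where "a_elt p = I (p - 1) +>\<^bsub>S\<^esub> f p"

lemma a_elt_closed: "1 \<le> p \<Longrightarrow> p \<le> c \<Longrightarrow> a_elt p \<in> carrier (RR (p - 1))"
  unfolding a_elt_def using f_closed[of p] reduction.scalar_closed[OF redU] by blast

text \<open>\<open>U\<^sub>n(p)\<close> is free over \<open>R(p-1)\<close>, where \<open>f\<^sub>p\<close> is a nonzerodivisor.\<close>

lemma UM_torsion_free: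
  assumes p: "1 \<le> p" "p \<le> c" and x: "x \<in> carrier (UM p n)" and ax: "a_elt p \<odot>\<^bsub>UM p n\<^esub> x = \<zero>\<^bsub>UM p n\<^esub>"
  shows "x = \<zero>\<^bsub>UM p n\<^esub>"
proof -
  interpret reduction S "I (p - 1)" "Um p n" "UM p n" "redU p n" by (rule redU[OF p])
  interpret M: module S "Um p n" by (rule M)
  obtain y where y: "y \<in> carrier (Um p n)" "redU p n y = x" using onto[OF x] by blast
  have "f p \<odot>\<^bsub>Um p n\<^esub> y \<in> ideal_smult S (I (p - 1)) (Um p n)"
    using kernel[of "f p \<odot>\<^bsub>Um p n\<^esub> y"] smult[OF f_closed[OF p] y(1)] ax y f_closed[OF p] by (simp add: a_elt_def)
  then have "y \<in> ideal_smult S (I (p - 1)) (Um p n)"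
    by (rule fg_free_divide[OF Um_free[OF p] I I f_closed[OF p] y(1) _ f_nonzerodivisor[OF p]])
  then show ?thesis using kernel[OF y(1)] y(2) by simp
qed

subsection \<open>Words as powers of the new variable followed by shorter words\<close>

text \<open>A family indexed by words is regrouped by the first letter \<open>i\<close>, the exponent of the new variable.\<close>

definition unT :: "nat \<Rightarrow> nat \<Rightarrow> (nat list \<Rightarrow> 'x) \<Rightarrow> nat \<Rightarrow> nat list \<Rightarrow> 'x"
  where "unT p n x = (\<lambda>i\<in>{i. 2 * i \<le> n}. \<lambda>w\<in>U_index p (n - 2 * i). x (i # w))"

abbreviation hatU :: "nat \<Rightarrow> nat \<Rightarrow> ('a set, nat \<Rightarrow> nat list \<Rightarrow> 'b set) module"
  where "hatU p n \<equiv> direct_sum {i. 2 * i \<le> n} (\<lambda>i. UM p (n - 2 * i))"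

definition redH :: "nat \<Rightarrow> nat \<Rightarrow> (nat list \<Rightarrow> 'b) \<Rightarrow> nat \<Rightarrow> nat list \<Rightarrow> 'b set"
  where "redH p n x = (\<lambda>i\<in>{i. 2 * i \<le> n}. redU p (n - 2 * i) (unT p n x i))"

lemma parity: "2 * i \<le> n \<Longrightarrow> (n - 2 * i) mod 2 = n mod (2::nat)"
  by (metis le_add_diff_inverse2 mod_mult_self2)

lemma unT_iso:
  assumes p: "1 \<le> p" "p \<le> c"
  shows "unT p n \<in> module_iso S (Tm p n) (direct_sum {i. 2 * i \<le> n} (\<lambda>i. Um p (n - 2 * i)))"
proof (rule module_isoI[OF Tm_module[OF p(2)] direct_sum_module[OF S Um_module[OF p]]])
  have memT: "x \<in> carrier (Tm p n) \<longleftrightarrow> x \<in> extensional (T_index p n) \<and> (\<forall>w\<in>T_index p n. x w \<in> B (n mod 2) (p + 1 - length w))" for x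
    by (auto simp: Tm_def direct_sum_simps PiE_iff)
  have len: "p + 1 - length w = p - length (tl w)" if "w \<in> T_index p n" for w
    using that by (cases w) (auto simp: T_index_eq)
  show "unT p n \<in> module_hom S (Tm p n) (direct_sum {i. 2 * i \<le> n} (\<lambda>i. Um p (n - 2 * i)))"
  proof (rule module_homI)
    fix x assume x: "x \<in> carrier (Tm p n)"
    have "x (i # w) \<in> B (n mod 2) (p - length w)" if "2 * i \<le> n" "w \<in> U_index p (n - 2 * i)" for i w
    proof -
      have "i # w \<in> T_index p n" using T_index_Cons[OF p(1)] that by blast
      then have "x (i # w) \<in> B (n mod 2) (p + 1 - length (i # w))" using x memT by blast
      then show ?thesis by simp
    qed
    then show "unT p n x \<in> carrier (direct_sum {i. 2 * i \<le> n} (\<lambda>i. Um p (n - 2 * i)))"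
      using parity[of _ n] by (auto simp: unT_def Um_def direct_sum_simps PiE_iff)
  qed (auto simp: unT_def Um_def Tm_def direct_sum_simps T_index_Cons[OF p(1)] parity intro!: restrict_ext)
  fix x assume x: "x \<in> carrier (Tm p n)" and z: "unT p n x = \<zero>\<^bsub>direct_sum {i. 2 * i \<le> n} (\<lambda>i. Um p (n - 2 * i))\<^esub>"
  have "x w = \<zero>\<^bsub>A (n mod 2)\<^esub>" if w: "w \<in> T_index p n" for w
  proof -
    note hd = T_index_hd_tl[OF p(1) w]
    have "unT p n x (hd w) (tl w) = \<zero>\<^bsub>A (n mod 2)\<^esub>"
      using hd unfolding z by (simp add: direct_sum_simps Um_def parity)
    then show ?thesis using hd by (simp add: unT_def)
  qed
  then show "x = \<zero>\<^bsub>Tm p n\<^esub>" using x by (auto simp: Tm_def direct_sum_simps PiE_iff extensional_def)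
next
  fix y assume y: "y \<in> carrier (direct_sum {i. 2 * i \<le> n} (\<lambda>i. Um p (n - 2 * i)))"
  have yB: "y i w \<in> B (n mod 2) (p - length w)" if "2 * i \<le> n" "w \<in> U_index p (n - 2 * i)" for i w
    using y that parity[of i n] by (auto simp: direct_sum_simps Um_def PiE_iff)
  let ?x = "\<lambda>w\<in>T_index p n. y (hd w) (tl w)"
  have "?x \<in> carrier (Tm p n)"
    unfolding Tm_def direct_sum_simps
  proof (rule restrict_PiE_iff[THEN iffD2], rule ballI)
    fix w assume w: "w \<in> T_index p n"
    have "p + 1 - length w = p - length (tl w)" using w by (cases w) (auto simp: T_index_eq)
    then show "y (hd w) (tl w) \<in> carrier (C (n mod 2) (p + 1 - length w))"
      using yB[of "hd w" "tl w"] T_index_hd_tl[OF p(1) w] by (simp only: AF_carrier)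
  qed
  moreover have "unT p n ?x = y"
    using y T_index_Cons[OF p(1), of _ _ n]
    by (auto simp: unT_def direct_sum_simps Um_def PiE_iff extensional_def fun_eq_iff restrict_def)
  ultimately show "\<exists>x\<in>carrier (Tm p n). unT p n x = y" by blast
qed

lemma redH: "1 \<le> p \<Longrightarrow> p \<le> c \<Longrightarrow> reduction S (I (p - 1)) (Tm p n) (hatU p n) (redH p n)"
  unfolding redH_def
  by (rule reduction_iso[OF direct_sum_reduction[OF S I_ideal _ redU] Tm_module unT_iso]) auto

text \<open>The map \<open>\<Oplus>\<^sub>i y\<^sup>(\<^sup>i\<^sup>) U\<^sub>n\<^sub>-\<^sub>2\<^sub>i(p) \<rightarrow> T\<^sub>n(p)\<close> that divides out \<open>f\<^sub>p\<close>.\<close>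

definition Y :: "nat \<Rightarrow> nat \<Rightarrow> (nat \<Rightarrow> nat list \<Rightarrow> 'b set) \<Rightarrow> nat list \<Rightarrow> 'b set"
  where "Y p n z = (\<lambda>w\<in>T_index p n. base_change_map S (I p) (C (n mod 2) (p + 1 - length w)) id (z (hd w) (tl w)))"

lemma reduce_further:
  assumes "1 \<le> p" "p \<le> c" "s < 2" "1 \<le> q" "q \<le> c" "x \<in> B s q"
  shows "base_change_map S (I p) (C s q) id (cl (p - 1) (C s q) x) = cl p (C s q) x"
  using base_change_map_residue[OF C_module[OF assms(3-5)] C_module[OF assms(3-5)], of "I p" "I (p - 1)" id x]
    I_ideal[of p] I_ideal[of "p - 1"] I_mono[of "p - 1" p] assms by (auto simp: module_hom_def)

lemma Y_redH:
  assumes p: "1 \<le> p" "p \<le> c" and x: "x \<in> carrier (Tm p n)"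
  shows "Y p n (redH p n x) = redT p n x"
  unfolding Y_def redT_def
proof (rule restrict_ext)
  fix w assume w: "w \<in> T_index p n"
  note hd = T_index_hd_tl[OF p(1) w] and rg = T_index_range[OF w]
  have len: "p + 1 - length w = p - length (tl w)" using w by (cases w) (auto simp: T_index_eq)
  have "x w \<in> B (n mod 2) (p + 1 - length w)" using x w by (auto simp: Tm_def direct_sum_simps PiE_iff)
  from reduce_further[OF p _ _ _ this]
  have "base_change_map S (I p) (C (n mod 2) (p + 1 - length w)) id (cl (p - 1) (C (n mod 2) (p + 1 - length w)) (x w))
      = cl p (C (n mod 2) (p + 1 - length w)) (x w)"
    using rg p by auto
  moreover have "redH p n x (hd w) (tl w) = cl (p - 1) (C (n mod 2) (p + 1 - length w)) (x w)"
    unfolding len using hd by (simp add: redH_def redU_def unT_def parity)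
  ultimately show "base_change_map S (I p) (C (n mod 2) (p + 1 - length w)) id (redH p n x (hd w) (tl w))
      = cl p (C (n mod 2) (p + 1 - length w)) (x w)"
    by (simp only:)
qed

lemma Y_additive:
  assumes p: "1 \<le> p" "p \<le> c"
  shows "additive_map (hatU p n) (TM p n) (Y p n)"
proof -
  interpret H: reduction S "I (p - 1)" "Tm p n" "hatU p n" "redH p n" by (rule redH[OF p])
  interpret T: reduction S "I p" "Tm p n" "TM p n" "redT p n" by (rule redT[OF p(2)])
  interpret M: module S "Tm p n" by (rule T.M)
  note Y = Y_redH[OF p]
  show ?thesis
    unfolding additive_map_def
  proof (intro conjI ballI)
    show "abelian_group (hatU p n)" "abelian_group (TM p n)" using H.P T.P by (auto simp: module_def)
    show "Y p n \<in> carrier (hatU p n) \<rightarrow> carrier (TM p n)"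
    proof
      fix z assume "z \<in> carrier (hatU p n)"
      then obtain x where "x \<in> carrier (Tm p n)" "redH p n x = z" using H.onto by blast
      then show "Y p n z \<in> carrier (TM p n)" using Y[of x n] T.closed[of x] by simp
    qed
    fix z z' assume "z \<in> carrier (hatU p n)" "z' \<in> carrier (hatU p n)"
    then obtain x x' where x: "x \<in> carrier (Tm p n)" "z = redH p n x" and x': "x' \<in> carrier (Tm p n)" "z' = redH p n x'"
      using H.onto by metis
    have "Y p n (z \<oplus>\<^bsub>hatU p n\<^esub> z') = Y p n (redH p n (x \<oplus>\<^bsub>Tm p n\<^esub> x'))" using x x' by (simp only: H.add)
    also have "\<dots> = Y p n z \<oplus>\<^bsub>TM p n\<^esub> Y p n z'" using x x' by (simp only: Y M.M.a_closed T.add)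
    finally show "Y p n (z \<oplus>\<^bsub>hatU p n\<^esub> z') = Y p n z \<oplus>\<^bsub>TM p n\<^esub> Y p n z'" .
  qed
qed

lemma Y_onto:
  assumes p: "1 \<le> p" "p \<le> c" and t: "t \<in> carrier (TM p n)"
  shows "\<exists>z\<in>carrier (hatU p n). Y p n z = t"
  using reduction.onto[OF redT[OF p(2)] t] Y_redH[OF p] reduction.closed[OF redH[OF p]] by metis

text \<open>Both sides are reductions of \<open>Tm p n\<close>, modulo \<open>I(p-1)\<close> and modulo \<open>I(p) = I(p-1) + f\<^sub>p S\<close>.\<close>

lemma Y_zero_iff:
  assumes p: "1 \<le> p" "p \<le> c" and z: "z \<in> carrier (hatU p n)"
  shows "Y p n z = \<zero>\<^bsub>TM p n\<^esub> \<longleftrightarrow> (\<exists>u\<in>carrier (hatU p n). z = a_elt p \<odot>\<^bsub>hatU p n\<^esub> u)"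
proof -
  interpret H: reduction S "I (p - 1)" "Tm p n" "hatU p n" "redH p n" by (rule redH[OF p])
  interpret T: reduction S "I p" "Tm p n" "TM p n" "redT p n" by (rule redT[OF p(2)])
  interpret M: module S "Tm p n" by (rule T.M)
  note fp = f_closed[OF p]
  obtain x where x: "x \<in> carrier (Tm p n)" "redH p n x = z" using H.onto[OF z] by blast
  have Yz: "Y p n z = \<zero>\<^bsub>TM p n\<^esub> \<longleftrightarrow> x \<in> ideal_smult S (I p) (Tm p n)"
    using Y_redH[OF p x(1)] T.kernel[OF x(1)] x(2) by simp
  show ?thesis
  proof
    assume "Y p n z = \<zero>\<^bsub>TM p n\<^esub>"
    then obtain y where y: "y \<in> carrier (Tm p n)" "x \<ominus>\<^bsub>Tm p n\<^esub> f p \<odot>\<^bsub>Tm p n\<^esub> y \<in> ideal_smult S (I (p - 1)) (Tm p n)"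
      using Yz ideal_smult_step[OF p T.M] by blast
    have fy: "f p \<odot>\<^bsub>Tm p n\<^esub> y \<in> carrier (Tm p n)" using fp y(1) by simp
    have "z = redH p n (f p \<odot>\<^bsub>Tm p n\<^esub> y)" using H.eq_iff[OF x(1) fy] y(2) x(2) by blast
    also have "\<dots> = a_elt p \<odot>\<^bsub>hatU p n\<^esub> redH p n y" unfolding a_elt_def by (rule H.smult[OF fp y(1)])
    finally show "\<exists>u\<in>carrier (hatU p n). z = a_elt p \<odot>\<^bsub>hatU p n\<^esub> u" using H.closed[OF y(1)] by blast
  next
    assume "\<exists>u\<in>carrier (hatU p n). z = a_elt p \<odot>\<^bsub>hatU p n\<^esub> u"
    then obtain y where y: "y \<in> carrier (Tm p n)" "z = a_elt p \<odot>\<^bsub>hatU p n\<^esub> redH p n y" using H.onto by metis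
    then have "z = redH p n (f p \<odot>\<^bsub>Tm p n\<^esub> y)" unfolding a_elt_def using H.smult[OF fp y(1)] by simp
    then have "Y p n z = redT p n (f p \<odot>\<^bsub>Tm p n\<^esub> y)" using Y_redH[OF p] fp y(1) by simp
    also have "\<dots> = \<zero>\<^bsub>TM p n\<^esub>"
      using T.kernel[of "f p \<odot>\<^bsub>Tm p n\<^esub> y"] ideal_smult_gen[OF T.M f_in_I[OF p] y(1)] fp y(1) by simp
    finally show "Y p n z = \<zero>\<^bsub>TM p n\<^esub>" .
  qed
qed

lemma Y_inj:
  assumes p: "1 \<le> p" "p \<le> c" and i: "2 * i \<le> n" and g: "g \<in> carrier (UM p (n - 2 * i))"
  shows "Y p n (ds_inj {i. 2 * i \<le> n} (\<lambda>i. UM p (n - 2 * i)) i g) = y_mult S f A B p i (n - 2 * i) g"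
proof -
  have n: "n - 2 * i + 2 * i = n" using i by simp
  show ?thesis
    unfolding Y_def y_mult_def n Let_def
  proof (rule restrict_ext)
    fix w assume w: "w \<in> T_index p n"
    note hd = T_index_hd_tl[OF p(1) w] and rg = T_index_range[OF w]
    have len: "p + 1 - length w = p - length (tl w)" using w by (cases w) (auto simp: T_index_eq)
    let ?C = "C (n mod 2) (p + 1 - length w)"
    have m: "module S ?C" by (rule TC_module[OF p(2) w])
    interpret module S ?C by (rule m)
    have p1: "p - 1 \<le> c" using p by simp
    have "\<zero>\<^bsub>UM p (n - 2 * hd w)\<^esub> (tl w) = cl (p - 1) ?C \<zero>\<^bsub>?C\<^esub>"
      using hd by (simp only: U_module_def direct_sum_simps restrict_apply parity len if_True
          residue_zero[OF m[unfolded len] I_ideal[OF p1]])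
    then have "base_change_map S (I p) ?C id (\<zero>\<^bsub>UM p (n - 2 * hd w)\<^esub> (tl w)) = cl p ?C \<zero>\<^bsub>?C\<^esub>"
      using reduce_further[OF p, of "n mod 2" "p + 1 - length w" "\<zero>\<^bsub>?C\<^esub>"] rg p M.zero_closed by simp
    also have "\<dots> = \<zero>\<^bsub>base_change S (I p) ?C\<^esub>" using residue_zero[OF m I_ideal[OF p(2)]] by simp
    finally show "base_change_map S (I p) ?C id (ds_inj {i. 2 * i \<le> n} (\<lambda>i. UM p (n - 2 * i)) i g (hd w) (tl w))
      = (if hd w = i then base_change_map S (I p) (filt A B ((n - 2 * i) mod 2) (p + 1 - length w)) id (g (tl w))
         else \<zero>\<^bsub>base_change S (I p) (filt A B ((n - 2 * i) mod 2) (p + 1 - length w))\<^esub>)"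
      using hd by (simp add: ds_inj_def parity[OF i])
  qed
qed

subsection \<open>The identifications in degrees 0 and 1\<close>

abbreviation Uid :: "nat \<Rightarrow> nat \<Rightarrow> 'b set \<Rightarrow> nat list \<Rightarrow> 'b set" where "Uid \<equiv> U_ident S f c A B"
abbreviation Tid :: "nat \<Rightarrow> nat \<Rightarrow> 'b set \<Rightarrow> nat list \<Rightarrow> 'b set" where "Tid \<equiv> T_ident S f c A B"
abbreviation UD where "UD \<equiv> U_diff S f c A F d B"

lemma base_change_map_cmp:
  assumes "s < 2" "p \<le> c" "r \<le> c" "1 \<le> q" "q \<le> c" "x \<in> F s p"
  shows "base_change_map S (I r) (C s q) (\<lambda>x. cmp s x q) (cl r (AF s p) x) = cl r (C s q) (cmp s x q)"
  using base_change_map_residue[OF AF_module[OF assms(1,2)] C_module[OF assms(1,4,5)] I_ideal[OF assms(3)]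
      I_ideal[OF assms(3)] subset_refl cmp_hom[OF assms(1,2,4,5)]] assms(6) by simp

lemma Uid_class:
  assumes "1 \<le> p" "p \<le> c" "s < 2" "x \<in> F s p"
  shows "Uid p s (cl (p - 1) (AF s p) x) = redU p s (\<lambda>w\<in>U_index p s. cmp s x (p - length w))"
  unfolding U_ident_def redU_def
proof (rule restrict_ext)
  fix w assume w: "w \<in> U_index p s"
  then have "base_change_map S (I (p - 1)) (C s (p - length w)) (\<lambda>x. cmp s x (p - length w)) (cl (p - 1) (AF s p) x)
      = cl (p - 1) (C s (p - length w)) (cmp s x (p - length w))"
    using U_index_range[OF assms(1) w] assms by (intro base_change_map_cmp) auto
  then show "base_change_map S (I (p - 1)) (C s (p - length w)) (\<lambda>x. cmp s x (p - length w)) (cl (p - 1) (AF s p) x)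
      = cl (p - 1) (C (s mod 2) (p - length w)) (restrict (\<lambda>w. cmp s x (p - length w)) (U_index p s) w)"
    using w assms by (simp only: mod_less restrict_apply if_True)
qed

lemma Tid_class:
  assumes "p \<le> c" "s < 2" "x \<in> F s p"
  shows "Tid p s (cl p (AF s p) x) = redT p s (\<lambda>w\<in>T_index p s. cmp s x (p + 1 - length w))"
  unfolding T_ident_def redT_def
proof (rule restrict_ext)
  fix w assume w: "w \<in> T_index p s"
  then have "base_change_map S (I p) (C s (p + 1 - length w)) (\<lambda>x. cmp s x (p + 1 - length w)) (cl p (AF s p) x)
      = cl p (C s (p + 1 - length w)) (cmp s x (p + 1 - length w))"
    using T_index_range[OF w] assms by (intro base_change_map_cmp) auto
  then show "base_change_map S (I p) (C s (p + 1 - length w)) (\<lambda>x. cmp s x (p + 1 - length w)) (cl p (AF s p) x)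
      = cl p (C (s mod 2) (p + 1 - length w)) (restrict (\<lambda>w. cmp s x (p + 1 - length w)) (T_index p s) w)"
    using w assms by (simp only: mod_less restrict_apply if_True)
qed

lemma Uid_iso:
  assumes "1 \<le> p" "p \<le> c" "s < 2"
  shows "Uid p s \<in> module_iso (RR (p - 1)) (base_change S (I (p - 1)) (AF s p)) (UM p s)"
proof (rule reduction_induced_iso[OF base_change_reduction[OF AF_module[OF assms(3,2)] I_ideal] redU[OF assms(1,2)]])
  show "(\<lambda>x. \<lambda>w\<in>U_index p s. cmp s x (p - length w)) \<in> module_iso S (AF s p) (Um p s)"
    using ident_iso[OF assms(3,2) U_index_bij[OF assms(1,3)]] assms(3) by (simp add: Um_def)
qed (use assms Uid_class in auto)

lemma Tid_iso:
  assumes "p \<le> c" "s < 2"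
  shows "Tid p s \<in> module_iso (RR p) (base_change S (I p) (AF s p)) (TM p s)"
proof (rule reduction_induced_iso[OF base_change_reduction[OF AF_module[OF assms(2,1)] I_ideal] redT[OF assms(1)]])
  show "(\<lambda>x. \<lambda>w\<in>T_index p s. cmp s x (p + 1 - length w)) \<in> module_iso S (AF s p) (Tm p s)"
    using ident_iso[OF assms(2,1) T_index_bij[OF assms(2)]] assms(2) by (simp add: Tm_def)
qed (use assms Tid_class in auto)

lemma Uid_onto:
  assumes "1 \<le> p" "p \<le> c" "s < 2" "u \<in> carrier (UM p s)"
  shows "\<exists>x\<in>F s p. u = Uid p s (cl (p - 1) (AF s p) x)"
proof -
  have "carrier (base_change S (I (p - 1)) (AF s p)) = cl (p - 1) (AF s p) ` F s p"
    using residue_carrier[OF AF_module[OF assms(3,2)] I_ideal[of "p - 1"]] assms by simp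
  then show ?thesis using Uid_iso[OF assms(1-3)] assms(4) by (fastforce simp: module_iso_def bij_betw_def)
qed

lemma Tid_onto:
  assumes "p \<le> c" "s < 2" "u \<in> carrier (TM p s)"
  shows "\<exists>x\<in>F s p. u = Tid p s (cl p (AF s p) x)"
proof -
  have "carrier (base_change S (I p) (AF s p)) = cl p (AF s p) ` F s p"
    using residue_carrier[OF AF_module[OF assms(2,1)] I_ideal[of p]] assms by simp
  then show ?thesis using Tid_iso[OF assms(1,2)] assms(3) by (fastforce simp: module_iso_def bij_betw_def)
qed

lemma Uid_zero_iff:
  assumes "1 \<le> p" "p \<le> c" "s < 2" "x \<in> F s p"
  shows "Uid p s (cl (p - 1) (AF s p) x) = \<zero>\<^bsub>UM p s\<^esub> \<longleftrightarrow> x \<in> ideal_smult S (I (p - 1)) (AF s p)"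
proof -
  have p1: "p - 1 \<le> c" using assms by simp
  interpret Q: reduction S "I (p - 1)" "AF s p" "base_change S (I (p - 1)) (AF s p)" "cl (p - 1) (AF s p)"
    by (rule base_change_reduction[OF AF_module[OF assms(3,2)] I_ideal[OF p1]])
  interpret P: module "RR (p - 1)" "base_change S (I (p - 1)) (AF s p)" by (rule Q.P)
  have iso: "Uid p s \<in> module_hom (RR (p - 1)) (base_change S (I (p - 1)) (AF s p)) (UM p s)"
    "inj_on (Uid p s) (carrier (base_change S (I (p - 1)) (AF s p)))"
    using Uid_iso[OF assms(1-3)] by (auto simp: module_iso_def bij_betw_def)
  have z: "Uid p s \<zero>\<^bsub>base_change S (I (p - 1)) (AF s p)\<^esub> = \<zero>\<^bsub>UM p s\<^esub>"
    by (rule additive_zero[OF module_hom_additive[OF Q.P UM_module[OF assms(1,2)] iso(1)]])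
  have x: "x \<in> carrier (AF s p)" using assms by simp
  show ?thesis using inj_on_eq_iff[OF iso(2) Q.closed[OF x] P.M.zero_closed] z Q.kernel[OF x] by simp
qed

lemma Tid_zero:
  assumes "p \<le> c" "s < 2" "x \<in> F s p" "x \<in> ideal_smult S (I p) (AF s p)"
  shows "Tid p s (cl p (AF s p) x) = \<zero>\<^bsub>TM p s\<^esub>"
proof -
  interpret Q: reduction S "I p" "AF s p" "base_change S (I p) (AF s p)" "cl p (AF s p)"
    by (rule base_change_reduction[OF AF_module[OF assms(2,1)] I_ideal[OF assms(1)]])
  have iso: "Tid p s \<in> module_hom (RR p) (base_change S (I p) (AF s p)) (TM p s)"
    using Tid_iso[OF assms(1,2)] by (simp add: module_iso_def)
  have "cl p (AF s p) x = \<zero>\<^bsub>base_change S (I p) (AF s p)\<^esub>" using Q.kernel assms by simp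
  then show ?thesis using additive_zero[OF module_hom_additive[OF Q.P TM_module[OF assms(1)] iso]] by simp
qed

subsection \<open>The differential of the mapping cone\<close>

text \<open>The inclusion of the subcomplex \<open>T(p-1)\<close> into the cone \<open>U(p)\<close>.\<close>

definition cone_incl :: "nat \<Rightarrow> nat \<Rightarrow> (nat list \<Rightarrow> 'b set) \<Rightarrow> nat list \<Rightarrow> 'b set"
  where "cone_incl p m t =
    (\<lambda>w\<in>U_index p m. if w = [] then \<zero>\<^bsub>base_change S (I (p - 1)) (C (m mod 2) p)\<^esub> else t w)"

lemma T_sub_U: "1 \<le> p \<Longrightarrow> w \<in> U_index p m \<Longrightarrow> w \<noteq> [] \<longleftrightarrow> w \<in> T_index (p - 1) m"
  by (auto simp: T_index_eq U_index_eq)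

lemma T_in_U: "1 \<le> p \<Longrightarrow> w \<in> T_index (p - 1) m \<Longrightarrow> w \<in> U_index p m \<and> w \<noteq> []"
  by (auto simp: T_index_eq U_index_eq)

lemma TM_mem: "t \<in> carrier (TM p m) \<longleftrightarrow> t \<in> extensional (T_index p m) \<and>
    (\<forall>w\<in>T_index p m. t w \<in> carrier (base_change S (I p) (C (m mod 2) (p + 1 - length w))))"
  by (auto simp: T_module_def direct_sum_simps PiE_iff)

lemma TM_zero_apply: "w \<in> T_index p m \<Longrightarrow> \<zero>\<^bsub>TM p m\<^esub> w = \<zero>\<^bsub>base_change S (I p) (C (m mod 2) (p + 1 - length w))\<^esub>"
  by (simp add: T_module_def direct_sum_simps)

lemma UM_zero_apply: "w \<in> U_index p m \<Longrightarrow> \<zero>\<^bsub>UM p m\<^esub> w = \<zero>\<^bsub>base_change S (I (p - 1)) (C (m mod 2) (p - length w))\<^esub>"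
  by (simp add: U_module_def direct_sum_simps)

lemma cone_incl_zero: "1 \<le> p \<Longrightarrow> cone_incl p m \<zero>\<^bsub>TM (p - 1) m\<^esub> = \<zero>\<^bsub>UM p m\<^esub>"
  unfolding cone_incl_def U_module_def direct_sum_simps
proof (rule restrict_ext)
  fix w assume "1 \<le> p" "w \<in> U_index p m"
  then show "(if w = [] then \<zero>\<^bsub>base_change S (I (p - 1)) (C (m mod 2) p)\<^esub> else \<zero>\<^bsub>TM (p - 1) m\<^esub> w)
      = \<zero>\<^bsub>base_change S (I (p - 1)) (C (m mod 2) (p - length w))\<^esub>"
    using TM_zero_apply[of w "p - 1" m] T_sub_U[of p w m] by (cases "w = []") auto
qed

lemma cone_incl_inj:
  assumes "1 \<le> p" "t \<in> carrier (TM (p - 1) m)" "cone_incl p m t = \<zero>\<^bsub>UM p m\<^esub>" "p \<le> c"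
  shows "t = \<zero>\<^bsub>TM (p - 1) m\<^esub>"
proof -
  have "t w = \<zero>\<^bsub>TM (p - 1) m\<^esub> w" if w: "w \<in> T_index (p - 1) m" for w
  proof -
    have "cone_incl p m t w = \<zero>\<^bsub>UM p m\<^esub> w" using assms(3) by simp
    then show ?thesis
      using T_in_U[OF assms(1) w] TM_zero_apply[OF w] UM_zero_apply[of w p m] assms(1) by (simp add: cone_incl_def)
  qed
  moreover have "\<zero>\<^bsub>TM (p - 1) m\<^esub> \<in> extensional (T_index (p - 1) m)" by (simp add: T_module_def direct_sum_simps)
  ultimately show ?thesis using assms(2) by (auto simp: TM_mem intro: extensionalityI)
qed

lemma cone_incl_ge2: "1 \<le> p \<Longrightarrow> 2 \<le> m \<Longrightarrow> t \<in> carrier (TM (p - 1) m) \<Longrightarrow> cone_incl p m t = t"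
  using U_index_ge2[of p m] U_index_Nil_iff[of p m]
  by (intro extensionalityI[of _ "U_index p m"]) (auto simp: cone_incl_def TM_mem)

lemma cone_incl_Tid:
  assumes p: "1 \<le> p" "p \<le> c" and s: "s < 2" and a: "a \<in> F s (p - 1)"
  shows "cone_incl p s (Tid (p - 1) s (cl (p - 1) (AF s (p - 1)) a)) = Uid p s (cl (p - 1) (AF s p) a)"
proof -
  have p1: "p - 1 \<le> c" using p by simp
  have ap: "a \<in> F s p" using AF_mono[OF s _ p(2) a] by simp
  show ?thesis
    unfolding Uid_class[OF p s ap] Tid_class[OF p1 s a] cone_incl_def redU_def
  proof (rule restrict_ext)
    fix w assume w: "w \<in> U_index p s"
    show "(if w = [] then \<zero>\<^bsub>base_change S (I (p - 1)) (C (s mod 2) p)\<^esub>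
        else redT (p - 1) s (\<lambda>w\<in>T_index (p - 1) s. cmp s a (p - 1 + 1 - length w)) w)
      = cl (p - 1) (C (s mod 2) (p - length w)) ((\<lambda>w\<in>U_index p s. cmp s a (p - length w)) w)"
    proof (cases "w = []")
      case True
      then show ?thesis using w p s cmp_vanish[OF s p1 a, of p] residue_zero[OF C_module[OF s p] I_ideal[OF p1]] by simp
    next
      case False
      then have "w \<in> T_index (p - 1) s" using T_sub_U[OF p(1) w] by blast
      then show ?thesis using False w p by (simp add: redT_def)
    qed
  qed
qed

text \<open>Exactness is only claimed in positive degrees: by the last clause the cokernel of \<open>\<delta> 1\<close> is that of \<open>R(p) \<otimes> d\<^sub>p\<close>,
  which is how the augmentation to \<open>M(p)\<close> will arise.\<close>

definition resolves :: "nat \<Rightarrow> (nat \<Rightarrow> (nat list \<Rightarrow> 'b set) \<Rightarrow> nat list \<Rightarrow> 'b set) \<Rightarrow> bool"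
  where "resolves p \<delta> \<longleftrightarrow>
    (\<forall>n\<ge>1. \<delta> n \<in> module_hom (RR p) (TM p n) (TM p (n - 1))) \<and>
    (\<forall>n\<ge>1. \<forall>x\<in>carrier (TM p (n + 1)). \<delta> n (\<delta> (n + 1) x) = \<zero>\<^bsub>TM p (n - 1)\<^esub>) \<and>
    (\<forall>n\<ge>1. \<forall>x\<in>carrier (TM p n). \<delta> n x = \<zero>\<^bsub>TM p (n - 1)\<^esub> \<longrightarrow> (\<exists>y\<in>carrier (TM p (n + 1)). \<delta> (n + 1) y = x)) \<and>
    (\<forall>x\<in>F 1 p. \<delta> 1 (Tid p 1 (cl p (AF 1 p) x)) = Tid p 0 (cl p (AF 0 p) (d x)))"

lemma psi_eq:
  assumes p: "1 \<le> p" "p \<le> c" and x: "x \<in> F 1 p"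
  shows "psi c A d B p x = d x \<ominus>\<^bsub>A 0\<^esub> cmp 0 (d x) p"
proof -
  have s: "(0::nat) < 2" by simp
  have p1: "p - 1 \<le> c" using p by simp
  interpret A0: module S "A 0" by (rule A_module[OF s])
  note ret = retract_hom
  interpret filtered_module S "A 0" "F 0" "B 0" c by (rule filtered[OF s])
  let ?y = "d x \<ominus>\<^bsub>A 0\<^esub> cmp 0 (d x) p"
  have dx: "d x \<in> F 0 p" using module_homD(1)[OF d_hom[OF p(2)]] x by simp
  have y: "?y \<in> F 0 (p - 1)" using module_homD(1)[OF ret(1)[OF s p], of "d x"] dx by simp
  have yp: "?y \<in> F 0 p" using AF_mono[OF s _ p(2) y] by simp
  have cF: "cmp 0 (d x) p \<in> B 0 p" using module_homD(1)[OF cmp_hom[OF s p(2) p], of "d x"] dx by simp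
  have "cmp 0 ?y q = cmp 0 (d x) q" if q: "q \<in> {1..p - 1}" for q
  proof -
    have q': "1 \<le> q" "q \<le> c" "q \<noteq> p" using q p by auto
    interpret Cq: module S "C 0 q" by (rule C_module[OF s q'(1,2)])
    have add: "additive_map (AF 0 p) (C 0 q) (\<lambda>x. cmp 0 x q)"
      by (rule module_hom_additive[OF AF_module[OF s p(2)] C_module[OF s q'(1,2)] cmp_hom[OF s p(2) q'(1,2)]])
    have "cmp 0 (d x) q = cmp 0 ?y q \<oplus>\<^bsub>A 0\<^esub> cmp 0 (cmp 0 (d x) p) q"
      using additive_add[OF add, of ?y "cmp 0 (d x) p"] yp C_in_AF[OF s p cF] ret(3)[OF s p dx] by simp
    moreover have "cmp 0 (cmp 0 (d x) p) q = \<zero>\<^bsub>A 0\<^esub>" using cmp_in_C[OF s p cF q'(1,2)] q'(3) by simp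
    moreover have "cmp 0 ?y q \<in> carrier (A 0)"
      using additive_closed[OF add, of ?y] yp BD(1)[OF q'(1,2)] by simp
    ultimately show ?thesis by simp
  qed
  then have "psi c A d B p x = (\<Oplus>\<^bsub>A 0\<^esub>q\<in>{1..p - 1}. cmp 0 ?y q)"
    unfolding psi_def using component_eq[OF s] FD(1)[OF p1 y] FD(1)[OF p(2) dx] comp_closed p1
    by (intro A0.finsum_cong') auto
  also have "\<dots> = ?y" using comp_sum_F[OF p1 y] component_eq[OF s] by simp
  finally show ?thesis .
qed

context
  fixes p and \<delta>' :: "nat \<Rightarrow> (nat list \<Rightarrow> 'b set) \<Rightarrow> nat list \<Rightarrow> 'b set"
  assumes p: "1 \<le> p" "p \<le> c" and res: "resolves (p - 1) \<delta>'"
begin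

lemma p1: "p - 1 \<le> c" using p by simp

lemma U_diff_ge2:
  assumes "2 \<le> n" "u \<in> carrier (UM p n)"
  shows "UD p \<delta>' n u = cone_incl p (n - 1) (\<delta>' n u)" and "\<delta>' n u \<in> carrier (TM (p - 1) (n - 1))"
proof -
  have u: "u \<in> carrier (TM (p - 1) n)" using assms p UM_eq_TM by simp
  then have "restrict u (T_index (p - 1) n) = u" by (simp add: TM_mem extensional_restrict)
  then show "UD p \<delta>' n u = cone_incl p (n - 1) (\<delta>' n u)"
    using assms(1) by (simp add: U_diff_def cone_incl_def Let_def del: One_nat_def)
  have "\<delta>' n \<in> module_hom (RR (p - 1)) (TM (p - 1) n) (TM (p - 1) (n - 1))"
    using res assms(1) by (simp add: resolves_def)
  from module_homD(1)[OF this u] show "\<delta>' n u \<in> carrier (TM (p - 1) (n - 1))" .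
qed

text \<open>For \<open>x = a + b\<close> with \<open>a\<close> in \<open>A\<^sub>1(p-1)\<close> and \<open>b\<close> in \<open>B\<^sub>1(p)\<close>, the cone differential is \<open>d a + \<psi>\<^sub>p b\<close> in \<open>A\<^sub>0(p-1)\<close> and
  \<open>b\<^sub>p b\<close> in \<open>B\<^sub>0(p)\<close>. These are the components of \<open>d x\<close>, as \<open>d a\<close> has no component in \<open>B\<^sub>0(p)\<close>.\<close>

lemma U_diff_1:
  assumes x: "x \<in> F 1 p"
  shows "UD p \<delta>' 1 (Uid p 1 (cl (p - 1) (AF 1 p) x)) = Uid p 0 (cl (p - 1) (AF 0 p) (d x))"
proof -
  have s: "(1::nat) < 2" "(0::nat) < 2" by auto
  note id = I_ideal[OF p1]
  let ?b = "cmp 1 x p" and ?a = "x \<ominus>\<^bsub>A 1\<^esub> cmp 1 x p"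
  let ?u = "Uid p 1 (cl (p - 1) (AF 1 p) x)"
  have b: "?b \<in> B 1 p" using module_homD(1)[OF cmp_hom[OF s(1) p(2) p], of x] x by simp
  have bF: "?b \<in> F 1 p" using C_in_AF[OF s(1) p b] .
  have a: "?a \<in> F 1 (p - 1)" using module_homD(1)[OF retract_hom(1)[OF s(1) p], of x] x by simp
  have aF: "?a \<in> F 1 p" using AF_mono[OF s(1) _ p(2) a] by simp
  have dadd: "additive_map (AF 1 p) (AF 0 p) d"
    by (rule module_hom_additive[OF AF_module[OF s(1) p(2)] AF_module[OF s(2) p(2)] d_hom[OF p(2)]])
  have dxF: "d x \<in> F 0 p" "d ?b \<in> F 0 p" "d ?a \<in> F 0 p"
    using additive_closed[OF dadd] x bF aF by auto
  have da: "d ?a \<in> F 0 (p - 1)" using module_homD(1)[OF d_hom[OF p1], of ?a] a by simp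
  have dx: "d x = d ?a \<oplus>\<^bsub>A 0\<^esub> d ?b"
    using additive_add[OF dadd, of ?a ?b] retract_hom(3)[OF s(1) p x] aF bF by simp
  have cadd: "additive_map (AF r p) (C r q) (\<lambda>x. cmp r x q)" if "r < 2" "1 \<le> q" "q \<le> c" for r q
    by (rule module_hom_additive[OF AF_module[OF that(1) p(2)] C_module[OF that] cmp_hom[OF that(1) p(2) that(2,3)]])
  have uw: "?u w = cl (p - 1) (C 1 (p - length w)) (cmp 1 x (p - length w))" if "w \<in> U_index p 1" for w
    unfolding Uid_class[OF p s(1) x] using that by (simp add: redU_def)
  have u_Nil: "?u [] = cl (p - 1) (C 1 p) ?b" using uw[of "[]"] U_index_Nil_iff[OF p(1)] by simp
  have t: "restrict ?u (T_index (p - 1) 1) = Tid (p - 1) 1 (cl (p - 1) (AF 1 (p - 1)) ?a)"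
    unfolding Tid_class[OF p1 s(1) a] redT_def
  proof (rule restrict_ext)
    fix w assume w: "w \<in> T_index (p - 1) 1"
    note wU = T_in_U[OF p(1) w] and rg = T_index_range[OF w]
    have q: "1 \<le> p - length w" "p - length w \<le> c" "p - length w \<noteq> p" "p - 1 + 1 - length w = p - length w" using rg p by auto
    interpret Cq: module S "C 1 (p - length w)" by (rule C_module[OF s(1) q(1,2)])
    have "cmp 1 x (p - length w) = cmp 1 ?a (p - length w) \<oplus>\<^bsub>C 1 (p - length w)\<^esub> cmp 1 ?b (p - length w)"
      using additive_add[OF cadd[OF s(1) q(1,2)], of ?a ?b] retract_hom(3)[OF s(1) p x] aF bF by simp
    also have "cmp 1 ?b (p - length w) = \<zero>\<^bsub>C 1 (p - length w)\<^esub>" using cmp_in_C[OF s(1) p b q(1,2)] q(3) by simp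
    also have "cmp 1 ?a (p - length w) \<oplus>\<^bsub>C 1 (p - length w)\<^esub> \<zero>\<^bsub>C 1 (p - length w)\<^esub> = cmp 1 ?a (p - length w)"
      using additive_closed[OF cadd[OF s(1) q(1,2)], of ?a] aF by (intro Cq.M.r_zero) simp
    finally show "?u w = cl (p - 1) (C (1 mod 2) (p - 1 + 1 - length w))
        (restrict (\<lambda>w. cmp 1 ?a (p - 1 + 1 - length w)) (T_index (p - 1) 1) w)"
      using uw[of w] wU w q(4) by simp
  qed
  have \<delta>t: "\<delta>' 1 (restrict ?u (T_index (p - 1) 1)) = Tid (p - 1) 0 (cl (p - 1) (AF 0 (p - 1)) (d ?a))"
    unfolding t using res a by (simp add: resolves_def)
  have b_hom: "b_map c A d B p \<in> module_hom S (C 1 p) (C 0 p)"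
    unfolding b_map_def
    using module_hom_comp[OF C_incl[OF s(1) p] module_hom_comp[OF d_hom[OF p(2)] cmp_hom[OF s(2) p(2) p]]] by simp
  have psi_hom: "psi c A d B p \<in> module_hom S (C 1 p) (AF 0 (p - 1))"
  proof (rule module_hom_cong[OF C_module[OF s(1) p]])
    show "(\<lambda>x. d x \<ominus>\<^bsub>A 0\<^esub> cmp 0 (d x) p) \<in> module_hom S (C 1 p) (AF 0 (p - 1))"
      using module_hom_comp[OF C_incl[OF s(1) p] module_hom_comp[OF d_hom[OF p(2)] retract_hom(1)[OF s(2) p]]] by simp
    show "psi c A d B p x = d x \<ominus>\<^bsub>A 0\<^esub> cmp 0 (d x) p" if "x \<in> carrier (C 1 p)" for x
      using psi_eq[OF p] C_in_AF[OF s(1) p] that by simp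
  qed
  have bm: "base_change_map S (I (p - 1)) (C 0 p) (b_map c A d B p) (?u []) = cl (p - 1) (C 0 p) (cmp 0 (d ?b) p)"
    unfolding u_Nil
    using base_change_map_residue[OF C_module[OF s(1) p] C_module[OF s(2) p] id id subset_refl b_hom, of ?b] b
    by (simp add: b_map_def)
  let ?\<psi> = "d ?b \<ominus>\<^bsub>A 0\<^esub> cmp 0 (d ?b) p"
  have \<psi>: "?\<psi> \<in> F 0 (p - 1)" using module_homD(1)[OF retract_hom(1)[OF s(2) p], of "d ?b"] dxF by simp
  have pm: "base_change_map S (I (p - 1)) (AF 0 (p - 1)) (psi c A d B p) (?u []) = cl (p - 1) (AF 0 (p - 1)) ?\<psi>"
    unfolding u_Nil
    using base_change_map_residue[OF C_module[OF s(1) p] AF_module[OF s(2) p1] id id subset_refl psi_hom, of ?b] b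
      psi_eq[OF p bF] by simp
  show ?thesis
    unfolding Uid_class[OF p s(2) dxF(1)] redU_def
    unfolding U_diff_def Let_def
  proof (simp only: if_True diff_self_eq_0 refl, rule restrict_ext)
    fix w assume w: "w \<in> U_index p 0"
    have q: "1 \<le> p - length w" "p - length w \<le> c" using U_index_range[OF p(1) w] p by auto
    interpret Cq: module S "C 0 (p - length w)" by (rule C_module[OF s(2) q])
    note cq = cadd[OF s(2) q]
    have dxq: "cmp 0 (d x) (p - length w) = cmp 0 (d ?a) (p - length w) \<oplus>\<^bsub>C 0 (p - length w)\<^esub> cmp 0 (d ?b) (p - length w)"
      using additive_add[OF cq, of "d ?a" "d ?b"] dx dxF by simp
    have cc: "cmp 0 (d ?a) (p - length w) \<in> carrier (C 0 (p - length w))" "cmp 0 (d ?b) (p - length w) \<in> carrier (C 0 (p - length w))"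
      using additive_closed[OF cq, of "d ?a"] additive_closed[OF cq, of "d ?b"] dxF by auto
    show "(if w = [] then base_change_map S (I (p - 1)) (C 0 p) (b_map c A d B p) (?u [])
      else \<delta>' 1 (restrict ?u (T_index (p - 1) 1)) w \<oplus>\<^bsub>base_change S (I (p - 1)) (C 0 (p - length w))\<^esub>
        Tid (p - 1) 0 (base_change_map S (I (p - 1)) (AF 0 (p - 1)) (psi c A d B p) (?u [])) w)
      = cl (p - 1) (C (0 mod 2) (p - length w)) (restrict (\<lambda>w. cmp 0 (d x) (p - length w)) (U_index p 0) w)"
    proof (cases "w = []")
      case True
      have "cmp 0 (d ?a) p = \<zero>\<^bsub>A 0\<^esub>" using cmp_vanish[OF s(2) p1 da, of p] p by simp
      then have "cmp 0 (d x) p = cmp 0 (d ?b) p" using dxq cc True Cq.M.l_zero by simp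
      then show ?thesis using True w bm by simp
    next
      case False
      then have wT: "w \<in> T_index (p - 1) 0" using T_sub_U[OF p(1) w] by blast
      have ql: "p - length w < p" "p - 1 + 1 - length w = p - length w" using False p q by auto
      have "d ?b = ?\<psi> \<oplus>\<^bsub>A 0\<^esub> cmp 0 (d ?b) p" using retract_hom(3)[OF s(2) p dxF(2)] .
      moreover have cB: "cmp 0 (d ?b) p \<in> B 0 p" using module_homD(1)[OF cmp_hom[OF s(2) p(2) p], of "d ?b"] dxF by simp
      moreover have "cmp 0 (cmp 0 (d ?b) p) (p - length w) = \<zero>\<^bsub>A 0\<^esub>" using cmp_in_C[OF s(2) p cB q] ql by simp
      moreover have \<psi>F: "?\<psi> \<in> F 0 p" using AF_mono[OF s(2) _ p(2) \<psi>] by simp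
      moreover have "cmp 0 ?\<psi> (p - length w) \<oplus>\<^bsub>A 0\<^esub> \<zero>\<^bsub>A 0\<^esub> = cmp 0 ?\<psi> (p - length w)"
        using Cq.M.r_zero[of "cmp 0 ?\<psi> (p - length w)"] additive_closed[OF cq, of ?\<psi>] \<psi>F by simp
      ultimately have e: "cmp 0 ?\<psi> (p - length w) = cmp 0 (d ?b) (p - length w)"
        using additive_add[OF cq, of ?\<psi> "cmp 0 (d ?b) p"] C_in_AF[OF s(2) p cB] by simp
      show ?thesis
        unfolding \<delta>t pm Tid_class[OF p1 s(2) da] Tid_class[OF p1 s(2) \<psi>]
        using False w wT ql(2) e dxq residue_add[OF C_module[OF s(2) q] id cc] by (simp add: redT_def)
    qed
  qed
qed

end

subsection \<open>One step of the construction\<close>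

lemma Tid_closed:
  assumes "p \<le> c" "s < 2" "x \<in> F s p"
  shows "Tid p s (cl p (AF s p) x) \<in> carrier (TM p s)"
proof -
  have "Tid p s \<in> module_hom (RR p) (base_change S (I p) (AF s p)) (TM p s)"
    using Tid_iso[OF assms(1,2)] by (simp add: module_iso_def)
  moreover have "cl p (AF s p) x \<in> carrier (base_change S (I p) (AF s p))"
    using residue_carrier[OF AF_module[OF assms(2,1)] I_ideal[OF assms(1)]] assms(3) by simp
  ultimately show ?thesis by (rule module_homD(1))
qed

lemma Uid_closed:
  assumes "1 \<le> p" "p \<le> c" "s < 2" "x \<in> F s p"
  shows "Uid p s (cl (p - 1) (AF s p) x) \<in> carrier (UM p s)"
proof -
  have p1: "p - 1 \<le> c" using assms by simp
  have "Uid p s \<in> module_hom (RR (p - 1)) (base_change S (I (p - 1)) (AF s p)) (UM p s)"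
    using Uid_iso[OF assms(1-3)] by (simp add: module_iso_def)
  moreover have "cl (p - 1) (AF s p) x \<in> carrier (base_change S (I (p - 1)) (AF s p))"
    using residue_carrier[OF AF_module[OF assms(3,2)] I_ideal[OF p1]] assms(4) by simp
  ultimately show ?thesis by (rule module_homD(1))
qed

lemma resolves_exact:
  assumes "resolves p \<delta>" "1 \<le> n" "x \<in> carrier (TM p n)" "\<delta> n x = \<zero>\<^bsub>TM p (n - 1)\<^esub>"
  shows "\<exists>y\<in>carrier (TM p (n + 1)). \<delta> (n + 1) y = x"
  using assms unfolding resolves_def by blast

context
  fixes p and \<delta>' and \<sigma> and \<delta>''
  assumes p: "1 \<le> p" "p \<le> c" and res: "resolves (p - 1) \<delta>'"
    and hh: "higher_homotopies (RR (p - 1)) (a_elt p) (UM p) (UD p \<delta>') \<sigma>"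
    and sh: "shamash_differential (RR p) (UM p) \<sigma> (TM p) (y_mult S f A B p) \<delta>''"
begin

lemma p1': "p - 1 \<le> c" using p by simp

lemma sigma_0: "1 \<le> n \<Longrightarrow> u \<in> carrier (UM p n) \<Longrightarrow> \<sigma> 0 n u = UD p \<delta>' n u"
  using hh by (simp add: higher_homotopies_def)

lemma sigma_0_hom:
  assumes "1 \<le> n"
  shows "\<sigma> 0 n \<in> module_hom (RR (p - 1)) (UM p n) (UM p (n - 1))"
proof -
  have "1 \<le> n + 2 * 0" using assms by simp
  then have "\<sigma> 0 n \<in> module_hom (RR (p - 1)) (UM p n) (UM p (n + 2 * 0 - 1))"
    using hh unfolding higher_homotopies_def by blast
  then show ?thesis by simp
qed

lemma UD_closed: "1 \<le> n \<Longrightarrow> u \<in> carrier (UM p n) \<Longrightarrow> UD p \<delta>' n u \<in> carrier (UM p (n - 1))"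
  using module_homD(1)[OF sigma_0_hom] sigma_0 by simp

lemma U_complex:
  assumes n: "2 \<le> n" and u: "u \<in> carrier (UM p n)"
  shows "UD p \<delta>' (n - 1) (UD p \<delta>' n u) = \<zero>\<^bsub>UM p (n - 2)\<^esub>"
proof -
  note g = U_diff_ge2[OF p res n u]
  have uT: "u \<in> carrier (TM (p - 1) (n - 1 + 1))" using u n UM_eq_TM[OF p(1) n] by simp
  have n1: "1 \<le> n - 1" using n by simp
  have dd: "\<delta>' (n - 1) (\<delta>' n u) = \<zero>\<^bsub>TM (p - 1) (n - 2)\<^esub>"
  proof -
    have "\<delta>' (n - 1) (\<delta>' (n - 1 + 1) u) = \<zero>\<^bsub>TM (p - 1) (n - 1 - 1)\<^esub>"
      using res uT n1 unfolding resolves_def by blast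
    moreover have "n - 1 + 1 = n" "n - 1 - 1 = n - 2" using n by auto
    ultimately show ?thesis by simp
  qed
  show ?thesis
  proof (cases "n = 2")
    case True
    then have t: "\<delta>' 2 u \<in> carrier (TM (p - 1) 1)" using g(2) by simp
    have s: "(1::nat) < 2" "(0::nat) < 2" by auto
    obtain a where a: "a \<in> F 1 (p - 1)" "\<delta>' 2 u = Tid (p - 1) 1 (cl (p - 1) (AF 1 (p - 1)) a)"
      using Tid_onto[OF p1' s(1) t] by blast
    have aF: "a \<in> F 1 p" using AF_mono[OF s(1) _ p(2) a(1)] by simp
    have da: "d a \<in> F 0 (p - 1)" using module_homD(1)[OF d_hom[OF p1'], of a] a(1) by simp
    have "UD p \<delta>' 2 u = Uid p 1 (cl (p - 1) (AF 1 p) a)"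
      using g(1) True a(2) cone_incl_Tid[OF p s(1) a(1)] by simp
    then have "UD p \<delta>' 1 (UD p \<delta>' 2 u) = Uid p 0 (cl (p - 1) (AF 0 p) (d a))"
      using U_diff_1[OF p res aF] by simp
    also have "\<dots> = cone_incl p 0 (Tid (p - 1) 0 (cl (p - 1) (AF 0 (p - 1)) (d a)))"
      using cone_incl_Tid[OF p s(2) da] by simp
    also have "Tid (p - 1) 0 (cl (p - 1) (AF 0 (p - 1)) (d a)) = \<delta>' 1 (\<delta>' 2 u)"
      using res a by (simp add: resolves_def)
    also have "\<dots> = \<zero>\<^bsub>TM (p - 1) 0\<^esub>" using dd True by simp
    finally show ?thesis using True cone_incl_zero[OF p(1), of 0] by simp
  next
    case False
    then have n2: "2 \<le> n - 1" using n by simp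
    have e: "UD p \<delta>' n u = \<delta>' n u" using g cone_incl_ge2[OF p(1) n2] by simp
    have v: "\<delta>' n u \<in> carrier (UM p (n - 1))" using g(2) UM_eq_TM[OF p(1) n2] by simp
    have "UD p \<delta>' (n - 1) (\<delta>' n u) = cone_incl p (n - 1 - 1) (\<delta>' (n - 1) (\<delta>' n u))"
      using U_diff_ge2(1)[OF p res n2 v] .
    also have "n - 1 - 1 = n - 2" using n by simp
    finally show ?thesis unfolding e dd using cone_incl_zero[OF p(1)] by simp
  qed
qed

text \<open>In degrees \<open>\<ge> 2\<close> this is exactness of \<open>T(p-1)\<close>. A cycle of degree 1 is represented modulo \<open>I(p-1)\<close> by an element of
  \<open>A\<^sub>1(p-1)\<close>, by \<open>kernel_reduces\<close>, hence comes from a cycle of \<open>T(p-1)\<close>.\<close>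

lemma U_exact:
  assumes n: "1 \<le> n" and u: "u \<in> carrier (UM p n)" and z: "UD p \<delta>' n u = \<zero>\<^bsub>UM p (n - 1)\<^esub>"
  shows "\<exists>v\<in>carrier (UM p (n + 1)). UD p \<delta>' (n + 1) v = u"
proof (cases "n = 1")
  case True
  have s: "(1::nat) < 2" "(0::nat) < 2" by auto
  obtain x where x: "x \<in> F 1 p" "u = Uid p 1 (cl (p - 1) (AF 1 p) x)"
    using Uid_onto[OF p s(1)] u True by blast
  have dx: "d x \<in> F 0 p" using module_homD(1)[OF d_hom[OF p(2)], of x] x(1) by simp
  have "Uid p 0 (cl (p - 1) (AF 0 p) (d x)) = \<zero>\<^bsub>UM p 0\<^esub>"
    using U_diff_1[OF p res x(1)] z x(2) True by simp
  then have "d x \<in> ideal_smult S (I (p - 1)) (AF 0 p)" using Uid_zero_iff[OF p s(2) dx] by simp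
  then obtain a where a: "a \<in> F 1 (p - 1)" "x \<ominus>\<^bsub>A 1\<^esub> a \<in> ideal_smult S (I (p - 1)) (AF 1 p)"
    "d a \<in> ideal_smult S (I (p - 1)) (AF 0 (p - 1))" using kernel_reduces[OF p x(1)] by blast
  have aF: "a \<in> F 1 p" using AF_mono[OF s(1) _ p(2) a(1)] by simp
  have da: "d a \<in> F 0 (p - 1)" using module_homD(1)[OF d_hom[OF p1'], of a] a(1) by simp
  interpret P: module S "AF 1 p" by (rule AF_module[OF s(1) p(2)])
  interpret A1: module S "A 1" by (rule A_module[OF s(1)])
  have "x \<ominus>\<^bsub>AF 1 p\<^esub> a = x \<ominus>\<^bsub>A 1\<^esub> a"
  proof -
    note incl = submodule_homs(1)[OF A_module[OF s(1)] AF_sub[OF s(1) p(2)]]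
    have "additive_map (AF 1 p) (A 1) (\<lambda>x. x)"
      using module_hom_additive[OF AF_module[OF s(1) p(2)] A_module[OF s(1)]] incl by (simp add: filt_def)
    from additive_diff[OF this, of x a] show ?thesis using x(1) aF by simp
  qed
  then have "cl (p - 1) (AF 1 p) x = cl (p - 1) (AF 1 p) a"
    using residue_eq_iff[OF AF_module[OF s(1) p(2)] I_ideal[OF p1'], of x a] x(1) aF a(2) by simp
  then have ua: "u = cone_incl p 1 (Tid (p - 1) 1 (cl (p - 1) (AF 1 (p - 1)) a))"
    using x(2) cone_incl_Tid[OF p s(1) a(1)] by simp
  have "\<delta>' 1 (Tid (p - 1) 1 (cl (p - 1) (AF 1 (p - 1)) a)) = \<zero>\<^bsub>TM (p - 1) 0\<^esub>"
    using res a(1) Tid_zero[OF p1' s(2) da a(3)] by (simp add: resolves_def)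
  moreover have "Tid (p - 1) 1 (cl (p - 1) (AF 1 (p - 1)) a) \<in> carrier (TM (p - 1) 1)"
    by (rule Tid_closed[OF p1' s(1) a(1)])
  ultimately have "\<exists>y\<in>carrier (TM (p - 1) (1 + 1)). \<delta>' (1 + 1) y = Tid (p - 1) 1 (cl (p - 1) (AF 1 (p - 1)) a)"
    by (intro resolves_exact[OF res le_refl]) simp_all
  then obtain y where y: "y \<in> carrier (TM (p - 1) (1 + 1))" "\<delta>' (1 + 1) y = Tid (p - 1) 1 (cl (p - 1) (AF 1 (p - 1)) a)"
    by blast
  have "(2::nat) \<le> 1 + 1" by simp
  have yU: "y \<in> carrier (UM p (1 + 1))" using y(1) UM_eq_TM[OF p(1), of "1 + 1"] by simp
  have "UD p \<delta>' (1 + 1) y = u" using U_diff_ge2(1)[OF p res _ yU] y(2) ua by simp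
  then show ?thesis using True yU by blast
next
  case False
  then have n2: "2 \<le> n" using n by simp
  note g = U_diff_ge2[OF p res n2 u]
  have "\<delta>' n u = \<zero>\<^bsub>TM (p - 1) (n - 1)\<^esub>" using cone_incl_inj[OF p(1) g(2) _ p(2)] g(1) z by simp
  moreover have "u \<in> carrier (TM (p - 1) n)" using u UM_eq_TM[OF p(1) n2] by simp
  ultimately obtain y where y: "y \<in> carrier (TM (p - 1) (n + 1))" "\<delta>' (n + 1) y = u"
    using res n unfolding resolves_def by blast
  have n3: "2 \<le> n + 1" using n by simp
  have yU: "y \<in> carrier (UM p (n + 1))" using y(1) UM_eq_TM[OF p(1) n3] by simp
  have "UD p \<delta>' (n + 1) y = cone_incl p n u" using U_diff_ge2(1)[OF p res n3 yU] y(2) by simp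
  also have "\<dots> = u" using cone_incl_ge2[OF p(1) n2] u UM_eq_TM[OF p(1) n2] by simp
  finally show ?thesis using yU by blast
qed

lemma shamash: "shamash_system (RR (p - 1)) (a_elt p) (UM p) (UD p \<delta>') \<sigma>"
proof (rule shamash_system.intro)
  fix n x assume n: "2 \<le> n" and x: "x \<in> carrier (UM p n)"
  have "1 \<le> n" "1 \<le> n - 1" using n by auto
  then show "\<sigma> 0 (n - 1) (\<sigma> 0 n x) = \<zero>\<^bsub>UM p (n - 2)\<^esub>"
    using sigma_0 UD_closed x U_complex[OF n x] by simp
qed (use RR_cring[OF p1'] a_elt_closed[OF p] UM_module[OF p] hh in auto)

interpretation Sh: shamash_system "RR (p - 1)" "a_elt p" "UM p" "UD p \<delta>'" \<sigma> by (rule shamash)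

lemma hat_eq: "Sh.hat n = hatU p n"
  by (simp add: Sh.hat_def)

abbreviation DD where "DD \<equiv> shamash_system.D (UM p) \<sigma>"

lemma \<delta>_hom: "1 \<le> n \<Longrightarrow> \<delta>'' n \<in> module_hom (RR p) (TM p n) (TM p (n - 1))"
  using sh by (simp add: shamash_differential_def)

lemma \<delta>_y_mult:
  "1 \<le> n + 2 * i \<Longrightarrow> g \<in> carrier (UM p n) \<Longrightarrow> \<delta>'' (n + 2 * i) (y_mult S f A B p i n g) =
    (\<Oplus>\<^bsub>TM p (n + 2 * i - 1)\<^esub>j\<in>{j. j \<le> i \<and> 1 \<le> n + 2 * j}. y_mult S f A B p (i - j) (n + 2 * j - 1) (\<sigma> j n g))"
  using sh unfolding shamash_differential_def by blast

text \<open>Both sides are additive in \<open>z\<close>, and on a single term \<open>y\<^sup>(\<^sup>i\<^sup>) g\<close> this is the formula that defines the Shamash differential.\<close>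

lemma delta_Y:
  assumes n: "1 \<le> n" and z: "z \<in> carrier (hatU p n)"
  shows "\<delta>'' n (Y p n z) = Y p (n - 1) (DD n z)"
proof -
  have cQ: "cring (RR (p - 1))" by (rule RR_cring[OF p1'])
  have add\<delta>: "additive_map (TM p n) (TM p (n - 1)) (\<delta>'' n)"
    by (rule module_hom_additive[OF TM_module[OF p(2)] TM_module[OF p(2)] \<delta>_hom[OF n]])
  have 1: "additive_map (hatU p n) (TM p (n - 1)) (\<lambda>z. \<delta>'' n (Y p n z))"
    by (rule additive_comp[OF Y_additive[OF p] add\<delta>])
  have 2: "additive_map (hatU p n) (TM p (n - 1)) (\<lambda>z. Y p (n - 1) (DD n z))"
    by (rule additive_comp[OF Sh.D_additive[OF n, unfolded hat_eq] Y_additive[OF p]])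
  show ?thesis
  proof (rule additive_eq_on_ds[OF cQ UM_module[OF p] _ 1 2 _ z])
    fix i g assume "i \<in> {i. 2 * i \<le> n}" and g: "g \<in> carrier (UM p (n - 2 * i))"
    then have i: "2 * i \<le> n" by simp
    let ?m = "n - 2 * i"
    let ?J = "{j. j \<le> i \<and> 1 \<le> ?m + 2 * j}"
    let ?z = "ds_inj {i. 2 * i \<le> n} (\<lambda>i. UM p (n - 2 * i)) i g"
    have nm: "?m + 2 * i = n" using i by simp
    have z: "?z \<in> carrier (hatU p n)"
      using module_homD(1)[OF Sh.y_inj_hom[OF i]] g by (simp add: Sh.y_inj_def hat_eq)
    have sc: "\<sigma> j ?m g \<in> carrier (UM p (?m + 2 * j - 1))" if "j \<in> ?J" for j
      using module_homD(1)[of "\<sigma> j ?m" "RR (p - 1)" "UM p ?m" "UM p (?m + 2 * j - 1)" g] hh g that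
      unfolding higher_homotopies_def by blast
    have Yc: "y_mult S f A B p (i - j) (?m + 2 * j - 1) (\<sigma> j ?m g) \<in> carrier (TM p (n - 1))" if j: "j \<in> ?J" for j
    proof -
      have e: "2 * (i - j) \<le> n - 1" "n - 1 - 2 * (i - j) = ?m + 2 * j - 1" using i j by auto
      have gj: "\<sigma> j ?m g \<in> carrier (UM p (n - 1 - 2 * (i - j)))" using sc[OF j] e(2) by simp
      have "ds_inj {i. 2 * i \<le> n - 1} (\<lambda>i. UM p (n - 1 - 2 * i)) (i - j) (\<sigma> j ?m g) \<in> carrier (hatU p (n - 1))"
        using module_homD(1)[OF Sh.y_inj_hom[OF e(1)] gj] by (simp add: Sh.y_inj_def hat_eq)
      from additive_closed[OF Y_additive[OF p] this] show ?thesis using Y_inj[OF p e(1) gj] e(2) by simp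
    qed
    have "\<delta>'' n (Y p n ?z) = \<delta>'' (?m + 2 * i) (y_mult S f A B p i ?m g)"
      using Y_inj[OF p i g] nm by simp
    also have "\<dots> = (\<Oplus>\<^bsub>TM p (?m + 2 * i - 1)\<^esub>j\<in>?J. y_mult S f A B p (i - j) (?m + 2 * j - 1) (\<sigma> j ?m g))"
      using nm n by (intro \<delta>_y_mult g) simp
    finally have L: "\<delta>'' n (Y p n ?z) = (\<Oplus>\<^bsub>TM p (n - 1)\<^esub>j\<in>?J. y_mult S f A B p (i - j) (?m + 2 * j - 1) (\<sigma> j ?m g))"
      unfolding nm .
    have DDz: "DD n ?z \<in> carrier (hatU p (n - 1))" using Sh.D_closed[OF n] z by (simp add: hat_eq)
    have fin: "finite ?J" by simp
    interpret T: module "RR p" "TM p (n - 1)" by (rule TM_module[OF p(2)])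
    show "\<delta>'' n (Y p n ?z) = Y p (n - 1) (DD n ?z)"
    proof (rule extensionalityI[of _ "T_index p (n - 1)"])
      have "\<delta>'' n (Y p n ?z) \<in> carrier (TM p (n - 1))" using additive_closed[OF 1 z] .
      then show "\<delta>'' n (Y p n ?z) \<in> extensional (T_index p (n - 1))" by (simp add: TM_mem)
      show "Y p (n - 1) (DD n ?z) \<in> extensional (T_index p (n - 1))" by (simp add: Y_def)
      fix w assume w: "w \<in> T_index p (n - 1)"
      note hd = T_index_hd_tl[OF p(1) w]
      let ?C = "C ((n - 1) mod 2) (p + 1 - length w)"
      let ?P = "base_change S (I p) ?C"
      interpret P: module "RR p" ?P by (rule base_change_module[OF TC_module[OF p(2) w] I_ideal[OF p(2)]])
      have ev: "additive_map (TM p (n - 1)) ?P (\<lambda>x. x w)"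
        unfolding T_module_def
        by (rule ds_proj_additive[OF RR_cring[OF p(2)] base_change_module[OF TC_module[OF p(2)] I_ideal[OF p(2)]] finite_T_index w])
      define X where "X = base_change_map S (I p) ?C id (\<sigma> (i - hd w) ?m g (tl w))"
      have term_w: "y_mult S f A B p (i - j) (?m + 2 * j - 1) (\<sigma> j ?m g) w = (if i - hd w = j \<and> hd w \<le> i then X else \<zero>\<^bsub>?P\<^esub>)"
        if j: "j \<in> ?J" for j
      proof -
        have e0: "n - 1 - 2 * (i - j) = ?m + 2 * j - 1" "2 * (i - j) \<le> n - 1" using i j by auto
        have e: "?m + 2 * j - 1 + 2 * (i - j) = n - 1" "(?m + 2 * j - 1) mod 2 = (n - 1) mod 2"
          using i j parity[OF e0(2)] unfolding e0(1) by auto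
        have "hd w = i - j \<longleftrightarrow> i - hd w = j \<and> hd w \<le> i" using j by auto
        then show ?thesis using w unfolding y_mult_def e X_def Let_def by auto
      qed
      have XP: "X \<in> carrier ?P" if "hd w \<le> i"
      proof -
        have j: "i - hd w \<in> ?J" using that hd i n by auto
        then show ?thesis using term_w[OF j] Yc[OF j] w that by (auto simp: TM_mem)
      qed
      have "(\<delta>'' n (Y p n ?z)) w = (\<Oplus>\<^bsub>?P\<^esub>j\<in>?J. y_mult S f A B p (i - j) (?m + 2 * j - 1) (\<sigma> j ?m g) w)"
        unfolding L using Yc by (intro additive_finsum[OF ev fin]) auto
      also have "\<dots> = (\<Oplus>\<^bsub>?P\<^esub>j\<in>?J. if i - hd w = j \<and> hd w \<le> i then X else \<zero>\<^bsub>?P\<^esub>)"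
      proof (rule P.finsum_cong'[OF refl _ term_w])
        show "(\<lambda>j. if i - hd w = j \<and> hd w \<le> i then X else \<zero>\<^bsub>?P\<^esub>) \<in> ?J \<rightarrow> carrier ?P"
          using XP P.M.zero_closed by (intro Pi_I) (simp split: if_split)
      qed
      also have "\<dots> = (if hd w \<le> i then X else \<zero>\<^bsub>?P\<^esub>)"
      proof (cases "hd w \<le> i")
        case True
        have "(\<Oplus>\<^bsub>?P\<^esub>j\<in>?J. if i - hd w = j then X else \<zero>\<^bsub>?P\<^esub>) = X"
          using True hd i n XP by (intro P.finsum_singleton fin) auto
        then show ?thesis using True by simp
      next
        case False
        then show ?thesis using P.finsum_zero by simp
      qed
      also have "\<dots> = Y p (n - 1) (DD n ?z) w"
      proof -
        have "DD n ?z (hd w) = (if hd w \<le> i then \<sigma> (i - hd w) ?m g else \<zero>\<^bsub>UM p (n - 1 - 2 * hd w)\<^esub>)"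
          using Sh.D_y_inj[OF i g _ n, of "hd w"] hd by (simp add: Sh.y_inj_def)
        moreover have "base_change_map S (I p) ?C id (\<zero>\<^bsub>UM p (n - 1 - 2 * hd w)\<^esub> (tl w)) = \<zero>\<^bsub>?P\<^esub>"
        proof -
          have len: "p + 1 - length w = p - length (tl w)" using w by (cases w) (auto simp: T_index_eq)
          have m: "module S ?C" by (rule TC_module[OF p(2) w])
          interpret CC: module S ?C by (rule m)
          have "\<zero>\<^bsub>UM p (n - 1 - 2 * hd w)\<^esub> (tl w) = cl (p - 1) ?C \<zero>\<^bsub>?C\<^esub>"
            using hd by (simp only: U_module_def direct_sum_simps restrict_apply parity len if_True
                residue_zero[OF m[unfolded len] I_ideal[OF p1']])
          then show ?thesis
            using reduce_further[OF p, of "(n - 1) mod 2" "p + 1 - length w" "\<zero>\<^bsub>?C\<^esub>"] T_index_range[OF w] p CC.M.zero_closed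
              residue_zero[OF m I_ideal[OF p(2)]] by simp
        qed
        ultimately show ?thesis using w by (simp add: Y_def X_def)
      qed
      finally show "(\<delta>'' n (Y p n ?z)) w = Y p (n - 1) (DD n ?z) w" .
    qed
  qed simp
qed

lemma Tid_y_mult:
  assumes s: "s < 2" and x: "x \<in> F s p"
  shows "y_mult S f A B p 0 s (Uid p s (cl (p - 1) (AF s p) x)) = Tid p s (cl p (AF s p) x)"
  unfolding Tid_class[OF p(2) s x] redT_def y_mult_def Let_def
proof (simp only: mult_0_right add_0_right, rule restrict_ext)
  fix w assume w: "w \<in> T_index p s"
  note hd = T_index_hd_tl[OF p(1) w] and rg = T_index_range[OF w]
  have len: "p + 1 - length w = p - length (tl w)" using w by (cases w) (auto simp: T_index_eq)
  have h0: "hd w = 0" using hd s by simp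
  have cB: "cmp s x (p + 1 - length w) \<in> B s (p + 1 - length w)"
    using module_homD(1)[OF cmp_hom[OF s p(2), of "p + 1 - length w"], of x] x rg p by simp
  have "Uid p s (cl (p - 1) (AF s p) x) (tl w) = cl (p - 1) (C s (p + 1 - length w)) (cmp s x (p + 1 - length w))"
    unfolding Uid_class[OF p s x] len using hd h0 s by (simp add: redU_def)
  then show "(if hd w = 0 then base_change_map S (I p) (C (s mod 2) (p + 1 - length w)) id (Uid p s (cl (p - 1) (AF s p) x) (tl w))
      else \<zero>\<^bsub>base_change S (I p) (C (s mod 2) (p + 1 - length w))\<^esub>)
    = cl p (C (s mod 2) (p + 1 - length w)) (restrict (\<lambda>w. cmp s x (p + 1 - length w)) (T_index p s) w)"
    using h0 s w reduce_further[OF p s _ _ cB] rg p by simp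
qed

text \<open>\<open>Y\<close> carries \<open>D\<close> to the differential of \<open>T(p)\<close> and has kernel \<open>f\<^sub>p\<close> times its source. So the complex property is
  \<open>D\<^sup>2 = f\<^sub>p t\<close>, and a cycle of \<open>T(p)\<close> is a \<open>z\<close> with \<open>D z\<close> divisible by \<open>f\<^sub>p\<close>, to which \<open>exact_mod\<close> applies.\<close>

lemma resolves_step: "resolves p \<delta>''"
  unfolding resolves_def
proof (intro conjI allI impI ballI)
  show "\<delta>'' n \<in> module_hom (RR p) (TM p n) (TM p (n - 1))" if "1 \<le> n" for n by (rule \<delta>_hom[OF that])
next
  fix n t assume n: "1 \<le> n" and t: "t \<in> carrier (TM p (n + 1))"
  obtain z where z: "z \<in> carrier (hatU p (n + 1))" "t = Y p (n + 1) z" using Y_onto[OF p t] by blast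
  have Dz: "DD (n + 1) z \<in> carrier (hatU p n)" using Sh.D_closed[of "n + 1" z] z by (simp add: hat_eq)
  have DDz: "DD n (DD (n + 1) z) \<in> carrier (hatU p (n - 1))" using Sh.D_closed[OF n, of "DD (n + 1) z"] Dz by (simp add: hat_eq)
  let ?u = "\<lambda>i\<in>{i. 2 * i \<le> n - 1}. z (Suc i)"
  have u: "?u \<in> carrier (hatU p (n - 1))"
  proof -
    have "z (Suc i) \<in> carrier (UM p (n - 1 - 2 * i))" if "2 * i \<le> n - 1" for i
      using z(1)[folded hat_eq] that n by (auto simp: Sh.hat_mem dest!: spec[of _ "Suc i"])
    then show ?thesis by (auto simp: direct_sum_simps)
  qed
  have "DD n (DD (n + 1) z) = a_elt p \<odot>\<^bsub>hatU p (n - 1)\<^esub> ?u"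
  proof (rule Sh.hat_eqI[of _ "n - 1"])
    show "a_elt p \<odot>\<^bsub>hatU p (n - 1)\<^esub> ?u \<in> carrier (Sh.hat (n - 1))"
      using module.smult_closed[OF Sh.hat_module[of "n - 1"] Sh.a, of ?u] u unfolding hat_eq by blast
    fix i assume i: "2 * i \<le> n - 1"
    have "DD (n + 1 - 1) (DD (n + 1) z) i = a_elt p \<odot>\<^bsub>UM p (n + 1 - 2 - 2 * i)\<^esub> z (Suc i)"
      using z n i by (intro Sh.D_D) (auto simp: hat_eq)
    then show "DD n (DD (n + 1) z) i = (a_elt p \<odot>\<^bsub>hatU p (n - 1)\<^esub> ?u) i"
      using i by (simp add: direct_sum_simps)
  qed (use DDz in \<open>simp add: hat_eq\<close>)
  then have "Y p (n - 1) (DD n (DD (n + 1) z)) = \<zero>\<^bsub>TM p (n - 1)\<^esub>" using Y_zero_iff[OF p DDz] u by blast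
  then show "\<delta>'' n (\<delta>'' (n + 1) t) = \<zero>\<^bsub>TM p (n - 1)\<^esub>"
    using delta_Y[of "n + 1" z] z delta_Y[OF n Dz] by simp
next
  fix n t assume n: "1 \<le> n" and t: "t \<in> carrier (TM p n)" and \<delta>t: "\<delta>'' n t = \<zero>\<^bsub>TM p (n - 1)\<^esub>"
  obtain z where z: "z \<in> carrier (hatU p n)" "t = Y p n z" using Y_onto[OF p t] by blast
  have Dz: "DD n z \<in> carrier (hatU p (n - 1))" using Sh.D_closed[OF n] z by (simp add: hat_eq)
  have "Y p (n - 1) (DD n z) = \<zero>\<^bsub>TM p (n - 1)\<^esub>" using delta_Y[OF n z(1)] z(2) \<delta>t by simp
  then obtain u where u: "u \<in> carrier (hatU p (n - 1))" "DD n z = a_elt p \<odot>\<^bsub>hatU p (n - 1)\<^esub> u"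
    using Y_zero_iff[OF p Dz] by blast
  have "\<exists>v\<in>carrier (Sh.hat (n + 1)). DD (n + 1) v = z"
  proof (rule Sh.exact_mod[OF UM_torsion_free[OF p] _ n])
    fix m x assume "1 \<le> m" "x \<in> carrier (UM p m)" "\<sigma> 0 m x = \<zero>\<^bsub>UM p (m - 1)\<^esub>"
    then show "\<exists>y\<in>carrier (UM p (m + 1)). \<sigma> 0 (m + 1) y = x"
      using U_exact[of m x] sigma_0[of m x] sigma_0[of "m + 1"] by auto
  qed (use z u hat_eq in simp_all)
  then obtain v where v: "v \<in> carrier (hatU p (n + 1))" "DD (n + 1) v = z" by (auto simp: hat_eq)
  have "\<delta>'' (n + 1) (Y p (n + 1) v) = t" using delta_Y[of "n + 1" v] v z(2) by simp
  then show "\<exists>y\<in>carrier (TM p (n + 1)). \<delta>'' (n + 1) y = t"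
    using additive_closed[OF Y_additive[OF p] v(1)] by blast
next
  fix x assume x: "x \<in> F 1 p"
  have s: "(1::nat) < 2" "(0::nat) < 2" by auto
  have dx: "d x \<in> F 0 p" using module_homD(1)[OF d_hom[OF p(2)], of x] x by simp
  let ?g = "Uid p 1 (cl (p - 1) (AF 1 p) x)"
  have g: "?g \<in> carrier (UM p 1)" by (rule Uid_closed[OF p s(1) x])
  interpret T: module "RR p" "TM p 0" by (rule TM_module[OF p(2)])
  have Tc: "Tid p 0 (cl p (AF 0 p) (d x)) \<in> carrier (TM p 0)"
    by (rule Tid_closed[OF p(2) s(2) dx])
  have J: "{j. j \<le> (0::nat) \<and> 1 \<le> 1 + 2 * j} = {0}" by auto
  have "\<delta>'' (1 + 2 * 0) (y_mult S f A B p 0 1 ?g)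
      = (\<Oplus>\<^bsub>TM p (1 + 2 * 0 - 1)\<^esub>j\<in>{j. j \<le> 0 \<and> 1 \<le> 1 + 2 * j}. y_mult S f A B p (0 - j) (1 + 2 * j - 1) (\<sigma> j 1 ?g))"
    by (rule \<delta>_y_mult[OF _ g]) simp
  also have "\<dots> = y_mult S f A B p 0 0 (\<sigma> 0 1 ?g)"
    unfolding J using sigma_0[of 1 ?g] g U_diff_1[OF p res x] Tid_y_mult[OF s(2) dx] Tc
    by (simp add: T.finsum_insert)
  also have "\<dots> = Tid p 0 (cl p (AF 0 p) (d x))"
    using sigma_0[of 1 ?g] g U_diff_1[OF p res x] Tid_y_mult[OF s(2) dx] by simp
  finally show "\<delta>'' 1 (Tid p 1 (cl p (AF 1 p) x)) = Tid p 0 (cl p (AF 0 p) (d x))"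
    using Tid_y_mult[OF s(1) x] by simp
qed

end

subsection \<open>The identification in degree 2\<close>

abbreviation Hs :: "nat \<Rightarrow> ('a, nat \<Rightarrow> 'b) module" where "Hs p \<equiv> h_source A F p"
abbreviation T2id where "T2id \<equiv> T2_ident S f c A B"

text \<open>The linear map over \<open>S\<close> that induces the identification in degree 2.\<close>

definition T2_lift :: "nat \<Rightarrow> (nat \<Rightarrow> 'b) \<Rightarrow> nat list \<Rightarrow> 'b"
  where "T2_lift p v = (\<lambda>w\<in>T_index p 2. cmp 0 (v (p - leading_zeros w)) (p + 1 - length w))"

lemma Hs_summand: "p \<le> c \<Longrightarrow> q \<in> {1..p} \<Longrightarrow> module S (AF 0 q)"
  by (intro AF_module) auto

lemma Hs_module: "p \<le> c \<Longrightarrow> module S (Hs p)"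
  unfolding h_source_def by (rule direct_sum_module[OF S Hs_summand])

lemma Hs_mem: "v \<in> carrier (Hs p) \<longleftrightarrow> v \<in> extensional {1..p} \<and> (\<forall>q\<in>{1..p}. v q \<in> F 0 q)"
  by (auto simp: h_source_def direct_sum_simps PiE_iff)

lemma Hs_component_hom:
  assumes "p \<le> c" "1 \<le> q'" "q' \<le> q" "q \<le> p"
  shows "(\<lambda>v. cmp 0 (v q) q') \<in> module_hom S (Hs p) (C 0 q')"
proof -
  have q: "q \<in> {1..p}" using assms by auto
  have "(\<lambda>v. v q) \<in> module_hom S (Hs p) (AF 0 q)"
    unfolding h_source_def by (rule ds_proj_hom[OF S Hs_summand[OF assms(1)] _ q]) auto
  from module_hom_comp[OF this cmp_hom[of 0 q q']] show ?thesis using assms by simp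
qed

text \<open>The words of \<open>T\<^sub>2(p)\<close> correspond to the pairs \<open>q' \<le> q \<le> p\<close>, that is, to the summands \<open>B\<^sub>0(q')\<close> of the modules \<open>A\<^sub>0(q)\<close>.\<close>

lemma T2_lift_iso:
  assumes p: "p \<le> c"
  shows "T2_lift p \<in> module_iso S (Hs p) (Tm p 2)"
proof (rule module_isoI[OF Hs_module[OF p] Tm_module[OF p]])
  have s: "(0::nat) < 2" by simp
  interpret A0: filtered_module S "A 0" "F 0" "B 0" c by (rule filtered[OF s])
  note ceq = component_eq[OF s]
  have TC: "module S (C 0 (p + 1 - length w))" if "w \<in> T_index p 2" for w
    using TC_module[OF p that] by simp
  have Tm2: "Tm p 2 = direct_sum (T_index p 2) (\<lambda>w. C 0 (p + 1 - length w))" by (simp add: Tm_def)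
  show "T2_lift p \<in> module_hom S (Hs p) (Tm p 2)"
    unfolding T2_lift_def Tm2
    by (rule ds_homI[OF S TC finite_T_index Hs_module[OF p]]) (auto intro!: Hs_component_hom p dest: T_index_2)
  fix v assume v: "v \<in> carrier (Hs p)" and z: "T2_lift p v = \<zero>\<^bsub>Tm p 2\<^esub>"
  interpret M: module S "A 0" by (rule A_module[OF s])
  have "v q = \<zero>\<^bsub>A 0\<^esub>" if q: "q \<in> {1..p}" for q
  proof -
    have "cmp 0 (v q) q' = \<zero>\<^bsub>A 0\<^esub>" if q': "q' \<in> {1..q}" for q'
    proof -
      have le: "1 \<le> q'" "q' \<le> q" "q \<le> p" using q q' by auto
      have "T2_lift p v (T2_word p q q') = \<zero>\<^bsub>Tm p 2\<^esub> (T2_word p q q')" using z by simp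
      then show ?thesis using T2_word[OF le] by (simp add: T2_lift_def Tm2 direct_sum_simps)
    qed
    then have "(\<Oplus>\<^bsub>A 0\<^esub>q'\<in>{1..q}. cmp 0 (v q) q') = (\<Oplus>\<^bsub>A 0\<^esub>q'\<in>{1..q}. \<zero>\<^bsub>A 0\<^esub>)" by (intro M.finsum_cong') auto
    then show ?thesis using A0.comp_sum_F[of q "v q"] v q p ceq by (auto simp: Hs_mem)
  qed
  then show "v = \<zero>\<^bsub>Hs p\<^esub>"
    using v[unfolded Hs_mem] by (intro extensionalityI[of _ "{1..p}"]) (auto simp: h_source_def direct_sum_simps)
next
  have s: "(0::nat) < 2" by simp
  interpret A0: filtered_module S "A 0" "F 0" "B 0" c by (rule filtered[OF s])
  note ceq = component_eq[OF s]
  fix y assume y: "y \<in> carrier (Tm p 2)"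
  have yB: "y w \<in> B 0 (p + 1 - length w)" if "w \<in> T_index p 2" for w
    using y that by (auto simp: Tm_def direct_sum_simps PiE_iff)
  have yB': "y (T2_word p q q') \<in> B 0 q'" if "1 \<le> q'" "q' \<le> q" "q \<le> p" for q q'
    using yB[OF T2_word(1)[OF that]] T2_word(3)[OF that] by simp
  let ?v = "\<lambda>q\<in>{1..p}. \<Oplus>\<^bsub>A 0\<^esub>q'\<in>{1..q}. y (T2_word p q q')"
  have "(\<Oplus>\<^bsub>A 0\<^esub>q'\<in>{1..q}. y (T2_word p q q')) \<in> F 0 q" if "q \<in> {1..p}" for q
    using that p yB' by (intro A0.sum_in_F) auto
  then have "?v \<in> carrier (Hs p)" by (auto simp: Hs_mem)
  moreover have "T2_lift p ?v = y"
  proof (rule extensionalityI[of _ "T_index p 2"])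
    fix w assume w: "w \<in> T_index p 2"
    note T = T_index_2[OF w]
    let ?q = "p - leading_zeros w" and ?q' = "p + 1 - length w"
    have "T2_lift p ?v w = cmp 0 (\<Oplus>\<^bsub>A 0\<^esub>q'\<in>{1..?q}. y (T2_word p ?q q')) ?q'"
      using w T by (simp add: T2_lift_def)
    also have "\<dots> = y (T2_word p ?q ?q')"
      unfolding ceq using T p yB' by (subst A0.comp_sum_partial) auto
    also have "\<dots> = y w" using T(5) by simp
    finally show "T2_lift p ?v w = y w" .
  qed (use y in \<open>auto simp: T2_lift_def Tm_def direct_sum_simps PiE_iff\<close>)
  ultimately show "\<exists>x\<in>carrier (Hs p). T2_lift p x = y" by blast
qed

lemma T2id_class:
  assumes p: "p \<le> c" and v: "v \<in> carrier (Hs p)"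
  shows "T2id p (residue S (I p) (Hs p) v) = redT p 2 (T2_lift p v)"
  unfolding T2_ident_def redT_def T2_lift_def
proof (rule restrict_ext)
  fix w assume w: "w \<in> T_index p 2"
  note T = T_index_2[OF w]
  have q: "1 \<le> p + 1 - length w" "p + 1 - length w \<le> c" using T p by auto
  show "base_change_map S (I p) (C 0 (p + 1 - length w)) (\<lambda>v. cmp 0 (v (p - leading_zeros w)) (p + 1 - length w)) (residue S (I p) (Hs p) v)
    = cl p (C (2 mod 2) (p + 1 - length w)) (restrict (\<lambda>w. cmp 0 (v (p - leading_zeros w)) (p + 1 - length w)) (T_index p 2) w)"
    using base_change_map_residue[OF Hs_module[OF p] C_module[of 0, OF _ q] I_ideal[OF p] I_ideal[OF p] subset_refl
        Hs_component_hom[OF p T(1,2,4)] v] w by simp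
qed

lemma T2id_iso:
  assumes p: "p \<le> c"
  shows "T2id p \<in> module_iso (RR p) (base_change S (I p) (Hs p)) (TM p 2)"
  by (rule reduction_induced_iso[OF base_change_reduction[OF Hs_module[OF p] I_ideal[OF p]] redT[OF p] T2_lift_iso[OF p]])
    (rule T2id_class[OF p])

lemma T2id_closed: "p \<le> c \<Longrightarrow> v \<in> carrier (Hs p) \<Longrightarrow> T2id p (residue S (I p) (Hs p) v) \<in> carrier (TM p 2)"
  using T2id_class reduction.closed[OF redT] T2_lift_iso module_homD(1)[of "T2_lift p" S "Hs p" "Tm p 2" v]
  by (simp add: module_iso_def)

subsection \<open>The second differential\<close>

lemma h_in_F: "1 \<le> q \<Longrightarrow> q \<le> c \<Longrightarrow> x \<in> F 0 q \<Longrightarrow> h q x \<in> F 1 q"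
  using module_homD(1)[OF h_hom, of q x] by simp

lemma h_row_hom:
  assumes p: "p \<le> c"
  shows "h_row A h p \<in> module_hom S (Hs p) (AF 1 p)"
proof -
  have s: "(1::nat) < 2" by simp
  have "h_row A h p \<in> module_hom S (Hs p) (A 1)"
    unfolding h_row_def
  proof (rule module_hom_finsum_map[OF Hs_module[OF p] A_module[OF s]])
    fix q assume q: "q \<in> {1..p}"
    then have q1: "1 \<le> q" "q \<le> c" using p by auto
    have "(\<lambda>v. v q) \<in> module_hom S (Hs p) (AF 0 q)"
      unfolding h_source_def by (rule ds_proj_hom[OF S Hs_summand[OF p] _ q]) auto
    moreover have "h q \<in> module_hom S (AF 0 q) (A 1)"
      using hmf q1 by (auto simp: higher_matrix_factorization_def)
    ultimately show "(\<lambda>v. h q (v q)) \<in> module_hom S (Hs p) (A 1)" by (rule module_hom_comp)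
  qed simp
  moreover have "h_row A h p v \<in> F 1 p" if v: "v \<in> carrier (Hs p)" for v
    unfolding h_row_def
  proof (rule submodule_finsum[OF A_module[OF s] AF_sub[OF s p]])
    fix q assume q: "q \<in> {1..p}"
    then have "h q (v q) \<in> F 1 q" using v p by (intro h_in_F) (auto simp: Hs_mem)
    then show "h q (v q) \<in> F 1 p" using AF_mono[OF s _ p] q by auto
  qed simp
  ultimately show ?thesis
    using submodule_homs(3)[OF A_module[OF s] AF_sub[OF s p], of "h_row A h p" "Hs p"] by (simp add: filt_def)
qed

lemma h_row_in_F: "p \<le> c \<Longrightarrow> v \<in> carrier (Hs p) \<Longrightarrow> h_row A h p v \<in> F 1 p"
  using module_homD(1)[OF h_row_hom, of p v] by simp

lemma h_row_step:
  assumes p: "1 \<le> p" "p \<le> c" and v: "v \<in> carrier (Hs p)"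
  shows "h_row A h p v = h_row A h (p - 1) (restrict v {1..p - 1}) \<oplus>\<^bsub>A 1\<^esub> h p (v p)"
proof -
  have s: "(1::nat) < 2" by simp
  interpret M: module S "A 1" by (rule A_module[OF s])
  have hc: "h q (v q) \<in> carrier (A 1)" if "q \<in> {1..p}" for q
    using h_in_F[of q "v q"] v that p submoduleD(1)[OF A_module[OF s] AF_sub[OF s, of q]] by (auto simp: Hs_mem)
  have I: "{1..p} = insert p {1..p - 1}" using p by auto
  have "h_row A h p v = h p (v p) \<oplus>\<^bsub>A 1\<^esub> (\<Oplus>\<^bsub>A 1\<^esub>q\<in>{1..p - 1}. h q (v q))"
    unfolding h_row_def I using hc p by (intro M.finsum_insert) auto
  also have "(\<Oplus>\<^bsub>A 1\<^esub>q\<in>{1..p - 1}. h q (v q)) = h_row A h (p - 1) (restrict v {1..p - 1})"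
    unfolding h_row_def using hc by (intro M.finsum_cong') auto
  also have "h p (v p) \<oplus>\<^bsub>A 1\<^esub> h_row A h (p - 1) (restrict v {1..p - 1}) = h_row A h (p - 1) (restrict v {1..p - 1}) \<oplus>\<^bsub>A 1\<^esub> h p (v p)"
  proof (rule M.a_comm)
    show "h p (v p) \<in> carrier (A 1)" using hc[of p] p by simp
    show "h_row A h (p - 1) (restrict v {1..p - 1}) \<in> carrier (A 1)"
      unfolding h_row_def using hc by (intro M.finsum_closed) auto
  qed
  finally show ?thesis .
qed

lemma Hs_restrict:
  assumes "v \<in> carrier (Hs p)"
  shows "restrict v {1..p - 1} \<in> carrier (Hs (p - 1))"
  using assms by (auto simp: Hs_mem)

definition second_is_h :: "nat \<Rightarrow> (nat \<Rightarrow> (nat list \<Rightarrow> 'b set) \<Rightarrow> nat list \<Rightarrow> 'b set) \<Rightarrow> bool"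
  where "second_is_h p \<delta> \<longleftrightarrow>
    (\<forall>v\<in>carrier (Hs p). \<delta> 2 (T2id p (residue S (I p) (Hs p) v)) = Tid p 1 (cl p (AF 1 p) (h_row A h p v)))"

text \<open>Words of \<open>T\<^sub>2(p)\<close> that start with 0 continue with a word of \<open>T\<^sub>2(p-1)\<close>; those that start with 1 continue with zeros
  and belong to \<open>y\<^sub>p A\<^sub>0(p)\<close>.\<close>

lemma T2id_split:
  assumes p: "1 \<le> p" "p \<le> c" and v: "v \<in> carrier (Hs p)"
  shows "T2id p (residue S (I p) (Hs p) v) =
    y_mult S f A B p 0 2 (T2id (p - 1) (residue S (I (p - 1)) (Hs (p - 1)) (restrict v {1..p - 1})))
    \<oplus>\<^bsub>TM p 2\<^esub> y_mult S f A B p 1 0 (Uid p 0 (cl (p - 1) (AF 0 p) (v p)))"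
proof -
  have p1: "p - 1 \<le> c" using p by simp
  have s: "(0::nat) < 2" by simp
  let ?v' = "restrict v {1..p - 1}"
  have vp: "v p \<in> F 0 p" using v p by (auto simp: Hs_mem)
  have n2: "0 + 2 * 1 = (2::nat)" "2 + 2 * 0 = (2::nat)" by auto
  show ?thesis
    unfolding T2id_class[OF p(2) v] T2id_class[OF p1 Hs_restrict[OF v]] T_module_def direct_sum_simps(3) redT_def[of p]
      y_mult_def n2 Let_def
  proof (rule restrict_ext)
    fix w assume w: "w \<in> T_index p 2"
    note T = T_index_2[OF w] and hd = T_index_hd_tl[OF p(1) w]
    let ?C = "C 0 (p + 1 - length w)"
    have len: "p + 1 - length w = p - length (tl w)" using w by (cases w) (auto simp: T_index_eq)
    have q: "1 \<le> p + 1 - length w" "p + 1 - length w \<le> c" using T p by auto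
    interpret P: module "RR p" "base_change S (I p) ?C"
      by (rule base_change_module[OF C_module[OF s q] I_ideal[OF p(2)]])
    let ?b = "cmp 0 (v (p - leading_zeros w)) (p + 1 - length w)"
    have b: "?b \<in> B 0 (p + 1 - length w)"
      using module_homD(1)[OF Hs_component_hom[OF p(2) T(1,2,4)] v] by simp
    have cb: "cl p ?C ?b \<in> carrier (base_change S (I p) ?C)"
      using residue_carrier[OF C_module[OF s q] I_ideal[OF p(2)]] b by simp
    note rf = reduce_further[OF p s q b]
    consider "hd w = 0" | "hd w = 1" using hd by linarith
    then have "cl p ?C ?b = (if hd w = 0 then base_change_map S (I p) ?C id (redT (p - 1) 2 (T2_lift (p - 1) ?v') (tl w))
          else \<zero>\<^bsub>base_change S (I p) ?C\<^esub>)
      \<oplus>\<^bsub>base_change S (I p) ?C\<^esub>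
         (if hd w = 1 then base_change_map S (I p) ?C id (Uid p 0 (cl (p - 1) (AF 0 p) (v p)) (tl w))
          else \<zero>\<^bsub>base_change S (I p) ?C\<^esub>)"
    proof cases
      case 1
      then have lz: "leading_zeros w = Suc (leading_zeros (tl w))" using hd by (cases w) auto
      have "tl w \<in> T_index (p - 1) 2" using hd 1 U_index_ge2[OF p(1), of 2] by simp
      note tw = this T_index_2[OF this]
      have e: "p - 1 + 1 - length (tl w) = p + 1 - length w" "p - 1 - leading_zeros (tl w) = p - leading_zeros w"
        using len lz p by linarith+
      have "redT (p - 1) 2 (T2_lift (p - 1) ?v') (tl w)
        = cl (p - 1) (C 0 (p - 1 + 1 - length (tl w))) (cmp 0 (?v' (p - 1 - leading_zeros (tl w))) (p - 1 + 1 - length (tl w)))"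
        using tw(1) by (simp add: redT_def T2_lift_def)
      also have "?v' (p - 1 - leading_zeros (tl w)) = v (p - leading_zeros w)" using tw(4,5) e(2) by simp
      finally have "redT (p - 1) 2 (T2_lift (p - 1) ?v') (tl w) = cl (p - 1) ?C ?b" unfolding e(1) .
      then show ?thesis using 1 rf cb P.M.r_zero by simp
    next
      case 2
      then have lz: "leading_zeros w = 0" using hd by (cases w) auto
      have "Uid p 0 (cl (p - 1) (AF 0 p) (v p)) (tl w) = cl (p - 1) ?C ?b"
        unfolding Uid_class[OF p s vp] len using hd 2 lz by (simp add: redU_def)
      then show ?thesis using 2 rf cb P.M.l_zero by simp
    qed
    then show "cl p (C (2 mod 2) (p + 1 - length w)) (T2_lift p v w) =
      (\<lambda>w\<in>T_index p 2. if hd w = 0 then base_change_map S (I p) (C (2 mod 2) (p + 1 - length w)) id (redT (p - 1) 2 (T2_lift (p - 1) ?v') (tl w))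
          else \<zero>\<^bsub>base_change S (I p) (C (2 mod 2) (p + 1 - length w))\<^esub>) w
      \<oplus>\<^bsub>base_change S (I p) (C (2 mod 2) (p + 1 - length w))\<^esub>
      (\<lambda>w\<in>T_index p 2. if hd w = 1 then base_change_map S (I p) (C (0 mod 2) (p + 1 - length w)) id (Uid p 0 (cl (p - 1) (AF 0 p) (v p)) (tl w))
          else \<zero>\<^bsub>base_change S (I p) (C (0 mod 2) (p + 1 - length w))\<^esub>) w"
      using w by (simp add: T2_lift_def)
  qed
qed

text \<open>By the splitting of \<open>T\<^sub>2(p)\<close> the Shamash differential has two parts: \<open>\<sigma>\<^sub>0\<close>, the differential of \<open>T(p-1)\<close>, and \<open>\<sigma>\<^sub>1\<close> on
  \<open>U\<^sub>0(p)\<close>, which is \<open>h\<^sub>p\<close>. The component \<open>\<sigma>\<^sub>0\<close> on \<open>y\<^sub>p U\<^sub>0(p)\<close> would end in degree \<open>-1\<close> of \<open>U(p)\<close>, so it is absent.\<close>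

lemma second_step:
  assumes p: "1 \<le> p" "p \<le> c" and res: "resolves (p - 1) \<delta>'"
    and hh: "higher_homotopies (RR (p - 1)) (a_elt p) (UM p) (UD p \<delta>') \<sigma>"
    and sh: "shamash_differential (RR p) (UM p) \<sigma> (TM p) (y_mult S f A B p) \<delta>''"
    and \<sigma>h: "\<And>X. X \<in> carrier (base_change S (I (p - 1)) (AF 0 p)) \<Longrightarrow>
      \<sigma> 1 0 (Uid p 0 X) = Uid p 1 (base_change_map S (I (p - 1)) (AF 1 p) (h p) X)"
    and sec: "second_is_h (p - 1) \<delta>'"
  shows "second_is_h p \<delta>''"
  unfolding second_is_h_def
proof
  have p1: "p - 1 \<le> c" using p by simp
  have s: "(1::nat) < 2" "(0::nat) < 2" by auto
  fix v assume v: "v \<in> carrier (Hs p)"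
  let ?v' = "restrict v {1..p - 1}"
  let ?u = "T2id (p - 1) (residue S (I (p - 1)) (Hs (p - 1)) ?v')"
  let ?g = "Uid p 0 (cl (p - 1) (AF 0 p) (v p))"
  have v': "?v' \<in> carrier (Hs (p - 1))" by (rule Hs_restrict[OF v])
  have vp: "v p \<in> F 0 p" using v p by (auto simp: Hs_mem)
  have uT: "?u \<in> carrier (TM (p - 1) 2)" by (rule T2id_closed[OF p1 v'])
  then have u: "?u \<in> carrier (UM p 2)" using UM_eq_TM[OF p(1), of 2] by simp
  have g: "?g \<in> carrier (UM p 0)" by (rule Uid_closed[OF p s(2) vp])
  let ?r = "h_row A h (p - 1) ?v'"
  have r: "?r \<in> F 1 (p - 1)" by (rule h_row_in_F[OF p1 v'])
  have rF: "?r \<in> F 1 p" using AF_mono[OF s(1) _ p(2) r] by simp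
  have hp: "h p (v p) \<in> F 1 p" by (rule h_in_F[OF p vp])
  note yeq = \<delta>_y_mult[OF p res hh sh] and Ty = Tid_y_mult[OF p res hh sh]
  interpret T: module "RR p" "TM p (Suc 0)" by (rule TM_module[OF p(2)])
  have Tr: "Tid p 1 (cl p (AF 1 p) ?r) \<in> carrier (TM p 1)" by (rule Tid_closed[OF p(2) s(1) rF])
  have Th: "Tid p 1 (cl p (AF 1 p) (h p (v p))) \<in> carrier (TM p 1)" by (rule Tid_closed[OF p(2) s(1) hp])
  have \<sigma>u: "\<sigma> 0 2 ?u = Uid p 1 (cl (p - 1) (AF 1 p) ?r)"
  proof -
    have "\<sigma> 0 2 ?u = UD p \<delta>' 2 ?u" by (rule sigma_0[OF p res hh sh _ u]) simp
    also have "\<dots> = cone_incl p (2 - 1) (\<delta>' 2 ?u)" by (rule U_diff_ge2(1)[OF p res _ u]) simp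
    also have "\<delta>' 2 ?u = Tid (p - 1) 1 (cl (p - 1) (AF 1 (p - 1)) ?r)" using sec v' by (simp add: second_is_h_def)
    also have "cone_incl p (2 - 1) (Tid (p - 1) 1 (cl (p - 1) (AF 1 (p - 1)) ?r)) = Uid p 1 (cl (p - 1) (AF 1 p) ?r)"
      using cone_incl_Tid[OF p s(1) r] by simp
    finally show ?thesis .
  qed
  have J0: "{j. j \<le> (0::nat) \<and> 1 \<le> 2 + 2 * j} = {0}" and J1: "{j. j \<le> (1::nat) \<and> 1 \<le> 0 + 2 * j} = {1}" by auto
  have "\<delta>'' (2 + 2 * 0) (y_mult S f A B p 0 2 ?u) = (\<Oplus>\<^bsub>TM p (2 + 2 * 0 - 1)\<^esub>j\<in>{j. j \<le> 0 \<and> 1 \<le> 2 + 2 * j}.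
      y_mult S f A B p (0 - j) (2 + 2 * j - 1) (\<sigma> j 2 ?u))"
    by (rule yeq[OF _ u]) simp
  also have "\<dots> = Tid p 1 (cl p (AF 1 p) ?r)"
    unfolding J0 using \<sigma>u Ty[OF s(1) rF] Tr by (simp add: T.finsum_insert)
  finally have D0: "\<delta>'' 2 (y_mult S f A B p 0 2 ?u) = Tid p 1 (cl p (AF 1 p) ?r)" by simp
  have \<sigma>g: "\<sigma> 1 0 ?g = Uid p 1 (cl (p - 1) (AF 1 p) (h p (v p)))"
    using \<sigma>h[of "cl (p - 1) (AF 0 p) (v p)"] residue_carrier[OF AF_module[OF s(2) p(2)] I_ideal[OF p1]] vp
      base_change_map_residue[OF AF_module[OF s(2) p(2)] AF_module[OF s(1) p(2)] I_ideal[OF p1] I_ideal[OF p1] subset_refl h_hom[OF p], of "v p"]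
    by simp
  have "\<delta>'' (0 + 2 * 1) (y_mult S f A B p 1 0 ?g) = (\<Oplus>\<^bsub>TM p (0 + 2 * 1 - 1)\<^esub>j\<in>{j. j \<le> 1 \<and> 1 \<le> 0 + 2 * j}.
      y_mult S f A B p (1 - j) (0 + 2 * j - 1) (\<sigma> j 0 ?g))"
    by (rule yeq[OF _ g]) simp
  also have "\<dots> = Tid p 1 (cl p (AF 1 p) (h p (v p)))"
    unfolding J1 using \<sigma>g Ty[OF s(1) hp] Th by (simp add: T.finsum_insert)
  finally have D1: "\<delta>'' 2 (y_mult S f A B p 1 0 ?g) = Tid p 1 (cl p (AF 1 p) (h p (v p)))" by (simp add: numeral_2_eq_2)
  have "\<delta>'' 2 \<in> module_hom (RR p) (TM p 2) (TM p (2 - 1))" by (rule \<delta>_hom[OF p res hh sh]) simp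
  then have add2: "additive_map (TM p 2) (TM p 1) (\<delta>'' 2)"
    using module_hom_additive[OF TM_module[OF p(2)] TM_module[OF p(2)]] by simp
  have yc: "y_mult S f A B p 0 2 ?u \<in> carrier (TM p 2)" "y_mult S f A B p 1 0 ?g \<in> carrier (TM p 2)"
  proof -
    have cQ: "cring (RR (p - 1))" by (rule RR_cring[OF p1])
    have inj: "ds_inj {i. 2 * i \<le> 2} (\<lambda>i. UM p (2 - 2 * i)) i x \<in> carrier (hatU p 2)"
      if "2 * i \<le> 2" "x \<in> carrier (UM p (2 - 2 * i))" for i x
      using module_homD(1)[OF ds_inj_hom[OF cQ, of "{i. 2 * i \<le> 2}" "\<lambda>i. UM p (2 - 2 * i)" i]] UM_module[OF p] that by simp
    show "y_mult S f A B p 0 2 ?u \<in> carrier (TM p 2)"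
      using Y_inj[OF p, of 0 2 ?u] additive_closed[OF Y_additive[OF p] inj[of 0 ?u]] u by simp
    show "y_mult S f A B p 1 0 ?g \<in> carrier (TM p 2)"
      using Y_inj[OF p, of 1 2 ?g] additive_closed[OF Y_additive[OF p] inj[of 1 ?g]] g by simp
  qed
  have Tid_hom: "Tid p 1 \<in> module_hom (RR p) (base_change S (I p) (AF 1 p)) (TM p 1)"
    using Tid_iso[OF p(2) s(1)] by (simp add: module_iso_def)
  have "\<delta>'' 2 (T2id p (residue S (I p) (Hs p) v)) = Tid p 1 (cl p (AF 1 p) ?r) \<oplus>\<^bsub>TM p 1\<^esub> Tid p 1 (cl p (AF 1 p) (h p (v p)))"
    unfolding T2id_split[OF p v] additive_add[OF add2 yc] D0 D1 ..
  also have "\<dots> = Tid p 1 (cl p (AF 1 p) ?r \<oplus>\<^bsub>base_change S (I p) (AF 1 p)\<^esub> cl p (AF 1 p) (h p (v p)))"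
    using module_homD(2)[OF Tid_hom] residue_carrier[OF AF_module[OF s(1) p(2)] I_ideal[OF p(2)]] rF hp by simp
  also have "\<dots> = Tid p 1 (cl p (AF 1 p) (h_row A h p v))"
    using residue_add[OF AF_module[OF s(1) p(2)] I_ideal[OF p(2)], of ?r "h p (v p)"] rF hp h_row_step[OF p v] by simp
  finally show "\<delta>'' 2 (T2id p (residue S (I p) (Hs p) v)) = Tid p 1 (cl p (AF 1 p) (h_row A h p v))" .
qed

subsection \<open>The recursion\<close>

text \<open>The construction leaves \<open>\<delta> 0\<close> unspecified. As \<open>T(0) = 0\<close>, the zero map can be taken for it, and the recursion starts at
  \<open>p = 0\<close> instead of \<open>p = 1\<close>.\<close>

definition from_0 :: "(nat \<Rightarrow> nat \<Rightarrow> (nat list \<Rightarrow> 'b set) \<Rightarrow> nat list \<Rightarrow> 'b set) \<Rightarrow>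
    nat \<Rightarrow> nat \<Rightarrow> (nat list \<Rightarrow> 'b set) \<Rightarrow> nat list \<Rightarrow> 'b set"
  where "from_0 \<delta> p = (if p = 0 then (\<lambda>n x. \<zero>\<^bsub>TM 0 (n - 1)\<^esub>) else \<delta> p)"

lemma TM_0: "t \<in> carrier (TM 0 n) \<Longrightarrow> t = \<zero>\<^bsub>TM 0 n\<^esub>"
  by (auto simp: T_module_def direct_sum_simps)

lemma from_0_start: "resolves 0 (from_0 \<delta> 0)" "second_is_h 0 (from_0 \<delta> 0)"
proof -
  have s: "(1::nat) < 2" "(0::nat) < 2" by auto
  have z: "\<zero>\<^bsub>TM 0 n\<^esub> \<in> carrier (TM 0 n)" for n
  proof -
    interpret module "RR 0" "TM 0 n" by (rule TM_module) simp
    show ?thesis by (rule M.zero_closed)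
  qed
  then have z': "\<exists>y. y \<in> carrier (TM 0 n)" for n by blast
  have hom: "(\<lambda>x. \<zero>\<^bsub>TM 0 (n - 1)\<^esub>) \<in> module_hom (RR 0) (TM 0 n) (TM 0 (n - 1))" for n
    by (rule module_hom_zero_map[OF TM_module]) simp
  have dF: "d x \<in> F 0 0" if "x \<in> F 1 0" for x using module_homD(1)[OF d_hom[of 0], of x] that by simp
  show "resolves 0 (from_0 \<delta> 0)"
    unfolding resolves_def from_0_def
    using hom z' TM_0 TM_0[OF Tid_closed[OF _ s(2) dF]] by auto
  show "second_is_h 0 (from_0 \<delta> 0)"
    unfolding second_is_h_def from_0_def using TM_0[OF Tid_closed[OF _ s(1) h_row_in_F]] by simp
qed

context
  fixes \<sigma> \<delta>
  assumes con: "T_construction S f c A F d h B \<sigma> \<delta>"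
begin

text \<open>For \<open>p = 1\<close> the cone does not depend on \<open>\<delta> 0\<close>, because \<open>T(0)\<close> has no words.\<close>

lemma construction:
  assumes p: "1 \<le> p" "p \<le> c"
  shows "higher_homotopies (RR (p - 1)) (a_elt p) (UM p) (UD p (from_0 \<delta> (p - 1))) (\<sigma> p)"
    and "shamash_differential (RR p) (UM p) (\<sigma> p) (TM p) (y_mult S f A B p) (from_0 \<delta> p)"
    and "X \<in> carrier (base_change S (I (p - 1)) (AF 0 p)) \<Longrightarrow>
      \<sigma> p 1 0 (Uid p 0 X) = Uid p 1 (base_change_map S (I (p - 1)) (AF 1 p) (h p) X)"
proof -
  have UD: "UD p (from_0 \<delta> (p - 1)) = UD p (\<delta> (p - 1))"
  proof (cases "p = 1")
    case True
    have "w = []" if "w \<in> U_index 1 m" for w m using that by (simp add: U_index_eq)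
    then show ?thesis using True by (auto simp: U_diff_def Let_def fun_eq_iff restrict_def)
  next
    case False
    then show ?thesis using p by (simp add: from_0_def)
  qed
  have *: "p \<in> {1..c}" using p by simp
  note con' = con[unfolded T_construction_def, rule_format, OF *]
  show "higher_homotopies (RR (p - 1)) (a_elt p) (UM p) (UD p (from_0 \<delta> (p - 1))) (\<sigma> p)"
    using con' unfolding UD by (simp add: hmf_ring_def a_elt_def)
  show "shamash_differential (RR p) (UM p) (\<sigma> p) (TM p) (y_mult S f A B p) (from_0 \<delta> p)"
    using con' p by (simp add: hmf_ring_def from_0_def)
  show "\<sigma> p 1 0 (Uid p 0 X) = Uid p 1 (base_change_map S (I (p - 1)) (AF 1 p) (h p) X)"
    if "X \<in> carrier (base_change S (I (p - 1)) (AF 0 p))"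
    using con' that by blast
qed

lemma resolves_all: "p \<le> c \<Longrightarrow> resolves p (from_0 \<delta> p) \<and> second_is_h p (from_0 \<delta> p)"
proof (induction p)
  case 0
  then show ?case using from_0_start by blast
next
  case (Suc p)
  have p: "1 \<le> Suc p" "Suc p \<le> c" using Suc.prems by auto
  have IH: "resolves (Suc p - 1) (from_0 \<delta> (Suc p - 1))" "second_is_h (Suc p - 1) (from_0 \<delta> (Suc p - 1))"
    using Suc by auto
  note con' = construction[OF p]
  show ?case
    using resolves_step[OF p IH(1) con'(1,2)] second_step[OF p IH(1) con'(1,2) con'(3) IH(2)] by blast
qed

end

section \<open>Lifting the differentials\<close>

subsection \<open>Products with the maximal ideal\<close>

context
  fixes m
  assumes m: "ideal m S" and Im: "I c \<subseteq> m"
begin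

interpretation m: ideal m S by (rule m)

abbreviation mI :: "nat \<Rightarrow> 'a set" where "mI p \<equiv> m \<cdot>\<^bsub>S\<^esub> I p"

lemma I_in_m: "p \<le> c \<Longrightarrow> I p \<subseteq> m"
  using I_mono[of p c] Im by blast

lemma mI_ideal: "p \<le> c \<Longrightarrow> ideal (mI p) S"
  by (rule S.ideal_prod_is_ideal[OF m I_ideal])

lemma mI_in_I: "p \<le> c \<Longrightarrow> mI p \<subseteq> I p"
  using S.ideal_prod_inter[OF m I_ideal] by blast

lemma mI_step:
  assumes p: "1 \<le> p" "p \<le> c" and x: "x \<in> mI p"
  shows "\<exists>b\<in>m. \<exists>y\<in>mI (p - 1). x = f p \<otimes>\<^bsub>S\<^esub> b \<oplus>\<^bsub>S\<^esub> y"
  using x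
proof (induction rule: ideal_prod.induct)
  case (prod i j)
  have p1: "p - 1 \<le> c" using p by simp
  obtain r y where ry: "r \<in> carrier S" "y \<in> I (p - 1)" "j = f p \<otimes>\<^bsub>S\<^esub> r \<oplus>\<^bsub>S\<^esub> y" using I_step[OF p prod(2)] by blast
  have c: "i \<in> carrier S" "y \<in> carrier S" "f p \<in> carrier S"
    using m.Icarr prod(1) ideal.Icarr[OF I_ideal[OF p1] ry(2)] f_closed[OF p] by auto
  have "i \<otimes>\<^bsub>S\<^esub> j = f p \<otimes>\<^bsub>S\<^esub> (i \<otimes>\<^bsub>S\<^esub> r) \<oplus>\<^bsub>S\<^esub> i \<otimes>\<^bsub>S\<^esub> y"
    using c ry(1) by (simp add: ry(3) S.r_distr S.m_lcomm)
  moreover have "i \<otimes>\<^bsub>S\<^esub> r \<in> m" using m.I_r_closed[OF prod(1) ry(1)] .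
  moreover have "i \<otimes>\<^bsub>S\<^esub> y \<in> mI (p - 1)" using prod(1) ry(2) by (rule ideal_prod.prod)
  ultimately show ?case by blast
next
  case (sum s1 s2)
  have p1: "p - 1 \<le> c" using p by simp
  obtain b1 y1 b2 y2 where yy: "b1 \<in> m" "y1 \<in> mI (p - 1)" "s1 = f p \<otimes>\<^bsub>S\<^esub> b1 \<oplus>\<^bsub>S\<^esub> y1"
    "b2 \<in> m" "y2 \<in> mI (p - 1)" "s2 = f p \<otimes>\<^bsub>S\<^esub> b2 \<oplus>\<^bsub>S\<^esub> y2" using sum.IH by blast
  have c: "b1 \<in> carrier S" "b2 \<in> carrier S" "y1 \<in> carrier S" "y2 \<in> carrier S" "f p \<in> carrier S"
    using m.Icarr yy(1,4) ideal.Icarr[OF mI_ideal[OF p1]] yy(2,5) f_closed[OF p] by auto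
  have "s1 \<oplus>\<^bsub>S\<^esub> s2 = f p \<otimes>\<^bsub>S\<^esub> (b1 \<oplus>\<^bsub>S\<^esub> b2) \<oplus>\<^bsub>S\<^esub> (y1 \<oplus>\<^bsub>S\<^esub> y2)"
    using c by (simp add: yy(3,6) S.r_distr S.a_ac)
  moreover have "b1 \<oplus>\<^bsub>S\<^esub> b2 \<in> m" using yy(1,4) m.a_closed by blast
  moreover have "y1 \<oplus>\<^bsub>S\<^esub> y2 \<in> mI (p - 1)" using yy(2,5) by (rule ideal_prod.sum)
  ultimately show ?case by blast
qed

text \<open>By \<open>m I(p) + I(p-1) = f\<^sub>p m + I(p-1)\<close> and regularity, \<open>r\<close> is in \<open>m + I(p-1) = m\<close>.\<close>

lemma f_times_in_mI:
  assumes p: "1 \<le> p" "p \<le> c" and r: "r \<in> carrier S" and fr: "f p \<otimes>\<^bsub>S\<^esub> r \<in> mI p <+>\<^bsub>S\<^esub> I (p - 1)"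
  shows "r \<in> m"
proof -
  have p1: "p - 1 \<le> c" using p by simp
  interpret J: ideal "I (p - 1)" S by (rule I_ideal[OF p1])
  note fp = f_closed[OF p]
  obtain x z where xz: "f p \<otimes>\<^bsub>S\<^esub> r = x \<oplus>\<^bsub>S\<^esub> z" "x \<in> mI p" "z \<in> I (p - 1)"
    using fr by (auto simp: set_add_def set_mult_def)
  obtain b y where y: "b \<in> m" "y \<in> mI (p - 1)" "x = f p \<otimes>\<^bsub>S\<^esub> b \<oplus>\<^bsub>S\<^esub> y" using mI_step[OF p xz(2)] by blast
  have yI: "y \<in> I (p - 1)" using y(2) mI_in_I[OF p1] by blast
  have c: "b \<in> carrier S" "y \<in> carrier S" "z \<in> carrier S" using m.Icarr y(1) J.Icarr yI xz(3) by auto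
  have "f p \<otimes>\<^bsub>S\<^esub> (r \<ominus>\<^bsub>S\<^esub> b) = f p \<otimes>\<^bsub>S\<^esub> r \<ominus>\<^bsub>S\<^esub> f p \<otimes>\<^bsub>S\<^esub> b"
    using fp r c by (simp add: S.minus_eq S.r_distr S.r_minus)
  also have "\<dots> = y \<oplus>\<^bsub>S\<^esub> z"
    using fp c by (simp add: xz(1) y(3) S.minus_eq S.a_ac S.r_neg S.r_neg1 S.r_neg2)
  finally have "f p \<otimes>\<^bsub>S\<^esub> (r \<ominus>\<^bsub>S\<^esub> b) \<in> I (p - 1)" using yI xz(3) J.a_closed by simp
  then have "r \<ominus>\<^bsub>S\<^esub> b \<in> m" using f_nonzerodivisor[OF p, of "r \<ominus>\<^bsub>S\<^esub> b"] r c I_in_m[OF p1] by auto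
  then have "(r \<ominus>\<^bsub>S\<^esub> b) \<oplus>\<^bsub>S\<^esub> b \<in> m" using y(1) m.a_closed by blast
  then show ?thesis using r c by (simp add: S.minus_eq S.a_assoc S.l_neg)
qed

text \<open>For \<open>x = f\<^sub>p b + y\<close> with \<open>b\<close> in \<open>m\<close> and \<open>y\<close> in \<open>m I(p-1)\<close>, regularity puts \<open>b\<close> into \<open>I(p-1)\<close>, and \<open>f\<^sub>p\<close> is in \<open>m\<close>.\<close>

lemma mI_Int:
  assumes p: "1 \<le> p" "p \<le> c"
  shows "mI p \<inter> I (p - 1) \<subseteq> mI (p - 1)"
proof
  have p1: "p - 1 \<le> c" using p by simp
  interpret J: ideal "I (p - 1)" S by (rule I_ideal[OF p1])
  interpret K: ideal "mI (p - 1)" S by (rule mI_ideal[OF p1])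
  note fp = f_closed[OF p]
  fix x assume x: "x \<in> mI p \<inter> I (p - 1)"
  obtain b y where y: "b \<in> m" "y \<in> mI (p - 1)" "x = f p \<otimes>\<^bsub>S\<^esub> b \<oplus>\<^bsub>S\<^esub> y" using mI_step[OF p] x by blast
  have yI: "y \<in> I (p - 1)" using y(2) mI_in_I[OF p1] by blast
  have c: "b \<in> carrier S" "y \<in> carrier S" using m.Icarr y(1) J.Icarr yI by auto
  have "f p \<otimes>\<^bsub>S\<^esub> b = x \<ominus>\<^bsub>S\<^esub> y" using fp c by (simp add: y(3) S.minus_eq S.a_assoc S.r_neg)
  also have "\<dots> \<in> I (p - 1)"
    unfolding S.minus_eq using x by (intro J.a_closed J.a_inv_closed yI) blast
  finally have "b \<in> I (p - 1)" using f_nonzerodivisor[OF p c(1)] by blast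
  moreover have "f p \<in> m" using f_in_I[OF p] I_in_m[OF p(2)] by blast
  ultimately have "f p \<otimes>\<^bsub>S\<^esub> b \<in> mI (p - 1)" by (intro ideal_prod.prod)
  then show "x \<in> mI (p - 1)" unfolding y(3) using y(2) by (rule ideal_prod.sum)
qed

end

subsection \<open>Restriction to and extension from shorter words\<close>

text \<open>The inclusion of \<open>Tm (p - 1) n\<close> as the part with \<open>y\<^sub>p\<^sup>(\<^sup>0\<^sup>)\<close>, prefixing words by 0, and a retraction for it. The condition on
  \<open>tl w\<close> excludes the word \<open>[0]\<close> of the summand \<open>B\<^sub>s(p)\<close>, which occurs for \<open>n < 2\<close>.\<close>

definition pad :: "nat \<Rightarrow> nat \<Rightarrow> (nat list \<Rightarrow> 'b) \<Rightarrow> nat list \<Rightarrow> 'b"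
  where "pad p n x = (\<lambda>w\<in>T_index p n. if hd w = 0 \<and> tl w \<in> T_index (p - 1) n then x (tl w) else \<zero>\<^bsub>A (n mod 2)\<^esub>)"

definition cut :: "nat \<Rightarrow> nat \<Rightarrow> (nat list \<Rightarrow> 'b) \<Rightarrow> nat list \<Rightarrow> 'b"
  where "cut p n y = (\<lambda>w\<in>T_index (p - 1) n. y (0 # w))"

text \<open>The map \<open>t\<close> with \<open>D\<^sup>2 = f\<^sub>p t\<close>, on representatives.\<close>

definition shift :: "nat \<Rightarrow> nat \<Rightarrow> (nat list \<Rightarrow> 'b) \<Rightarrow> nat list \<Rightarrow> 'b"
  where "shift p n y = (\<lambda>w\<in>T_index p (n - 2). y (Suc (hd w) # tl w))"

lemma T_index_0_Cons: "1 \<le> p \<Longrightarrow> w \<in> T_index (p - 1) n \<Longrightarrow> 0 # w \<in> T_index p n"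
  by (auto simp: T_index_eq)

lemma Tm_mem: "x \<in> carrier (Tm p n) \<longleftrightarrow> x \<in> extensional (T_index p n) \<and> (\<forall>w\<in>T_index p n. x w \<in> B (n mod 2) (p + 1 - length w))"
  by (auto simp: Tm_def direct_sum_simps PiE_iff)

lemma Tm_proj_hom: "p \<le> c \<Longrightarrow> w \<in> T_index p n \<Longrightarrow> (\<lambda>x. x w) \<in> module_hom S (Tm p n) (C (n mod 2) (p + 1 - length w))"
  unfolding Tm_def by (rule ds_proj_hom[OF S TC_module finite_T_index])

lemma Tm_homI:
  assumes "p \<le> c" "module S L" "\<And>w. w \<in> T_index p n \<Longrightarrow> g w \<in> module_hom S L (C (n mod 2) (p + 1 - length w))"
  shows "(\<lambda>x. \<lambda>w\<in>T_index p n. g w x) \<in> module_hom S L (Tm p n)"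
  unfolding Tm_def by (rule ds_homI[OF S TC_module[OF assms(1)] finite_T_index assms(2,3)])

lemma Tm_ideal_iff:
  assumes "p \<le> c" "ideal K S" "x \<in> carrier (Tm p n)"
  shows "x \<in> ideal_smult S K (Tm p n) \<longleftrightarrow> (\<forall>w\<in>T_index p n. x w \<in> ideal_smult S K (C (n mod 2) (p + 1 - length w)))"
  unfolding Tm_def
  by (rule ideal_smult_direct_sum[OF S TC_module[OF assms(1)] finite_T_index assms(2) assms(3)[unfolded Tm_def]])

context
  fixes p
  assumes p: "1 \<le> p" "p \<le> c"
begin

lemma p_pred: "p - 1 \<le> c" using p by simp

lemma pad_hom: "pad p n \<in> module_hom S (Tm (p - 1) n) (Tm p n)"
  unfolding pad_def
proof (rule Tm_homI[OF p(2) Tm_module[OF p_pred]])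
  fix w assume w: "w \<in> T_index p n"
  have len: "p + 1 - length w = p - 1 + 1 - length (tl w)" using w p by (cases w) (auto simp: T_index_eq)
  show "(\<lambda>x. if hd w = 0 \<and> tl w \<in> T_index (p - 1) n then x (tl w) else \<zero>\<^bsub>A (n mod 2)\<^esub>)
    \<in> module_hom S (Tm (p - 1) n) (C (n mod 2) (p + 1 - length w))"
  proof (cases "hd w = 0 \<and> tl w \<in> T_index (p - 1) n")
    case True
    then show ?thesis using Tm_proj_hom[OF p_pred, of "tl w" n, folded len] by simp
  next
    case False
    then show ?thesis using module_hom_zero_map[OF TC_module[OF p(2) w], of "Tm (p - 1) n"] by auto
  qed
qed

lemma cut_hom: "cut p n \<in> module_hom S (Tm p n) (Tm (p - 1) n)"
  unfolding cut_def
proof (rule Tm_homI[OF p_pred Tm_module[OF p(2)]])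
  fix w assume w: "w \<in> T_index (p - 1) n"
  then show "(\<lambda>x. x (0 # w)) \<in> module_hom S (Tm p n) (C (n mod 2) (p - 1 + 1 - length w))"
    using Tm_proj_hom[OF p(2) T_index_0_Cons[OF p(1) w]] p by simp
qed

lemma cut_pad: "x \<in> carrier (Tm (p - 1) n) \<Longrightarrow> cut p n (pad p n x) = x"
  using T_index_0_Cons[OF p(1)]
  by (intro extensionalityI[of _ "T_index (p - 1) n"]) (auto simp: cut_def pad_def Tm_mem)

lemma shift_closed:
  assumes "2 \<le> n" "y \<in> carrier (Tm p n)"
  shows "shift p n y \<in> carrier (Tm p (n - 2))"
  unfolding Tm_mem
proof (intro conjI ballI)
  fix w assume w: "w \<in> T_index p (n - 2)"
  have "Suc (hd w) # tl w \<in> T_index p n" "length (Suc (hd w) # tl w) = length w"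
    using w assms(1) by (cases w; auto simp: T_index_eq)+
  moreover have "(n - 2) mod 2 = n mod 2" using assms(1) by (metis le_add_diff_inverse2 mod_add_self2)
  ultimately show "shift p n y w \<in> B ((n - 2) mod 2) (p + 1 - length w)"
    using assms(2) w by (auto simp: shift_def Tm_mem)
qed (simp add: shift_def)

lemma redH_apply:
  "2 * i \<le> n \<Longrightarrow> w \<in> U_index p (n - 2 * i) \<Longrightarrow> redH p n x i w = cl (p - 1) (C (n mod 2) (p - length w)) (x (i # w))"
  by (simp add: redH_def redU_def unT_def parity)

lemma redH_ext: "redH p n x \<in> extensional {i. 2 * i \<le> n}" "2 * i \<le> n \<Longrightarrow> redH p n x i \<in> extensional (U_index p (n - 2 * i))"
  by (auto simp: redH_def redU_def)

lemma redH_eqI: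
  assumes "z \<in> carrier (hatU p n)"
    and "\<And>i w. 2 * i \<le> n \<Longrightarrow> w \<in> U_index p (n - 2 * i) \<Longrightarrow> cl (p - 1) (C (n mod 2) (p - length w)) (x (i # w)) = z i w"
  shows "redH p n x = z"
proof (rule extensionalityI[OF redH_ext(1)])
  show "z \<in> extensional {i. 2 * i \<le> n}" using assms(1) by (auto simp: direct_sum_simps PiE_iff)
  fix i assume "i \<in> {i. 2 * i \<le> n}"
  then have i: "2 * i \<le> n" by simp
  have zi: "z i \<in> extensional (U_index p (n - 2 * i))"
    using assms(1) i by (auto simp: direct_sum_simps PiE_iff U_module_def)
  show "redH p n x i = z i"
    by (rule extensionalityI[OF redH_ext(2)[OF i] zi]) (use i assms(2) redH_apply in simp)
qed

lemma cone_incl_closed: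
  assumes "t \<in> carrier (TM (p - 1) n)" shows "cone_incl p n t \<in> carrier (UM p n)"
  unfolding U_module_def direct_sum_simps cone_incl_def
proof (rule restrict_PiE_iff[THEN iffD2], rule ballI)
  fix w assume w: "w \<in> U_index p n"
  interpret module "RR (p - 1)" "base_change S (I (p - 1)) (C (n mod 2) (p - length w))"
    by (rule base_change_module[OF UC_module[OF p w] I_ideal[OF p_pred]])
  show "(if w = [] then \<zero>\<^bsub>base_change S (I (p - 1)) (C (n mod 2) p)\<^esub> else t w)
    \<in> carrier (base_change S (I (p - 1)) (C (n mod 2) (p - length w)))"
  proof (cases "w = []")
    case True
    then show ?thesis using M.zero_closed by simp
  next
    case False
    then have wT: "w \<in> T_index (p - 1) n" using T_sub_U[OF p(1) w] by blast
    then have "t w \<in> carrier (base_change S (I (p - 1)) (C (n mod 2) (p - 1 + 1 - length w)))" using assms TM_mem by blast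
    then show ?thesis using False p by simp
  qed
qed

lemma hat0_closed:
  assumes "g \<in> carrier (UM p n)"
  shows "ds_inj {i. 2 * i \<le> n} (\<lambda>i. UM p (n - 2 * i)) 0 g \<in> carrier (hatU p n)"
  using module_homD(1)[OF ds_inj_hom[OF RR_cring[OF p_pred] UM_module[OF p], of "{i. 2 * i \<le> n}" 0 "\<lambda>i. n - 2 * i"]] assms
  by simp

lemma redH_pad:
  assumes x: "x \<in> carrier (Tm (p - 1) n)"
  shows "redH p n (pad p n x) = ds_inj {i. 2 * i \<le> n} (\<lambda>i. UM p (n - 2 * i)) 0 (cone_incl p n (redT (p - 1) n x))"
proof (rule redH_eqI)
  have "redT (p - 1) n x \<in> carrier (TM (p - 1) n)" using reduction.closed[OF redT[OF p_pred] x] .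
  from hat0_closed[OF cone_incl_closed[OF this]]
  show "ds_inj {i. 2 * i \<le> n} (\<lambda>i. UM p (n - 2 * i)) 0 (cone_incl p n (redT (p - 1) n x)) \<in> carrier (hatU p n)" .
  fix i w assume i: "2 * i \<le> n" and w: "w \<in> U_index p (n - 2 * i)"
  have iw: "i # w \<in> T_index p n" using T_index_Cons[OF p(1)] i w by blast
  have Cm: "module S (C (n mod 2) (p - length w))" using UC_module[OF p w] by (simp add: parity[OF i])
  have z: "cl (p - 1) (C (n mod 2) (p - length w)) \<zero>\<^bsub>A (n mod 2)\<^esub> = \<zero>\<^bsub>base_change S (I (p - 1)) (C (n mod 2) (p - length w))\<^esub>"
    using residue_zero[OF Cm I_ideal[OF p_pred]] by simp
  show "cl (p - 1) (C (n mod 2) (p - length w)) (pad p n x (i # w))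
    = ds_inj {i. 2 * i \<le> n} (\<lambda>i. UM p (n - 2 * i)) 0 (cone_incl p n (redT (p - 1) n x)) i w"
  proof (cases "i = 0")
    case True
    show ?thesis
    proof (cases "w = []")
      case True
      then show ?thesis using \<open>i = 0\<close> iw w z by (simp add: pad_def ds_inj_def cone_incl_def T_index_eq)
    next
      case False
      then have wT: "w \<in> T_index (p - 1) n" using T_sub_U[OF p(1), of w n] w True by simp
      then show ?thesis using False True iw w p by (simp add: pad_def ds_inj_def cone_incl_def redT_def)
    qed
  next
    case False
    then show ?thesis using iw i w z UM_zero_apply[OF w] by (simp add: pad_def ds_inj_def parity[OF i])
  qed
qed

lemma UD_cone_incl:
  assumes res: "resolves (p - 1) \<delta>'" and n: "1 \<le> n" and t: "t \<in> carrier (TM (p - 1) n)"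
  shows "UD p \<delta>' n (cone_incl p n t) = cone_incl p (n - 1) (\<delta>' n t)"
proof (cases "n = 1")
  case True
  have s: "(1::nat) < 2" "(0::nat) < 2" by auto
  obtain a where a: "a \<in> F 1 (p - 1)" "t = Tid (p - 1) 1 (cl (p - 1) (AF 1 (p - 1)) a)"
    using Tid_onto[OF p_pred s(1)] t True by blast
  have aF: "a \<in> F 1 p" using AF_mono[OF s(1) _ p(2) a(1)] by simp
  have da: "d a \<in> F 0 (p - 1)" using module_homD(1)[OF d_hom[OF p_pred], of a] a(1) by simp
  have "UD p \<delta>' 1 (cone_incl p 1 t) = Uid p 0 (cl (p - 1) (AF 0 p) (d a))"
    using U_diff_1[OF p res aF] a(2) cone_incl_Tid[OF p s(1) a(1)] by simp
  also have "\<dots> = cone_incl p 0 (Tid (p - 1) 0 (cl (p - 1) (AF 0 (p - 1)) (d a)))"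
    using cone_incl_Tid[OF p s(2) da] by simp
  also have "Tid (p - 1) 0 (cl (p - 1) (AF 0 (p - 1)) (d a)) = \<delta>' 1 t"
    using res a by (simp add: resolves_def)
  finally show ?thesis using True by simp
next
  case False
  then have n2: "2 \<le> n" using n by simp
  have "t \<in> carrier (UM p n)" using t UM_eq_TM[OF p(1) n2] by simp
  then show ?thesis using U_diff_ge2(1)[OF p res n2, of t] cone_incl_ge2[OF p(1) n2 t] by simp
qed

end

definition lifts :: "nat \<Rightarrow> (nat \<Rightarrow> (nat list \<Rightarrow> 'b set) \<Rightarrow> nat list \<Rightarrow> 'b set) \<Rightarrow>
    (nat \<Rightarrow> (nat list \<Rightarrow> 'b) \<Rightarrow> nat list \<Rightarrow> 'b) \<Rightarrow> bool"
  where "lifts p \<delta> L \<longleftrightarrow> (\<forall>n\<ge>1. L n \<in> module_hom S (Tm p n) (Tm p (n - 1)) \<and>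
    (\<forall>x\<in>carrier (Tm p n). redT p (n - 1) (L n x) = \<delta> n (redT p n x)))"

text \<open>Writing \<open>L\<^sup>2\<close> as \<open>f\<^sub>1 t\<^sub>1 + \<dots> + f\<^sub>p t\<^sub>p\<close>, the condition says that \<open>t\<^sub>1, \<dots>, t\<^sub>p\<close> are jointly injective modulo \<open>m\<close>, if \<open>m\<close> contains the regular sequence.\<close>

definition detects :: "'a set \<Rightarrow> nat \<Rightarrow> (nat \<Rightarrow> (nat list \<Rightarrow> 'b) \<Rightarrow> nat list \<Rightarrow> 'b) \<Rightarrow> bool"
  where "detects m p L \<longleftrightarrow> (\<forall>n\<ge>2. \<forall>y\<in>carrier (Tm p n).
    L (n - 1) (L n y) \<in> ideal_smult S (m \<cdot>\<^bsub>S\<^esub> I p) (Tm p (n - 2)) \<longrightarrow> y \<in> ideal_smult S m (Tm p n))"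

lemma lifts_hom: "lifts p \<delta> L \<Longrightarrow> 1 \<le> n \<Longrightarrow> L n \<in> module_hom S (Tm p n) (Tm p (n - 1))"
  by (simp add: lifts_def)

lemma lifts_red: "lifts p \<delta> L \<Longrightarrow> 1 \<le> n \<Longrightarrow> x \<in> carrier (Tm p n) \<Longrightarrow> redT p (n - 1) (L n x) = \<delta> n (redT p n x)"
  by (simp add: lifts_def)

lemma lifts_comp_hom:
  assumes "lifts p \<delta> L" "2 \<le> n"
  shows "(\<lambda>y. L (n - 1) (L n y)) \<in> module_hom S (Tm p n) (Tm p (n - 2))"
proof -
  have n: "1 \<le> n" "1 \<le> n - 1" "n - 1 - 1 = n - 2" using assms(2) by auto
  show ?thesis using module_hom_comp[OF lifts_hom[OF assms(1) n(1)] lifts_hom[OF assms(1) n(2)]] unfolding n(3) .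
qed

lemma lifts_comp_in_I:
  assumes p: "p \<le> c" and L: "lifts p \<delta> L" and res: "resolves p \<delta>" and n: "2 \<le> n" and y: "y \<in> carrier (Tm p n)"
  shows "L (n - 1) (L n y) \<in> ideal_smult S (I p) (Tm p (n - 2))"
proof -
  have n1: "1 \<le> n" "1 \<le> n - 1" "n - 1 - 1 = n - 2" "n - 1 + 1 = n" using n by auto
  have Ly: "L n y \<in> carrier (Tm p (n - 1))" using module_homD(1)[OF lifts_hom[OF L n1(1)] y] .
  have "redT p (n - 1 - 1) (L (n - 1) (L n y)) = \<delta> (n - 1) (\<delta> n (redT p n y))"
    using lifts_red[OF L n1(2) Ly] lifts_red[OF L n1(1) y] by simp
  also have "\<dots> = \<zero>\<^bsub>TM p (n - 1 - 1)\<^esub>"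
  proof -
    have "redT p n y \<in> carrier (TM p (n - 1 + 1))" unfolding n1(4) by (rule reduction.closed[OF redT[OF p] y])
    then have "\<delta> (n - 1) (\<delta> (n - 1 + 1) (redT p n y)) = \<zero>\<^bsub>TM p (n - 1 - 1)\<^esub>" using res n1(2) unfolding resolves_def by blast
    then show ?thesis unfolding n1(4) .
  qed
  finally have "redT p (n - 2) (L (n - 1) (L n y)) = \<zero>\<^bsub>TM p (n - 2)\<^esub>" unfolding n1(3) .
  then show ?thesis
    using reduction.kernel[OF redT[OF p], of "L (n - 1) (L n y)" "n - 2"] module_homD(1)[OF lifts_comp_hom[OF L n] y] by simp
qed

subsection \<open>Lifts of one step\<close>

context
  fixes p and \<delta>' and \<sigma> and \<delta>'' and L
  assumes p: "1 \<le> p" "p \<le> c" and res: "resolves (p - 1) \<delta>'"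
    and hh: "higher_homotopies (RR (p - 1)) (a_elt p) (UM p) (UD p \<delta>') \<sigma>"
    and sh: "shamash_differential (RR p) (UM p) \<sigma> (TM p) (y_mult S f A B p) \<delta>''"
    and L: "lifts (p - 1) \<delta>' L"
begin

lemma pp: "p - 1 \<le> c" using p by simp

interpretation Sh: shamash_system "RR (p - 1)" "a_elt p" "UM p" "UD p \<delta>'" \<sigma> by (rule shamash[OF p res hh sh])

abbreviation "DX \<equiv> shamash_system.D (UM p) \<sigma>"

lemma hatX: "Sh.hat n = hatU p n" by (simp add: Sh.hat_def)

text \<open>On terms with \<open>y\<^sup>(\<^sup>0\<^sup>)\<close> the map \<open>D\<close> is the differential of \<open>U(p)\<close>, and on those from \<open>T(p-1)\<close> the differential of \<open>T(p-1)\<close>,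
  which \<open>L\<close> lifts.\<close>

lemma D_redH_pad:
  assumes n: "1 \<le> n" and x: "x \<in> carrier (Tm (p - 1) n)"
  shows "DX n (redH p n (pad p n x)) = redH p (n - 1) (pad p (n - 1) (L n x))"
proof -
  have Lx: "L n x \<in> carrier (Tm (p - 1) (n - 1))" using module_homD(1)[OF lifts_hom[OF L n] x] .
  let ?t = "redT (p - 1) n x"
  have t: "?t \<in> carrier (TM (p - 1) n)" using reduction.closed[OF redT[OF pp] x] .
  let ?g = "cone_incl p n ?t"
  have g: "?g \<in> carrier (UM p n)" by (rule cone_incl_closed[OF p t])
  have dt: "\<delta>' n ?t \<in> carrier (TM (p - 1) (n - 1))"
  proof -
    have "\<delta>' n \<in> module_hom (RR (p - 1)) (TM (p - 1) n) (TM (p - 1) (n - 1))" using res n unfolding resolves_def by blast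
    from module_homD(1)[OF this t] show ?thesis .
  qed
  have \<sigma>g: "\<sigma> 0 n ?g = cone_incl p (n - 1) (\<delta>' n ?t)"
    using sigma_0[OF p res hh sh n g] UD_cone_incl[OF p res n t] by simp
  have rhs: "redH p (n - 1) (pad p (n - 1) (L n x))
      = ds_inj {i. 2 * i \<le> n - 1} (\<lambda>i. UM p (n - 1 - 2 * i)) 0 (cone_incl p (n - 1) (\<delta>' n ?t))"
    unfolding redH_pad[OF p Lx] lifts_red[OF L n x] ..
  show ?thesis
    unfolding rhs redH_pad[OF p x]
  proof (rule Sh.hat_eqI[of _ "n - 1"])
    show "DX n (ds_inj {i. 2 * i \<le> n} (\<lambda>i. UM p (n - 2 * i)) 0 ?g) \<in> carrier (Sh.hat (n - 1))"
      using Sh.D_closed[OF n] hat0_closed[OF p g] unfolding hatX .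
    show "ds_inj {i. 2 * i \<le> n - 1} (\<lambda>i. UM p (n - 1 - 2 * i)) 0 (cone_incl p (n - 1) (\<delta>' n ?t)) \<in> carrier (Sh.hat (n - 1))"
      using hat0_closed[OF p cone_incl_closed[OF p dt]] unfolding hatX .
    fix i assume i: "2 * i \<le> n - 1"
    have g0: "?g \<in> carrier (UM p (n - 2 * 0))" using g by simp
    show "DX n (ds_inj {i. 2 * i \<le> n} (\<lambda>i. UM p (n - 2 * i)) 0 ?g) i
      = ds_inj {i. 2 * i \<le> n - 1} (\<lambda>i. UM p (n - 1 - 2 * i)) 0 (cone_incl p (n - 1) (\<delta>' n ?t)) i"
      using Sh.D_y_inj[OF _ g0 i n] \<sigma>g i by (simp add: Sh.y_inj_def ds_inj_def)
  qed
qed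

text \<open>A lift of \<open>D\<close> exists because \<open>Tm p n\<close> is free. On the direct summand \<open>Tm (p - 1) n\<close> it may be replaced by the lift that has
  been chosen for \<open>p - 1\<close>.\<close>

lemma lift_D_exists:
  "\<exists>L'. \<forall>n\<ge>1. L' n \<in> module_hom S (Tm p n) (Tm p (n - 1)) \<and>
    (\<forall>y\<in>carrier (Tm p n). redH p (n - 1) (L' n y) = DX n (redH p n y)) \<and>
    (\<forall>x\<in>carrier (Tm (p - 1) n). L' n (pad p n x) = pad p (n - 1) (L n x))"
proof -
  have "\<exists>g. g \<in> module_hom S (Tm p n) (Tm p (n - 1)) \<and>
    (\<forall>y\<in>carrier (Tm p n). redH p (n - 1) (g y) = DX n (redH p n y)) \<and>
    (\<forall>x\<in>carrier (Tm (p - 1) n). g (pad p n x) = pad p (n - 1) (L n x))" if n: "1 \<le> n" for n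
  proof -
    have "DX n \<in> module_hom (S Quot I (p - 1)) (hatU p n) (hatU p (n - 1))"
      using Sh.D_hom[OF n] unfolding hatX .
    from reduction.lift_exists[OF redH[OF p] Tm_free[OF p(2)] redH[OF p] this]
    obtain g0 where g0: "g0 \<in> module_hom S (Tm p n) (Tm p (n - 1))"
      "\<And>y. y \<in> carrier (Tm p n) \<Longrightarrow> redH p (n - 1) (g0 y) = DX n (redH p n y)" by blast
    note Mn = Tm_module[OF p(2), of n] and Mn1 = Tm_module[OF p(2), of "n - 1"] and M' = Tm_module[OF pp, of n] and M1' = Tm_module[OF pp, of "n - 1"]
    interpret Mn: module S "Tm p n" by (rule Mn)
    interpret Mn1: module S "Tm p (n - 1)" by (rule Mn1)
    let ?pc = "\<lambda>y. pad p n (cut p n y)"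
    have pc: "?pc \<in> module_hom S (Tm p n) (Tm p n)" by (rule module_hom_comp[OF cut_hom[OF p] pad_hom[OF p]])
    have pcadd: "additive_map (Tm p n) (Tm p n) ?pc" by (rule module_hom_additive[OF Mn Mn pc])
    let ?rest = "\<lambda>y. y \<ominus>\<^bsub>Tm p n\<^esub> ?pc y"
    have rest: "?rest \<in> module_hom S (Tm p n) (Tm p n)"
    proof (rule module_homI)
      fix x y assume xy: "x \<in> carrier (Tm p n)" "y \<in> carrier (Tm p n)"
      show "?rest (x \<oplus>\<^bsub>Tm p n\<^esub> y) = ?rest x \<oplus>\<^bsub>Tm p n\<^esub> ?rest y"
        using xy additive_closed[OF pcadd xy(1)] additive_closed[OF pcadd xy(2)] additive_add[OF pcadd xy]
        by (simp add: Mn.M.minus_eq Mn.M.minus_add Mn.M.a_ac)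
    next
      fix r x assume rx: "r \<in> carrier S" "x \<in> carrier (Tm p n)"
      show "?rest (r \<odot>\<^bsub>Tm p n\<^esub> x) = r \<odot>\<^bsub>Tm p n\<^esub> ?rest x"
        using rx additive_closed[OF pcadd rx(2)] module_homD(3)[OF pc rx]
        by (simp add: Mn.M.minus_eq Mn.smult_r_distr Mn.smult_r_minus)
    qed (use additive_closed[OF pcadd] in simp)
    let ?l = "\<lambda>y. pad p (n - 1) (L n (cut p n y))"
    have l: "?l \<in> module_hom S (Tm p n) (Tm p (n - 1))"
      by (rule module_hom_comp[OF cut_hom[OF p] module_hom_comp[OF lifts_hom[OF L n] pad_hom[OF p]]])
    have k: "(\<lambda>y. g0 (?rest y)) \<in> module_hom S (Tm p n) (Tm p (n - 1))" by (rule module_hom_comp[OF rest g0(1)])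
    \<comment> \<open>the chosen lift on the summand, an arbitrary lift on its complement\<close>
    let ?g = "\<lambda>y. ?l y \<oplus>\<^bsub>Tm p (n - 1)\<^esub> g0 (?rest y)"
    have g: "?g \<in> module_hom S (Tm p n) (Tm p (n - 1))" by (rule module_hom_add[OF Mn Mn1 l k])
    interpret H: reduction S "I (p - 1)" "Tm p n" "hatU p n" "redH p n" by (rule redH[OF p])
    interpret H1: reduction S "I (p - 1)" "Tm p (n - 1)" "hatU p (n - 1)" "redH p (n - 1)" by (rule redH[OF p])
    have Dadd: "additive_map (hatU p n) (hatU p (n - 1)) (DX n)" using Sh.D_additive[OF n] unfolding hatX .
    have "redH p (n - 1) (?g y) = DX n (redH p n y)" if y: "y \<in> carrier (Tm p n)" for y
    proof -
      have cy: "cut p n y \<in> carrier (Tm (p - 1) n)" using module_homD(1)[OF cut_hom[OF p] y] .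
      have py: "?pc y \<in> carrier (Tm p n)" using additive_closed[OF pcadd y] .
      have ry: "?rest y \<in> carrier (Tm p n)" using module_homD(1)[OF rest y] .
      have "redH p (n - 1) (?g y) = redH p (n - 1) (?l y) \<oplus>\<^bsub>hatU p (n - 1)\<^esub> redH p (n - 1) (g0 (?rest y))"
        by (rule H1.add[OF module_homD(1)[OF l y] module_homD(1)[OF k y]])
      also have "\<dots> = DX n (redH p n (?pc y)) \<oplus>\<^bsub>hatU p (n - 1)\<^esub> DX n (redH p n (?rest y))"
        unfolding g0(2)[OF ry] D_redH_pad[OF n cy] ..
      also have "\<dots> = DX n (redH p n (?pc y \<oplus>\<^bsub>Tm p n\<^esub> ?rest y))"
        unfolding H.add[OF py ry] using additive_add[OF Dadd H.closed[OF py] H.closed[OF ry]] by simp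
      also have "?pc y \<oplus>\<^bsub>Tm p n\<^esub> ?rest y = y" by (rule Mn.M.diff_add[OF y py])
      finally show ?thesis .
    qed
    moreover have "?g (pad p n x) = pad p (n - 1) (L n x)" if x: "x \<in> carrier (Tm (p - 1) n)" for x
    proof -
      have px: "pad p n x \<in> carrier (Tm p n)" using module_homD(1)[OF pad_hom[OF p] x] .
      have plx: "pad p (n - 1) (L n x) \<in> carrier (Tm p (n - 1))"
        using module_homD(1)[OF pad_hom[OF p] module_homD(1)[OF lifts_hom[OF L n] x]] .
      have "?rest (pad p n x) = \<zero>\<^bsub>Tm p n\<^esub>" unfolding cut_pad[OF p x] using px by (simp add: Mn.M.minus_eq Mn.M.r_neg)
      then have "g0 (?rest (pad p n x)) = \<zero>\<^bsub>Tm p (n - 1)\<^esub>"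
        using additive_zero[OF module_hom_additive[OF Mn Mn1 g0(1)]] by (simp only:)
      then show ?thesis unfolding cut_pad[OF p x] using Mn1.M.r_zero[OF plx] by (simp only:)
    qed
    ultimately show ?thesis using g by (intro exI[of _ ?g] conjI ballI)
  qed
  then have "\<forall>n. \<exists>g. 1 \<le> n \<longrightarrow> (g \<in> module_hom S (Tm p n) (Tm p (n - 1)) \<and>
    (\<forall>y\<in>carrier (Tm p n). redH p (n - 1) (g y) = DX n (redH p n y)) \<and>
    (\<forall>x\<in>carrier (Tm (p - 1) n). g (pad p n x) = pad p (n - 1) (L n x)))" by blast
  from choice[OF this] show ?thesis .
qed

lemma lift_is_lift:
  assumes "\<forall>n\<ge>1. L' n \<in> module_hom S (Tm p n) (Tm p (n - 1)) \<and>
    (\<forall>y\<in>carrier (Tm p n). redH p (n - 1) (L' n y) = DX n (redH p n y)) \<and> P n"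
  shows "lifts p \<delta>'' L'"
  unfolding lifts_def
proof (intro allI impI conjI ballI)
  fix n :: nat assume n: "1 \<le> n"
  show hom: "L' n \<in> module_hom S (Tm p n) (Tm p (n - 1))" using assms n by blast
  fix x assume x: "x \<in> carrier (Tm p n)"
  have Lx: "L' n x \<in> carrier (Tm p (n - 1))" by (rule module_homD(1)[OF hom x])
  have "redT p (n - 1) (L' n x) = Y p (n - 1) (DX n (redH p n x))"
    using Y_redH[OF p Lx] assms n x by simp
  also have "\<dots> = \<delta>'' n (Y p n (redH p n x))"
    using delta_Y[OF p res hh sh n reduction.closed[OF redH[OF p] x]] by simp
  finally show "redT p (n - 1) (L' n x) = \<delta>'' n (redT p n x)" using Y_redH[OF p x] by simp
qed

text \<open>Modulo \<open>I(p-1)\<close> the square of the lift is \<open>D\<^sup>2 = f\<^sub>p t\<close>.\<close>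

lemma lift_square:
  assumes L': "\<forall>n\<ge>1. L' n \<in> module_hom S (Tm p n) (Tm p (n - 1)) \<and>
    (\<forall>y\<in>carrier (Tm p n). redH p (n - 1) (L' n y) = DX n (redH p n y)) \<and> P n"
    and n: "2 \<le> n" and y: "y \<in> carrier (Tm p n)"
  shows "L' (n - 1) (L' n y) \<ominus>\<^bsub>Tm p (n - 2)\<^esub> f p \<odot>\<^bsub>Tm p (n - 2)\<^esub> shift p n y
    \<in> ideal_smult S (I (p - 1)) (Tm p (n - 2))"
proof -
  have n1: "1 \<le> n" "1 \<le> n - 1" "n - 1 - 1 = n - 2" using n by auto
  interpret H: reduction S "I (p - 1)" "Tm p (n - 2)" "hatU p (n - 2)" "redH p (n - 2)" by (rule redH[OF p])
  interpret M: module S "Tm p (n - 2)" by (rule H.M)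
  have Ly: "L' n y \<in> carrier (Tm p (n - 1))" using L' n1(1) module_homD(1)[OF _ y] by blast
  have LLy: "L' (n - 1) (L' n y) \<in> carrier (Tm p (n - 2))"
    using L' n1(2) module_homD(1)[OF _ Ly, of "L' (n - 1)" S "Tm p (n - 1 - 1)"] unfolding n1(3)[symmetric] by blast
  have sy: "shift p n y \<in> carrier (Tm p (n - 2))" by (rule shift_closed[OF p n y])
  have fs: "f p \<odot>\<^bsub>Tm p (n - 2)\<^esub> shift p n y \<in> carrier (Tm p (n - 2))" using f_closed[OF p] sy by simp
  have Hy: "redH p n y \<in> carrier (Sh.hat n)" using reduction.closed[OF redH[OF p] y] unfolding hatX .
  have "redH p (n - 1 - 1) (L' (n - 1) (L' n y)) = DX (n - 1) (redH p (n - 1) (L' n y))" using L' n1(2) Ly by blast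
  also have "redH p (n - 1) (L' n y) = DX n (redH p n y)" using L' n1(1) y by blast
  finally have "redH p (n - 1 - 1) (L' (n - 1) (L' n y)) = DX (n - 1) (DX n (redH p n y))" .
  then have 1: "redH p (n - 2) (L' (n - 1) (L' n y)) = DX (n - 1) (DX n (redH p n y))" unfolding n1(3) .
  have "DX (n - 1) (DX n (redH p n y)) = a_elt p \<odot>\<^bsub>hatU p (n - 2)\<^esub> redH p (n - 2) (shift p n y)"
  proof (rule Sh.hat_eqI[of _ "n - 2"])
    show "DX (n - 1) (DX n (redH p n y)) \<in> carrier (Sh.hat (n - 2))"
      using H.closed[OF LLy] unfolding 1 hatX .
    show "a_elt p \<odot>\<^bsub>hatU p (n - 2)\<^esub> redH p (n - 2) (shift p n y) \<in> carrier (Sh.hat (n - 2))"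
      unfolding hatX by (rule module.smult_closed[OF H.P Sh.a H.closed[OF sy]])
    fix i assume i: "2 * i \<le> n - 2"
    have i': "2 * Suc i \<le> n" "n - 2 * Suc i = n - 2 - 2 * i" using i n by auto
    have "redH p (n - 2) (shift p n y) i = redH p n y (Suc i)"
    proof (rule extensionalityI[OF redH_ext(2)[OF p i]])
      show "redH p n y (Suc i) \<in> extensional (U_index p (n - 2 - 2 * i))"
        using redH_ext(2)[OF p i'(1), of y] unfolding i'(2) .
      fix w assume w: "w \<in> U_index p (n - 2 - 2 * i)"
      have "i # w \<in> T_index p (n - 2)" using T_index_Cons[OF p(1)] i w by blast
      moreover have "(n - 2) mod 2 = n mod 2" using n by (metis le_add_diff_inverse2 mod_add_self2)
      ultimately show "redH p (n - 2) (shift p n y) i w = redH p n y (Suc i) w"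
        using redH_apply[OF p i w] redH_apply[OF p i'(1), of w y] w unfolding i'(2) by (simp add: shift_def)
    qed
    then show "DX (n - 1) (DX n (redH p n y)) i = (a_elt p \<odot>\<^bsub>hatU p (n - 2)\<^esub> redH p (n - 2) (shift p n y)) i"
      using Sh.D_D[OF n Hy i] i by (simp add: direct_sum_simps)
  qed
  also have "\<dots> = redH p (n - 2) (f p \<odot>\<^bsub>Tm p (n - 2)\<^esub> shift p n y)"
    unfolding a_elt_def by (rule H.smult[OF f_closed[OF p] sy, symmetric])
  finally show ?thesis using H.eq_iff[OF LLy fs] 1 by simp
qed

context
  fixes m
  assumes m: "ideal m S" and Im: "I c \<subseteq> m"
begin

text \<open>Modulo \<open>I(p-1)\<close>, \<open>L'\<^sup>2 y\<close> is \<open>f\<^sub>p\<close> times the shift of \<open>y\<close>; being in \<open>m I(p) Tm\<close>, it forces the shift into \<open>m Tm\<close>. The shift shows all components of \<open>y\<close>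
  with a positive power of \<open>y\<^sub>p\<close>, and the components with \<open>y\<^sub>p\<^sup>(\<^sup>0\<^sup>)\<close> form an element \<open>y\<^sub>0\<close> of \<open>Tm (p - 1) n\<close>. On the difference of \<open>y\<close> and
  \<open>y\<^sub>0\<close>, which is in \<open>m Tm\<close>, the square takes values in \<open>m I(p) Tm\<close>; so \<open>L\<^sup>2 y\<^sub>0\<close> has coordinates in
  \<open>m I(p) \<inter> I(p-1) \<subseteq> m I(p-1)\<close>, and the hypothesis on \<open>L\<close> applies to \<open>y\<^sub>0\<close>.\<close>

lemma detects_step:
  assumes L': "\<forall>n\<ge>1. L' n \<in> module_hom S (Tm p n) (Tm p (n - 1)) \<and>
    (\<forall>y\<in>carrier (Tm p n). redH p (n - 1) (L' n y) = DX n (redH p n y)) \<and>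
    (\<forall>x\<in>carrier (Tm (p - 1) n). L' n (pad p n x) = pad p (n - 1) (L n x))"
    and res'': "resolves p \<delta>''" and det: "detects m (p - 1) L"
  shows "detects m p L'"
  unfolding detects_def
proof (intro allI impI ballI)
  fix n y assume n: "2 \<le> n" and y: "y \<in> carrier (Tm p n)"
    and LLy: "L' (n - 1) (L' n y) \<in> ideal_smult S (m \<cdot>\<^bsub>S\<^esub> I p) (Tm p (n - 2))"
  have n1: "1 \<le> n" "1 \<le> n - 1" "n - 1 - 1 = n - 2" using n by auto
  have lifts': "lifts p \<delta>'' L'" by (rule lift_is_lift[OF L'])
  note M = Tm_module[OF p(2)] and M' = Tm_module[OF pp]
  note mIp = mI_ideal[OF m Im p(2)] and mIp1 = mI_ideal[OF m Im pp] and Ip1 = I_ideal[OF pp] and Ip = I_ideal[OF p(2)]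
  let ?K = "m \<cdot>\<^bsub>S\<^esub> I p <+>\<^bsub>S\<^esub> I (p - 1)"
  have K: "ideal ?K S" by (rule S.add_ideals[OF mIp Ip1])
  have z: "\<zero>\<^bsub>S\<^esub> \<in> m \<cdot>\<^bsub>S\<^esub> I p" "\<zero>\<^bsub>S\<^esub> \<in> I (p - 1)"
    using mIp Ip1 by (auto simp: ideal_def additive_subgroup.zero_closed)
  have sub1: "m \<cdot>\<^bsub>S\<^esub> I p \<subseteq> ?K"
  proof
    fix r assume r: "r \<in> m \<cdot>\<^bsub>S\<^esub> I p"
    then have "r = r \<oplus>\<^bsub>S\<^esub> \<zero>\<^bsub>S\<^esub>" using ideal.Icarr[OF mIp] by simp
    then show "r \<in> ?K" using r z by (auto simp: set_add_def set_mult_def)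
  qed
  have sub2: "I (p - 1) \<subseteq> ?K"
  proof
    fix r assume r: "r \<in> I (p - 1)"
    then have "r = \<zero>\<^bsub>S\<^esub> \<oplus>\<^bsub>S\<^esub> r" using ideal.Icarr[OF Ip1] by simp
    then show "r \<in> ?K" using r z by (auto simp: set_add_def set_mult_def)
  qed
  interpret M0: module S "Tm p (n - 2)" by (rule M)
  interpret Mn: module S "Tm p n" by (rule M)
  let ?v = "f p \<odot>\<^bsub>Tm p (n - 2)\<^esub> shift p n y" and ?u = "L' (n - 1) (L' n y)"
  have sy: "shift p n y \<in> carrier (Tm p (n - 2))" by (rule shift_closed[OF p n y])
  have vc: "?v \<in> carrier (Tm p (n - 2))" using f_closed[OF p] sy by simp
  have uc: "?u \<in> carrier (Tm p (n - 2))" using module_homD(1)[OF lifts_comp_hom[OF lifts' n] y] .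
  note KD = ideal_smultD[OF M K]
  have "?v = ?u \<ominus>\<^bsub>Tm p (n - 2)\<^esub> (?u \<ominus>\<^bsub>Tm p (n - 2)\<^esub> ?v)" using M0.M.diff_diff[OF uc vc] by simp
  also have "\<dots> \<in> ideal_smult S ?K (Tm p (n - 2))"
    using KD(5)[OF ideal_smult_mono[OF M K sub1 LLy] ideal_smult_mono[OF M K sub2 lift_square[OF L' n y]]] .
  finally have sm: "shift p n y \<in> ideal_smult S m (Tm p (n - 2))"
    by (rule fg_free_divide[OF Tm_free[OF p(2)] K m f_closed[OF p] sy _ f_times_in_mI[OF m Im p]])
  let ?y0 = "cut p n y"
  have y0: "?y0 \<in> carrier (Tm (p - 1) n)" using module_homD(1)[OF cut_hom[OF p] y] .
  have py0: "pad p n ?y0 \<in> carrier (Tm p n)" using module_homD(1)[OF pad_hom[OF p] y0] .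
  let ?r = "y \<ominus>\<^bsub>Tm p n\<^esub> pad p n ?y0"
  have rc: "?r \<in> carrier (Tm p n)" using y py0 by simp
  have r: "?r \<in> ideal_smult S m (Tm p n)"
    unfolding Tm_ideal_iff[OF p(2) m rc]
  proof
    fix w assume w: "w \<in> T_index p n"
    let ?C = "C (n mod 2) (p + 1 - length w)"
    interpret Cm: module S ?C by (rule TC_module[OF p(2) w])
    note mD = ideal_smultD[OF Cm.module_axioms m]
    have yw: "y w \<in> carrier ?C" using y w by (simp add: Tm_mem)
    have rw: "?r w = y w \<ominus>\<^bsub>?C\<^esub> pad p n ?y0 w"
      by (rule additive_diff[OF module_hom_additive[OF M Cm.module_axioms Tm_proj_hom[OF p(2) w]] y py0])
    \<comment> \<open>the words with first letter 0 are removed from \<open>y\<close>; those with a positive first letter occur in the shift\<close>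
    show "?r w \<in> ideal_smult S m ?C"
    proof (cases "hd w = 0")
      case True
      have w0: "w = 0 # tl w" "tl w \<in> T_index (p - 1) n"
        using w True n by (cases w; auto simp: T_index_eq)+
      then have "pad p n ?y0 w = y w" using w True by (simp add: pad_def cut_def)
      moreover have "y w \<ominus>\<^bsub>?C\<^esub> y w = \<zero>\<^bsub>?C\<^esub>" using Cm.M.r_neg[OF yw] unfolding Cm.M.minus_eq .
      ultimately show ?thesis unfolding rw using mD(2) by (simp only:)
    next
      case False
      then have pz: "pad p n ?y0 w = \<zero>\<^bsub>?C\<^esub>" using w by (simp add: pad_def)
      let ?w = "(hd w - 1) # tl w"
      have w': "?w \<in> T_index p (n - 2)" "Suc (hd ?w) # tl ?w = w" "length ?w = length w"
        using w False by (cases w; auto simp: T_index_eq)+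
      have par: "(n - 2) mod 2 = n mod 2" using n by (metis le_add_diff_inverse2 mod_add_self2)
      have "shift p n y ?w \<in> ideal_smult S m (C ((n - 2) mod 2) (p + 1 - length ?w))"
        using sm w'(1) unfolding Tm_ideal_iff[OF p(2) m sy] by blast
      moreover have "y (Suc (hd ?w) # tl ?w) = y w" by (simp only: w'(2))
      then have "shift p n y ?w = y w" using w'(1) by (simp add: shift_def)
      ultimately have yi: "y w \<in> ideal_smult S m ?C" unfolding par w'(3) by simp
      show ?thesis unfolding rw pz using mD(5)[OF yi mD(2)] .
    qed
  qed
  have L'2: "(\<lambda>y. L' (n - 1) (L' n y)) \<in> module_hom S (Tm p n) (Tm p (n - 2))" by (rule lifts_comp_hom[OF lifts' n])
  have "L' (n - 1) (L' n ?r) \<in> ideal_smult S (I p \<cdot>\<^bsub>S\<^esub> m) (Tm p (n - 2))"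
    by (rule ideal_smult_hom_prod[OF M M L'2 m Ip lifts_comp_in_I[OF p(2) lifts' res'' n] r])
  then have LLr: "L' (n - 1) (L' n ?r) \<in> ideal_smult S (m \<cdot>\<^bsub>S\<^esub> I p) (Tm p (n - 2))"
    using S.ideal_prod_commute[OF m Ip] by simp
  have add: "additive_map (Tm p n) (Tm p (n - 2)) (\<lambda>y. L' (n - 1) (L' n y))" by (rule module_hom_additive[OF M M L'2])
  note mD = ideal_smultD[OF M mIp]
  have Ly0: "L n ?y0 \<in> carrier (Tm (p - 1) (n - 1))" using module_homD(1)[OF lifts_hom[OF L n1(1)] y0] .
  let ?x = "L (n - 1) (L n ?y0)"
  have x: "?x \<in> carrier (Tm (p - 1) (n - 2))" using module_homD(1)[OF lifts_comp_hom[OF L n] y0] .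
  have "L' n (pad p n ?y0) = pad p (n - 1) (L n ?y0)" using L' n1(1) y0 by blast
  moreover have "L' (n - 1) (pad p (n - 1) (L n ?y0)) = pad p (n - 1 - 1) ?x" using L' n1(2) Ly0 by blast
  ultimately have "L' (n - 1) (L' n (pad p n ?y0)) = pad p (n - 1 - 1) ?x" by simp
  then have e: "L' (n - 1) (L' n (pad p n ?y0)) = pad p (n - 2) ?x" unfolding n1(3) .
  have "pad p n ?y0 = y \<ominus>\<^bsub>Tm p n\<^esub> ?r" using Mn.M.diff_diff[OF y py0] by simp
  then have "pad p (n - 2) ?x = ?u \<ominus>\<^bsub>Tm p (n - 2)\<^esub> L' (n - 1) (L' n ?r)"
    using additive_diff[OF add y rc] e by simp
  also have "\<dots> \<in> ideal_smult S (m \<cdot>\<^bsub>S\<^esub> I p) (Tm p (n - 2))" using mD(5)[OF LLy LLr] .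
  finally have "cut p (n - 2) (pad p (n - 2) ?x) \<in> ideal_smult S (m \<cdot>\<^bsub>S\<^esub> I p) (Tm (p - 1) (n - 2))"
    by (rule ideal_smult_hom[OF M M' cut_hom[OF p] _ mIp])
  then have x1: "?x \<in> ideal_smult S (m \<cdot>\<^bsub>S\<^esub> I p) (Tm (p - 1) (n - 2))" unfolding cut_pad[OF p x] .
  have x2: "?x \<in> ideal_smult S (I (p - 1)) (Tm (p - 1) (n - 2))" by (rule lifts_comp_in_I[OF pp L res n y0])
  have "?x \<in> ideal_smult S (m \<cdot>\<^bsub>S\<^esub> I (p - 1)) (Tm (p - 1) (n - 2))"
    by (rule fg_free_Int[OF Tm_free[OF pp] mIp Ip1 x1 x2 mIp1 mI_Int[OF m Im p]])
  then have "?y0 \<in> ideal_smult S m (Tm (p - 1) n)" using det n y0 unfolding detects_def by blast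
  then have "pad p n ?y0 \<in> ideal_smult S m (Tm p n)" by (rule ideal_smult_hom[OF M' M pad_hom[OF p] _ m])
  then have "pad p n ?y0 \<oplus>\<^bsub>Tm p n\<^esub> ?r \<in> ideal_smult S m (Tm p n)" using ideal_smultD(3)[OF M m] r by blast
  then show "y \<in> ideal_smult S m (Tm p n)" using Mn.M.diff_add[OF y py0] by simp
qed

end

end

lemma lifts_exist:
  assumes con: "T_construction S f c A F d h B \<sigma> \<delta>" and m: "ideal m S" and Im: "I c \<subseteq> m"
  shows "p \<le> c \<Longrightarrow> \<exists>L. lifts p (from_0 \<delta> p) L \<and> detects m p L"
proof (induction p)
  case 0
  have T0: "x = \<zero>\<^bsub>Tm 0 n\<^esub>" if "x \<in> carrier (Tm 0 n)" for x n
    using that by (auto simp: Tm_def direct_sum_simps)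
  have M: "module S (Tm 0 n)" for n by (rule Tm_module) simp
  let ?L = "\<lambda>n x. \<zero>\<^bsub>Tm 0 (n - 1)\<^esub>"
  have "lifts 0 (from_0 \<delta> 0) ?L"
    unfolding lifts_def from_0_def if_P[OF refl]
    using module_hom_zero_map[OF M] additive_zero[OF reduction.additive_map[OF redT[of 0]], OF le0] by blast
  moreover have "detects m 0 ?L"
    unfolding detects_def using T0 ideal_smultD(2)[OF M m] by metis
  ultimately show ?case by blast
next
  case (Suc p)
  have p: "1 \<le> Suc p" "Suc p \<le> c" using Suc.prems by auto
  obtain L where L: "lifts (Suc p - 1) (from_0 \<delta> (Suc p - 1)) L" "detects m (Suc p - 1) L" using Suc by auto
  have res: "resolves (Suc p - 1) (from_0 \<delta> (Suc p - 1))" "resolves (Suc p) (from_0 \<delta> (Suc p))"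
    using resolves_all[OF con, of "Suc p - 1"] resolves_all[OF con p(2)] p by auto
  note con' = construction[OF con p]
  from lift_D_exists[OF p res(1) con'(1,2) L(1)] obtain L' where
    L': "\<forall>n\<ge>1. L' n \<in> module_hom S (Tm (Suc p) n) (Tm (Suc p) (n - 1)) \<and>
      (\<forall>y\<in>carrier (Tm (Suc p) n). redH (Suc p) (n - 1) (L' n y) = shamash_system.D (UM (Suc p)) (\<sigma> (Suc p)) n (redH (Suc p) n y)) \<and>
      (\<forall>x\<in>carrier (Tm (Suc p - 1) n). L' n (pad (Suc p) n x) = pad (Suc p) (n - 1) (L n x))" by blast
  show ?case
    using lift_is_lift[OF p res(1) con'(1,2) L(1) L'] detects_step[OF p res(1) con'(1,2) L(1) m Im L' res(2) L(2)] by blast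
qed

text \<open>For \<open>n \<ge> 3\<close> the threefold composite \<open>L (L (L x))\<close> is \<open>L\<close> applied to an element of \<open>I(p) Tm\<close>, where \<open>L\<close> acts in degree
  \<open>n - 2\<close> and has values in \<open>m Tm\<close> by induction. It is also \<open>L\<^sup>2\<close> applied to \<open>L x\<close>, so \<open>detects\<close> gives \<open>L x \<in> m Tm\<close>.\<close>

lemma minimal_from_degree_2:
  assumes p: "p \<le> c" and L: "lifts p \<delta> L" and res: "resolves p \<delta>" and m: "ideal m S" and det: "detects m p L"
    and L1: "\<And>x. x \<in> carrier (Tm p 1) \<Longrightarrow> L 1 x \<in> ideal_smult S m (Tm p 0)"
    and L2: "\<And>x. x \<in> carrier (Tm p 2) \<Longrightarrow> L 2 x \<in> ideal_smult S m (Tm p 1)"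
  shows "1 \<le> n \<Longrightarrow> x \<in> carrier (Tm p n) \<Longrightarrow> L n x \<in> ideal_smult S m (Tm p (n - 1))"
proof (induction n arbitrary: x rule: less_induct)
  case (less n)
  consider "n = 1" | "n = 2" | "3 \<le> n" using less.prems(1) by linarith
  then show ?case
  proof cases
    case 3
    have n: "2 \<le> n" "2 \<le> n - 1" "1 \<le> n" "1 \<le> n - 2" "n - 2 < n" "n - 1 - 1 = n - 2" "n - 1 - 2 = n - 2 - 1" using 3 by auto
    note M = Tm_module[OF p]
    have Lx: "L n x \<in> carrier (Tm p (n - 1))" using module_homD(1)[OF lifts_hom[OF L n(3)] less.prems(2)] .
    have "L (n - 2) (L (n - 1) (L n x)) \<in> ideal_smult S (m \<cdot>\<^bsub>S\<^esub> I p) (Tm p (n - 2 - 1))"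
      by (rule ideal_smult_hom_prod[OF M M lifts_hom[OF L n(4)] I_ideal[OF p] m less.IH[OF n(5,4)]
            lifts_comp_in_I[OF p L res n(1) less.prems(2)]])
    then have "L (n - 1 - 1) (L (n - 1) (L n x)) \<in> ideal_smult S (m \<cdot>\<^bsub>S\<^esub> I p) (Tm p (n - 1 - 2))"
      unfolding n(6,7) .
    then show ?thesis using det n(2) Lx unfolding detects_def by blast
  qed (use less.prems L1 L2 in auto)
qed

section \<open>The resolution and its minimality\<close>

subsection \<open>The first two differentials and exactness\<close>

lemma base_change_AF:
  assumes "p \<le> c" "s < 2"
  shows "reduction S (I p) (AF s p) (base_change S (I p) (AF s p)) (cl p (AF s p))"
  using base_change_reduction[OF AF_module[OF assms(2,1)] I_ideal[OF assms(1)]] .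

lemma RA_carrier: "p \<le> c \<Longrightarrow> s < 2 \<Longrightarrow> carrier (base_change S (I p) (AF s p)) = cl p (AF s p) ` F s p"
  using residue_carrier[OF AF_module I_ideal] by simp

lemma Rd_class:
  assumes "p \<le> c" "x \<in> F 1 p"
  shows "Rd S f A F d p (cl p (AF 1 p) x) = cl p (AF 0 p) (d x)"
  unfolding Rd_def
  using base_change_map_residue[OF AF_module[of 1 p] AF_module[of 0 p] I_ideal I_ideal subset_refl d_hom] assms by simp

lemma Rd_hom:
  assumes p: "p \<le> c"
  shows "Rd S f A F d p \<in> module_hom (RR p) (base_change S (I p) (AF 1 p)) (base_change S (I p) (AF 0 p))"
  by (rule reduction_induced_hom[OF base_change_AF[OF p] base_change_AF[OF p] d_hom[OF p]]) (use Rd_class[OF p] in auto)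

lemma first_differential:
  assumes p: "p \<le> c" and res: "resolves p \<delta>"
  shows "is_map_via (RR p) (TM p 1) (TM p 0) (\<delta> 1) (Tid p 1) (Tid p 0)
    (base_change S (I p) (AF 1 p)) (base_change S (I p) (AF 0 p)) (Rd S f A F d p)"
  unfolding is_map_via_def
proof (intro conjI ballI)
  fix X assume "X \<in> carrier (base_change S (I p) (AF 1 p))"
  then obtain x where x: "x \<in> F 1 p" "X = cl p (AF 1 p) x" using RA_carrier[OF p, of 1] by auto
  show "\<delta> 1 (Tid p 1 X) = Tid p 0 (Rd S f A F d p X)"
    using res x(1) unfolding x(2) Rd_class[OF p x(1)] resolves_def by blast
qed (use Tid_iso[OF p] Rd_hom[OF p] in auto)

lemma base_change_Hs: "p \<le> c \<Longrightarrow> reduction S (I p) (Hs p) (base_change S (I p) (Hs p)) (residue S (I p) (Hs p))"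
  using base_change_reduction[OF Hs_module I_ideal] .

lemma h_row_class:
  assumes "p \<le> c" "v \<in> carrier (Hs p)"
  shows "base_change_map S (I p) (AF 1 p) (h_row A h p) (residue S (I p) (Hs p) v) = cl p (AF 1 p) (h_row A h p v)"
  using base_change_map_residue[OF Hs_module AF_module[of 1 p] I_ideal I_ideal subset_refl h_row_hom] assms by simp

lemma second_differential:
  assumes p: "p \<le> c" and sec: "second_is_h p \<delta>"
  shows "is_map_via (RR p) (TM p 2) (TM p 1) (\<delta> 2) (T2id p) (Tid p 1)
    (base_change S (I p) (Hs p)) (base_change S (I p) (AF 1 p)) (base_change_map S (I p) (AF 1 p) (h_row A h p))"
  unfolding is_map_via_def
proof (intro conjI ballI)
  show "base_change_map S (I p) (AF 1 p) (h_row A h p)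
      \<in> module_hom (RR p) (base_change S (I p) (Hs p)) (base_change S (I p) (AF 1 p))"
    by (rule reduction_induced_hom[OF base_change_Hs[OF p] base_change_AF[OF p] h_row_hom[OF p]]) (use h_row_class[OF p] in auto)
  fix X assume "X \<in> carrier (base_change S (I p) (Hs p))"
  then obtain v where v: "v \<in> carrier (Hs p)" "X = residue S (I p) (Hs p) v" unfolding residue_carrier[OF Hs_module[OF p] I_ideal[OF p]] by blast
  show "\<delta> 2 (T2id p X) = Tid p 1 (base_change_map S (I p) (AF 1 p) (h_row A h p) X)"
    using sec v(1) unfolding v(2) h_row_class[OF p v(1)] second_is_h_def by blast
qed (use Tid_iso[OF p] T2id_iso[OF p] in auto)

text \<open>The augmentation is the inverse of the identification \<open>R(p) \<otimes> A\<^sub>0(p) \<cong> T\<^sub>0(p)\<close> followed by the projection to the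
  cokernel.\<close>

lemma is_free_resolution:
  assumes p: "p \<le> c" and res: "resolves p \<delta>"
  shows "free_resolution (RR p) (TM p) \<delta> (hmf_module S f A F d p)"
  unfolding free_resolution_def
proof (intro conjI allI impI)
  fix n :: nat
  show "fg_free (RR p) (TM p n)" by (rule TM_free[OF p])
  assume n: "1 \<le> n"
  show "\<delta> n \<in> module_hom (RR p) (TM p n) (TM p (n - 1))" using res n unfolding resolves_def by blast
  have hom: "\<delta> (n + 1) \<in> module_hom (RR p) (TM p (n + 1)) (TM p (n + 1 - 1))"
    using res le_add2[of 1 n] unfolding resolves_def by blast
  show "\<delta> (n + 1) ` carrier (TM p (n + 1)) = {x \<in> carrier (TM p n). \<delta> n x = \<zero>\<^bsub>TM p (n - 1)\<^esub>}"
  proof (intro equalityI subsetI)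
    fix x assume "x \<in> \<delta> (n + 1) ` carrier (TM p (n + 1))"
    then obtain y where y: "y \<in> carrier (TM p (n + 1))" "x = \<delta> (n + 1) y" by blast
    have "x \<in> carrier (TM p n)" using module_homD(1)[OF hom y(1)] y(2) by simp
    moreover have "\<delta> n x = \<zero>\<^bsub>TM p (n - 1)\<^esub>" unfolding y(2) using res n y(1) unfolding resolves_def by blast
    ultimately show "x \<in> {x \<in> carrier (TM p n). \<delta> n x = \<zero>\<^bsub>TM p (n - 1)\<^esub>}" by blast
  next
    fix x assume "x \<in> {x \<in> carrier (TM p n). \<delta> n x = \<zero>\<^bsub>TM p (n - 1)\<^esub>}"
    then have "\<exists>y\<in>carrier (TM p (n + 1)). \<delta> (n + 1) y = x" using res n unfolding resolves_def by blast
    then show "x \<in> \<delta> (n + 1) ` carrier (TM p (n + 1))" by blast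
  qed
next
  let ?A = "base_change S (I p) (AF 0 p)"
  let ?N = "Rd S f A F d p ` carrier (base_change S (I p) (AF 1 p))"
  have A: "module (RR p) ?A" and A1: "module (RR p) (base_change S (I p) (AF 1 p))"
    using base_change_AF[OF p] by (auto simp: reduction_def)
  have N: "submodule ?N (RR p) ?A" by (rule hom_image_submodule[OF A1 A Rd_hom[OF p]])
  note q = quot_module_hom[OF A N]
  have iso: "Tid p 0 \<in> module_iso (RR p) ?A (TM p 0)" by (rule Tid_iso[OF p]) simp
  let ?inv = "inv_into (carrier ?A) (Tid p 0)"
  let ?\<epsilon> = "\<lambda>u. ?N +>\<^bsub>?A\<^esub> ?inv u"
  have M: "hmf_module S f A F d p = quot_module ?A ?N" by (simp add: hmf_module_def RA_def)
  have inv: "?inv \<in> module_hom (RR p) (TM p 0) ?A"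
    using module_iso_inverse[OF A iso] by (simp add: module_iso_def)
  have \<epsilon>: "?\<epsilon> \<in> module_hom (RR p) (TM p 0) (quot_module ?A ?N)" by (rule module_hom_comp[OF inv q(1)])
  have inj: "inj_on (Tid p 0) (carrier ?A)" and im: "Tid p 0 ` carrier ?A = carrier (TM p 0)"
    using iso by (auto simp: module_iso_def bij_betw_def)
  have inv_Tid: "?inv (Tid p 0 X) = X" if "X \<in> carrier ?A" for X by (rule inv_into_f_f[OF inj that])
  have Tid_inv: "Tid p 0 (?inv u) = u" "?inv u \<in> carrier ?A" if "u \<in> carrier (TM p 0)" for u
    using that f_inv_into_f[of u "Tid p 0" "carrier ?A"] inv_into_into[of u "Tid p 0" "carrier ?A"] unfolding im by auto
  have N_eq: "?N = {cl p (AF 0 p) (d x) |x. x \<in> F 1 p}"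
    using Rd_class[OF p] RA_carrier[OF p, of 1] by auto
  show "\<exists>\<epsilon>\<in>module_hom (RR p) (TM p 0) (hmf_module S f A F d p).
      \<epsilon> ` carrier (TM p 0) = carrier (hmf_module S f A F d p) \<and>
      \<delta> 1 ` carrier (TM p 1) = {x \<in> carrier (TM p 0). \<epsilon> x = \<zero>\<^bsub>hmf_module S f A F d p\<^esub>}"
    unfolding M
  proof (intro bexI[of _ ?\<epsilon>] conjI \<epsilon> equalityI subsetI)
    fix y assume "y \<in> ?\<epsilon> ` carrier (TM p 0)"
    then show "y \<in> carrier (quot_module ?A ?N)" using module_homD(1)[OF \<epsilon>] by blast
  next
    fix y assume "y \<in> carrier (quot_module ?A ?N)"
    then obtain X where X: "X \<in> carrier ?A" "?N +>\<^bsub>?A\<^esub> X = y" using q(2) by blast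
    then have "?\<epsilon> (Tid p 0 X) = y" using inv_Tid by simp
    moreover have "Tid p 0 X \<in> carrier (TM p 0)" using X(1) im by blast
    ultimately show "y \<in> ?\<epsilon> ` carrier (TM p 0)" by blast
  next
    fix u assume "u \<in> \<delta> 1 ` carrier (TM p 1)"
    then obtain x where x: "x \<in> F 1 p" "u = \<delta> 1 (Tid p 1 (cl p (AF 1 p) x))" using Tid_onto[OF p, of 1] by auto
    have u: "u = Tid p 0 (cl p (AF 0 p) (d x))" using res x unfolding resolves_def by blast
    have dx: "cl p (AF 0 p) (d x) \<in> ?N" using x(1) N_eq by blast
    have dxA: "cl p (AF 0 p) (d x) \<in> carrier ?A"
      using module_homD(1)[OF d_hom[OF p], of x] RA_carrier[OF p, of 0] x(1) by simp
    have "?\<epsilon> u = \<zero>\<^bsub>quot_module ?A ?N\<^esub>" unfolding u inv_Tid[OF dxA] using q(3)[OF dxA] dx by simp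
    moreover have "u \<in> carrier (TM p 0)" unfolding u using dxA im by blast
    ultimately show "u \<in> {u \<in> carrier (TM p 0). ?\<epsilon> u = \<zero>\<^bsub>quot_module ?A ?N\<^esub>}" by blast
  next
    fix u assume "u \<in> {u \<in> carrier (TM p 0). ?\<epsilon> u = \<zero>\<^bsub>quot_module ?A ?N\<^esub>}"
    then have u: "u \<in> carrier (TM p 0)" "?\<epsilon> u = \<zero>\<^bsub>quot_module ?A ?N\<^esub>" by auto
    then have "?inv u \<in> ?N" using q(3)[OF Tid_inv(2)[OF u(1)]] by simp
    then obtain x where x: "x \<in> F 1 p" "?inv u = cl p (AF 0 p) (d x)" unfolding N_eq by blast
    have "u = Tid p 0 (cl p (AF 0 p) (d x))" using Tid_inv(1)[OF u(1)] x(2) by simp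
    also have "\<dots> = \<delta> 1 (Tid p 1 (cl p (AF 1 p) x))" using res x(1) unfolding resolves_def by simp
    finally show "u \<in> \<delta> 1 ` carrier (TM p 1)" using Tid_closed[OF p _ x(1)] by simp
  qed
qed

subsection \<open>Minimality\<close>

context
  fixes p
  assumes p: "p \<le> c" and loc: "local_ring S" and noeth: "noetherian_ring S"
begin

private abbreviation "mS \<equiv> max_ideal S"
private abbreviation "mR \<equiv> max_ideal (RR p)"

lemma mS_ideal: "ideal mS S"
  using max_ideal_local(1)[OF loc noeth] by (simp add: maximalideal_def)

lemma I_in_mS: "q \<le> c \<Longrightarrow> I q \<subseteq> mS"
  using max_ideal_local(2)[OF loc noeth I_ideal I_proper] .

lemma mR_eq: "mR = (\<lambda>r. I p +>\<^bsub>S\<^esub> r) ` mS" and mR_ideal: "ideal ((\<lambda>r. I p +>\<^bsub>S\<^esub> r) ` mS) (RR p)"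
  using max_ideal_quotient[OF loc noeth I_ideal[OF p] I_proper[OF p]] .

text \<open>The maximal ideal contains \<open>I(p)\<close>, so minimality over \<open>R(p)\<close> can be tested on representatives.\<close>

lemma redT_small_iff:
  "x \<in> carrier (Tm p n) \<Longrightarrow> redT p n x \<in> ideal_smult (RR p) mR (TM p n) \<longleftrightarrow> x \<in> ideal_smult S mS (Tm p n)"
  unfolding mR_eq using reduction.ideal_smult_iff[OF redT[OF p] mS_ideal I_in_mS[OF p] _ mR_ideal] .

lemma Tid_small_iff:
  assumes s: "s < 2" and x: "x \<in> F s p"
  shows "Tid p s (cl p (AF s p) x) \<in> ideal_smult (RR p) mR (TM p s) \<longleftrightarrow> x \<in> ideal_smult S mS (AF s p)"
proof -
  interpret red: reduction S "I p" "AF s p" "base_change S (I p) (AF s p)" "cl p (AF s p)" by (rule base_change_AF[OF p s])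
  have xc: "x \<in> carrier (AF s p)" using x by simp
  show ?thesis
    using module_iso_ideal_smult_iff[OF red.P TM_module[OF p] Tid_iso[OF p s] mR_ideal red.closed[OF xc]]
      red.ideal_smult_iff[OF mS_ideal I_in_mS[OF p] xc mR_ideal] unfolding mR_eq by simp
qed

text \<open>Every element of \<open>T\<^sub>1(p)\<close> and of \<open>T\<^sub>2(p)\<close> comes from \<open>A\<^sub>1(p)\<close> and from \<open>A\<^sub>0(1) \<oplus> \<dots> \<oplus> A\<^sub>0(p)\<close>, so minimality of the first two
  differentials is that of \<open>d\<^sub>p\<close> and \<open>h(p)\<close>; the other degrees follow from these.\<close>

lemma minimal_iff:
  assumes res: "resolves p \<delta>" and sec: "second_is_h p \<delta>" and L: "lifts p \<delta> L" and det: "detects mS p L"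
  shows "(\<forall>n\<ge>1. \<delta> n ` carrier (TM p n) \<subseteq> ideal_smult (RR p) mR (TM p (n - 1))) \<longleftrightarrow> hmf_minimal S A F d h p"
proof
  have hF: "h_row A h p v \<in> F 1 p" if "v \<in> carrier (Hs p)" for v by (rule h_row_in_F[OF p that])
  have dF: "d x \<in> F 0 p" if "x \<in> F 1 p" for x using module_homD(1)[OF d_hom[OF p], of x] that by simp
  have first: "\<delta> 1 (Tid p 1 (cl p (AF 1 p) x)) \<in> ideal_smult (RR p) mR (TM p 0) \<longleftrightarrow> d x \<in> ideal_smult S mS (AF 0 p)"
    if x: "x \<in> F 1 p" for x
  proof -
    have "\<delta> 1 (Tid p 1 (cl p (AF 1 p) x)) = Tid p 0 (cl p (AF 0 p) (d x))" using res x unfolding resolves_def by blast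
    then show ?thesis using Tid_small_iff[OF _ dF[OF x]] by simp
  qed
  have second: "\<delta> 2 (T2id p (residue S (I p) (Hs p) v)) \<in> ideal_smult (RR p) mR (TM p 1)
      \<longleftrightarrow> h_row A h p v \<in> ideal_smult S mS (AF 1 p)" if v: "v \<in> carrier (Hs p)" for v
  proof -
    have "\<delta> 2 (T2id p (residue S (I p) (Hs p) v)) = Tid p 1 (cl p (AF 1 p) (h_row A h p v))"
      using sec v unfolding second_is_h_def by blast
    then show ?thesis using Tid_small_iff[OF _ hF[OF v]] by simp
  qed
  {
    assume min: "\<forall>n\<ge>1. \<delta> n ` carrier (TM p n) \<subseteq> ideal_smult (RR p) mR (TM p (n - 1))"
    have m1: "\<delta> 1 ` carrier (TM p 1) \<subseteq> ideal_smult (RR p) mR (TM p 0)" using min[rule_format, of 1] by simp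
    have m2: "\<delta> 2 ` carrier (TM p 2) \<subseteq> ideal_smult (RR p) mR (TM p 1)" using min[rule_format, of 2] by simp
    have "d x \<in> ideal_smult S mS (AF 0 p)" if x: "x \<in> F 1 p" for x
      using m1 first[OF x] Tid_closed[OF p _ x] by (auto simp: image_subset_iff)
    moreover have "h_row A h p v \<in> ideal_smult S mS (AF 1 p)" if v: "v \<in> carrier (Hs p)" for v
      using m2 second[OF v] T2id_closed[OF p v] by (auto simp: image_subset_iff)
    ultimately show "hmf_minimal S A F d h p" unfolding hmf_minimal_def by blast
  next
    assume "hmf_minimal S A F d h p"
    then have dm: "\<And>x. x \<in> F 1 p \<Longrightarrow> d x \<in> ideal_smult S mS (AF 0 p)"
      and hm: "\<And>v. v \<in> carrier (Hs p) \<Longrightarrow> h_row A h p v \<in> ideal_smult S mS (AF 1 p)"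
      unfolding hmf_minimal_def by auto
    have cT: "redT p n x \<in> carrier (TM p n)" if "x \<in> carrier (Tm p n)" for n x
      by (rule reduction.closed[OF redT[OF p] that])
    have cL: "L n x \<in> carrier (Tm p (n - 1))" if "1 \<le> n" "x \<in> carrier (Tm p n)" for n x
      using module_homD(1)[OF lifts_hom[OF L that(1)] that(2)] .
    have L1: "L 1 x \<in> ideal_smult S mS (Tm p 0)" if x: "x \<in> carrier (Tm p 1)" for x
    proof -
      obtain a where a: "a \<in> F 1 p" "redT p 1 x = Tid p 1 (cl p (AF 1 p) a)" using Tid_onto[OF p _ cT[OF x]] by auto
      have "\<delta> 1 (redT p 1 x) \<in> ideal_smult (RR p) mR (TM p 0)" unfolding a(2) using first[OF a(1)] dm[OF a(1)] by simp
      then show ?thesis using lifts_red[OF L _ x] redT_small_iff[of "L 1 x" 0] cL[OF _ x] by simp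
    qed
    have L2: "L 2 x \<in> ideal_smult S mS (Tm p 1)" if x: "x \<in> carrier (Tm p 2)" for x
    proof -
      have "x \<in> T2_lift p ` carrier (Hs p)" using T2_lift_iso[OF p] x by (simp add: module_iso_def bij_betw_def)
      then obtain v where v: "v \<in> carrier (Hs p)" "redT p 2 x = T2id p (residue S (I p) (Hs p) v)"
        using T2id_class[OF p] by auto
      have "\<delta> 2 (redT p 2 x) \<in> ideal_smult (RR p) mR (TM p 1)" unfolding v(2) using second[OF v(1)] hm[OF v(1)] by simp
      then show ?thesis using lifts_red[OF L _ x] redT_small_iff[of "L 2 x" 1] cL[OF _ x] by simp
    qed
    show "\<forall>n\<ge>1. \<delta> n ` carrier (TM p n) \<subseteq> ideal_smult (RR p) mR (TM p (n - 1))"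
    proof (intro allI impI subsetI)
      fix n u assume n: "1 \<le> (n :: nat)" and "u \<in> \<delta> n ` carrier (TM p n)"
      then obtain x where x: "x \<in> carrier (Tm p n)" "u = \<delta> n (redT p n x)"
        using reduction.onto[OF redT[OF p], of _ n] by blast
      have "L n x \<in> ideal_smult S mS (Tm p (n - 1))"
        by (rule minimal_from_degree_2[OF p L res mS_ideal det L1 L2 n x(1)])
      then show "u \<in> ideal_smult (RR p) mR (TM p (n - 1))"
        unfolding x(2) lifts_red[OF L n x(1), symmetric] redT_small_iff[OF cL[OF n x(1)]] .
    qed
  }
qed

end

end

theorem theorem5p2:
  fixes S :: "('a, 'k) ring_scheme"
    and f :: "nat \<Rightarrow> 'a"
    and c :: nat
    and A :: "nat \<Rightarrow> ('a, 'b, 'k1) module_scheme"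
    and F B :: "nat \<Rightarrow> nat \<Rightarrow> 'b set"
    and d :: "'b \<Rightarrow> 'b"
    and h :: "nat \<Rightarrow> 'b \<Rightarrow> 'b"
    and \<sigma> :: "nat \<Rightarrow> nat \<Rightarrow> nat \<Rightarrow> (nat list \<Rightarrow> 'b set) \<Rightarrow> nat list \<Rightarrow> 'b set"
    and \<delta> :: "nat \<Rightarrow> nat \<Rightarrow> (nat list \<Rightarrow> 'b set) \<Rightarrow> nat list \<Rightarrow> 'b set"
  assumes "cring S" and "noetherian_ring S"
    and "regular_sequence S f c"
    and "higher_matrix_factorization S f c A F d h"
    and "splittings S c A F B"
    and "T_construction S f c A F d h B \<sigma> \<delta>"
  shows "(\<forall>p\<in>{1..c}.
      free_resolution (hmf_ring S f p) (T_module S f A B p) (\<delta> p) (hmf_module S f A F d p) \<and>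
      is_map_via (hmf_ring S f p)
        (T_module S f A B p 1) (T_module S f A B p 0) (\<delta> p 1)
        (T_ident S f c A B p 1) (T_ident S f c A B p 0)
        (RA S f A F 1 p) (RA S f A F 0 p) (Rd S f A F d p) \<and>
      is_map_via (hmf_ring S f p)
        (T_module S f A B p 2) (T_module S f A B p 1) (\<delta> p 2)
        (T2_ident S f c A B p) (T_ident S f c A B p 1)
        (base_change S (seq_ideal S f p) (h_source A F p)) (RA S f A F 1 p)
        (base_change_map S (seq_ideal S f p) (filt A F 1 p) (h_row A h p))) \<and>
    (local_ring S \<longrightarrow>
      (\<forall>p\<in>{1..c}.
        minimal_free_resolution (hmf_ring S f p) (T_module S f A B p) (\<delta> p) (hmf_module S f A F d p)
        \<longleftrightarrow> hmf_minimal S A F d h p))"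
proof -
  interpret hmf_setting S f c A F d h B by (rule hmf_setting.intro[OF assms(1,3,4,5)])
  have step: "resolves p (\<delta> p)" "second_is_h p (\<delta> p)" "p \<le> c" if "p \<in> {1..c}" for p
    using resolves_all[OF assms(6), of p] that by (auto simp: from_0_def)
  have "minimal_free_resolution (RR p) (TM p) (\<delta> p) (hmf_module S f A F d p) \<longleftrightarrow> hmf_minimal S A F d h p"
    if loc: "local_ring S" and p: "p \<in> {1..c}" for p
  proof -
    note p' = step(3)[OF p]
    have "ideal (max_ideal S) S" "I c \<subseteq> max_ideal S"
      using mS_ideal[OF p' loc assms(2)] I_in_mS[OF p' loc assms(2)] by auto
    from lifts_exist[OF assms(6) this p'] p obtain L where L: "lifts p (\<delta> p) L" "detects (max_ideal S) p L"
      by (auto simp: from_0_def)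
    show ?thesis
      unfolding minimal_free_resolution_def
      using minimal_iff[OF p' loc assms(2) step(1,2)[OF p] L] is_free_resolution[OF p' step(1)[OF p]] by blast
  qed
  then show ?thesis
    unfolding hmf_ring_def RA_def
    by (intro conjI ballI impI is_free_resolution first_differential second_differential step)
qed

end
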